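(* Let $H\subset G$ be finite groups, let $J\in\mathbb{C}[H]\otimes\mathbb{C}[H]$ be a minimal twist, and let $A=\mathbb{C}[G]^J$. Let $Z\subset G$ be a double coset of $H$ in $G$, let $g\in Z$, and let $K_g=H\cap gHg^{-1}$. Let $W_1$ be the pullback to $K_g$ of the projective $H$-representation $V_1$ along $\theta_1:K_g\to H$, $\theta_1(a)=g^{-1}ag$, and let $W_2$ be the pullback to $K_g$ of the projective $H$-representation $V_2$ along the inclusion $\theta_2:K_g\to H$, $\theta_2(a)=a$. Let $(\hat K_g,\tilde\pi_W)$ be any linearization of the projective representation $W=W_1\otimes W_2$ of $K_g$. Let $\zeta$ be the kernel of the projection $\hat K_g\to K_g$, and let $\chi:\zeta\to\mathbb{C}^*$ be the character by which $\zeta$ acts in $W$. Then there exists a one-to-one correspondence between isomorphism classes of irreducible representations of the algebra $A_Z^*$ and isomorphism classes of irreducible representations of $\hat K_g$ on which $\zeta$ acts by $\chi$, such that if a representation $Y$ of $A_Z^*$ corresponds to a representation $X$ of $\hat K_g$, then $$\dim Y=\frac{|H|}{|K_g|}\dim X .$$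
   Context: Twists: for a finite group $H$, let $\Delta_0(x)=x\otimes x$ and $\varepsilon(x)=1$ ($x\in H$) be the usual coproduct and counit of $\mathbb{C}[H]$. A twist is an invertible $J\in\mathbb{C}[H]\otimes\mathbb{C}[H]$ with $(\Delta_0\otimes I)(J)(J\otimes 1)=(I\otimes\Delta_0)(J)(1\otimes J)$ and $(\varepsilon\otimes I)(J)=(I\otimes\varepsilon)(J)=1$. Let $J_{21}$ be the image of $J$ under the flip of tensor factors. The twist $J$ is minimal if the right (and left) tensor components of $R=J_{21}^{-1}J$ span $\mathbb{C}[H]$, i.e. $\{(f\otimes I)(R): f\in\mathbb{C}[H]^*\}=\mathbb{C}[H]$ and likewise on the other side. For $H\subset G$, $\mathbb{C}[G]^J$ is the Hopf algebra which equals $\mathbb{C}[G]$ as an algebra, with the same counit and with coproduct $\Delta(x)=J^{-1}(x\otimes x)J$ for $x\in G$. Its dual $A^*$ has multiplication $(\varphi\psi)(x)=(\varphi\otimes\psi)(\Delta(x))$ and basis $\{\delta_x: x\in G\}$, $\delta_x(y)=\delta_{xy}$ (Kronecker delta) for $y\in G$. For a double coset $Z=HgH$, $A_Z^*=\bigoplus_{x\in Z}\mathbb{C}\delta_x\subset A^*$; it is a subalgebra of $A^*$, with unit $\sum_{x\in Z}\delta_x$, and $A^*=\bigoplus_Z A_Z^*$ as algebras. The projective representations $V_1,V_2$: let $A_1=A_2=\mathbb{C}[H]$ as vector spaces, with coalgebra structures $\Delta_1(x)=(x\otimes x)J$ and $\Delta_2(x)=J^{-1}(x\otimes x)$ for $x\in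 H$, and the usual counit $\varepsilon$. The dual algebras $A_1^*,A_2^*$ have basis $\{\delta_h: h\in H\}$, and $H$ acts on them by algebra automorphisms via $\rho_1(h)\delta_y=\delta_{hy}$ on $A_1^*$ and $\rho_2(h)\delta_y=\delta_{yh^{-1}}$ on $A_2^*$. Since $J$ is minimal, $A_1^*$ and $A_2^*$ are simple algebras. Let $V_i$ be the simple $A_i^*$-module, so $A_i^*\cong \mathrm{End}(V_i)$ and $\dim V_i=|H|^{1/2}$; each automorphism $\rho_i(h)$ is conjugation by an element of $GL(V_i)$ unique up to scalar, and this gives a projective representation $H\to PGL(V_i)$, also denoted $V_i$. A projective representation of a group $\Gamma$ is a vector space $V$ with a homomorphism $\pi_V:\Gamma\to PGL(V)$. A linearization of it is a central extension $\hat\Gamma$ of $\Gamma$ by a central subgroup $\zeta$ together with a linear representation $\tilde\pi_V:\hat\Gamma\to GL(V)$ which descends to $\pi_V$. *)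

theory Defs
  imports "HOL-Algebra.Coset" "HOL-Library.Indicator_Function" "Jordan_Normal_Form.VS_Connect"
begin

section \<open>Group algebras and twists\<close>

text \<open>The vector space with basis \<open>X\<close> (also the space of functions on \<open>X\<close>, i.e. its dual),
  for finite \<open>X\<close>. The basis vector \<open>x\<close>, and likewise \<open>\<delta>\<^sub>x\<close> in the dual, is \<open>indicator {x}\<close>.\<close>

definition vectors_on :: "'a set \<Rightarrow> ('a \<Rightarrow> complex) set" where
  "vectors_on X = {v. \<forall>x. x \<notin> X \<longrightarrow> v x = 0}"

text \<open>The linear extension of a map \<open>f\<close> of basis vectors: \<open>\<Sum>x\<in>X. v x \<cdot> x\<close> is sent to
  \<open>\<Sum>x\<in>X. v x \<cdot> f x\<close>.\<close>

definition lin_ext :: "'a set \<Rightarrow> ('a \<Rightarrow> 'b) \<Rightarrow> ('a \<Rightarrow> complex) \<Rightarrow> ('b \<Rightarrow> complex)" where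
  "lin_ext X f v = (\<lambda>y. \<Sum>x\<in>{x\<in>X. f x = y}. v x)"

definition group_algebra :: "('a, 'm) monoid_scheme \<Rightarrow> (complex, 'a \<Rightarrow> complex) module" where
  "group_algebra \<Gamma> =
    \<lparr>carrier = vectors_on (carrier \<Gamma>),
     mult = (\<lambda>u v x. \<Sum>(y, z)\<in>{(y, z). y \<in> carrier \<Gamma> \<and> z \<in> carrier \<Gamma> \<and> y \<otimes>\<^bsub>\<Gamma>\<^esub> z = x}. u y * v z),
     one = indicator {\<one>\<^bsub>\<Gamma>\<^esub>},
     zero = (\<lambda>x. 0),
     add = (\<lambda>u v x. u x + v x),
     smult = (\<lambda>c v x. c * v x)\<rparr>"

text \<open>Throughout, the tensor powers of the group algebra of \<open>\<Gamma>\<close> are the group algebras of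
  \<open>\<Gamma> \<times>\<times> \<Gamma>\<close> and \<open>\<Gamma> \<times>\<times> \<Gamma> \<times>\<times> \<Gamma>\<close>, the basis vector \<open>x \<otimes> y\<close> being the pair \<open>(x, y)\<close>.\<close>

definition twist :: "('a, 'm) monoid_scheme \<Rightarrow> ('a \<times> 'a \<Rightarrow> complex) \<Rightarrow> bool" where
  "twist \<Gamma> J \<longleftrightarrow>
    (let X = carrier \<Gamma> \<times> carrier \<Gamma>; C3 = group_algebra (\<Gamma> \<times>\<times> \<Gamma> \<times>\<times> \<Gamma>) in
      J \<in> Units (group_algebra (\<Gamma> \<times>\<times> \<Gamma>)) \<and>
      lin_ext X (\<lambda>(x, y). (x, x, y)) J \<otimes>\<^bsub>C3\<^esub> lin_ext X (\<lambda>(x, y). (x, y, \<one>\<^bsub>\<Gamma>\<^esub>)) J =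
        lin_ext X (\<lambda>(x, y). (x, y, y)) J \<otimes>\<^bsub>C3\<^esub> lin_ext X (\<lambda>(x, y). (\<one>\<^bsub>\<Gamma>\<^esub>, x, y)) J \<and>
      lin_ext X snd J = \<one>\<^bsub>group_algebra \<Gamma>\<^esub> \<and>
      lin_ext X fst J = \<one>\<^bsub>group_algebra \<Gamma>\<^esub>)"

definition twist_R :: "('a, 'm) monoid_scheme \<Rightarrow> ('a \<times> 'a \<Rightarrow> complex) \<Rightarrow> ('a \<times> 'a \<Rightarrow> complex)" where
  "twist_R \<Gamma> J =
    (let C2 = group_algebra (\<Gamma> \<times>\<times> \<Gamma>); J21 = lin_ext (carrier \<Gamma> \<times> carrier \<Gamma>) (\<lambda>(x, y). (y, x)) J
     in inv\<^bsub>C2\<^esub> J21 \<otimes>\<^bsub>C2\<^esub> J)"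

text \<open>A linear functional on the group algebra is given by its arbitrary values \<open>f x\<close> on the
  basis, so the right-hand factors below are \<open>(f \<otimes> I) R\<close> and \<open>(I \<otimes> f) R\<close>.\<close>

definition minimal_twist :: "('a, 'm) monoid_scheme \<Rightarrow> ('a \<times> 'a \<Rightarrow> complex) \<Rightarrow> bool" where
  "minimal_twist \<Gamma> J \<longleftrightarrow>
    twist \<Gamma> J \<and>
    range (\<lambda>f y. \<Sum>x\<in>carrier \<Gamma>. f x * twist_R \<Gamma> J (x, y)) = carrier (group_algebra \<Gamma>) \<and>
    range (\<lambda>f x. \<Sum>y\<in>carrier \<Gamma>. f y * twist_R \<Gamma> J (x, y)) = carrier (group_algebra \<Gamma>)"

section \<open>Dual algebras\<close>

text \<open>The dual algebra of the coalgebra with basis \<open>X\<close>, counit \<open>\<epsilon> x = 1\<close>, and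
  comultiplication \<open>D x = \<Sum>a\<in>X. \<Sum>b\<in>X. D x (a, b) \<cdot> a \<otimes> b\<close> for \<open>x \<in> X\<close>.\<close>

definition dual_algebra ::
    "'a set \<Rightarrow> ('a \<Rightarrow> 'a \<times> 'a \<Rightarrow> complex) \<Rightarrow> (complex, 'a \<Rightarrow> complex) module" where
  "dual_algebra X D =
    \<lparr>carrier = vectors_on X,
     mult = (\<lambda>\<phi> \<psi> x. if x \<in> X then \<Sum>(a, b)\<in>X \<times> X. \<phi> a * \<psi> b * D x (a, b) else 0),
     one = indicator X,
     zero = (\<lambda>x. 0),
     add = (\<lambda>\<phi> \<psi> x. \<phi> x + \<psi> x),
     smult = (\<lambda>c \<phi> x. c * \<phi> x)\<rparr>"

text \<open>The comultiplication of the twisted group algebra, \<open>D x = J\<inverse> (x \<otimes> x) J\<close> for \<open>x\<close> in \<open>G\<close>,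
  where \<open>J\<close> is a twist of the subgroup \<open>H\<close>.\<close>

definition twisted_comult ::
    "('a, 'm) monoid_scheme \<Rightarrow> 'a set \<Rightarrow> ('a \<times> 'a \<Rightarrow> complex) \<Rightarrow> 'a \<Rightarrow> ('a \<times> 'a \<Rightarrow> complex)" where
  "twisted_comult G H J x =
    (let C2 = group_algebra (G \<times>\<times> G); \<Gamma> = G\<lparr>carrier := H\<rparr>; J' = inv\<^bsub>group_algebra (\<Gamma> \<times>\<times> \<Gamma>)\<^esub> J
     in J' \<otimes>\<^bsub>C2\<^esub> indicator {(x, x)} \<otimes>\<^bsub>C2\<^esub> J)"

definition twisted_dual ::
    "('a, 'm) monoid_scheme \<Rightarrow> 'a set \<Rightarrow> ('a \<times> 'a \<Rightarrow> complex) \<Rightarrow> (complex, 'a \<Rightarrow> complex) module" where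
  "twisted_dual G H J = dual_algebra (carrier G) (twisted_comult G H J)"

definition double_coset_algebra ::
    "('a, 'm) monoid_scheme \<Rightarrow> 'a set \<Rightarrow> ('a \<times> 'a \<Rightarrow> complex) \<Rightarrow> 'a set \<Rightarrow> (complex, 'a \<Rightarrow> complex) module" where
  "double_coset_algebra G H J Z =
    (twisted_dual G H J)\<lparr>carrier := vectors_on Z, one := indicator Z\<rparr>"

definition A1_dual :: "('a, 'm) monoid_scheme \<Rightarrow> ('a \<times> 'a \<Rightarrow> complex) \<Rightarrow> (complex, 'a \<Rightarrow> complex) module" where
  "A1_dual \<Gamma> J =
    dual_algebra (carrier \<Gamma>) (\<lambda>x. indicator {(x, x)} \<otimes>\<^bsub>group_algebra (\<Gamma> \<times>\<times> \<Gamma>)\<^esub> J)"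

definition A2_dual :: "('a, 'm) monoid_scheme \<Rightarrow> ('a \<times> 'a \<Rightarrow> complex) \<Rightarrow> (complex, 'a \<Rightarrow> complex) module" where
  "A2_dual \<Gamma> J =
    dual_algebra (carrier \<Gamma>)
      (\<lambda>x. inv\<^bsub>group_algebra (\<Gamma> \<times>\<times> \<Gamma>)\<^esub> J \<otimes>\<^bsub>group_algebra (\<Gamma> \<times>\<times> \<Gamma>)\<^esub> indicator {(x, x)})"

definition \<rho>1 :: "('a, 'm) monoid_scheme \<Rightarrow> 'a \<Rightarrow> ('a \<Rightarrow> complex) \<Rightarrow> ('a \<Rightarrow> complex)" where
  "\<rho>1 \<Gamma> h = lin_ext (carrier \<Gamma>) (\<lambda>y. h \<otimes>\<^bsub>\<Gamma>\<^esub> y)"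

definition \<rho>2 :: "('a, 'm) monoid_scheme \<Rightarrow> 'a \<Rightarrow> ('a \<Rightarrow> complex) \<Rightarrow> ('a \<Rightarrow> complex)" where
  "\<rho>2 \<Gamma> h = lin_ext (carrier \<Gamma>) (\<lambda>y. y \<otimes>\<^bsub>\<Gamma>\<^esub> inv\<^bsub>\<Gamma>\<^esub> h)"

section \<open>Linear representations\<close>

text \<open>Representations are on coordinate spaces \<open>carrier_vec n\<close>; a representation is recorded
  together with its dimension, as a pair \<open>(n, \<rho>)\<close>.\<close>

abbreviation GL :: "nat \<Rightarrow> complex mat monoid" where
  "GL n \<equiv> units_of (ring_mat TYPE(complex) n ())"

definition irreducible_matrices :: "nat \<Rightarrow> complex mat set \<Rightarrow> bool" where
  "irreducible_matrices n S \<longleftrightarrow>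
    n > 0 \<and>
    (\<forall>U. VectorSpace.subspace class_ring U (module_vec TYPE(complex) n) \<and>
         (\<forall>M\<in>S. \<forall>u\<in>U. M *\<^sub>v u \<in> U) \<longrightarrow>
         U = {0\<^sub>v n} \<or> U = carrier_vec n)"

definition alg_rep :: "(complex, 'v, 'm) module_scheme \<Rightarrow> nat \<Rightarrow> ('v \<Rightarrow> complex mat) \<Rightarrow> bool" where
  "alg_rep A n \<rho> \<longleftrightarrow>
    \<rho> \<in> Ring.ring_hom A (ring_mat TYPE(complex) n ()) \<and>
    (\<forall>c. \<forall>x\<in>carrier A. \<rho> (c \<odot>\<^bsub>A\<^esub> x) = c \<cdot>\<^sub>m \<rho> x)"

definition alg_irrep :: "(complex, 'v, 'm) module_scheme \<Rightarrow> nat \<Rightarrow> ('v \<Rightarrow> complex mat) \<Rightarrow> bool" where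
  "alg_irrep A n \<rho> \<longleftrightarrow> alg_rep A n \<rho> \<and> irreducible_matrices n (\<rho> ` carrier A)"

definition group_irrep :: "('k, 'm) monoid_scheme \<Rightarrow> nat \<Rightarrow> ('k \<Rightarrow> complex mat) \<Rightarrow> bool" where
  "group_irrep \<Gamma> n \<sigma> \<longleftrightarrow> \<sigma> \<in> hom \<Gamma> (GL n) \<and> irreducible_matrices n (\<sigma> ` carrier \<Gamma>)"

text \<open>The subset \<open>S\<close> acts through the scalars \<open>\<chi>\<close>.\<close>

definition acts_by :: "'k set \<Rightarrow> ('k \<Rightarrow> complex) \<Rightarrow> nat \<Rightarrow> ('k \<Rightarrow> complex mat) \<Rightarrow> bool" where
  "acts_by S \<chi> n \<sigma> \<longleftrightarrow> (\<forall>z\<in>S. \<sigma> z = \<chi> z \<cdot>\<^sub>m 1\<^sub>m n)"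

definition rep_isomorphic ::
    "'x set \<Rightarrow> nat \<times> ('x \<Rightarrow> complex mat) \<Rightarrow> nat \<times> ('x \<Rightarrow> complex mat) \<Rightarrow> bool" where
  "rep_isomorphic X r s \<longleftrightarrow>
    fst r = fst s \<and> (\<exists>P\<in>carrier (GL (fst r)). \<forall>x\<in>X. P * snd r x = snd s x * P)"

text \<open>The isomorphism classes of a family \<open>\<R>\<close> of representations of an algebra or group with
  underlying set \<open>X\<close>.\<close>

definition iso_classes ::
    "'x set \<Rightarrow> (nat \<times> ('x \<Rightarrow> complex mat)) set \<Rightarrow> (nat \<times> ('x \<Rightarrow> complex mat)) set set" where
  "iso_classes X \<R> = \<R> // {(r, s). r \<in> \<R> \<and> s \<in> \<R> \<and> rep_isomorphic X r s}"

section \<open>Projective representations\<close>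

definition scalar_matrices :: "nat \<Rightarrow> complex mat set" where
  "scalar_matrices n = {c \<cdot>\<^sub>m 1\<^sub>m n | c. c \<noteq> 0}"

abbreviation PGL :: "nat \<Rightarrow> complex mat set monoid" where
  "PGL n \<equiv> GL n Mod scalar_matrices n"

definition projective_rep :: "('a, 'm) monoid_scheme \<Rightarrow> nat \<Rightarrow> ('a \<Rightarrow> complex mat set) \<Rightarrow> bool" where
  "projective_rep \<Gamma> n \<pi> \<longleftrightarrow> \<pi> \<in> hom \<Gamma> (PGL n)"

text \<open>Let \<open>\<tau>\<close> be the simple module of a simple algebra \<open>A\<close>, so that \<open>A\<close> is the full matrix
  algebra via \<open>\<tau>\<close>. The set of all \<open>T\<close> such that the automorphism \<open>\<alpha>\<close> of \<open>A\<close> is conjugation by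
  \<open>T\<close> is one coset of the scalar matrices, that is, an element of \<open>PGL n\<close>.\<close>

definition conj_class ::
    "(complex, 'v, 'm) module_scheme \<Rightarrow> nat \<Rightarrow> ('v \<Rightarrow> complex mat) \<Rightarrow> ('v \<Rightarrow> 'v) \<Rightarrow> complex mat set" where
  "conj_class A n \<tau> \<alpha> =
    {T \<in> carrier (GL n). \<forall>\<phi>\<in>carrier A. \<tau> (\<alpha> \<phi>) = T * \<tau> \<phi> * inv\<^bsub>GL n\<^esub> T}"

definition kronecker :: "complex mat \<Rightarrow> complex mat \<Rightarrow> complex mat" where
  "kronecker S T =
    mat (dim_row S * dim_row T) (dim_col S * dim_col T)
      (\<lambda>(i, j). S $$ (i div dim_row T, j div dim_col T) * T $$ (i mod dim_row T, j mod dim_col T))"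

text \<open>The map induced by the tensor product on classes modulo scalars; the set below is already
  closed under multiplication by nonzero scalars.\<close>

definition pgl_tensor :: "complex mat set \<Rightarrow> complex mat set \<Rightarrow> complex mat set" where
  "pgl_tensor P Q = {kronecker S T | S T. S \<in> P \<and> T \<in> Q}"

text \<open>\<open>\<Gamma>'\<close> with the projection \<open>p\<close> is a central extension of \<open>\<Gamma>\<close>, not necessarily finite, and
  its linear representation \<open>\<sigma>\<close> descends to \<open>\<pi>\<close>.\<close>

definition central_extension ::
    "('a, 'm) monoid_scheme \<Rightarrow> ('k, 'l) monoid_scheme \<Rightarrow> ('k \<Rightarrow> 'a) \<Rightarrow> bool" where
  "central_extension \<Gamma> \<Gamma>' p \<longleftrightarrow>
    group \<Gamma>' \<and> p \<in> epi \<Gamma>' \<Gamma> \<and>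
    (\<forall>z\<in>kernel \<Gamma>' \<Gamma> p. \<forall>x\<in>carrier \<Gamma>'. z \<otimes>\<^bsub>\<Gamma>'\<^esub> x = x \<otimes>\<^bsub>\<Gamma>'\<^esub> z)"

definition linearization ::
    "('a, 'm) monoid_scheme \<Rightarrow> nat \<Rightarrow> ('a \<Rightarrow> complex mat set) \<Rightarrow>
     ('k, 'l) monoid_scheme \<Rightarrow> ('k \<Rightarrow> 'a) \<Rightarrow> ('k \<Rightarrow> complex mat) \<Rightarrow> bool" where
  "linearization \<Gamma> n \<pi> \<Gamma>' p \<sigma> \<longleftrightarrow>
    central_extension \<Gamma> \<Gamma>' p \<and>
    \<sigma> \<in> hom \<Gamma>' (GL n) \<and>
    (\<forall>x\<in>carrier \<Gamma>'. scalar_matrices n #>\<^bsub>GL n\<^esub> \<sigma> x = \<pi> (p x))"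

lemma group_GL: "group (GL n)"
proof -
  interpret ring "ring_mat TYPE(complex) n ()" by (rule ring_mat)
  show ?thesis by (rule units_group)
qed

lemma scalar_matrices_normal: "scalar_matrices n \<lhd> GL n"
proof -
  interpret R: ring "ring_mat TYPE(complex) n ()" by (rule ring_mat)
  interpret group "GL n" by (rule group_GL)
  have comm: "M * (c \<cdot>\<^sub>m 1\<^sub>m n) = (c \<cdot>\<^sub>m 1\<^sub>m n) * M" if "M \<in> carrier_mat n n" for M and c :: complex
    using that mult_smult_distrib[OF that, of "1\<^sub>m n" n c]
      mult_smult_assoc_mat[of "1\<^sub>m n" n n M n c] by simp
  have GL_simps: "mult (GL n) = (*)" "one (GL n) = 1\<^sub>m n"
    by (simp_all add: units_of_def ring_mat_def)
  have GLc: "M \<in> carrier_mat n n" if "M \<in> carrier (GL n)" for M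
    using that by (auto simp: units_of_def Units_def ring_mat_def)
  have prod: "(c \<cdot>\<^sub>m 1\<^sub>m n) * (d \<cdot>\<^sub>m 1\<^sub>m n) = (c * d) \<cdot>\<^sub>m (1\<^sub>m n :: complex mat)" for c d
    by (subst mult_smult_assoc_mat[of _ n n _ n]) (auto intro!: eq_matI)
  have one_smult: "1 \<cdot>\<^sub>m (1\<^sub>m n :: complex mat) = 1\<^sub>m n"
    by (rule eq_matI) auto
  have sub: "subgroup (scalar_matrices n) (GL n)"
  proof (rule subgroupI)
    show carr: "scalar_matrices n \<subseteq> carrier (GL n)"
    proof
      fix M assume "M \<in> scalar_matrices n"
      then obtain c where c: "c \<noteq> 0" "M = c \<cdot>\<^sub>m 1\<^sub>m n" by (auto simp: scalar_matrices_def)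
      have "M * (inverse c \<cdot>\<^sub>m 1\<^sub>m n) = 1\<^sub>m n" "(inverse c \<cdot>\<^sub>m 1\<^sub>m n) * M = 1\<^sub>m n"
        using c by (simp_all add: prod one_smult)
      moreover have "M \<in> carrier_mat n n" "inverse c \<cdot>\<^sub>m 1\<^sub>m n \<in> carrier_mat n n"
        using c by auto
      ultimately show "M \<in> carrier (GL n)"
        unfolding units_of_def Units_def ring_mat_def
        by (simp only: partial_object.simps monoid.simps mem_Collect_eq) (intro conjI bexI TrueI)
    qed
    have "1 \<cdot>\<^sub>m 1\<^sub>m n \<in> scalar_matrices n" unfolding scalar_matrices_def by force
    then show "scalar_matrices n \<noteq> {}" by (intro notI) simp
    fix M assume M: "M \<in> scalar_matrices n"
    then obtain c where c: "c \<noteq> 0" "M = c \<cdot>\<^sub>m 1\<^sub>m n" by (auto simp: scalar_matrices_def)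
    have "inverse c \<cdot>\<^sub>m 1\<^sub>m n \<in> scalar_matrices n" using c unfolding scalar_matrices_def by force
    moreover have "(inverse c \<cdot>\<^sub>m 1\<^sub>m n) \<otimes>\<^bsub>GL n\<^esub> M = \<one>\<^bsub>GL n\<^esub>"
      using c by (simp add: GL_simps prod one_smult)
    ultimately show "inv\<^bsub>GL n\<^esub> M \<in> scalar_matrices n"
      using inv_equality[OF _ subsetD[OF carr M] subsetD[OF carr]] by simp
    fix N assume "N \<in> scalar_matrices n"
    then obtain d where d: "d \<noteq> 0" "N = d \<cdot>\<^sub>m 1\<^sub>m n" by (auto simp: scalar_matrices_def)
    show "M \<otimes>\<^bsub>GL n\<^esub> N \<in> scalar_matrices n"
      unfolding scalar_matrices_def
      by (rule CollectI, rule exI[of _ "c * d"]) (simp add: c d GL_simps prod)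
  qed
  show ?thesis
  proof (rule normalI[OF sub], rule ballI)
    fix M assume "M \<in> carrier (GL n)"
    then have "M * S = S * M" if "S \<in> scalar_matrices n" for S
      using that comm[OF GLc] unfolding scalar_matrices_def by blast
    then show "scalar_matrices n #>\<^bsub>GL n\<^esub> M = M <#\<^bsub>GL n\<^esub> scalar_matrices n"
      by (simp add: r_coset_def l_coset_def GL_simps)
  qed
qed

text \<open>That \<open>\<pi>\<close> is a projective representation need not be required in a linearization.\<close>

lemma linearization_imp_projective_rep:
  assumes "group \<Gamma>" "linearization \<Gamma> n \<pi> \<Gamma>' p \<sigma>"
  shows "projective_rep \<Gamma> n \<pi>"
proof -
  interpret normal "scalar_matrices n" "GL n" by (rule scalar_matrices_normal)
  have p: "p \<in> hom \<Gamma>' \<Gamma>" "p ` carrier \<Gamma>' = carrier \<Gamma>" and \<sigma>: "\<sigma> \<in> hom \<Gamma>' (GL n)"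
    and \<pi>: "\<And>x. x \<in> carrier \<Gamma>' \<Longrightarrow> \<pi> (p x) = scalar_matrices n #>\<^bsub>GL n\<^esub> \<sigma> x"
    and grp: "group \<Gamma>'"
    using assms(2) by (auto simp: linearization_def central_extension_def epi_def)
  have \<sigma>c: "\<sigma> x \<in> carrier (GL n)" if "x \<in> carrier \<Gamma>'" for x
    using \<sigma> that by (auto simp: hom_def)
  show ?thesis
    unfolding projective_rep_def
  proof (rule homI)
    fix a assume "a \<in> carrier \<Gamma>"
    then obtain x where x: "x \<in> carrier \<Gamma>'" "a = p x" using p(2) by blast
    then show "\<pi> a \<in> carrier (PGL n)" using \<sigma>c \<pi> by (simp add: carrier_FactGroup)
    fix b assume "b \<in> carrier \<Gamma>"
    then obtain y where y: "y \<in> carrier \<Gamma>'" "b = p y" using p(2) by blast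
    interpret \<Gamma>': group \<Gamma>' by (rule grp)
    have "\<pi> (a \<otimes>\<^bsub>\<Gamma>\<^esub> b) = \<pi> (p (x \<otimes>\<^bsub>\<Gamma>'\<^esub> y))" using x y p(1) by (simp add: hom_mult)
    also have "\<dots> = scalar_matrices n #>\<^bsub>GL n\<^esub> (\<sigma> x \<otimes>\<^bsub>GL n\<^esub> \<sigma> y)"
      using x y \<pi> \<sigma> by (simp add: hom_mult)
    also have "\<dots> = \<pi> a \<otimes>\<^bsub>PGL n\<^esub> \<pi> b"
      using x y \<pi> \<sigma>c rcos_sum by (simp add: FactGroup_def)
    finally show "\<pi> (a \<otimes>\<^bsub>\<Gamma>\<^esub> b) = \<pi> a \<otimes>\<^bsub>PGL n\<^esub> \<pi> b" .
  qed
qed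

section \<open>The objects attached to a double coset\<close>

definition double_cosets :: "('a, 'm) monoid_scheme \<Rightarrow> 'a set \<Rightarrow> 'a set set" where
  "double_cosets G H = {H <#>\<^bsub>G\<^esub> {x} <#>\<^bsub>G\<^esub> H | x. x \<in> carrier G}"

definition K_subgroup :: "('a, 'm) monoid_scheme \<Rightarrow> 'a set \<Rightarrow> 'a \<Rightarrow> 'a set" where
  "K_subgroup G H g = H \<inter> (\<lambda>h. g \<otimes>\<^bsub>G\<^esub> h \<otimes>\<^bsub>G\<^esub> inv\<^bsub>G\<^esub> g) ` H"

text \<open>The projective representations \<open>V\<^sub>1\<close>, \<open>V\<^sub>2\<close> of \<open>\<Gamma>\<close> on given simple modules
  \<open>(n, \<tau>)\<close> of the two dual algebras.\<close>

definition V1_proj :: "('a, 'm) monoid_scheme \<Rightarrow> ('a \<times> 'a \<Rightarrow> complex) \<Rightarrow> nat \<Rightarrow>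
    (('a \<Rightarrow> complex) \<Rightarrow> complex mat) \<Rightarrow> 'a \<Rightarrow> complex mat set" where
  "V1_proj \<Gamma> J n \<tau> h = conj_class (A1_dual \<Gamma> J) n \<tau> (\<rho>1 \<Gamma> h)"

definition V2_proj :: "('a, 'm) monoid_scheme \<Rightarrow> ('a \<times> 'a \<Rightarrow> complex) \<Rightarrow> nat \<Rightarrow>
    (('a \<Rightarrow> complex) \<Rightarrow> complex mat) \<Rightarrow> 'a \<Rightarrow> complex mat set" where
  "V2_proj \<Gamma> J n \<tau> h = conj_class (A2_dual \<Gamma> J) n \<tau> (\<rho>2 \<Gamma> h)"

end

theory Submission
  imports Defs "Jordan_Normal_Form.Schur_Decomposition" "Jordan_Normal_Form.Spectral_Radius"
    "HOL-Algebra.Multiplicative_Group"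
begin

text \<open>Write \<open>\<Delta>\<^sub>1(y) = (y \<otimes> y) J\<close> and \<open>\<Delta>\<^sub>2(x) = J\<inverse> (x \<otimes> x)\<close>. For \<open>w = x g y\<close> with \<open>x, y\<close> in \<open>H\<close> the
  comultiplication factors as \<open>\<Delta>(w) = \<Delta>\<^sub>2(x) (g \<otimes> g) \<Delta>\<^sub>1(y)\<close>. So the surjection \<open>(y, x) \<mapsto> x g y\<close> from
  \<open>H \<times> H\<close> to the double coset is a map of coalgebras, and pulling functions back embeds the double
  coset algebra into the tensor product of the two dual algebras, that is, into the matrix algebra of
  \<open>W = V\<^sub>1 \<otimes> V\<^sub>2\<close> (\<open>\<Theta>\<close>, \<open>\<Theta>_mult\<close>). The image consists of the functions that are constant on the fibres of
  the surjection. These fibres are the orbits of a free action of \<open>K\<^sub>g\<close> on \<open>H \<times> H\<close>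
  (\<open>same_orbit_point\<close>, \<open>move_fixed_point_free\<close>), and the definition of \<open>V\<^sub>1\<close> and \<open>V\<^sub>2\<close> says that the action is
  implemented by conjugation with the linearization \<open>\<pi>\<close> (\<open>\<pi>_permutes_basis\<close>). Hence the double coset algebra
  is the commutant of the extension of \<open>K\<^sub>g\<close> acting on \<open>W\<close> (\<open>\<Theta>_in_commutant\<close>, \<open>\<Theta>_onto\<close>).

  By the double commutant principle, the irreducible modules of the commutant are the multiplicity
  spaces of the irreducible representations that occur in \<open>W\<close> (\<open>module_of_irr\<close>, \<open>com_irrep_unique\<close>,
  \<open>com_irrep_has_irr\<close>). The correspondence and the dimension formula then follow if every irreducible \<open>X\<close> with
  character \<open>\<chi>\<close> occurs with multiplicity \<open>|H| dim X / |K\<^sub>g|\<close>. For this it suffices that the trace of \<open>\<pi>\<close>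
  vanishes outside the kernel \<open>\<zeta>\<close> (\<open>mtrace_e00\<close>). Conjugation by \<open>\<pi>(k)\<close> permutes a basis of the matrix algebra of
  \<open>W\<close>, without fixed points if \<open>k\<close> is not in \<open>\<zeta>\<close>; so its trace, which is the product of the traces of
  \<open>\<pi>(k)\<close> and \<open>\<pi>(k)\<inverse>\<close>, is zero. As some power of \<open>\<pi>(k)\<close> is scalar, already the trace of \<open>\<pi>(k)\<close> is zero
  (\<open>\<pi>_trace\<close>). The extension may be infinite; sums over it are replaced by sums over a section, which is
  harmless because two representations with the same \<open>\<chi>\<close> change by the same scalar along a fibre.

  Minimality enters through the structure of the two dual algebras. The functional
  \<open>\<phi> \<mapsto> \<Sum>\<^sub>x \<phi>(x)\<close> on the dual of \<open>\<Delta>\<^sub>1\<close> is the trace of the regular representation, and the twist equation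
  gives an explicit inverse of its Gram matrix (\<open>sG'_inverse\<close>). Minimality makes the centre
  one-dimensional (\<open>sc_center\<close>). Applied in an irreducible module \<open>V\<close>, the Casimir element of the
  form is computed by Schur's lemma (\<open>E_eq\<close>); this yields explicit dual bases of the full matrix algebra of \<open>V\<close>
  and \<open>dim\<^sup>2 V = |H|\<close> (\<open>dual_basis_expansion\<close>, \<open>dual_basis_trace\<close>, \<open>dim_square\<close>). The dual of \<open>\<Delta>\<^sub>2\<close> is the same
  construction for the opposite group and the twist \<open>J\<inverse>\<close> (\<open>opposite_twist_datum\<close>).\<close>

section \<open>Finite sums of matrices, and traces\<close>

lemma sum_delta_left:
  fixes f :: "'i \<Rightarrow> complex"
  assumes "finite S"
  shows "(\<Sum>x\<in>S. (if x = a then 1 else 0) * f x) = (if a \<in> S then f a else 0)"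
    and "(\<Sum>x\<in>S. (if a = x then 1 else 0) * f x) = (if a \<in> S then f a else 0)"
    and "(\<Sum>x\<in>S. f x * (if x = a then 1 else 0)) = (if a \<in> S then f a else 0)"
    and "(\<Sum>x\<in>S. f x * (if a = x then 1 else 0)) = (if a \<in> S then f a else 0)"
proof -
  have "(\<Sum>x\<in>S. (if x = a then 1 else 0) * f x) = (\<Sum>x\<in>S. if x = a then f x else 0)"
    by (intro sum.cong refl) simp
  then show 1: "(\<Sum>x\<in>S. (if x = a then 1 else 0) * f x) = (if a \<in> S then f a else 0)"
    using assms by (simp add: sum.delta')
  show "(\<Sum>x\<in>S. (if a = x then 1 else 0) * f x) = (if a \<in> S then f a else 0)"
    unfolding eq_commute[of a] by (rule 1)
  show 2: "(\<Sum>x\<in>S. f x * (if x = a then 1 else 0)) = (if a \<in> S then f a else 0)"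
    unfolding mult.commute[of "f _"] by (rule 1)
  show "(\<Sum>x\<in>S. f x * (if a = x then 1 else 0)) = (if a \<in> S then f a else 0)"
    unfolding eq_commute[of a] by (rule 2)
qed

lemma sum_rotate:
  "(\<Sum>x\<in>A. \<Sum>y\<in>B. \<Sum>z\<in>C. f x y z) = (\<Sum>y\<in>B. \<Sum>z\<in>C. \<Sum>x\<in>A. f x y z)"
proof -
  have "(\<Sum>x\<in>A. \<Sum>y\<in>B. \<Sum>z\<in>C. f x y z) = (\<Sum>y\<in>B. \<Sum>x\<in>A. \<Sum>z\<in>C. f x y z)" by (rule sum.swap)
  also have "\<dots> = (\<Sum>y\<in>B. \<Sum>z\<in>C. \<Sum>x\<in>A. f x y z)" by (intro sum.cong refl sum.swap)
  finally show ?thesis .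
qed

text \<open>Finite sums of matrices of a fixed shape, defined entrywise because matrices of all shapes share
  one type and so have no neutral element for addition.\<close>

definition msum :: "nat \<Rightarrow> nat \<Rightarrow> ('i \<Rightarrow> complex mat) \<Rightarrow> 'i set \<Rightarrow> complex mat" where
  "msum r c f I = mat r c (\<lambda>(i, j). \<Sum>x\<in>I. f x $$ (i, j))"

lemma msum_carrier [simp]: "msum r c f I \<in> carrier_mat r c"
  by (simp add: msum_def)

lemma dim_msum [simp]: "dim_row (msum r c f I) = r" "dim_col (msum r c f I) = c"
  by (simp_all add: msum_def)

lemma index_msum [simp]: "i < r \<Longrightarrow> j < c \<Longrightarrow> msum r c f I $$ (i, j) = (\<Sum>x\<in>I. f x $$ (i, j))"
  by (simp add: msum_def)

lemma mult_entry:
  assumes "A \<in> carrier_mat r n" "B \<in> carrier_mat n c" "i < r" "j < c"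
  shows "(A * B) $$ (i, j) = (\<Sum>k<n. A $$ (i, k) * (B $$ (k, j) :: complex))"
  using assms by (simp add: scalar_prod_def lessThan_atLeast0)

lemma mult_vec_entry:
  assumes "A \<in> carrier_mat r n" "v \<in> carrier_vec n" "i < r"
  shows "(A *\<^sub>v v) $ i = (\<Sum>k<n. A $$ (i, k) * (v $ k :: complex))"
  using assms by (simp add: scalar_prod_def lessThan_atLeast0)

lemma square_mult_carrier [simp]:
  "A \<in> carrier_mat d d \<Longrightarrow> B \<in> carrier_mat d d \<Longrightarrow> A * B \<in> carrier_mat d d"
  by (rule mult_carrier_mat)

lemma smult_smult_mat: "a \<cdot>\<^sub>m (b \<cdot>\<^sub>m M) = (a * b) \<cdot>\<^sub>m (M :: complex mat)"
  by (rule eq_matI) auto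

lemma zero_smult_mat: "M \<in> carrier_mat r c \<Longrightarrow> 0 \<cdot>\<^sub>m M = (0\<^sub>m r c :: complex mat)"
  by (rule eq_matI) auto

lemma one_smult_mat: "1 \<cdot>\<^sub>m M = (M :: complex mat)"
  by (rule eq_matI) auto

lemma smult_entry:
  "A \<in> carrier_mat r c \<Longrightarrow> i < r \<Longrightarrow> j < c \<Longrightarrow> (a \<cdot>\<^sub>m A) $$ (i, j) = a * A $$ (i, j)"
  by simp

lemma add_entry:
  "B \<in> carrier_mat r c \<Longrightarrow> i < r \<Longrightarrow> j < c \<Longrightarrow> (A + B) $$ (i, j) = A $$ (i, j) + B $$ (i, j)"
  by simp

lemma msum_cong: "(\<And>x. x \<in> I \<Longrightarrow> f x = g x) \<Longrightarrow> msum r c f I = msum r c g I"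
  by (simp add: msum_def)

lemma msum_empty [simp]: "msum r c f {} = 0\<^sub>m r c"
  by (rule eq_matI) auto

lemma msum_insert:
  assumes "finite J" "j \<notin> J" "f j \<in> carrier_mat r c"
  shows "msum r c f (insert j J) = msum r c f J + f j"
  using assms by (intro eq_matI) (auto simp: add.commute)

lemma mult_msum:
  assumes "A \<in> carrier_mat r n" "\<And>x. x \<in> I \<Longrightarrow> f x \<in> carrier_mat n c"
  shows "A * msum n c f I = msum r c (\<lambda>x. A * f x) I"
proof (rule eq_matI)
  fix i j assume ij: "i < dim_row (msum r c (\<lambda>x. A * f x) I)" "j < dim_col (msum r c (\<lambda>x. A * f x) I)"
  then have "(A * msum n c f I) $$ (i, j) = (\<Sum>k<n. A $$ (i, k) * (\<Sum>x\<in>I. f x $$ (k, j)))"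
    by (subst mult_entry[OF assms(1) msum_carrier]) auto
  also have "\<dots> = (\<Sum>x\<in>I. \<Sum>k<n. A $$ (i, k) * f x $$ (k, j))"
    by (simp add: sum_distrib_left) (rule sum.swap)
  also have "\<dots> = (\<Sum>x\<in>I. (A * f x) $$ (i, j))"
    using ij by (intro sum.cong refl mult_entry[symmetric, OF assms(1) assms(2)]) auto
  finally show "(A * msum n c f I) $$ (i, j) = msum r c (\<lambda>x. A * f x) I $$ (i, j)"
    using ij by simp
qed (use assms in auto)

lemma msum_mult:
  assumes "A \<in> carrier_mat n c" "\<And>x. x \<in> I \<Longrightarrow> f x \<in> carrier_mat r n"
  shows "msum r n f I * A = msum r c (\<lambda>x. f x * A) I"
proof (rule eq_matI)
  fix i j assume ij: "i < dim_row (msum r c (\<lambda>x. f x * A) I)" "j < dim_col (msum r c (\<lambda>x. f x * A) I)"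
  then have "(msum r n f I * A) $$ (i, j) = (\<Sum>k<n. (\<Sum>x\<in>I. f x $$ (i, k)) * A $$ (k, j))"
    by (subst mult_entry[OF msum_carrier assms(1)]) auto
  also have "\<dots> = (\<Sum>x\<in>I. \<Sum>k<n. f x $$ (i, k) * A $$ (k, j))"
    by (simp add: sum_distrib_right) (rule sum.swap)
  also have "\<dots> = (\<Sum>x\<in>I. (f x * A) $$ (i, j))"
    using ij by (intro sum.cong refl mult_entry[symmetric, OF assms(2) assms(1)]) auto
  finally show "(msum r n f I * A) $$ (i, j) = msum r c (\<lambda>x. f x * A) I $$ (i, j)"
    using ij by simp
qed (use assms in auto)

lemma smult_msum:
  "(\<And>x. x \<in> I \<Longrightarrow> f x \<in> carrier_mat r c) \<Longrightarrow> a \<cdot>\<^sub>m msum r c f I = msum r c (\<lambda>x. a \<cdot>\<^sub>m f x) I"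
proof (rule eq_matI)
  fix i j assume f: "\<And>x. x \<in> I \<Longrightarrow> f x \<in> carrier_mat r c"
    and "i < dim_row (msum r c (\<lambda>x. a \<cdot>\<^sub>m f x) I)" "j < dim_col (msum r c (\<lambda>x. a \<cdot>\<^sub>m f x) I)"
  then have ij: "i < r" "j < c" by simp_all
  show "(a \<cdot>\<^sub>m msum r c f I) $$ (i, j) = msum r c (\<lambda>x. a \<cdot>\<^sub>m f x) I $$ (i, j)"
    using ij by (auto simp: sum_distrib_left smult_entry[OF f] intro!: sum.cong)
qed auto

lemma msum_smult:
  "M \<in> carrier_mat r c \<Longrightarrow> msum r c (\<lambda>x. a x \<cdot>\<^sub>m M) I = (\<Sum>x\<in>I. a x) \<cdot>\<^sub>m M"
  by (rule eq_matI) (auto simp: sum_distrib_right)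

lemma msum_reindex:
  "bij_betw h S T \<Longrightarrow> msum r c (\<lambda>x. f (h x)) S = msum r c f T"
  unfolding msum_def by (intro cong_mat refl) (auto intro: sum.reindex_bij_betw)

lemma msum_swap:
  "msum r c (\<lambda>x. msum r c (\<lambda>y. f x y) J) I = msum r c (\<lambda>y. msum r c (\<lambda>x. f x y) I) J"
  by (rule eq_matI) (auto intro: sum.swap)

lemma msum_delta:
  assumes "finite I" "i \<in> I" "\<And>x. x \<in> I \<Longrightarrow> M x \<in> carrier_mat r c"
  shows "msum r c (\<lambda>x. (if x = i then 1 else 0) \<cdot>\<^sub>m M x) I = M i"
proof (rule eq_matI)
  fix k l assume "k < dim_row (M i)" "l < dim_col (M i)"
  then have kl: "k < r" "l < c" using assms(2,3) by auto
  have "(\<Sum>x\<in>I. ((if x = i then 1 else 0) \<cdot>\<^sub>m M x) $$ (k, l)) = (\<Sum>x\<in>I. if x = i then M x $$ (k, l) else 0)"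
    by (intro sum.cong refl) (use kl in \<open>simp add: smult_entry[OF assms(3)]\<close>)
  then show "msum r c (\<lambda>x. (if x = i then 1 else 0) \<cdot>\<^sub>m M x) I $$ (k, l) = M i $$ (k, l)"
    using kl assms(1,2) by simp
qed (use assms(2,3) in auto)

lemma msum_lincomb:
  assumes "\<And>y. y \<in> J \<Longrightarrow> M y \<in> carrier_mat r c"
  shows "msum r c (\<lambda>x. a x \<cdot>\<^sub>m msum r c (\<lambda>y. b x y \<cdot>\<^sub>m M y) J) I
    = msum r c (\<lambda>y. (\<Sum>x\<in>I. a x * b x y) \<cdot>\<^sub>m M y) J"
proof (rule eq_matI)
  fix i j assume "i < dim_row (msum r c (\<lambda>y. (\<Sum>x\<in>I. a x * b x y) \<cdot>\<^sub>m M y) J)"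
    "j < dim_col (msum r c (\<lambda>y. (\<Sum>x\<in>I. a x * b x y) \<cdot>\<^sub>m M y) J)"
  then have ij: "i < r" "j < c" by simp_all
  have "msum r c (\<lambda>x. a x \<cdot>\<^sub>m msum r c (\<lambda>y. b x y \<cdot>\<^sub>m M y) J) I $$ (i, j)
      = (\<Sum>x\<in>I. a x * (\<Sum>y\<in>J. b x y * M y $$ (i, j)))"
    using ij by (auto intro!: sum.cong arg_cong2[of _ _ _ _ times] smult_entry assms simp: smult_entry[OF msum_carrier])
  also have "\<dots> = (\<Sum>y\<in>J. (\<Sum>x\<in>I. a x * b x y) * M y $$ (i, j))"
    by (simp add: sum_distrib_left sum_distrib_right mult.assoc) (rule sum.swap)
  also have "\<dots> = msum r c (\<lambda>y. (\<Sum>x\<in>I. a x * b x y) \<cdot>\<^sub>m M y) J $$ (i, j)"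
    using ij by (auto intro!: sum.cong simp: smult_entry[OF assms])
  finally show "msum r c (\<lambda>x. a x \<cdot>\<^sub>m msum r c (\<lambda>y. b x y \<cdot>\<^sub>m M y) J) I $$ (i, j) = \<dots>" .
qed auto

lemma msum_add:
  assumes "\<And>x. x \<in> I \<Longrightarrow> f x \<in> carrier_mat r c" "\<And>x. x \<in> I \<Longrightarrow> g x \<in> carrier_mat r c"
  shows "msum r c (\<lambda>x. f x + g x) I = msum r c f I + msum r c g I"
proof (rule eq_matI)
  fix i j assume "i < dim_row (msum r c f I + msum r c g I)" "j < dim_col (msum r c f I + msum r c g I)"
  then have ij: "i < r" "j < c" by simp_all
  have "(\<Sum>x\<in>I. (f x + g x) $$ (i, j)) = (\<Sum>x\<in>I. f x $$ (i, j) + g x $$ (i, j))"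
    by (intro sum.cong refl add_entry[OF assms(2)] ij)
  then show "msum r c (\<lambda>x. f x + g x) I $$ (i, j) = (msum r c f I + msum r c g I) $$ (i, j)"
    using ij by (simp add: sum.distrib)
qed auto

definition mtrace :: "complex mat \<Rightarrow> complex" where
  "mtrace A = (\<Sum>i<dim_row A. A $$ (i, i))"

lemma mtrace_comm:
  assumes "A \<in> carrier_mat r n" "B \<in> carrier_mat n r"
  shows "mtrace (A * B) = mtrace (B * A)"
proof -
  have "mtrace (A * B) = (\<Sum>i<r. \<Sum>k<n. A $$ (i, k) * B $$ (k, i))"
    unfolding mtrace_def using assms by (intro sum.cong mult_entry[OF assms]) auto
  also have "\<dots> = (\<Sum>k<n. \<Sum>i<r. B $$ (k, i) * A $$ (i, k))"
    by (subst sum.swap) (simp add: mult.commute)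
  also have "\<dots> = mtrace (B * A)"
    unfolding mtrace_def using assms by (intro sum.cong mult_entry[symmetric, OF assms(2,1)]) auto
  finally show ?thesis .
qed

lemma mtrace_one [simp]: "mtrace (1\<^sub>m n) = of_nat n"
  by (simp add: mtrace_def)

lemma mtrace_smult: "A \<in> carrier_mat n n \<Longrightarrow> mtrace (a \<cdot>\<^sub>m A) = a * mtrace A"
  by (auto simp: mtrace_def sum_distrib_left)

lemma mtrace_msum: "(\<And>x. x \<in> I \<Longrightarrow> f x \<in> carrier_mat n n) \<Longrightarrow>
    mtrace (msum n n f I) = (\<Sum>x\<in>I. mtrace (f x))"
  unfolding mtrace_def by (simp, subst sum.swap) (auto intro!: sum.cong)

lemma mtrace_mult_entries:
  assumes "A \<in> carrier_mat r n" "B \<in> carrier_mat n r"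
  shows "mtrace (A * B) = (\<Sum>i<r. \<Sum>k<n. A $$ (i, k) * B $$ (k, i))"
  unfolding mtrace_def using assms by (intro sum.cong mult_entry[OF assms]) auto

text \<open>The hypothesis on the entries is the expansion of every matrix unit, from which the expansion of
  \<open>M\<close> follows by linearity. It is the form in which a pair of dual bases is found and passes to tensor
  products.\<close>

lemma expansion_in_dual_basis:
  assumes b: "\<And>p. p \<in> X \<Longrightarrow> b p \<in> carrier_mat d d" and b': "\<And>p. b' p \<in> carrier_mat d d"
    and entries: "\<And>i j k l. i < d \<Longrightarrow> j < d \<Longrightarrow> k < d \<Longrightarrow> l < d \<Longrightarrow>
      (\<Sum>p\<in>X. b' p $$ (l, k) * b p $$ (i, j)) = (if i = k \<and> j = l then 1 else 0)"
    and M: "M \<in> carrier_mat d d"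
  shows "M = msum d d (\<lambda>p. mtrace (M * b' p) \<cdot>\<^sub>m b p) X"
proof (rule eq_matI)
  fix i j assume "i < dim_row (msum d d (\<lambda>p. mtrace (M * b' p) \<cdot>\<^sub>m b p) X)"
    "j < dim_col (msum d d (\<lambda>p. mtrace (M * b' p) \<cdot>\<^sub>m b p) X)"
  then have ij: "i < d" "j < d" by auto
  have "msum d d (\<lambda>p. mtrace (M * b' p) \<cdot>\<^sub>m b p) X $$ (i, j)
      = (\<Sum>p\<in>X. mtrace (M * b' p) * b p $$ (i, j))"
    using ij by (simp add: smult_entry[OF b])
  also have "\<dots> = (\<Sum>p\<in>X. \<Sum>k<d. \<Sum>l<d. M $$ (k, l) * (b' p $$ (l, k) * b p $$ (i, j)))"
    by (simp add: mtrace_mult_entries[OF M b'] sum_distrib_right mult.assoc)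
  also have "\<dots> = (\<Sum>k<d. \<Sum>l<d. M $$ (k, l) * (\<Sum>p\<in>X. b' p $$ (l, k) * b p $$ (i, j)))"
    unfolding sum_distrib_left by (rule sum_rotate)
  also have "\<dots> = (\<Sum>k<d. (if i = k then 1 else 0) * (\<Sum>l<d. M $$ (k, l) * (if j = l then 1 else 0)))"
  proof (rule sum.cong[OF refl])
    fix k assume k: "k \<in> {..<d}"
    have "(\<Sum>l<d. M $$ (k, l) * (\<Sum>p\<in>X. b' p $$ (l, k) * b p $$ (i, j)))
        = (\<Sum>l<d. (if i = k then 1 else 0) * (M $$ (k, l) * (if j = l then 1 else 0)))"
      by (rule sum.cong[OF refl], subst entries) (use k ij in auto)
    then show "(\<Sum>l<d. M $$ (k, l) * (\<Sum>p\<in>X. b' p $$ (l, k) * b p $$ (i, j)))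
        = (if i = k then 1 else 0) * (\<Sum>l<d. M $$ (k, l) * (if j = l then 1 else 0))"
      unfolding sum_distrib_left .
  qed
  also have "\<dots> = M $$ (i, j)" using ij by (simp add: sum_delta_left)
  finally show "M $$ (i, j) = msum d d (\<lambda>p. mtrace (M * b' p) \<cdot>\<^sub>m b p) X $$ (i, j)" by simp
qed (use M in auto)

definition munit :: "nat \<Rightarrow> nat \<Rightarrow> nat \<Rightarrow> nat \<Rightarrow> complex mat" where
  "munit r c i j = mat r c (\<lambda>(k, l). if k = i \<and> l = j then 1 else 0)"

lemma munit_carrier [simp]: "munit r c i j \<in> carrier_mat r c"
  by (simp add: munit_def)

lemma dim_munit [simp]: "dim_row (munit r c i j) = r" "dim_col (munit r c i j) = c"
  by (simp_all add: munit_def)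

lemma index_munit [simp]: "k < r \<Longrightarrow> l < c \<Longrightarrow> munit r c i j $$ (k, l) = (if k = i \<and> l = j then 1 else 0)"
  by (simp add: munit_def)

text \<open>Matrix units turn an identity between products \<open>A X B\<close>, for all \<open>X\<close>, into one between products of
  entries.\<close>

lemma mult_munit_mult:
  assumes A: "A \<in> carrier_mat r m" and B: "B \<in> carrier_mat n c"
    and ij: "i < r" "j < c" and kl: "k < m" "l < n"
  shows "(A * munit m n k l * B) $$ (i, j) = A $$ (i, k) * B $$ (l, j)"
proof -
  have 1: "(A * munit m n k l) $$ (i, q) = A $$ (i, k) * (if q = l then 1 else 0)" if q: "q < n" for q
  proof -
    have "(A * munit m n k l) $$ (i, q) = (\<Sum>s<m. A $$ (i, s) * munit m n k l $$ (s, q))"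
      by (rule mult_entry[OF A munit_carrier ij(1) q])
    also have "\<dots> = (\<Sum>s<m. A $$ (i, s) * (if s = k then 1 else 0)) * (if q = l then 1 else 0)"
      unfolding sum_distrib_right by (intro sum.cong refl) (use q in auto)
    finally show ?thesis using kl by (simp add: sum_delta_left)
  qed
  have "(A * munit m n k l * B) $$ (i, j) = (\<Sum>q<n. (A * munit m n k l) $$ (i, q) * B $$ (q, j))"
    by (rule mult_entry[OF mult_carrier_mat[OF A munit_carrier] B ij])
  also have "\<dots> = (\<Sum>q<n. (if q = l then 1 else 0) * (A $$ (i, k) * B $$ (q, j)))"
    by (intro sum.cong refl) (simp add: 1)
  finally show ?thesis using kl by (simp add: sum_delta_left)
qed

section \<open>Subspaces and irreducible families\<close>

definition lin_subspace :: "nat \<Rightarrow> complex vec set \<Rightarrow> bool" where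
  "lin_subspace n U \<longleftrightarrow> U \<subseteq> carrier_vec n \<and> 0\<^sub>v n \<in> U \<and>
    (\<forall>u\<in>U. \<forall>v\<in>U. u + v \<in> U) \<and> (\<forall>c. \<forall>u\<in>U. c \<cdot>\<^sub>v u \<in> U)"

lemma subspace_iff_lin_subspace:
  "VectorSpace.subspace class_ring U (module_vec TYPE(complex) n) \<longleftrightarrow> lin_subspace n U"
proof
  assume "VectorSpace.subspace class_ring U (module_vec TYPE(complex) n)"
  then interpret submodule class_ring U "module_vec TYPE(complex) n"
    by (simp add: subspace_def)
  show "lin_subspace n U"
    using subset m_closed zero_closed smult_closed unfolding lin_subspace_def
    by (auto simp: module_vec_simps class_ring_simps)
next
  assume "lin_subspace n U"
  then show "VectorSpace.subspace class_ring U (module_vec TYPE(complex) n)"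
    using vec_vs[of n, where ?'a = complex] vec_module[of n, where ?'a = complex]
    unfolding subspace_def submodule_def lin_subspace_def
    by (auto simp: module_vec_simps class_ring_simps)
qed

lemma irreducible_matrices_iff:
  "irreducible_matrices n S \<longleftrightarrow> n > 0 \<and>
    (\<forall>U. lin_subspace n U \<and> (\<forall>M\<in>S. \<forall>u\<in>U. M *\<^sub>v u \<in> U) \<longrightarrow> U = {0\<^sub>v n} \<or> U = carrier_vec n)"
  by (simp add: irreducible_matrices_def subspace_iff_lin_subspace)

text \<open>Every subspace is the range of an injective matrix that has a left inverse. The coordinates of the
  ambient space are added one at a time: the vectors of \<open>V\<close> supported on the first \<open>k + 1\<close> coordinates
  exceed those supported on the first \<open>k\<close> by at most one dimension. Here the \<open>a j\<close> are the columns of the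
  matrix and the \<open>b i\<close> the rows of its left inverse.\<close>

lemma subspace_coordinates_upto:
  assumes V: "lin_subspace D V" and k: "k \<le> D"
  shows "\<exists>(n::nat) a b. (\<forall>j<n. a j \<in> V \<and> (\<forall>r<D. r \<ge> k \<longrightarrow> a j $ r = 0)) \<and>
    (\<forall>i<n. \<forall>j<n. (\<Sum>r<D. b i r * a j $ r) = (if i = j then 1 else 0 :: complex)) \<and>
    (\<forall>v\<in>V. (\<forall>r<D. r \<ge> k \<longrightarrow> v $ r = 0) \<longrightarrow> (\<forall>r<D. v $ r = (\<Sum>j<n. (\<Sum>q<D. b j q * v $ q) * a j $ r)))"
  using k
proof (induction k)
  case 0
  show ?case by (rule exI[of _ 0]) simp
next
  case (Suc k)
  have kD: "k < D" using Suc.prems by simp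
  obtain n :: nat and a b where
    A: "\<forall>j<n. a j \<in> V \<and> (\<forall>r<D. r \<ge> k \<longrightarrow> a j $ r = 0)"
    and BA: "\<forall>i<n. \<forall>j<n. (\<Sum>r<D. b i r * a j $ r) = (if i = j then 1 else 0 :: complex)"
    and G: "\<forall>v\<in>V. (\<forall>r<D. r \<ge> k \<longrightarrow> v $ r = 0) \<longrightarrow>
      (\<forall>r<D. v $ r = (\<Sum>j<n. (\<Sum>q<D. b j q * v $ q) * a j $ r))"
    using Suc.IH[OF Suc_leD[OF Suc.prems]] by (elim exE conjE)
  have a: "\<And>j. j < n \<Longrightarrow> a j \<in> V" "\<And>j r. j < n \<Longrightarrow> r < D \<Longrightarrow> r \<ge> k \<Longrightarrow> a j $ r = 0"
    using A by auto
  have ba: "\<And>i j. i < n \<Longrightarrow> j < n \<Longrightarrow> (\<Sum>r<D. b i r * a j $ r) = (if i = j then 1 else 0)"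
    using BA by blast
  have gen: "\<And>v r. v \<in> V \<Longrightarrow> (\<forall>r<D. r \<ge> k \<longrightarrow> v $ r = 0) \<Longrightarrow> r < D \<Longrightarrow>
      v $ r = (\<Sum>j<n. (\<Sum>q<D. b j q * v $ q) * a j $ r)"
    using G by blast
  have Vc: "V \<subseteq> carrier_vec D" and Vadd: "\<And>u v. u \<in> V \<Longrightarrow> v \<in> V \<Longrightarrow> u + v \<in> V"
    and Vsm: "\<And>c u. u \<in> V \<Longrightarrow> c \<cdot>\<^sub>v u \<in> V"
    using V by (auto simp: lin_subspace_def)
  show ?case
  proof (cases "\<exists>v\<in>V. (\<forall>r<D. r \<ge> Suc k \<longrightarrow> v $ r = 0) \<and> v $ k \<noteq> 0")
    case False
    then have k0: "\<forall>r<D. r \<ge> k \<longrightarrow> v $ r = 0" if "v \<in> V" "\<forall>r<D. r \<ge> Suc k \<longrightarrow> v $ r = 0" for v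
      using that by (metis not_less_eq_eq order_antisym)
    show ?thesis
    proof (rule exI[of _ n], rule exI[of _ a], rule exI[of _ b], intro conjI allI impI ballI)
      fix j assume "j < n"
      then show "a j \<in> V" using a by simp
      fix r assume "r < D" "Suc k \<le> r"
      then show "a j $ r = 0" using a \<open>j < n\<close> by simp
    next
      fix i j assume "i < n" "j < n"
      then show "(\<Sum>r<D. b i r * a j $ r) = (if i = j then 1 else 0)" using ba by simp
    next
      fix w r assume "w \<in> V" "\<forall>r<D. Suc k \<le> r \<longrightarrow> w $ r = 0" "r < D"
      then show "w $ r = (\<Sum>j<n. (\<Sum>q<D. b j q * w $ q) * a j $ r)" using gen k0 by blast
    qed
  next
    case True
    then obtain v0 where v0: "v0 \<in> V" "\<And>r. r < D \<Longrightarrow> r \<ge> Suc k \<Longrightarrow> v0 $ r = 0" "v0 $ k \<noteq> 0" by auto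
    define v where "v = inverse (v0 $ k) \<cdot>\<^sub>v v0"
    have v0c: "v0 \<in> carrier_vec D" using v0(1) Vc by auto
    have vV: "v \<in> V" unfolding v_def by (rule Vsm[OF v0(1)])
    have vc: "v \<in> carrier_vec D" using vV Vc by auto
    have v_ge: "v $ r = 0" if "r < D" "r \<ge> Suc k" for r
      using v0(2)[OF that] that v0c by (simp add: v_def)
    have v_k: "v $ k = 1" using v0c v0(3) kD by (simp add: v_def)
    note v = vV v_ge v_k
    define \<beta> where "\<beta> i = (\<Sum>r<D. b i r * v $ r)" for i
    define a' where "a' j = (if j = n then v else a j)" for j
    define b' where "b' i r = (if i = n then (if r = k then 1 else 0)
        else b i r - \<beta> i * (if r = k then 1 else 0))" for i r
    have b'sum: "(\<Sum>r<D. b' i r * w $ r) = (if i = n then w $ k else (\<Sum>r<D. b i r * w $ r) - \<beta> i * w $ k)"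
      for i w
    proof -
      have delta: "(\<Sum>r<D. (if r = k then 1 else 0) * w $ r) = w $ k"
        using kD by (simp add: sum_delta_left)
      show ?thesis
      proof (cases "i = n")
        case True
        then show ?thesis using delta by (simp add: b'_def)
      next
        case False
        then have "(\<Sum>r<D. b' i r * w $ r)
            = (\<Sum>r<D. b i r * w $ r - \<beta> i * ((if r = k then 1 else 0) * w $ r))"
          by (simp add: b'_def left_diff_distrib mult.assoc)
        also have "\<dots> = (\<Sum>r<D. b i r * w $ r) - \<beta> i * w $ k"
          by (simp only: sum_subtractf sum_distrib_left[symmetric] delta)
        finally show ?thesis using False by simp
      qed
    qed
    show ?thesis
    proof (rule exI[of _ "Suc n"], rule exI[of _ a'], rule exI[of _ b'], intro conjI allI impI ballI)
      fix j assume "j < Suc n"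
      then show "a' j \<in> V" using a(1)[of j] vV by (simp add: a'_def)
      fix r assume "r < D" "Suc k \<le> r"
      then show "a' j $ r = 0" using a(2)[of j r] v_ge[of r] \<open>j < Suc n\<close> by (simp add: a'_def)
    next
      fix i j assume "i < Suc n" "j < Suc n"
      then consider "i < n" "j < n" | "i < n" "j = n" | "i = n" "j < n" | "i = n" "j = n"
        by (auto simp: less_Suc_eq)
      then show "(\<Sum>r<D. b' i r * a' j $ r) = (if i = j then 1 else 0)"
      proof cases
        case 1
        then show ?thesis unfolding b'sum using a(2)[OF _ kD order_refl, of j] ba[of i j] by (simp add: a'_def)
      next
        case 2
        then show ?thesis unfolding b'sum using v_k by (simp add: a'_def \<beta>_def)
      next
        case 3
        then show ?thesis unfolding b'sum using a(2)[OF _ kD order_refl, of j] by (simp add: a'_def)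
      next
        case 4
        then show ?thesis unfolding b'sum using v_k by (simp add: a'_def)
      qed
    next
      fix w r assume w: "w \<in> V" "\<forall>r<D. Suc k \<le> r \<longrightarrow> w $ r = 0" and r: "r < D"
      define u where "u = w + (- (w $ k)) \<cdot>\<^sub>v v"
      have wc: "w \<in> carrier_vec D" using w Vc by auto
      have u: "u \<in> V" unfolding u_def by (intro Vadd Vsm w v)
      have ur: "u $ r = w $ r - w $ k * v $ r" if "r < D" for r
        using that wc vc by (simp add: u_def)
      have "\<forall>r<D. k \<le> r \<longrightarrow> u $ r = 0"
      proof (intro allI impI)
        fix q assume q: "q < D" "k \<le> q"
        show "u $ q = 0"
        proof (cases "q = k")
          case True
          then show ?thesis using ur[OF kD] v_k by simp
        next
          case False
          then have "Suc k \<le> q" using q by simp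
          then show ?thesis using ur[OF q(1)] v_ge[OF q(1)] w(2) q(1) by simp
        qed
      qed
      from gen[OF u this r] have "u $ r = (\<Sum>j<n. (\<Sum>q<D. b j q * u $ q) * a j $ r)" .
      also have "\<dots> = (\<Sum>j<n. ((\<Sum>q<D. b j q * w $ q) - \<beta> j * w $ k) * a j $ r)"
      proof (intro sum.cong refl arg_cong2[of _ _ _ _ times])
        fix j
        have "(\<Sum>q<D. b j q * u $ q) = (\<Sum>q<D. b j q * w $ q - b j q * v $ q * w $ k)"
          by (intro sum.cong refl) (simp add: ur algebra_simps)
        then show "(\<Sum>q<D. b j q * u $ q) = (\<Sum>q<D. b j q * w $ q) - \<beta> j * w $ k"
          by (simp add: \<beta>_def sum_subtractf sum_distrib_right)
      qed
      finally have "w $ r = (\<Sum>j<n. ((\<Sum>q<D. b j q * w $ q) - \<beta> j * w $ k) * a j $ r) + w $ k * v $ r"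
        using ur[OF r] by (simp add: diff_eq_eq)
      also have "(\<Sum>j<n. ((\<Sum>q<D. b j q * w $ q) - \<beta> j * w $ k) * a j $ r)
          = (\<Sum>j<n. (\<Sum>q<D. b' j q * w $ q) * a' j $ r)"
      proof (rule sum.cong[OF refl])
        fix j assume "j \<in> {..<n}"
        then have "j \<noteq> n" by simp
        then show "((\<Sum>q<D. b j q * w $ q) - \<beta> j * w $ k) * a j $ r = (\<Sum>q<D. b' j q * w $ q) * a' j $ r"
          unfolding b'sum a'_def by (simp only: if_False)
      qed
      also have "w $ k * v $ r = (\<Sum>q<D. b' n q * w $ q) * a' n $ r"
        unfolding b'sum a'_def by (simp only: if_True refl)
      also have "(\<Sum>j<n. (\<Sum>q<D. b' j q * w $ q) * a' j $ r) + (\<Sum>q<D. b' n q * w $ q) * a' n $ r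
          = (\<Sum>j<Suc n. (\<Sum>q<D. b' j q * w $ q) * a' j $ r)"
        by (simp only: sum.lessThan_Suc)
      finally show "w $ r = (\<Sum>j<Suc n. (\<Sum>q<D. b' j q * w $ q) * a' j $ r)" .
    qed
  qed
qed

lemma subspace_coordinates:
  assumes V: "lin_subspace D V"
  obtains n A B where "A \<in> carrier_mat D n" "B \<in> carrier_mat n D" "B * A = 1\<^sub>m n"
    "V = {A *\<^sub>v x | x. x \<in> carrier_vec n}" "\<And>v. v \<in> V \<Longrightarrow> A *\<^sub>v (B *\<^sub>v v) = v"
proof -
  obtain n :: nat and a b where
    A: "\<forall>j<n. a j \<in> V \<and> (\<forall>r<D. r \<ge> D \<longrightarrow> a j $ r = 0)"
    and BA: "\<forall>i<n. \<forall>j<n. (\<Sum>r<D. b i r * a j $ r) = (if i = j then 1 else 0 :: complex)"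
    and G: "\<forall>v\<in>V. (\<forall>r<D. r \<ge> D \<longrightarrow> v $ r = 0) \<longrightarrow>
      (\<forall>r<D. v $ r = (\<Sum>j<n. (\<Sum>q<D. b j q * v $ q) * a j $ r))"
    using subspace_coordinates_upto[OF V order_refl] by (elim exE conjE)
  have a: "\<And>j. j < n \<Longrightarrow> a j \<in> V" using A by auto
  have ba: "\<And>i j. i < n \<Longrightarrow> j < n \<Longrightarrow> (\<Sum>r<D. b i r * a j $ r) = (if i = j then 1 else 0)"
    using BA by blast
  have gen: "\<And>v r. v \<in> V \<Longrightarrow> r < D \<Longrightarrow> v $ r = (\<Sum>j<n. (\<Sum>q<D. b j q * v $ q) * a j $ r)"
    using G by (meson leD)
  have Vc: "V \<subseteq> carrier_vec D" and V0: "0\<^sub>v D \<in> V" and Vadd: "\<And>u v. u \<in> V \<Longrightarrow> v \<in> V \<Longrightarrow> u + v \<in> V"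
    and Vsm: "\<And>c u. u \<in> V \<Longrightarrow> c \<cdot>\<^sub>v u \<in> V"
    using V by (auto simp: lin_subspace_def)
  define A where "A = mat D n (\<lambda>(r, j). a j $ r)"
  define B where "B = mat n D (\<lambda>(i, r). b i r)"
  have A: "A \<in> carrier_mat D n" and B: "B \<in> carrier_mat n D" by (auto simp: A_def B_def)
  have BA: "B * A = 1\<^sub>m n"
  proof (rule eq_matI)
    fix i j assume "i < dim_row (1\<^sub>m n :: complex mat)" "j < dim_col (1\<^sub>m n :: complex mat)"
    then show "(B * A) $$ (i, j) = 1\<^sub>m n $$ (i, j)"
      using ba by (subst mult_entry[OF B A]) (auto simp: A_def B_def)
  qed (use A B in auto)
  have ABv: "A *\<^sub>v (B *\<^sub>v v) = v" if v: "v \<in> V" for v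
  proof (rule eq_vecI)
    have vc: "v \<in> carrier_vec D" using v Vc by auto
    fix r assume "r < dim_vec v"
    then have r: "r < D" using vc by simp
    have "(A *\<^sub>v (B *\<^sub>v v)) $ r = (\<Sum>j<n. A $$ (r, j) * (B *\<^sub>v v) $ j)"
      using r B vc by (intro mult_vec_entry[OF A]) auto
    also have "\<dots> = (\<Sum>j<n. a j $ r * (\<Sum>q<D. b j q * v $ q))"
    proof (intro sum.cong refl)
      fix j assume j: "j \<in> {..<n}"
      have "(B *\<^sub>v v) $ j = (\<Sum>q<D. B $$ (j, q) * v $ q)"
        using j by (intro mult_vec_entry[OF B vc]) simp
      also have "\<dots> = (\<Sum>q<D. b j q * v $ q)" using j by (simp add: B_def)
      finally show "A $$ (r, j) * (B *\<^sub>v v) $ j = a j $ r * (\<Sum>q<D. b j q * v $ q)"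
        using r j by (simp add: A_def)
    qed
    also have "\<dots> = v $ r" using gen[OF v r] by (simp add: mult.commute)
    finally show "(A *\<^sub>v (B *\<^sub>v v)) $ r = v $ r" .
  qed (use v Vc A B in auto)
  have comb: "vec D (\<lambda>r. \<Sum>j<m. x j * a j $ r) \<in> V" if "m \<le> n" for m x
    using that
  proof (induction m)
    case 0
    have "vec D (\<lambda>r. 0) = (0\<^sub>v D :: complex vec)" by auto
    then show ?case using V0 by simp
  next
    case (Suc m)
    have "vec D (\<lambda>r. \<Sum>j<Suc m. x j * a j $ r) = vec D (\<lambda>r. \<Sum>j<m. x j * a j $ r) + x m \<cdot>\<^sub>v a m"
      using a[of m] Suc.prems Vc by (intro eq_vecI) auto
    then show ?case using Suc a[of m] Vadd Vsm by simp
  qed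
  have "V = {A *\<^sub>v x | x. x \<in> carrier_vec n}"
  proof (intro equalityI subsetI)
    fix v assume v: "v \<in> V"
    then have "v = A *\<^sub>v (B *\<^sub>v v)" "B *\<^sub>v v \<in> carrier_vec n"
      using ABv[OF v] B Vc v by auto
    then show "v \<in> {A *\<^sub>v x | x. x \<in> carrier_vec n}"
      by (intro CollectI exI[of _ "B *\<^sub>v v"] conjI)
  next
    fix v assume "v \<in> {A *\<^sub>v x | x. x \<in> carrier_vec n}"
    then obtain x where x: "v = A *\<^sub>v x" "x \<in> carrier_vec n" by (elim CollectE exE conjE)
    have "(A *\<^sub>v x) $ r = (\<Sum>j<n. x $ j * a j $ r)" if r: "r < D" for r
    proof -
      have "(A *\<^sub>v x) $ r = (\<Sum>j<n. A $$ (r, j) * x $ j)"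
        by (rule mult_vec_entry[OF A x(2) r])
      also have "\<dots> = (\<Sum>j<n. x $ j * a j $ r)"
        by (intro sum.cong refl) (use r in \<open>simp add: A_def mult.commute\<close>)
      finally show ?thesis .
    qed
    then have "A *\<^sub>v x = vec D (\<lambda>r. \<Sum>j<n. x $ j * a j $ r)"
      using A by (intro eq_vecI) simp_all
    then show "v \<in> V" using comb[OF order_refl, of "\<lambda>j. x $ j"] x(1) by metis
  qed
  then show thesis by (rule that[OF A B BA _ ABv])
qed

section \<open>Schur's lemma\<close>

lemma mat_eq_by_vec:
  assumes "A \<in> carrier_mat r c" "B \<in> carrier_mat r c"
    and "\<And>v. v \<in> carrier_vec c \<Longrightarrow> A *\<^sub>v v = B *\<^sub>v (v :: complex vec)"
  shows "A = B"
proof (rule eq_matI)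
  fix i j assume "i < dim_row B" "j < dim_col B"
  then have ij: "i < r" "j < c" using assms by auto
  have *: "(M *\<^sub>v unit_vec c j) $ i = M $$ (i, j)" if "M \<in> carrier_mat r c" for M :: "complex mat"
    using that ij by (subst mult_vec_entry[OF that unit_vec_carrier ij(1)]) (simp add: unit_vec_def sum_delta_left)
  show "A $$ (i, j) = B $$ (i, j)"
    using assms(3)[of "unit_vec c j"] *[OF assms(1)] *[OF assms(2)] by simp
qed (use assms in auto)

lemma smult_mult_mat_vec:
  assumes "A \<in> carrier_mat r c" "v \<in> carrier_vec c"
  shows "(a \<cdot>\<^sub>m A) *\<^sub>v v = a \<cdot>\<^sub>v (A *\<^sub>v (v :: complex vec))"
proof (rule eq_vecI)
  fix i assume "i < dim_vec (a \<cdot>\<^sub>v (A *\<^sub>v v))"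
  then have i: "i < r" using assms by simp
  have "((a \<cdot>\<^sub>m A) *\<^sub>v v) $ i = (\<Sum>k<c. (a \<cdot>\<^sub>m A) $$ (i, k) * v $ k)"
    by (rule mult_vec_entry[of _ r]) (use assms i in auto)
  also have "\<dots> = a * (A *\<^sub>v v) $ i"
    unfolding mult_vec_entry[OF assms i] sum_distrib_left using assms i
    by (intro sum.cong refl) (simp add: smult_entry mult.assoc)
  finally show "((a \<cdot>\<^sub>m A) *\<^sub>v v) $ i = (a \<cdot>\<^sub>v (A *\<^sub>v v)) $ i" using assms i by simp
qed (use assms in auto)

lemma mult_mat_vec_zero [simp]: "A \<in> carrier_mat r c \<Longrightarrow> A *\<^sub>v 0\<^sub>v c = (0\<^sub>v r :: complex vec)"
  by (intro eq_vecI) auto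

lemma zero_mat_mult_vec [simp]: "v \<in> carrier_vec c \<Longrightarrow> 0\<^sub>m r c *\<^sub>v v = (0\<^sub>v r :: complex vec)"
  by (intro eq_vecI) auto

lemma kernel_lin_subspace:
  assumes "T \<in> carrier_mat m n"
  shows "lin_subspace n {u \<in> carrier_vec n. T *\<^sub>v u = 0\<^sub>v m}"
  using assms by (auto simp: lin_subspace_def mult_add_distrib_mat_vec[OF assms] mult_mat_vec[OF assms])

lemma range_lin_subspace:
  assumes T: "T \<in> carrier_mat m n"
  shows "lin_subspace m {T *\<^sub>v u | u. u \<in> carrier_vec n}"
  unfolding lin_subspace_def
proof (intro conjI ballI allI)
  show "{T *\<^sub>v u |u. u \<in> carrier_vec n} \<subseteq> carrier_vec m" using T by auto
  show "0\<^sub>v m \<in> {T *\<^sub>v u |u. u \<in> carrier_vec n}"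
    by (rule CollectI, rule exI[of _ "0\<^sub>v n"]) (use T in simp)
next
  fix u v assume "u \<in> {T *\<^sub>v u |u. u \<in> carrier_vec n}" "v \<in> {T *\<^sub>v u |u. u \<in> carrier_vec n}"
  then obtain u' v' where "u = T *\<^sub>v u'" "v = T *\<^sub>v v'" "u' \<in> carrier_vec n" "v' \<in> carrier_vec n"
    by (elim CollectE exE conjE)
  then show "u + v \<in> {T *\<^sub>v u |u. u \<in> carrier_vec n}"
    by (intro CollectI exI[of _ "u' + v'"]) (simp add: mult_add_distrib_mat_vec[OF T])
next
  fix c u assume "u \<in> {T *\<^sub>v u |u. u \<in> carrier_vec n}"
  then obtain u' where "u = T *\<^sub>v u'" "u' \<in> carrier_vec n" by (elim CollectE exE conjE)
  then show "c \<cdot>\<^sub>v u \<in> {T *\<^sub>v u |u. u \<in> carrier_vec n}"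
    by (intro CollectI exI[of _ "c \<cdot>\<^sub>v u'"]) (simp add: mult_mat_vec[OF T])
qed

lemma carrier_GL_iff:
  "T \<in> carrier (GL n) \<longleftrightarrow> T \<in> carrier_mat n n \<and>
     (\<exists>X\<in>carrier_mat n n. X * T = 1\<^sub>m n \<and> T * X = (1\<^sub>m n :: complex mat))"
  by (auto simp: units_of_def Units_def ring_mat_def)

lemma GL_simps [simp]: "monoid.mult (GL n) = (*)" "one (GL n) = 1\<^sub>m n"
  by (simp_all add: units_of_def ring_mat_def)

lemma carrier_GL_mat: "T \<in> carrier (GL n) \<Longrightarrow> T \<in> carrier_mat n n"
  by (simp add: carrier_GL_iff)

lemma GL_inv:
  assumes "T \<in> carrier (GL n)"
  shows "inv\<^bsub>GL n\<^esub> T \<in> carrier_mat n n" "T * inv\<^bsub>GL n\<^esub> T = 1\<^sub>m n" "inv\<^bsub>GL n\<^esub> T * T = 1\<^sub>m n"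
proof -
  interpret group "GL n" by (rule group_GL)
  show "inv\<^bsub>GL n\<^esub> T \<in> carrier_mat n n" by (rule carrier_GL_mat) (use assms in simp)
  show "T * inv\<^bsub>GL n\<^esub> T = 1\<^sub>m n" "inv\<^bsub>GL n\<^esub> T * T = 1\<^sub>m n"
    using r_inv[OF assms] l_inv[OF assms] by simp_all
qed

lemma GL_I:
  assumes "T \<in> carrier_mat n n" "X \<in> carrier_mat n n" "T * X = (1\<^sub>m n :: complex mat)"
  shows "T \<in> carrier (GL n)"
  using assms mat_mult_left_right_inverse[OF assms] by (auto simp: carrier_GL_iff)

lemma dim_le_of_left_inverse:
  assumes A: "A \<in> carrier_mat D n" and B: "B \<in> carrier_mat n D" and BA: "B * A = (1\<^sub>m n :: complex mat)"
  shows "n \<le> D"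
proof (rule ccontr)
  assume "\<not> n \<le> D"
  then have Dn: "D < n" by simp
  \<comment> \<open>padding with zeros to square matrices gives a one-sided inverse with a zero row\<close>
  define A' where "A' = mat n n (\<lambda>(i, j). if i < D then A $$ (i, j) else 0)"
  define B' where "B' = mat n n (\<lambda>(i, j). if j < D then B $$ (i, j) else 0)"
  have A': "A' \<in> carrier_mat n n" and B': "B' \<in> carrier_mat n n" by (auto simp: A'_def B'_def)
  have "B' * A' = 1\<^sub>m n"
  proof (rule eq_matI)
    fix i j assume "i < dim_row (1\<^sub>m n :: complex mat)" "j < dim_col (1\<^sub>m n :: complex mat)"
    then have ij: "i < n" "j < n" by auto
    have "(B' * A') $$ (i, j) = (\<Sum>k<n. B' $$ (i, k) * A' $$ (k, j))"
      by (rule mult_entry[OF B' A' ij])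
    also have "\<dots> = (\<Sum>k<D. B $$ (i, k) * A $$ (k, j))"
      by (rule sum.mono_neutral_cong_right) (use Dn ij in \<open>auto simp: A'_def B'_def\<close>)
    also have "\<dots> = (B * A) $$ (i, j)" by (rule mult_entry[OF B A ij, symmetric])
    finally show "(B' * A') $$ (i, j) = 1\<^sub>m n $$ (i, j)" using BA by simp
  qed (use A' B' in auto)
  then have "A' * B' = 1\<^sub>m n" by (rule mat_mult_left_right_inverse[OF B' A'])
  then have "(A' * B') $$ (D, D) = 1" using Dn by simp
  moreover have "(A' * B') $$ (D, D) = (\<Sum>k<n. A' $$ (D, k) * B' $$ (k, D))"
    by (rule mult_entry[OF A' B' Dn Dn])
  moreover have "\<dots> = 0" by (rule sum.neutral) (use Dn in \<open>auto simp: A'_def\<close>)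
  ultimately show False by simp
qed

text \<open>Schur's lemma: kernel and range of an intertwiner are invariant.\<close>

lemma schur_isomorphism:
  assumes f: "\<And>x. x \<in> I \<Longrightarrow> f x \<in> carrier_mat n n" "irreducible_matrices n (f ` I)"
    and g: "\<And>x. x \<in> I \<Longrightarrow> g x \<in> carrier_mat m m" "irreducible_matrices m (g ` I)"
    and T: "T \<in> carrier_mat m n" "\<And>x. x \<in> I \<Longrightarrow> T * f x = g x * T" "T \<noteq> 0\<^sub>m m n"
  shows "m = n" "T \<in> carrier (GL n)"
proof -
  let ?K = "{u \<in> carrier_vec n. T *\<^sub>v u = 0\<^sub>v m}"
  let ?R = "{T *\<^sub>v u | u. u \<in> carrier_vec n}"
  have comm: "T *\<^sub>v (f x *\<^sub>v u) = g x *\<^sub>v (T *\<^sub>v u)" if "x \<in> I" "u \<in> carrier_vec n" for x u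
    using assoc_mult_mat_vec[OF T(1) f(1) that(2)] assoc_mult_mat_vec[OF g(1) T(1) that(2)] T(2) that(1)
    by simp
  have "\<forall>M\<in>f ` I. \<forall>u\<in>?K. M *\<^sub>v u \<in> ?K"
    using comm f(1) g(1) by (auto intro!: mult_mat_vec_carrier)
  then have "?K = {0\<^sub>v n} \<or> ?K = carrier_vec n"
    using f(2) kernel_lin_subspace[OF T(1)] unfolding irreducible_matrices_iff by blast
  moreover have "?K \<noteq> carrier_vec n"
  proof
    assume "?K = carrier_vec n"
    then have "T = 0\<^sub>m m n" by (intro mat_eq_by_vec[OF T(1)]) auto
    then show False using T(3) by simp
  qed
  ultimately have K: "?K = {0\<^sub>v n}" by blast
  have "\<forall>M\<in>g ` I. \<forall>u\<in>?R. M *\<^sub>v u \<in> ?R"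
  proof (intro ballI)
    fix M u assume "M \<in> g ` I" "u \<in> ?R"
    then obtain x v where "M = g x" "x \<in> I" "u = T *\<^sub>v v" "v \<in> carrier_vec n"
      by (elim imageE CollectE exE conjE)
    then show "M *\<^sub>v u \<in> ?R"
      using comm f(1) by (intro CollectI exI[of _ "f x *\<^sub>v v"]) (auto intro!: mult_mat_vec_carrier)
  qed
  then have "?R = {0\<^sub>v m} \<or> ?R = carrier_vec m"
    using g(2) range_lin_subspace[OF T(1)] unfolding irreducible_matrices_iff by blast
  moreover have "?R \<noteq> {0\<^sub>v m}"
  proof
    assume R0: "?R = {0\<^sub>v m}"
    have "T = 0\<^sub>m m n"
    proof (rule mat_eq_by_vec[OF T(1)])
      fix v :: "complex vec" assume v: "v \<in> carrier_vec n"
      then have "T *\<^sub>v v \<in> ?R" by blast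
      then show "T *\<^sub>v v = 0\<^sub>m m n *\<^sub>v v" using R0 v by simp
    qed simp
    then show False using T(3) by simp
  qed
  ultimately have R: "?R = carrier_vec m" by blast
  have "\<exists>x. x \<in> carrier_vec n \<and> T *\<^sub>v x = unit_vec m j" for j
  proof -
    have "unit_vec m j \<in> ?R" unfolding R by simp
    then show ?thesis by force
  qed
  then obtain x where x: "\<And>j. x j \<in> carrier_vec n" "\<And>j. T *\<^sub>v x j = unit_vec m j" by metis
  define X where "X = mat n m (\<lambda>(i, j). x j $ i)"
  have X: "X \<in> carrier_mat n m" by (simp add: X_def)
  have TX: "T * X = 1\<^sub>m m"
  proof (rule eq_matI)
    fix i j assume "i < dim_row (1\<^sub>m m :: complex mat)" "j < dim_col (1\<^sub>m m :: complex mat)"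
    then have ij: "i < m" "j < m" by auto
    have "(T * X) $$ (i, j) = (\<Sum>k<n. T $$ (i, k) * X $$ (k, j))" by (rule mult_entry[OF T(1) X ij])
    also have "\<dots> = (\<Sum>k<n. T $$ (i, k) * x j $ k)"
      by (intro sum.cong refl) (use ij in \<open>simp add: X_def\<close>)
    also have "\<dots> = (T *\<^sub>v x j) $ i" by (rule mult_vec_entry[OF T(1) x(1) ij(1), symmetric])
    finally show "(T * X) $$ (i, j) = 1\<^sub>m m $$ (i, j)" using ij x(2) by (simp add: unit_vec_def)
  qed (use T X in auto)
  have XT: "X * T = 1\<^sub>m n"
  proof (rule mat_eq_by_vec)
    fix v :: "complex vec" assume v: "v \<in> carrier_vec n"
    define w where "w = X *\<^sub>v (T *\<^sub>v v) + (-1) \<cdot>\<^sub>v v"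
    have Xv: "X *\<^sub>v (T *\<^sub>v v) \<in> carrier_vec n" using X T v by auto
    have Tv: "T *\<^sub>v v \<in> carrier_vec m" using T v by auto
    have TXv: "T *\<^sub>v (X *\<^sub>v (T *\<^sub>v v)) = T *\<^sub>v v"
      using assoc_mult_mat_vec[OF T(1) X Tv] TX Tv by simp
    have "T *\<^sub>v w = T *\<^sub>v v + (-1) \<cdot>\<^sub>v (T *\<^sub>v v)"
      unfolding w_def using Xv v by (simp add: mult_add_distrib_mat_vec[OF T(1)] mult_mat_vec[OF T(1)] TXv)
    also have "\<dots> = 0\<^sub>v m" using Tv T(1) by (intro eq_vecI) auto
    finally have "w \<in> ?K" using Xv v by (auto simp: w_def)
    then have "w = 0\<^sub>v n" using K by auto
    have "(X *\<^sub>v (T *\<^sub>v v)) $ i = v $ i" if "i < n" for i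
    proof -
      have "w $ i = (X *\<^sub>v (T *\<^sub>v v)) $ i - v $ i" using that Xv v by (simp add: w_def)
      then show ?thesis using \<open>w = 0\<^sub>v n\<close> that by simp
    qed
    then have "X *\<^sub>v (T *\<^sub>v v) = v" using Xv v X by (intro eq_vecI) auto
    then show "X * T *\<^sub>v v = 1\<^sub>m n *\<^sub>v v"
      using assoc_mult_mat_vec[OF X T(1) v] v by simp
  qed (use X T in auto)
  have "of_nat m = (of_nat n :: complex)"
    using mtrace_comm[OF T(1) X] by (simp add: TX XT)
  then show mn: "m = n" by simp
  show "T \<in> carrier (GL n)"
    using GL_I[of T n X] T(1) X TX mn by simp
qed

text \<open>An intertwiner minus one of its eigenvalues is singular, hence zero.\<close>

lemma schur_scalar:
  assumes f: "\<And>x. x \<in> I \<Longrightarrow> f x \<in> carrier_mat n n" "irreducible_matrices n (f ` I)"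
    and T: "T \<in> carrier_mat n n" "\<And>x. x \<in> I \<Longrightarrow> T * f x = f x * T"
  shows "\<exists>c. T = c \<cdot>\<^sub>m 1\<^sub>m n"
proof -
  have n: "n > 0" using f(2) by (simp add: irreducible_matrices_iff)
  obtain k where "eigenvalue T k" using spectrum_non_empty[OF T(1) n] by (auto simp: spectrum_def)
  then obtain v where v: "v \<in> carrier_vec n" "v \<noteq> 0\<^sub>v n" "T *\<^sub>v v = k \<cdot>\<^sub>v v"
    using T(1) by (auto simp: eigenvalue_def eigenvector_def)
  define S where "S = T + (- k) \<cdot>\<^sub>m 1\<^sub>m n"
  have S: "S \<in> carrier_mat n n" using T(1) by (simp add: S_def)
  have comm: "S * f x = f x * S" if "x \<in> I" for x
  proof -
    have fx: "f x \<in> carrier_mat n n" using f(1) that .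
    have "S * f x = T * f x + (- k) \<cdot>\<^sub>m f x"
      unfolding S_def using fx T(1)
      by (simp add: add_mult_distrib_mat[of T n n "(- k) \<cdot>\<^sub>m 1\<^sub>m n" "f x" n])
        (simp add: mult_smult_assoc_mat[of "1\<^sub>m n" n n "f x" n])
    also have "\<dots> = f x * S"
      unfolding S_def using fx T that
      by (simp add: mult_add_distrib_mat[of "f x" n n T n "(- k) \<cdot>\<^sub>m 1\<^sub>m n"])
        (simp add: mult_smult_distrib[of "f x" n n "1\<^sub>m n" n])
    finally show ?thesis .
  qed
  have Sv: "S *\<^sub>v v = 0\<^sub>v n"
    unfolding S_def using v T(1)
    by (subst add_mult_distrib_mat_vec[of T n n]) (auto intro!: eq_vecI simp: smult_mult_mat_vec[of _ n n])
  have "S = 0\<^sub>m n n"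
  proof (rule ccontr)
    assume "S \<noteq> 0\<^sub>m n n"
    then have "S \<in> carrier (GL n)" using schur_isomorphism(2)[OF f f S comm] by simp
    then obtain X where X: "X \<in> carrier_mat n n" "X * S = 1\<^sub>m n" by (auto simp: carrier_GL_iff)
    have "v = (X * S) *\<^sub>v v" using X v by simp
    also have "\<dots> = X *\<^sub>v (S *\<^sub>v v)" by (rule assoc_mult_mat_vec[OF X(1) S v(1)])
    also have "\<dots> = 0\<^sub>v n" using Sv X by simp
    finally show False using v by simp
  qed
  have "T = k \<cdot>\<^sub>m 1\<^sub>m n"
  proof (rule eq_matI)
    fix i j assume "i < dim_row (k \<cdot>\<^sub>m 1\<^sub>m n :: complex mat)" "j < dim_col (k \<cdot>\<^sub>m 1\<^sub>m n :: complex mat)"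
    then have ij: "i < n" "j < n" by auto
    have "S $$ (i, j) = 0" using \<open>S = 0\<^sub>m n n\<close> ij by simp
    then show "T $$ (i, j) = (k \<cdot>\<^sub>m 1\<^sub>m n) $$ (i, j)" using ij T(1) by (auto simp: S_def)
  qed (use T in auto)
  then show ?thesis by blast
qed

section \<open>Subrepresentations, idempotents and traces\<close>

text \<open>An invariant nonzero subspace of least dimension is irreducible. It is described by coordinates
  \<open>A\<close> on it and a projection \<open>B\<close> to these coordinates, so that the operators restrict to \<open>B * f x * A\<close>.\<close>

lemma irreducible_subrepresentation:
  assumes f: "\<And>x. x \<in> I \<Longrightarrow> f x \<in> carrier_mat D D"
    and V: "lin_subspace D V" "V \<noteq> {0\<^sub>v D}" "\<And>x v. x \<in> I \<Longrightarrow> v \<in> V \<Longrightarrow> f x *\<^sub>v v \<in> V"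
  obtains n A B where "A \<in> carrier_mat D n" "B \<in> carrier_mat n D" "B * A = 1\<^sub>m n"
    "\<And>w. w \<in> carrier_vec n \<Longrightarrow> A *\<^sub>v w \<in> V"
    "\<And>x. x \<in> I \<Longrightarrow> f x * A = A * (B * f x * A)"
    "irreducible_matrices n ((\<lambda>x. B * f x * A) ` I)"
proof -
  define P where "P n \<longleftrightarrow> n > 0 \<and> (\<exists>A B. A \<in> carrier_mat D n \<and> B \<in> carrier_mat n D \<and> B * A = 1\<^sub>m n \<and>
    (\<forall>w\<in>carrier_vec n. A *\<^sub>v w \<in> V) \<and> (\<forall>x\<in>I. f x * A = A * (B * f x * A)))" for n
  have sub: "P n" if W: "lin_subspace D W" "W \<subseteq> V" "W \<noteq> {0\<^sub>v D}"
      "\<And>x v. x \<in> I \<Longrightarrow> v \<in> W \<Longrightarrow> f x *\<^sub>v v \<in> W"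
      and A: "A \<in> carrier_mat D n" and B: "B \<in> carrier_mat n D" and BA: "B * A = 1\<^sub>m n"
      and WA: "W = {A *\<^sub>v x | x. x \<in> carrier_vec n}" "\<And>v. v \<in> W \<Longrightarrow> A *\<^sub>v (B *\<^sub>v v) = v"
    for W n A B
  proof -
    have in_W: "A *\<^sub>v w \<in> W" if "w \<in> carrier_vec n" for w using WA(1) that by blast
    have "n > 0"
    proof (rule ccontr)
      assume "\<not> n > 0"
      then have n0: "n = 0" by simp
      have "v = 0\<^sub>v D" if "v \<in> W" for v
      proof -
        have "v \<in> {A *\<^sub>v x | x. x \<in> carrier_vec n}" using that WA(1) by simp
        then obtain x where "v = A *\<^sub>v x" "x \<in> carrier_vec n" by (elim CollectE exE conjE)
        then show ?thesis using A n0 by (intro eq_vecI) (auto simp: scalar_prod_def)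
      qed
      moreover have "0\<^sub>v D \<in> W" using W(1) by (simp add: lin_subspace_def)
      ultimately show False using W(3) by blast
    qed
    moreover have "f x * A = A * (B * f x * A)" if x: "x \<in> I" for x
    proof (rule mat_eq_by_vec)
      have fx: "f x \<in> carrier_mat D D" using f x .
      show "f x * A \<in> carrier_mat D n" "A * (B * f x * A) \<in> carrier_mat D n" using A B fx by auto
      fix v :: "complex vec" assume v: "v \<in> carrier_vec n"
      have Av: "A *\<^sub>v v \<in> carrier_vec D" using A v by auto
      have "A * (B * f x * A) *\<^sub>v v = A *\<^sub>v ((B * f x * A) *\<^sub>v v)"
        using A B fx v by (intro assoc_mult_mat_vec[of _ D n _ n]) auto
      also have "(B * f x * A) *\<^sub>v v = (B * f x) *\<^sub>v (A *\<^sub>v v)"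
        using A B fx v by (intro assoc_mult_mat_vec[of _ n D _ n]) auto
      also have "\<dots> = B *\<^sub>v (f x *\<^sub>v (A *\<^sub>v v))"
        using B fx Av by (intro assoc_mult_mat_vec[of _ n D _ D]) auto
      also have "A *\<^sub>v \<dots> = f x *\<^sub>v (A *\<^sub>v v)" using WA(2) W(4)[OF x in_W[OF v]] by simp
      also have "\<dots> = f x * A *\<^sub>v v" by (rule assoc_mult_mat_vec[OF fx A v, symmetric])
      finally show "f x * A *\<^sub>v v = A * (B * f x * A) *\<^sub>v v" by simp
    qed
    ultimately show "P n" unfolding P_def using A B BA in_W W(2) by blast
  qed
  obtain n1 A1 B1 where "A1 \<in> carrier_mat D n1" "B1 \<in> carrier_mat n1 D" "B1 * A1 = 1\<^sub>m n1"
    "V = {A1 *\<^sub>v x | x. x \<in> carrier_vec n1}" "\<And>v. v \<in> V \<Longrightarrow> A1 *\<^sub>v (B1 *\<^sub>v v) = v"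
    by (rule subspace_coordinates[OF V(1)]) (rule that)
  from sub[OF V(1) order_refl V(2,3) this] have "P n1" by simp
  define n where "n = (LEAST n. P n)"
  have "P n" unfolding n_def by (rule LeastI) fact
  have least: "n \<le> k" if "P k" for k unfolding n_def by (rule Least_le) fact
  obtain A B where n: "n > 0" and A: "A \<in> carrier_mat D n" and B: "B \<in> carrier_mat n D"
    and BA: "B * A = 1\<^sub>m n" and AV: "\<And>w. w \<in> carrier_vec n \<Longrightarrow> A *\<^sub>v w \<in> V"
    and fA: "\<And>x. x \<in> I \<Longrightarrow> f x * A = A * (B * f x * A)"
    using \<open>P n\<close> unfolding P_def by blast
  have "irreducible_matrices n ((\<lambda>x. B * f x * A) ` I)"
    unfolding irreducible_matrices_iff
  proof (intro conjI allI impI n, elim conjE)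
    fix U assume U: "lin_subspace n U" and inv: "\<forall>M\<in>(\<lambda>x. B * f x * A) ` I. \<forall>u\<in>U. M *\<^sub>v u \<in> U"
    show "U = {0\<^sub>v n} \<or> U = carrier_vec n"
    proof (rule disjCI)
      assume "U \<noteq> carrier_vec n"
      show "U = {0\<^sub>v n}"
      proof (rule ccontr)
        assume U0: "U \<noteq> {0\<^sub>v n}"
        have Uc: "U \<subseteq> carrier_vec n" using U by (simp add: lin_subspace_def)
        obtain k A' B' where A': "A' \<in> carrier_mat n k" and B': "B' \<in> carrier_mat k n"
          and BA': "B' * A' = 1\<^sub>m k" and UA: "U = {A' *\<^sub>v x | x. x \<in> carrier_vec k}"
          and AB': "\<And>v. v \<in> U \<Longrightarrow> A' *\<^sub>v (B' *\<^sub>v v) = v"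
          by (rule subspace_coordinates[OF U]) (rule that)
        define W where "W = {A *\<^sub>v u | u. u \<in> U}"
        have W_A: "W = {(A * A') *\<^sub>v x | x. x \<in> carrier_vec k}"
        proof (intro equalityI subsetI)
          fix w assume "w \<in> W"
          then obtain u where "w = A *\<^sub>v u" "u \<in> U" unfolding W_def by (elim CollectE exE conjE)
          moreover from this obtain x where "u = A' *\<^sub>v x" "x \<in> carrier_vec k"
            unfolding UA by (elim CollectE exE conjE)
          ultimately show "w \<in> {(A * A') *\<^sub>v x | x. x \<in> carrier_vec k}"
            by (intro CollectI exI[of _ x]) (simp add: assoc_mult_mat_vec[OF A A'])
        next
          fix w assume "w \<in> {(A * A') *\<^sub>v x | x. x \<in> carrier_vec k}"
          then obtain x where x: "w = (A * A') *\<^sub>v x" "x \<in> carrier_vec k" by (elim CollectE exE conjE)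
          then have "A' *\<^sub>v x \<in> U" unfolding UA by blast
          then show "w \<in> W" unfolding W_def using x
            by (intro CollectI exI[of _ "A' *\<^sub>v x"]) (simp add: assoc_mult_mat_vec[OF A A'])
        qed
        have BAu: "B *\<^sub>v (A *\<^sub>v u) = u" if "u \<in> carrier_vec n" for u
          using assoc_mult_mat_vec[OF B A that] BA that by simp
        have W: "lin_subspace D W" unfolding W_A by (rule range_lin_subspace) (use A A' in auto)
        have "W \<subseteq> V" unfolding W_def using AV Uc by blast
        moreover have "W \<noteq> {0\<^sub>v D}"
        proof
          assume W0: "W = {0\<^sub>v D}"
          have "u = 0\<^sub>v n" if u: "u \<in> U" for u
          proof -
            have "A *\<^sub>v u \<in> W" using u by (auto simp: W_def)
            then have "A *\<^sub>v u = 0\<^sub>v D" using W0 by simp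
            then show ?thesis using BAu[of u] u Uc B by auto
          qed
          moreover have "0\<^sub>v n \<in> U" using U by (simp add: lin_subspace_def)
          ultimately show False using U0 by blast
        qed
        moreover have "f x *\<^sub>v w \<in> W" if x: "x \<in> I" and "w \<in> W" for x w
        proof -
          obtain u where u: "w = A *\<^sub>v u" "u \<in> U" using \<open>w \<in> W\<close> unfolding W_def by (elim CollectE exE conjE)
          have uc: "u \<in> carrier_vec n" using u Uc by blast
          have fx: "f x \<in> carrier_mat D D" using f x .
          have g: "B * f x * A \<in> carrier_mat n n" using A B fx by auto
          have "f x *\<^sub>v w = (f x * A) *\<^sub>v u" using u(1) assoc_mult_mat_vec[OF fx A uc] by simp
          also have "\<dots> = A *\<^sub>v ((B * f x * A) *\<^sub>v u)"
            using fA[OF x] assoc_mult_mat_vec[OF A g uc] by simp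
          finally show ?thesis unfolding W_def using inv x u(2) by blast
        qed
        moreover have "A * A' \<in> carrier_mat D k" "B' * B \<in> carrier_mat k D" using A A' B B' by auto
        moreover have "(B' * B) * (A * A') = 1\<^sub>m k"
        proof -
          have "(B' * B) * (A * A') = B' * (B * (A * A'))"
            using A A' B B' by (intro assoc_mult_mat[of _ k n _ D _ k]) auto
          also have "B * (A * A') = (B * A) * A'"
            using A A' B by (intro assoc_mult_mat[symmetric, of _ n D _ n _ k]) auto
          finally show ?thesis using BA BA' A' by simp
        qed
        moreover have "(A * A') *\<^sub>v ((B' * B) *\<^sub>v w) = w" if wW: "w \<in> W" for w
        proof -
          obtain u where u: "w = A *\<^sub>v u" "u \<in> U" using wW unfolding W_def by (elim CollectE exE conjE)
          have uc: "u \<in> carrier_vec n" using u Uc by blast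
          have "(B' * B) *\<^sub>v w = B' *\<^sub>v u"
            using assoc_mult_mat_vec[OF B' B, of w] BAu[OF uc] u A uc by auto
          moreover have "(A * A') *\<^sub>v (B' *\<^sub>v u) = A *\<^sub>v (A' *\<^sub>v (B' *\<^sub>v u))"
            using B' uc by (intro assoc_mult_mat_vec[OF A A']) auto
          ultimately show ?thesis using AB'[OF u(2)] u(1) by simp
        qed
        ultimately have "P k" using sub[OF W _ _ _ _ _ _ W_A] by blast
        then have "n \<le> k" by (rule least)
        then have kn: "k = n" using dim_le_of_left_inverse[OF A' B' BA'] by simp
        have "v \<in> U" if v: "v \<in> carrier_vec n" for v
        proof -
          have "A' * B' = 1\<^sub>m n" using mat_mult_left_right_inverse[of B' n A'] A' B' BA' kn by simp
          then have "v = A' *\<^sub>v (B' *\<^sub>v v)" using assoc_mult_mat_vec[OF A' B' v] v by simp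
          moreover have "B' *\<^sub>v v \<in> carrier_vec k" using B' v by auto
          ultimately show ?thesis unfolding UA by (intro CollectI exI[of _ "B' *\<^sub>v v"] conjI)
        qed
        then show False using Uc \<open>U \<noteq> carrier_vec n\<close> by blast
      qed
    qed
  qed
  with A B BA AV fA show thesis by (rule that)
qed

text \<open>An idempotent is the identity on its range, so coordinates on the range factor it; by cyclicity of
  the trace, the trace of an idempotent is its rank.\<close>

lemma idempotent_factorization:
  assumes e: "e \<in> carrier_mat D D" "e * e = e"
  obtains n A B where "A \<in> carrier_mat D n" "B \<in> carrier_mat n D" "B * A = 1\<^sub>m n" "A * B = e"
    "of_nat n = mtrace e"
proof -
  define V where "V = {e *\<^sub>v x | x. x \<in> carrier_vec D}"
  have V: "lin_subspace D V" unfolding V_def by (rule range_lin_subspace[OF e(1)])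
  obtain n A C where A: "A \<in> carrier_mat D n" and C: "C \<in> carrier_mat n D" and CA: "C * A = 1\<^sub>m n"
    and VA: "V = {A *\<^sub>v x | x. x \<in> carrier_vec n}" and ACv: "\<And>v. v \<in> V \<Longrightarrow> A *\<^sub>v (C *\<^sub>v v) = v"
    by (rule subspace_coordinates[OF V]) (rule that)
  have ev: "e *\<^sub>v v = v" if v: "v \<in> V" for v
  proof -
    obtain x where x: "v = e *\<^sub>v x" "x \<in> carrier_vec D" using v unfolding V_def by (elim CollectE exE conjE)
    then show ?thesis using assoc_mult_mat_vec[OF e(1) e(1) x(2)] e(2) by simp
  qed
  have eA: "e * A = A"
  proof (rule mat_eq_by_vec)
    fix v :: "complex vec" assume v: "v \<in> carrier_vec n"
    then have "A *\<^sub>v v \<in> V" unfolding VA by blast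
    then show "e * A *\<^sub>v v = A *\<^sub>v v" using ev assoc_mult_mat_vec[OF e(1) A v] by simp
  qed (use A e in auto)
  define B where "B = C * e"
  have B: "B \<in> carrier_mat n D" using C e by (simp add: B_def)
  have BA: "B * A = 1\<^sub>m n" unfolding B_def using assoc_mult_mat[OF C e(1) A] eA CA by simp
  have AB: "A * B = e"
  proof (rule mat_eq_by_vec)
    fix v :: "complex vec" assume v: "v \<in> carrier_vec D"
    then have "e *\<^sub>v v \<in> V" unfolding V_def by blast
    have "A * B *\<^sub>v v = A *\<^sub>v (B *\<^sub>v v)" by (rule assoc_mult_mat_vec[OF A B v])
    also have "B *\<^sub>v v = C *\<^sub>v (e *\<^sub>v v)" unfolding B_def by (rule assoc_mult_mat_vec[OF C e(1) v])
    also have "A *\<^sub>v \<dots> = e *\<^sub>v v" by (rule ACv) fact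
    finally show "A * B *\<^sub>v v = e *\<^sub>v v" .
  qed (use A B e in auto)
  have "of_nat n = mtrace e" using mtrace_comm[OF A B] by (simp add: AB BA)
  with A B BA AB show thesis by (rule that)
qed

lemma upper_triangular_mult:
  assumes A: "(A :: complex mat) \<in> carrier_mat n n" "upper_triangular A"
    and B: "B \<in> carrier_mat n n" "upper_triangular B"
  shows "upper_triangular (A * B)" "i < n \<Longrightarrow> (A * B) $$ (i, i) = A $$ (i, i) * B $$ (i, i)"
proof -
  have z: "A $$ (i, j) = 0" "B $$ (i, j) = 0" if "j < i" "i < n" for i j
    using that A B by (auto simp: upper_triangular_def)
  show "upper_triangular (A * B)"
  proof (rule upper_triangularI)
    fix i j assume ij: "j < i" "i < dim_row (A * B)"
    then have i: "i < n" "j < n" using A by auto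
    have "(A * B) $$ (i, j) = (\<Sum>k<n. A $$ (i, k) * B $$ (k, j))" by (rule mult_entry[OF A(1) B(1) i])
    also have "\<dots> = 0"
    proof (rule sum.neutral, rule ballI)
      fix k assume "k \<in> {..<n}"
      then show "A $$ (i, k) * B $$ (k, j) = 0"
        using z(1)[of k i] z(2)[of j k] ij(1) i by (cases "k < i") auto
    qed
    finally show "(A * B) $$ (i, j) = 0" .
  qed
  assume i: "i < n"
  have "(A * B) $$ (i, i) = (\<Sum>k<n. A $$ (i, k) * B $$ (k, i))" by (rule mult_entry[OF A(1) B(1) i i])
  also have "\<dots> = (\<Sum>k\<in>{i}. A $$ (i, k) * B $$ (k, i))"
  proof (rule sum.mono_neutral_right)
    show "\<forall>k\<in>{..<n} - {i}. A $$ (i, k) * B $$ (k, i) = 0"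
    proof
      fix k assume "k \<in> {..<n} - {i}"
      then show "A $$ (i, k) * B $$ (k, i) = 0"
        using z(1)[of k i] z(2)[of i k] i by (cases "k < i") auto
    qed
  qed (use i in auto)
  finally show "(A * B) $$ (i, i) = A $$ (i, i) * B $$ (i, i)" by simp
qed

lemma upper_triangular_pow:
  assumes A: "(A :: complex mat) \<in> carrier_mat n n" "upper_triangular A"
  shows "upper_triangular (A ^\<^sub>m k) \<and> (\<forall>i<n. (A ^\<^sub>m k) $$ (i, i) = (A $$ (i, i)) ^ k)"
proof (induction k)
  case 0
  then show ?case using A by simp
next
  case (Suc k)
  have "A ^\<^sub>m k \<in> carrier_mat n n" using A(1) by (rule pow_carrier_mat)
  then show ?case using upper_triangular_mult[OF _ _ A] Suc by simp
qed

text \<open>All eigenvalues of \<open>U\<close> have the same absolute value, since their \<open>N\<close>-th powers are all equal to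
  \<open>c\<close>. So the eigenvalues of the inverse \<open>V\<close> are, up to a common positive factor, the conjugates of those
  of \<open>U\<close>, and \<open>mtrace U * mtrace V\<close> is a positive multiple of the squared absolute value of \<open>mtrace U\<close>.
  A triangular form of \<open>U\<close> makes the eigenvalues visible.\<close>

lemma trace_zero_of_finite_order:
  assumes U: "U \<in> carrier_mat n n" and V: "V \<in> carrier_mat n n" and UV: "U * V = 1\<^sub>m n"
    and pow: "U ^\<^sub>m N = c \<cdot>\<^sub>m 1\<^sub>m n" "c \<noteq> 0" "N > 0" and tr: "mtrace U * mtrace V = 0"
  shows "mtrace U = 0"
proof -
  obtain M where M: "N = Suc M" using pow(3) by (cases N) auto
  obtain as where "char_poly U = (\<Prod> a \<leftarrow> as. [:- a, 1:])" using char_poly_factorized[OF U] by auto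
  from schur_decomposition_exists[OF U this] obtain B where B: "B \<in> carrier_mat n n" "upper_triangular B"
    and "similar_mat U B" by auto
  then obtain P Q where PQ: "similar_mat_wit U B P Q" by (auto simp: similar_mat_def)
  have P: "P \<in> carrier_mat n n" and Q: "Q \<in> carrier_mat n n" and PQ1: "P * Q = 1\<^sub>m n"
    and QP1: "Q * P = 1\<^sub>m n" and UB: "U = P * B * Q"
    using similar_mat_witD2[OF U PQ] by auto
  define b where "b i = B $$ (i, i)" for i
  have tr_conj: "mtrace (P * X * Q) = mtrace X" if X: "X \<in> carrier_mat n n" for X
  proof -
    have "mtrace (P * X * Q) = mtrace (Q * (P * X))"
      using P X Q by (intro mtrace_comm[of _ n n]) auto
    also have "Q * (P * X) = X" using assoc_mult_mat[OF Q P X] QP1 X by simp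
    finally show ?thesis .
  qed
  have Bpow: "B ^\<^sub>m k \<in> carrier_mat n n" for k using B(1) by (rule pow_carrier_mat)
  have tr_pow: "mtrace (U ^\<^sub>m k) = (\<Sum>i<n. b i ^ k)" for k
  proof -
    have "mtrace (U ^\<^sub>m k) = mtrace (B ^\<^sub>m k)"
      unfolding similar_mat_wit_pow_id[OF PQ] by (rule tr_conj[OF Bpow])
    also have "\<dots> = (\<Sum>i<n. b i ^ k)"
      using upper_triangular_pow[OF B, of k] Bpow[of k] by (auto simp: mtrace_def b_def)
    finally show ?thesis .
  qed
  have BN: "B ^\<^sub>m N = c \<cdot>\<^sub>m 1\<^sub>m n"
  proof -
    have "Q * (U ^\<^sub>m N) * P = (Q * P) * B ^\<^sub>m N * (Q * P)"
      unfolding similar_mat_wit_pow_id[OF PQ] using P Q Bpow[of N]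
      by (simp add: assoc_mult_mat[of _ n n _ n _ n])
    also have "\<dots> = B ^\<^sub>m N"
      unfolding QP1 left_mult_one_mat[OF Bpow] right_mult_one_mat[OF Bpow] ..
    also have "Q * (U ^\<^sub>m N) * P = c \<cdot>\<^sub>m (Q * P)"
      unfolding pow(1) mult_smult_distrib[OF Q one_carrier_mat] right_mult_one_mat[OF Q]
      by (rule mult_smult_assoc_mat[OF Q P])
    finally show ?thesis using QP1 by simp
  qed
  have bN: "b i ^ N = c" if "i < n" for i
    using upper_triangular_pow[OF B, of N] BN that by (auto simp: b_def)
  define r where "r = root N (cmod c)"
  have r: "r > 0" using pow by (simp add: r_def)
  have cb: "cmod (b i) = r" if "i < n" for i
  proof -
    have "cmod c = cmod (b i) ^ N" by (simp only: bN[OF that] norm_power[symmetric])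
    then show ?thesis unfolding r_def using pow(3) by (simp add: real_root_power_cancel)
  qed
  have VU: "V * U = 1\<^sub>m n" by (rule mat_mult_left_right_inverse[OF U V UV])
  have UM: "U ^\<^sub>m M \<in> carrier_mat n n" using U by (rule pow_carrier_mat)
  have "c \<cdot>\<^sub>m V = U ^\<^sub>m M"
  proof -
    have "U ^\<^sub>m M = U ^\<^sub>m M * (U * V)" unfolding UV right_mult_one_mat[OF UM] ..
    also have "\<dots> = U ^\<^sub>m N * V" unfolding M using assoc_mult_mat[OF UM U V] by simp
    also have "\<dots> = c \<cdot>\<^sub>m V" unfolding pow(1) mult_smult_assoc_mat[OF one_carrier_mat V] left_mult_one_mat[OF V] ..
    finally show ?thesis by simp
  qed
  then have "c * mtrace V = (\<Sum>i<n. b i ^ M)" using mtrace_smult[OF V, of c] tr_pow[of M] by simp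
  also have "\<dots> = (\<Sum>i<n. c * (cnj (b i) / of_real (r\<^sup>2)))"
  proof (intro sum.cong refl)
    fix i assume "i \<in> {..<n}"
    then have i: "i < n" by simp
    have e1: "b i * cnj (b i) = of_real (r\<^sup>2)" using cb[OF i] by (simp add: complex_norm_square[symmetric])
    have e2: "b i ^ M * b i = c" using bN[OF i] by (simp add: M mult.commute)
    have "b i ^ M * of_real (r\<^sup>2) = c * cnj (b i)" unfolding e1[symmetric] e2[symmetric] by (simp only: mult.assoc)
    then show "b i ^ M = c * (cnj (b i) / of_real (r\<^sup>2))" using r by (simp add: field_simps)
  qed
  also have "\<dots> = c * (cnj (mtrace U) / of_real (r\<^sup>2))"
    using tr_pow[of 1] U by (simp add: sum_distrib_left sum_divide_distrib)
  finally have "mtrace V = cnj (mtrace U) / of_real (r\<^sup>2)"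
    using pow(2) by (simp only: mult_cancel_left simp_thms)
  then show ?thesis using tr r by auto
qed

section \<open>Symmetric algebras given by structure constants\<close>

text \<open>An associative algebra with basis \<open>X\<close> whose structure constants \<open>c a b x\<close> are the coefficients of \<open>x\<close>
  in the product of \<open>a\<close> and \<open>b\<close>. Its unit is the sum of all basis vectors, as in an algebra of functions.
  Every basis vector has trace 1 in the left and in the right regular representation, \<open>G'\<close> inverts the
  Gram matrix of the form given by the functional with value 1 on each basis vector, and the centre
  is spanned by the unit. The duals of the two one-sided twists of a group algebra have these
  properties. They force an irreducible module to have dimension \<open>d\<close> with \<open>d\<^sup>2 = card X\<close>, and they
  provide explicit dual bases of its matrix algebra.\<close>

locale symmetric_constants =
  fixes X :: "'a set" and c :: "'a \<Rightarrow> 'a \<Rightarrow> 'a \<Rightarrow> complex" and G' :: "'a \<Rightarrow> 'a \<Rightarrow> complex"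
  assumes fin: "finite X"
    and assoc: "\<And>a b d x. a \<in> X \<Longrightarrow> b \<in> X \<Longrightarrow> d \<in> X \<Longrightarrow> x \<in> X \<Longrightarrow>
      (\<Sum>y\<in>X. c a b y * c y d x) = (\<Sum>y\<in>X. c b d y * c a y x)"
    and unit: "\<And>b x. b \<in> X \<Longrightarrow> x \<in> X \<Longrightarrow> (\<Sum>a\<in>X. c a b x) = (if x = b then 1 else 0)"
    and trL: "\<And>a. a \<in> X \<Longrightarrow> (\<Sum>x\<in>X. c a x x) = 1"
    and trR: "\<And>a. a \<in> X \<Longrightarrow> (\<Sum>x\<in>X. c x a x) = 1"
    and G'G: "\<And>a d. a \<in> X \<Longrightarrow> d \<in> X \<Longrightarrow>
      (\<Sum>b\<in>X. G' a b * (\<Sum>z\<in>X. c b d z)) = (if a = d then 1 else 0)"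
    and center: "\<And>v a b. (\<And>b x. b \<in> X \<Longrightarrow> x \<in> X \<Longrightarrow>
        (\<Sum>a\<in>X. v a * c a b x) = (\<Sum>a\<in>X. v a * c b a x)) \<Longrightarrow> a \<in> X \<Longrightarrow> b \<in> X \<Longrightarrow> v a = v b"
begin

text \<open>The Gram matrix of the form.\<close>

definition G :: "'a \<Rightarrow> 'a \<Rightarrow> complex" where "G a b = (\<Sum>z\<in>X. c a b z)"

text \<open>The trilinear form, which is cyclic by associativity and symmetry of the bilinear form.\<close>

definition t :: "'a \<Rightarrow> 'a \<Rightarrow> 'a \<Rightarrow> complex" where "t a b d = (\<Sum>z\<in>X. c a b z * G z d)"

lemmas delta = sum_delta_left[OF fin]

text \<open>As left multiplication by each basis vector has trace 1, the form is the trace form of the left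
  regular representation. This makes it symmetric.\<close>

lemma G_trace: "a \<in> X \<Longrightarrow> b \<in> X \<Longrightarrow> G a b = (\<Sum>w\<in>X. \<Sum>z\<in>X. c b w z * c a z w)"
proof -
  assume ab: "a \<in> X" "b \<in> X"
  have "G a b = (\<Sum>z\<in>X. c a b z * (\<Sum>w\<in>X. c z w w))"
    unfolding G_def by (intro sum.cong refl) (simp add: trL)
  also have "\<dots> = (\<Sum>w\<in>X. \<Sum>z\<in>X. c a b z * c z w w)"
    by (simp add: sum_distrib_left) (rule sum.swap)
  also have "\<dots> = (\<Sum>w\<in>X. \<Sum>z\<in>X. c b w z * c a z w)"
    by (intro sum.cong refl assoc ab)
  finally show ?thesis .
qed

lemma G_sym: "a \<in> X \<Longrightarrow> b \<in> X \<Longrightarrow> G a b = G b a"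
  unfolding G_trace by (subst sum.swap) (simp add: mult.commute)

lemma G'G_delta: "a \<in> X \<Longrightarrow> d \<in> X \<Longrightarrow> (\<Sum>b\<in>X. G' a b * G b d) = (if a = d then 1 else 0)"
  unfolding G_def by (rule G'G)

lemma G'_sym: assumes "a \<in> X" "d \<in> X" shows "G' a d = G' d a"
proof -
  have "G' a d = (\<Sum>b\<in>X. G' a b * (if d = b then 1 else 0))" using assms by (simp add: delta)
  also have "\<dots> = (\<Sum>b\<in>X. G' a b * (\<Sum>e\<in>X. G' d e * G e b))"
    by (intro sum.cong refl) (simp add: G'G_delta assms)
  also have "\<dots> = (\<Sum>e\<in>X. \<Sum>b\<in>X. G' a b * (G' d e * G e b))"
    by (simp only: sum_distrib_left) (rule sum.swap)
  also have "\<dots> = (\<Sum>e\<in>X. G' d e * (\<Sum>b\<in>X. G' a b * G b e))"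
    by (simp only: sum_distrib_left) (intro sum.cong refl, simp add: G_sym)
  also have "\<dots> = (\<Sum>e\<in>X. G' d e * (if a = e then 1 else 0))"
    by (intro sum.cong refl) (simp add: G'G_delta assms)
  also have "\<dots> = G' d a" using assms by (simp add: delta)
  finally show ?thesis .
qed

lemma GG'_delta: assumes "a \<in> X" "d \<in> X"
  shows "(\<Sum>b\<in>X. G a b * G' b d) = (if a = d then 1 else 0)"
proof -
  have "(\<Sum>b\<in>X. G a b * G' b d) = (\<Sum>b\<in>X. G' d b * G b a)"
    by (intro sum.cong refl) (simp add: G_sym G'_sym assms mult.commute)
  then show ?thesis using G'G_delta[OF assms(2,1)] by auto
qed

lemma nondegenerate:
  assumes "\<And>u. u \<in> X \<Longrightarrow> (\<Sum>z\<in>X. f z * G z u) = (\<Sum>z\<in>X. g z * G z u)" and z: "z \<in> X"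
  shows "f z = g z"
proof -
  have rec: "h z = (\<Sum>u\<in>X. (\<Sum>y\<in>X. h y * G y u) * G' u z)" for h
  proof -
    have "(\<Sum>u\<in>X. (\<Sum>y\<in>X. h y * G y u) * G' u z) = (\<Sum>y\<in>X. h y * (\<Sum>u\<in>X. G y u * G' u z))"
      unfolding sum_distrib_left sum_distrib_right mult.assoc by (rule sum.swap)
    also have "\<dots> = (\<Sum>y\<in>X. h y * (if y = z then 1 else 0))"
      by (intro sum.cong refl) (simp add: GG'_delta z)
    finally show ?thesis using z by (simp add: delta)
  qed
  have "f z = (\<Sum>u\<in>X. (\<Sum>y\<in>X. f y * G y u) * G' u z)" by (rule rec)
  also have "\<dots> = (\<Sum>u\<in>X. (\<Sum>y\<in>X. g y * G y u) * G' u z)"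
    by (intro sum.cong refl arg_cong2[of _ _ _ _ times] assms(1))
  also have "\<dots> = g z" by (rule rec[symmetric])
  finally show ?thesis .
qed

lemma t_alt: assumes "a \<in> X" "b \<in> X" "d \<in> X" shows "t a b d = (\<Sum>z\<in>X. c b d z * G a z)"
proof -
  have "t a b d = (\<Sum>w\<in>X. \<Sum>z\<in>X. c a b z * c z d w)"
    unfolding t_def G_def sum_distrib_left by (rule sum.swap)
  also have "\<dots> = (\<Sum>w\<in>X. \<Sum>z\<in>X. c b d z * c a z w)" by (intro sum.cong refl assoc assms)
  also have "\<dots> = (\<Sum>z\<in>X. c b d z * G a z)"
    unfolding G_def sum_distrib_left by (rule sum.swap)
  finally show ?thesis .
qed

lemma t_cyclic: assumes "a \<in> X" "b \<in> X" "d \<in> X" shows "t a b d = t d a b"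
  by (subst t_alt[OF assms(3,1,2)], unfold t_def, intro sum.cong refl) (simp add: G_sym assms)

lemma c_eq_t: assumes "a \<in> X" "b \<in> X" "z \<in> X" shows "c a b z = (\<Sum>u\<in>X. t a b u * G' u z)"
proof -
  have "(\<Sum>u\<in>X. t a b u * G' u z) = (\<Sum>y\<in>X. c a b y * (\<Sum>u\<in>X. G y u * G' u z))"
    unfolding t_def sum_distrib_left sum_distrib_right mult.assoc by (rule sum.swap)
  also have "\<dots> = (\<Sum>y\<in>X. c a b y * (if y = z then 1 else 0))"
    by (intro sum.cong refl) (simp add: GG'_delta assms)
  finally show ?thesis using assms by (simp add: delta)
qed

text \<open>The Casimir element \<open>\<Sum> G' x y \<cdot> x \<otimes> y\<close> is balanced: multiplying its left factor by \<open>a\<close> from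
  the left amounts to multiplying its right factor by \<open>a\<close> from the right.\<close>

lemma casimir_balanced:
  assumes "a \<in> X" "z \<in> X" "w \<in> X"
  shows "(\<Sum>x\<in>X. G' x w * c a x z) = (\<Sum>y\<in>X. G' z y * c y a w)"
proof -
  have "(\<Sum>x\<in>X. G' x w * c a x z) = (\<Sum>x\<in>X. \<Sum>u\<in>X. G' x w * (t a x u * G' u z))"
    unfolding sum_distrib_left[symmetric] by (intro sum.cong refl) (simp add: c_eq_t assms)
  also have "\<dots> = (\<Sum>x\<in>X. \<Sum>u\<in>X. G' z u * (t u a x * G' x w))"
    by (intro sum.cong refl) (simp add: t_cyclic[of a] assms G'_sym[of z])
  also have "\<dots> = (\<Sum>u\<in>X. \<Sum>x\<in>X. G' z u * (t u a x * G' x w))" by (rule sum.swap)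
  also have "\<dots> = (\<Sum>u\<in>X. G' z u * c u a w)"
    unfolding sum_distrib_left[symmetric] by (intro sum.cong refl) (simp add: c_eq_t assms)
  finally show ?thesis .
qed

text \<open>The product of the two factors of the Casimir element is found by pairing it with an arbitrary basis
  vector \<open>u\<close>, where it becomes the trace of right multiplication by \<open>u\<close>.\<close>

lemma casimir_product:
  assumes z: "z \<in> X" shows "(\<Sum>x\<in>X. \<Sum>y\<in>X. G' x y * c x y z) = 1"
proof (rule nondegenerate[OF _ z])
  fix u assume u: "u \<in> X"
  have "(\<Sum>z\<in>X. (\<Sum>x\<in>X. \<Sum>y\<in>X. G' x y * c x y z) * G z u)
      = (\<Sum>x\<in>X. \<Sum>y\<in>X. G' x y * t x y u)"
    unfolding t_def sum_distrib_left sum_distrib_right mult.assoc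
    by (rule sum_rotate)
  also have "\<dots> = (\<Sum>y\<in>X. \<Sum>x\<in>X. G' x y * t x y u)" by (rule sum.swap)
  also have "\<dots> = (\<Sum>y\<in>X. \<Sum>z\<in>X. c y u z * (\<Sum>x\<in>X. G' y x * G x z))"
  proof (rule sum.cong[OF refl])
    fix y assume y: "y \<in> X"
    have "(\<Sum>x\<in>X. G' x y * t x y u) = (\<Sum>x\<in>X. \<Sum>z\<in>X. c y u z * (G' y x * G x z))"
      unfolding sum_distrib_left
      by (intro sum.cong refl) (simp add: t_alt y u sum_distrib_left G'_sym[of y] mult_ac)
    also have "\<dots> = (\<Sum>z\<in>X. c y u z * (\<Sum>x\<in>X. G' y x * G x z))"
      unfolding sum_distrib_left by (rule sum.swap)
    finally show "(\<Sum>x\<in>X. G' x y * t x y u) = \<dots>" .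
  qed
  also have "\<dots> = (\<Sum>y\<in>X. \<Sum>z\<in>X. c y u z * (if y = z then 1 else 0))"
    by (intro sum.cong refl) (simp add: G'G_delta)
  also have "\<dots> = 1" using trR[OF u] by (simp add: delta)
  also have "1 = (\<Sum>x\<in>X. (if x = u then 1 else 0 :: complex))" using u fin by simp
  also have "\<dots> = (\<Sum>x\<in>X. \<Sum>z\<in>X. c z u x)" by (intro sum.cong refl) (simp add: unit u)
  also have "\<dots> = (\<Sum>z\<in>X. 1 * G z u)" unfolding G_def mult_1 by (rule sum.swap)
  finally show "(\<Sum>z\<in>X. (\<Sum>x\<in>X. \<Sum>y\<in>X. G' x y * c x y z) * G z u) = (\<Sum>z\<in>X. 1 * G z u)" .
qed

lemma G_sum: assumes u: "u \<in> X" shows "(\<Sum>z\<in>X. G z u) = 1"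
proof -
  have "(\<Sum>z\<in>X. G z u) = (\<Sum>x\<in>X. \<Sum>z\<in>X. c z u x)" unfolding G_def by (rule sum.swap)
  also have "\<dots> = (\<Sum>x\<in>X. (if x = u then 1 else 0 :: complex))"
    by (intro sum.cong refl) (simp add: unit u)
  also have "\<dots> = 1" using u fin by simp
  finally show ?thesis .
qed

end

locale symmetric_constants_irrep = symmetric_constants +
  fixes d :: nat and b :: "'a \<Rightarrow> complex mat"
  assumes b_carrier [simp]: "\<And>x. x \<in> X \<Longrightarrow> b x \<in> carrier_mat d d"
    and b_mult: "\<And>x y. x \<in> X \<Longrightarrow> y \<in> X \<Longrightarrow> b x * b y = msum d d (\<lambda>z. c x y z \<cdot>\<^sub>m b z) X"
    and b_one: "msum d d b X = 1\<^sub>m d"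
    and irr: "irreducible_matrices d (b ` X)"
begin

lemma d_pos: "d > 0"
  using irr by (simp add: irreducible_matrices_iff)

text \<open>The entries of the Casimir element acting in the tensor square of the module.\<close>

definition E :: "nat \<Rightarrow> nat \<Rightarrow> nat \<Rightarrow> nat \<Rightarrow> complex" where
  "E i j k l = (\<Sum>x\<in>X. \<Sum>y\<in>X. G' x y * (b x $$ (i, j) * b y $$ (k, l)))"

lemma E_sym: "E i j k l = E k l i j"
  unfolding E_def by (subst sum.swap) (intro sum.cong refl, simp add: G'_sym mult.commute)

text \<open>By balancedness the operator \<open>M \<mapsto> \<Sum> G' x y b x M b y\<close> produces intertwiners, which are scalars by
  Schur's lemma.\<close>

lemma casimir_scalar:
  assumes M: "M \<in> carrier_mat d d"
  shows "\<exists>s. msum d d (\<lambda>x. msum d d (\<lambda>y. G' x y \<cdot>\<^sub>m (b x * M * b y)) X) X = s \<cdot>\<^sub>m 1\<^sub>m d"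
proof (rule schur_scalar[OF b_carrier irr msum_carrier])
  fix a assume a: "a \<in> X"
  define N where "N x y = b x * M * b y" for x y
  have N: "N x y \<in> carrier_mat d d" if "x \<in> X" "y \<in> X" for x y
    using that M by (auto simp: N_def)
  have left: "b a * N x y = msum d d (\<lambda>z. c a x z \<cdot>\<^sub>m N z y) X" if xy: "x \<in> X" "y \<in> X" for x y
  proof -
    have "b a * N x y = b a * b x * (M * b y)"
      unfolding N_def using a xy M by (simp add: assoc_mult_mat[of _ d d _ d _ d])
    also have "\<dots> = msum d d (\<lambda>z. (c a x z \<cdot>\<^sub>m b z) * (M * b y)) X"
      unfolding b_mult[OF a xy(1)] by (rule msum_mult) (use xy M in auto)
    also have "\<dots> = msum d d (\<lambda>z. c a x z \<cdot>\<^sub>m N z y) X"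
      unfolding N_def using xy M
      by (intro msum_cong) (simp add: mult_smult_assoc_mat[of _ d d _ d] assoc_mult_mat[of _ d d _ d _ d])
    finally show ?thesis .
  qed
  have right: "N x y * b a = msum d d (\<lambda>w. c y a w \<cdot>\<^sub>m N x w) X" if xy: "x \<in> X" "y \<in> X" for x y
  proof -
    have "N x y * b a = b x * M * (b y * b a)"
      unfolding N_def using a xy M by (simp add: assoc_mult_mat[of _ d d _ d _ d])
    also have "\<dots> = msum d d (\<lambda>z. (b x * M) * (c y a z \<cdot>\<^sub>m b z)) X"
      unfolding b_mult[OF xy(2) a] by (rule mult_msum) (use xy M in auto)
    also have "\<dots> = msum d d (\<lambda>w. c y a w \<cdot>\<^sub>m N x w) X"
      unfolding N_def using xy M by (intro msum_cong) (simp add: mult_smult_distrib[of _ d d _ d])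
    finally show ?thesis .
  qed
  let ?C = "msum d d (\<lambda>x. msum d d (\<lambda>y. G' x y \<cdot>\<^sub>m N x y) X) X"
  have "b a * ?C = msum d d (\<lambda>x. msum d d (\<lambda>y. G' x y \<cdot>\<^sub>m (b a * N x y)) X) X"
    using a N by (subst mult_msum[of _ d d], simp, simp, intro msum_cong, subst mult_msum[of _ d d])
      (auto intro!: msum_cong mult_smult_distrib[of _ d d _ d])
  also have "\<dots> = msum d d (\<lambda>y. msum d d (\<lambda>x. G' x y \<cdot>\<^sub>m msum d d (\<lambda>z. c a x z \<cdot>\<^sub>m N z y) X) X) X"
    by (subst msum_swap) (intro msum_cong, simp add: left)
  also have "\<dots> = msum d d (\<lambda>y. msum d d (\<lambda>z. (\<Sum>x\<in>X. G' x y * c a x z) \<cdot>\<^sub>m N z y) X) X"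
    by (intro msum_cong msum_lincomb N)
  also have "\<dots> = msum d d (\<lambda>y. msum d d (\<lambda>z. (\<Sum>x\<in>X. G' z x * c x a y) \<cdot>\<^sub>m N z y) X) X"
    by (intro msum_cong) (simp add: casimir_balanced a)
  also have "\<dots> = msum d d (\<lambda>z. msum d d (\<lambda>y. (\<Sum>x\<in>X. G' z x * c x a y) \<cdot>\<^sub>m N z y) X) X"
    by (rule msum_swap)
  also have "\<dots> = msum d d (\<lambda>z. msum d d (\<lambda>x. G' z x \<cdot>\<^sub>m msum d d (\<lambda>y. c x a y \<cdot>\<^sub>m N z y) X) X) X"
    by (intro msum_cong msum_lincomb[symmetric] N)
  also have "\<dots> = msum d d (\<lambda>z. msum d d (\<lambda>x. G' z x \<cdot>\<^sub>m (N z x * b a)) X) X"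
    by (intro msum_cong) (simp add: right)
  also have "\<dots> = ?C * b a"
    using a N by (subst msum_mult[of _ d d], simp, simp, intro msum_cong, subst msum_mult[of _ d d])
      (auto intro!: msum_cong mult_smult_assoc_mat[of _ d d _ d, symmetric])
  finally show "msum d d (\<lambda>x. msum d d (\<lambda>y. G' x y \<cdot>\<^sub>m (b x * M * b y)) X) X * b a
      = b a * msum d d (\<lambda>x. msum d d (\<lambda>y. G' x y \<cdot>\<^sub>m (b x * M * b y)) X) X"
    unfolding N_def by simp
qed

lemma E_scalar:
  assumes "j < d" "k < d"
  shows "\<exists>s. \<forall>i<d. \<forall>l<d. E i j k l = (if i = l then s else 0)"
proof -
  let ?M = "munit d d j k"
  obtain s where s: "msum d d (\<lambda>x. msum d d (\<lambda>y. G' x y \<cdot>\<^sub>m (b x * ?M * b y)) X) X = s \<cdot>\<^sub>m 1\<^sub>m d"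
    using casimir_scalar[of ?M] by auto
  have "E i j k l = (if i = l then s else 0)" if il: "i < d" "l < d" for i l
  proof -
    have "(b x * ?M * b y) $$ (i, l) = b x $$ (i, j) * b y $$ (k, l)" if xy: "x \<in> X" "y \<in> X" for x y
      by (rule mult_munit_mult[OF b_carrier[OF xy(1)] b_carrier[OF xy(2)] il assms])
    moreover have "b x * ?M * b y \<in> carrier_mat d d" if "x \<in> X" "y \<in> X" for x y
      by (rule mult_carrier_mat[OF mult_carrier_mat[OF b_carrier[OF that(1)] munit_carrier] b_carrier[OF that(2)]])
    ultimately have "E i j k l = msum d d (\<lambda>x. msum d d (\<lambda>y. G' x y \<cdot>\<^sub>m (b x * ?M * b y)) X) X $$ (i, l)"
      using il unfolding E_def
      by (simp add: smult_entry[of _ d d])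
    then show ?thesis unfolding s using il by simp
  qed
  then show ?thesis by blast
qed

text \<open>Since the Casimir element is symmetric, the scalar above can be read off in two ways, which
  forces it to be a multiple of the trace form of the matrix algebra.\<close>

lemma E_eq:
  assumes ijkl: "i < d" "j < d" "k < d" "l < d"
  shows "E i j k l = (if i = l \<and> j = k then 1 / of_nat d else 0)"
proof -
  obtain T where T: "\<And>i j k l. i < d \<Longrightarrow> j < d \<Longrightarrow> k < d \<Longrightarrow> l < d \<Longrightarrow> E i j k l = (if i = l then T j k else 0)"
  proof -
    have "\<exists>s. \<forall>j<d. \<forall>k<d. \<forall>i<d. \<forall>l<d. E i j k l = (if i = l then s j k else 0)"
    proof -
      define s where "s j k = (SOME s. \<forall>i<d. \<forall>l<d. E i j k l = (if i = l then s else 0))" for j k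
      have "\<forall>i<d. \<forall>l<d. E i j k l = (if i = l then s j k else 0)" if "j < d" "k < d" for j k
        unfolding s_def by (rule someI_ex[OF E_scalar[OF that]])
      then show ?thesis by blast
    qed
    then show ?thesis using that by blast
  qed
  define \<kappa> where "\<kappa> = T 0 0"
  have T_eq: "T j k = (if j = k then \<kappa> else 0)" if jk: "j < d" "k < d" for j k
  proof -
    have "T j k = E 0 j k 0" using T d_pos jk by simp
    also have "\<dots> = E k 0 0 j" by (rule E_sym)
    also have "\<dots> = (if k = j then T 0 0 else 0)" using T d_pos jk by simp
    finally show ?thesis by (auto simp: \<kappa>_def)
  qed
  have bb: "(b x * b y) $$ (0, 0) = (\<Sum>j<d. b x $$ (0, j) * b y $$ (j, 0))" if "x \<in> X" "y \<in> X" for x y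
    by (rule mult_entry[OF b_carrier b_carrier]) (use that d_pos in auto)
  have "of_nat d * \<kappa> = (\<Sum>j<d. E 0 j j 0)" using T T_eq d_pos by simp
  also have "\<dots> = (\<Sum>x\<in>X. \<Sum>y\<in>X. \<Sum>j<d. G' x y * (b x $$ (0, j) * b y $$ (j, 0)))"
    unfolding E_def by (rule sum_rotate)
  also have "\<dots> = (\<Sum>x\<in>X. \<Sum>y\<in>X. G' x y * (b x * b y) $$ (0, 0))"
    by (intro sum.cong refl) (simp add: bb sum_distrib_left)
  also have "\<dots> = (\<Sum>x\<in>X. \<Sum>y\<in>X. \<Sum>z\<in>X. G' x y * (c x y z * b z $$ (0, 0)))"
  proof (intro sum.cong refl)
    fix x y assume xy: "x \<in> X" "y \<in> X"
    have "(b x * b y) $$ (0, 0) = (\<Sum>z\<in>X. c x y z * b z $$ (0, 0))"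
      unfolding b_mult[OF xy] using d_pos by (simp add: smult_entry[OF b_carrier])
    then show "G' x y * (b x * b y) $$ (0, 0) = (\<Sum>z\<in>X. G' x y * (c x y z * b z $$ (0, 0)))"
      by (simp add: sum_distrib_left)
  qed
  also have "\<dots> = (\<Sum>z\<in>X. (\<Sum>x\<in>X. \<Sum>y\<in>X. G' x y * c x y z) * b z $$ (0, 0))"
    unfolding sum_distrib_right mult.assoc by (rule sum_rotate[symmetric])
  also have "\<dots> = msum d d b X $$ (0, 0)" using d_pos by (simp add: casimir_product)
  also have "\<dots> = 1" unfolding b_one using d_pos by simp
  finally have "\<kappa> = 1 / of_nat d" using d_pos by (simp add: field_simps)
  then show ?thesis using T[OF ijkl] T_eq[OF ijkl(2,3)] by auto
qed

text \<open>The trace is a functional \<open>\<tau>\<close> with \<open>\<tau> (x y) = \<tau> (y x)\<close>. Through the nondegenerate form it is given by a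
  central element \<open>v\<close>, which is a multiple of the unit; so the trace is a multiple of the functional
  with value 1 on each basis vector. The trace of the unit determines the factor.\<close>

lemma trace_b: assumes a: "a \<in> X" shows "of_nat (card X) * mtrace (b a) = of_nat d"
proof -
  define \<tau> where "\<tau> x = mtrace (b x)" for x
  have \<tau>_mult: "mtrace (b x * b y) = (\<Sum>z\<in>X. c x y z * \<tau> z)" if "x \<in> X" "y \<in> X" for x y
    unfolding b_mult[OF that] \<tau>_def by (subst mtrace_msum) (auto simp: mtrace_smult[OF b_carrier])
  have \<tau>_sym: "(\<Sum>z\<in>X. c x y z * \<tau> z) = (\<Sum>z\<in>X. c y x z * \<tau> z)" if "x \<in> X" "y \<in> X" for x y
    using \<tau>_mult[OF that] \<tau>_mult[OF that(2,1)] mtrace_comm[OF b_carrier b_carrier, of x y] that by simp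
  define v where "v w = (\<Sum>x\<in>X. \<tau> x * G' x w)" for w
  have vG: "(\<Sum>w\<in>X. v w * G w z) = \<tau> z" if z: "z \<in> X" for z
  proof -
    have "(\<Sum>w\<in>X. v w * G w z) = (\<Sum>x\<in>X. \<tau> x * (\<Sum>w\<in>X. G' x w * G w z))"
      unfolding v_def sum_distrib_left sum_distrib_right mult.assoc by (rule sum.swap)
    also have "\<dots> = (\<Sum>x\<in>X. \<tau> x * (if x = z then 1 else 0))"
      by (intro sum.cong refl) (simp add: G'G_delta z)
    finally show ?thesis using z by (simp add: delta)
  qed
  have vt: "(\<Sum>w\<in>X. v w * t w a u) = (\<Sum>z\<in>X. c a u z * \<tau> z)" if "a \<in> X" "u \<in> X" for a u
  proof -
    have "(\<Sum>w\<in>X. v w * t w a u) = (\<Sum>w\<in>X. \<Sum>z\<in>X. c a u z * (v w * G w z))"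
      by (intro sum.cong refl) (simp add: t_alt that sum_distrib_left mult_ac)
    also have "\<dots> = (\<Sum>z\<in>X. c a u z * (\<Sum>w\<in>X. v w * G w z))"
      unfolding sum_distrib_left by (rule sum.swap)
    finally show ?thesis by (simp add: vG)
  qed
  have "(\<Sum>w\<in>X. v w * c w a z) = (\<Sum>w\<in>X. v w * c a w z)" if a: "a \<in> X" and z: "z \<in> X" for a z
  proof (rule nondegenerate[OF _ z])
    fix u assume u: "u \<in> X"
    have "(\<Sum>z\<in>X. (\<Sum>w\<in>X. v w * c w a z) * G z u) = (\<Sum>w\<in>X. v w * t w a u)"
      unfolding t_def sum_distrib_left sum_distrib_right mult.assoc by (rule sum.swap)
    also have "\<dots> = (\<Sum>w\<in>X. v w * t w u a)" using vt \<tau>_sym a u by simp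
    also have "\<dots> = (\<Sum>w\<in>X. v w * t a w u)"
      by (intro sum.cong refl) (metis t_cyclic a u)
    also have "\<dots> = (\<Sum>z\<in>X. (\<Sum>w\<in>X. v w * c a w z) * G z u)"
      unfolding t_def sum_distrib_left sum_distrib_right mult.assoc by (rule sum.swap)
    finally show "(\<Sum>z\<in>X. (\<Sum>w\<in>X. v w * c w a z) * G z u) = (\<Sum>z\<in>X. (\<Sum>w\<in>X. v w * c a w z) * G z u)" .
  qed
  from center[OF this] have v_const: "v w = v a" if "w \<in> X" for w using that a by blast
  have \<tau>_const: "\<tau> z = v a" if z: "z \<in> X" for z
  proof -
    have "\<tau> z = (\<Sum>w\<in>X. v a * G w z)" unfolding vG[OF z, symmetric] by (intro sum.cong refl) (simp add: v_const)
    then show ?thesis by (simp add: sum_distrib_left[symmetric] G_sum z)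
  qed
  have "of_nat d = mtrace (msum d d b X)" unfolding b_one by simp
  also have "\<dots> = (\<Sum>x\<in>X. \<tau> x)" unfolding \<tau>_def by (rule mtrace_msum) simp
  also have "\<dots> = of_nat (card X) * v a" by (simp add: \<tau>_const)
  finally show ?thesis using \<tau>_const[OF a] by (simp add: \<tau>_def)
qed

text \<open>The dual basis for the trace form of the full matrix algebra.\<close>

definition b' :: "'a \<Rightarrow> complex mat" where
  "b' x = msum d d (\<lambda>y. (of_nat d * G' x y) \<cdot>\<^sub>m b y) X"

lemma b'_carrier [simp]: "b' x \<in> carrier_mat d d"
  by (simp add: b'_def)

text \<open>The entries of the Casimir element say that the family \<open>b'\<close> is dual to \<open>b\<close>; in particular the matrices
  \<open>b x\<close> span the matrix algebra.\<close>

lemma dual_basis_entries: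
  assumes "i < d" "j < d" "k < d" "l < d"
  shows "(\<Sum>x\<in>X. b' x $$ (l, k) * b x $$ (i, j)) = (if i = k \<and> j = l then 1 else 0)"
proof -
  have "(\<Sum>x\<in>X. b' x $$ (l, k) * b x $$ (i, j))
      = (\<Sum>x\<in>X. \<Sum>y\<in>X. of_nat d * (G' x y * (b x $$ (i, j) * b y $$ (l, k))))"
  proof (rule sum.cong[OF refl])
    fix x assume x: "x \<in> X"
    have "b' x $$ (l, k) * b x $$ (i, j) = (\<Sum>y\<in>X. of_nat d * G' x y * b y $$ (l, k)) * b x $$ (i, j)"
      using assms by (simp add: b'_def smult_entry[OF b_carrier])
    also have "\<dots> = (\<Sum>y\<in>X. of_nat d * (G' x y * (b x $$ (i, j) * b y $$ (l, k))))"
      unfolding sum_distrib_right by (intro sum.cong refl) (simp only: mult_ac)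
    finally show "b' x $$ (l, k) * b x $$ (i, j)
        = (\<Sum>y\<in>X. of_nat d * (G' x y * (b x $$ (i, j) * b y $$ (l, k))))" .
  qed
  also have "\<dots> = of_nat d * E i j l k" by (simp add: E_def sum_distrib_left)
  finally show ?thesis using assms d_pos by (simp add: E_eq)
qed

lemma dual_basis_expansion:
  assumes M: "M \<in> carrier_mat d d"
  shows "M = msum d d (\<lambda>x. mtrace (M * b' x) \<cdot>\<^sub>m b x) X"
  by (rule expansion_in_dual_basis[OF b_carrier b'_carrier dual_basis_entries M])

lemma dual_basis_trace_scaled:
  assumes a: "a \<in> X" and x: "x \<in> X"
  shows "of_nat (card X) * mtrace (b a * b' x) = (if a = x then of_nat (d * d) else 0)"
proof -
  have tr: "of_nat (card X) * mtrace (b a * b y) = of_nat d * G a y" if y: "y \<in> X" for y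
  proof -
    have "of_nat (card X) * mtrace (b a * b y) = (\<Sum>z\<in>X. c a y z * (of_nat (card X) * mtrace (b z)))"
      unfolding b_mult[OF a y] by (subst mtrace_msum) (auto simp: mtrace_smult[OF b_carrier] sum_distrib_left mult_ac)
    then show ?thesis by (simp add: trace_b G_def sum_distrib_left mult.commute)
  qed
  have "b a * b' x = msum d d (\<lambda>y. (of_nat d * G' x y) \<cdot>\<^sub>m (b a * b y)) X"
    unfolding b'_def using a
    by (subst mult_msum[of _ d d]) (auto intro!: msum_cong mult_smult_distrib[of _ d d _ d])
  then have "mtrace (b a * b' x) = (\<Sum>y\<in>X. of_nat d * G' x y * mtrace (b a * b y))"
    using a by (simp add: mtrace_msum mtrace_smult[of _ d] mult_carrier_mat[of _ d d _ d])
  then have "of_nat (card X) * mtrace (b a * b' x) = (\<Sum>y\<in>X. of_nat d * G' x y * (of_nat (card X) * mtrace (b a * b y)))"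
    by (simp add: sum_distrib_left mult_ac)
  also have "\<dots> = of_nat d * of_nat d * (\<Sum>y\<in>X. G' x y * G y a)"
    unfolding sum_distrib_left by (intro sum.cong refl) (simp add: tr G_sym[OF a] mult_ac)
  finally show ?thesis using G'G_delta[OF x a] by auto
qed

text \<open>Expanding \<open>b a\<close> in the family \<open>b\<close> returns \<open>b a\<close> scaled by \<open>d\<^sup>2 / card X\<close>; so this factor is 1.\<close>

lemma dim_square: "d * d = card X"
proof -
  have X0: "card X \<noteq> 0"
  proof
    assume "card X = 0"
    then have "X = {}" using fin by simp
    then have "msum d d b X $$ (0, 0) = 0" using d_pos by simp
    then show False unfolding b_one using d_pos by simp
  qed
  define q where "q = of_nat (d * d) / (of_nat (card X) :: complex)"
  have tr: "mtrace (b a * b' x) = (if x = a then 1 else 0) * q" if "a \<in> X" "x \<in> X" for a x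
  proof -
    have "mtrace (b a * b' x) = (of_nat (card X) * mtrace (b a * b' x)) / of_nat (card X)"
      using X0 by simp
    then show ?thesis unfolding dual_basis_trace_scaled[OF that] by (simp add: q_def)
  qed
  have "b a $$ (0, 0) = q * b a $$ (0, 0)" if a: "a \<in> X" for a
  proof -
    have "b a $$ (0, 0) = msum d d (\<lambda>x. mtrace (b a * b' x) \<cdot>\<^sub>m b x) X $$ (0, 0)"
      using dual_basis_expansion[OF b_carrier[OF a]] by simp
    also have "\<dots> = (\<Sum>x\<in>X. (if x = a then 1 else 0) * (q * b x $$ (0, 0)))"
      using d_pos by (simp add: smult_entry[OF b_carrier] tr[OF a] mult.assoc)
    also have "\<dots> = q * b a $$ (0, 0)" using a by (simp add: delta)
    finally show ?thesis .
  qed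
  then have "(\<Sum>a\<in>X. b a $$ (0, 0)) = q * (\<Sum>a\<in>X. b a $$ (0, 0))"
    unfolding sum_distrib_left by (intro sum.cong refl)
  moreover have "(\<Sum>a\<in>X. b a $$ (0, 0)) = msum d d b X $$ (0, 0)" using d_pos by simp
  ultimately have "q = 1" unfolding b_one using d_pos by simp
  then have "(of_nat (d * d) :: complex) = of_nat (card X)" using X0 by (simp add: q_def)
  then show ?thesis by (simp only: of_nat_eq_iff)
qed

lemma dual_basis_trace:
  assumes "a \<in> X" "x \<in> X"
  shows "mtrace (b a * b' x) = (if a = x then 1 else 0)"
proof -
  have "(of_nat (d * d) :: complex) \<noteq> 0" using d_pos by simp
  then show ?thesis using dual_basis_trace_scaled[OF assms] unfolding dim_square by auto
qed

end

section \<open>The dual algebra of a minimal twist is a matrix algebra\<close>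

text \<open>An element of the tensor square of a group algebra is used through its values on functions of two
  variables: multiplying by it then becomes substitution into the function, and identities between
  tensors become nested pairings.\<close>

definition pairing :: "'a set \<Rightarrow> ('a \<Rightarrow> 'a \<Rightarrow> complex) \<Rightarrow> ('a \<Rightarrow> 'a \<Rightarrow> complex) \<Rightarrow> complex" where
  "pairing X J F = (\<Sum>s\<in>X. \<Sum>t\<in>X. J s t * F s t)"

lemma pairing_cong:
  "(\<And>s t. s \<in> X \<Longrightarrow> t \<in> X \<Longrightarrow> F s t = F' s t) \<Longrightarrow> pairing X J F = pairing X J F'"
  unfolding pairing_def by (intro sum.cong refl) simp

lemma pairing_cmult: "pairing X J (\<lambda>s t. k * F s t) = k * pairing X J F"
  unfolding pairing_def sum_distrib_left by (intro sum.cong refl) (simp only: mult_ac)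

lemma pairing_cmult_right: "pairing X J (\<lambda>s t. F s t * k) = pairing X J F * k"
  unfolding pairing_def sum_distrib_right by (intro sum.cong refl) (simp only: mult_ac)

lemma pairing_diff: "pairing X J (\<lambda>s t. F s t - F' s t) = pairing X J F - pairing X J F'"
  unfolding pairing_def by (simp only: right_diff_distrib sum_subtractf)

lemma pairing_sum: "pairing X J (\<lambda>s t. \<Sum>y\<in>Y. F y s t) = (\<Sum>y\<in>Y. pairing X J (F y))"
  unfolding pairing_def sum_distrib_left by (rule sum_rotate[symmetric])

lemma pairing_swap:
  "pairing X J (\<lambda>s t. pairing X K (\<lambda>u v. F s t u v)) = pairing X K (\<lambda>u v. pairing X J (\<lambda>s t. F s t u v))"
proof -
  have "pairing X J (\<lambda>s t. pairing X K (\<lambda>u v. F s t u v))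
      = (\<Sum>u\<in>X. \<Sum>v\<in>X. pairing X J (\<lambda>s t. K u v * F s t u v))"
    by (subst (2) pairing_def) (simp only: pairing_sum)
  also have "\<dots> = pairing X K (\<lambda>u v. pairing X J (\<lambda>s t. F s t u v))"
    by (simp only: pairing_cmult) (simp only: pairing_def)
  finally show ?thesis .
qed

lemma (in group) cancel:
  "x \<in> carrier G \<Longrightarrow> y \<in> carrier G \<Longrightarrow> x \<otimes> (inv x \<otimes> y) = y"
  "x \<in> carrier G \<Longrightarrow> y \<in> carrier G \<Longrightarrow> inv x \<otimes> (x \<otimes> y) = y"
  by (simp_all add: m_assoc[symmetric])

text \<open>A minimal twist \<open>J\<close> with inverse \<open>J'\<close>, expressed through pairings: inversion, the twist equation, the
  two counit conditions, and the injectivity of \<open>f \<mapsto> (I \<otimes> f)(R)\<close> and \<open>f \<mapsto> (f \<otimes> I)(R)\<close> for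
  \<open>R = J\<^sub>2\<^sub>1\<inverse> J\<close>. This form is symmetric enough to pass to the opposite group.\<close>

locale twist_datum = group \<Gamma> for \<Gamma> :: "('a, 'm) monoid_scheme" (structure) +
  fixes J J' :: "'a \<Rightarrow> 'a \<Rightarrow> complex"
  assumes finH: "finite (carrier \<Gamma>)"
    and inv1: "\<And>F. pairing (carrier \<Gamma>) J (\<lambda>s t. pairing (carrier \<Gamma>) J' (\<lambda>u v. F (s \<otimes> u) (t \<otimes> v))) = F \<one> \<one>"
    and inv2: "\<And>F. pairing (carrier \<Gamma>) J' (\<lambda>s t. pairing (carrier \<Gamma>) J (\<lambda>u v. F (s \<otimes> u) (t \<otimes> v))) = F \<one> \<one>"
    and tw: "\<And>F. pairing (carrier \<Gamma>) J (\<lambda>s t. pairing (carrier \<Gamma>) J (\<lambda>u v. F (s \<otimes> u) (s \<otimes> v) t))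
      = pairing (carrier \<Gamma>) J (\<lambda>s t. pairing (carrier \<Gamma>) J (\<lambda>u v. F s (t \<otimes> u) (t \<otimes> v)))"
    and cu1: "\<And>F. pairing (carrier \<Gamma>) J (\<lambda>s t. F s) = F \<one>"
    and cu2: "\<And>F. pairing (carrier \<Gamma>) J (\<lambda>s t. F t) = F \<one>"
    and min1: "\<And>f h. (\<And>F. pairing (carrier \<Gamma>) J' (\<lambda>u w. pairing (carrier \<Gamma>) J
        (\<lambda>s t. F (w \<otimes> s) * f (u \<otimes> t))) = 0) \<Longrightarrow> h \<in> carrier \<Gamma> \<Longrightarrow> f h = 0"
    and min2: "\<And>f h. (\<And>F. pairing (carrier \<Gamma>) J' (\<lambda>u w. pairing (carrier \<Gamma>) J
        (\<lambda>s t. f (w \<otimes> s) * F (u \<otimes> t))) = 0) \<Longrightarrow> h \<in> carrier \<Gamma> \<Longrightarrow> f h = 0"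
begin

abbreviation H where "H \<equiv> carrier \<Gamma>"
abbreviation IJ where "IJ \<equiv> pairing (carrier \<Gamma>) J"
abbreviation IJ' where "IJ' \<equiv> pairing (carrier \<Gamma>) J'"

lemmas cancel_simps [simp] = cancel

lemma cu1': "IJ' (\<lambda>u v. F u) = F \<one>"
proof -
  have "F \<one> = IJ (\<lambda>s t. IJ' (\<lambda>u v. F (s \<otimes> u)))" using inv1[of "\<lambda>x y. F x"] by simp
  also have "\<dots> = IJ' (\<lambda>u v. IJ (\<lambda>s t. F (s \<otimes> u)))" by (rule pairing_swap)
  also have "\<dots> = IJ' (\<lambda>u v. F (\<one> \<otimes> u))" by (simp only: cu1[of "\<lambda>s. F (s \<otimes> _)"])
  also have "\<dots> = IJ' (\<lambda>u v. F u)" by (rule pairing_cong) simp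
  finally show ?thesis by simp
qed

lemma cu2': "IJ' (\<lambda>u v. F v) = F \<one>"
proof -
  have "F \<one> = IJ (\<lambda>s t. IJ' (\<lambda>u v. F (t \<otimes> v)))" using inv1[of "\<lambda>x y. F y"] by simp
  also have "\<dots> = IJ' (\<lambda>u v. IJ (\<lambda>s t. F (t \<otimes> v)))" by (rule pairing_swap)
  also have "\<dots> = IJ' (\<lambda>u v. F (\<one> \<otimes> v))" by (simp only: cu2[of "\<lambda>s. F (s \<otimes> _)"])
  also have "\<dots> = IJ' (\<lambda>u v. F v)" by (rule pairing_cong) simp
  finally show ?thesis by simp
qed

text \<open>The twist equation solved for \<open>(1 \<otimes> J)(J\<inverse> \<otimes> 1) = (I \<otimes> \<Delta>)(J\<inverse>)(\<Delta> \<otimes> I)(J)\<close>.\<close>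

lemma mixed:
  "IJ' (\<lambda>u v. IJ (\<lambda>s t. F (u \<otimes> s) (v \<otimes> s) (v \<otimes> t))) = IJ (\<lambda>s t. IJ' (\<lambda>u v. F u (s \<otimes> v) t))"
proof -
  have "IJ' (\<lambda>u v. IJ (\<lambda>s t. F (u \<otimes> s) (v \<otimes> s) (v \<otimes> t)))
      = IJ' (\<lambda>u v. IJ (\<lambda>s t. IJ (\<lambda>a b. IJ' (\<lambda>c d. F (u \<otimes> s \<otimes> (a \<otimes> c)) (v \<otimes> s \<otimes> (b \<otimes> d)) (v \<otimes> t)))))"
  proof (intro pairing_cong)
    fix u v s t assume "u \<in> H" "v \<in> H" "s \<in> H" "t \<in> H"
    then show "F (u \<otimes> s) (v \<otimes> s) (v \<otimes> t)
        = IJ (\<lambda>a b. IJ' (\<lambda>c d. F (u \<otimes> s \<otimes> (a \<otimes> c)) (v \<otimes> s \<otimes> (b \<otimes> d)) (v \<otimes> t)))"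
      using inv1[of "\<lambda>x y. F (u \<otimes> s \<otimes> x) (v \<otimes> s \<otimes> y) (v \<otimes> t)"] by simp
  qed
  also have "\<dots> = IJ' (\<lambda>u v. IJ (\<lambda>s t. IJ (\<lambda>a b. IJ' (\<lambda>c d.
      F (u \<otimes> (s \<otimes> a) \<otimes> c) (v \<otimes> (s \<otimes> b) \<otimes> d) (v \<otimes> t)))))"
    by (intro pairing_cong) (simp add: m_assoc)
  also have "\<dots> = IJ' (\<lambda>u v. IJ (\<lambda>s t. IJ (\<lambda>a b. IJ' (\<lambda>c d.
      F (u \<otimes> s \<otimes> c) (v \<otimes> (t \<otimes> a) \<otimes> d) (v \<otimes> (t \<otimes> b))))))"
    by (rule pairing_cong) (rule tw[of "\<lambda>x y z. IJ' (\<lambda>c d. F (_ \<otimes> x \<otimes> c) (_ \<otimes> y \<otimes> d) (_ \<otimes> z))"])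
  also have "\<dots> = IJ' (\<lambda>u v. IJ (\<lambda>s t. IJ (\<lambda>a b. IJ' (\<lambda>c d.
      F (u \<otimes> s \<otimes> c) (v \<otimes> t \<otimes> a \<otimes> d) (v \<otimes> t \<otimes> b)))))"
    by (intro pairing_cong) (simp add: m_assoc)
  also have "\<dots> = IJ (\<lambda>a b. IJ' (\<lambda>c d. F (\<one> \<otimes> c) (\<one> \<otimes> a \<otimes> d) (\<one> \<otimes> b)))"
    by (rule inv2[of "\<lambda>x y. IJ (\<lambda>a b. IJ' (\<lambda>c d. F (x \<otimes> c) (y \<otimes> a \<otimes> d) (y \<otimes> b)))"])
  also have "\<dots> = IJ (\<lambda>s t. IJ' (\<lambda>u v. F u (s \<otimes> v) t))"
    by (intro pairing_cong) simp
  finally show ?thesis .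
qed

subsection \<open>Structure constants\<close>

text \<open>The coefficient of \<open>\<delta>\<^sub>x\<close> in the product of \<open>\<delta>\<^sub>a\<close> and \<open>\<delta>\<^sub>b\<close> for the comultiplication
  \<open>x \<mapsto> (x \<otimes> x) J\<close>.\<close>

definition sc :: "'a \<Rightarrow> 'a \<Rightarrow> 'a \<Rightarrow> complex" where
  "sc a b x = J (inv x \<otimes> a) (inv x \<otimes> b)"

text \<open>The matrix of right convolution by \<open>\<Sum> J\<inverse>(u, v) u v\<inverse>\<close>.\<close>

definition sG' :: "'a \<Rightarrow> 'a \<Rightarrow> complex" where
  "sG' a b = IJ' (\<lambda>u v. if b = a \<otimes> u \<otimes> inv v then 1 else 0)"

lemma left_eq_iff: "x \<in> H \<Longrightarrow> s \<in> H \<Longrightarrow> a \<in> H \<Longrightarrow> s = inv x \<otimes> a \<longleftrightarrow> a = x \<otimes> s"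
  by (metis inv_closed inv_solve_left)

lemma sc_sum: assumes x: "x \<in> H"
  shows "(\<Sum>a\<in>H. \<Sum>b\<in>H. sc a b x * F a b) = IJ (\<lambda>s t. F (x \<otimes> s) (x \<otimes> t))"
proof -
  have bij: "bij_betw (\<lambda>s. x \<otimes> s) H H"
    using x by (intro bij_betw_byWitness[of _ "\<lambda>s. inv x \<otimes> s"]) (auto simp: m_assoc[symmetric])
  have "(\<Sum>a\<in>H. \<Sum>b\<in>H. sc a b x * F a b) = (\<Sum>s\<in>H. \<Sum>b\<in>H. sc (x \<otimes> s) b x * F (x \<otimes> s) b)"
    by (rule sum.reindex_bij_betw[OF bij, symmetric])
  also have "\<dots> = (\<Sum>s\<in>H. \<Sum>t\<in>H. sc (x \<otimes> s) (x \<otimes> t) x * F (x \<otimes> s) (x \<otimes> t))"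
    by (rule sum.cong[OF refl], rule sum.reindex_bij_betw[OF bij, symmetric])
  also have "\<dots> = IJ (\<lambda>s t. F (x \<otimes> s) (x \<otimes> t))"
    unfolding pairing_def using x by (intro sum.cong refl) (simp add: sc_def m_assoc[symmetric])
  finally show ?thesis .
qed

lemma sc_sum_left: assumes x: "x \<in> H" "b \<in> H"
  shows "(\<Sum>a\<in>H. sc a b x * f a) = IJ (\<lambda>s t. (if b = x \<otimes> t then 1 else 0) * f (x \<otimes> s))"
proof -
  have "IJ (\<lambda>s t. (if b = x \<otimes> t then 1 else 0) * f (x \<otimes> s))
      = (\<Sum>a\<in>H. \<Sum>b'\<in>H. sc a b' x * ((if b = b' then 1 else 0) * f a))"
    by (rule sc_sum[OF x(1), symmetric])
  also have "\<dots> = (\<Sum>a\<in>H. f a * (\<Sum>b'\<in>H. sc a b' x * (if b = b' then 1 else 0)))"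
    unfolding sum_distrib_left by (intro sum.cong refl) (simp only: mult_ac)
  finally show ?thesis using x finH by (simp add: sum_delta_left mult.commute)
qed

lemma sc_sum_right: assumes x: "x \<in> H" "a \<in> H"
  shows "(\<Sum>b\<in>H. sc a b x * f b) = IJ (\<lambda>s t. (if a = x \<otimes> s then 1 else 0) * f (x \<otimes> t))"
proof -
  have "IJ (\<lambda>s t. (if a = x \<otimes> s then 1 else 0) * f (x \<otimes> t))
      = (\<Sum>a'\<in>H. \<Sum>b\<in>H. sc a' b x * ((if a = a' then 1 else 0) * f b))"
    by (rule sc_sum[OF x(1), symmetric])
  also have "\<dots> = (\<Sum>a'\<in>H. (if a = a' then 1 else 0) * (\<Sum>b\<in>H. sc a' b x * f b))"
    unfolding sum_distrib_left by (intro sum.cong refl) (simp only: mult_ac)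
  finally show ?thesis using x finH by (simp add: sum_delta_left)
qed

lemma sc_eq: assumes x: "x \<in> H" "a \<in> H" "b \<in> H"
  shows "sc a b x = IJ (\<lambda>s t. (if a = x \<otimes> s then 1 else 0) * (if b = x \<otimes> t then 1 else 0))"
proof -
  have "sc a b x = (\<Sum>b'\<in>H. sc a b' x * (if b = b' then 1 else 0))"
    using x finH by (simp add: sum_delta_left)
  also have "\<dots> = IJ (\<lambda>s t. (if a = x \<otimes> s then 1 else 0) * (if b = x \<otimes> t then 1 else 0))"
    by (rule sc_sum_right[OF x(1,2)])
  finally show ?thesis .
qed

lemma sG'_sum: assumes a: "a \<in> H"
  shows "(\<Sum>b\<in>H. sG' a b * f b) = IJ' (\<lambda>u v. f (a \<otimes> u \<otimes> inv v))"
proof -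
  have "(\<Sum>b\<in>H. sG' a b * f b) = IJ' (\<lambda>u v. \<Sum>b\<in>H. (if b = a \<otimes> u \<otimes> inv v then 1 else 0) * f b)"
    unfolding sG'_def pairing_sum pairing_cmult_right ..
  also have "\<dots> = IJ' (\<lambda>u v. f (a \<otimes> u \<otimes> inv v))"
    by (rule pairing_cong) (use a finH in \<open>simp add: sum_delta_left\<close>)
  finally show ?thesis .
qed

lemma sc_total: assumes b: "b \<in> H" "d \<in> H"
  shows "(\<Sum>z\<in>H. sc b d z) = IJ (\<lambda>s t. if d = b \<otimes> inv s \<otimes> t then 1 else 0)"
proof -
  have bij: "bij_betw (\<lambda>s. b \<otimes> inv s) H H"
    using b by (intro bij_betw_byWitness[of _ "\<lambda>z. inv z \<otimes> b"]) (auto simp: m_assoc inv_mult_group)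
  have "(\<Sum>z\<in>H. sc b d z) = (\<Sum>s\<in>H. sc b d (b \<otimes> inv s))"
    by (rule sum.reindex_bij_betw[OF bij, symmetric])
  also have "\<dots> = (\<Sum>s\<in>H. J s (s \<otimes> inv b \<otimes> d))"
    using b by (intro sum.cong refl) (simp add: sc_def inv_mult_group m_assoc)
  also have "\<dots> = (\<Sum>s\<in>H. \<Sum>t\<in>H. J s t * (if t = s \<otimes> inv b \<otimes> d then 1 else 0))"
    using b finH by (intro sum.cong refl) (simp add: sum_delta_left)
  also have "\<dots> = IJ (\<lambda>s t. if d = b \<otimes> inv s \<otimes> t then 1 else 0)"
    unfolding pairing_def
  proof (intro sum.cong refl arg_cong2[of _ _ _ _ times])
    fix s t assume st: "s \<in> H" "t \<in> H"
    have "t = s \<otimes> inv b \<otimes> d \<longleftrightarrow> d = b \<otimes> inv s \<otimes> t"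
      using left_eq_iff[of "b \<otimes> inv s" t d] st b by (simp add: inv_mult_group)
    then show "(if t = s \<otimes> inv b \<otimes> d then 1 else 0) = (if d = b \<otimes> inv s \<otimes> t then 1 else 0 :: complex)"
      by simp
  qed
  finally show ?thesis .
qed

text \<open>The form \<open>(\<phi>, \<psi>) \<mapsto> \<Sum>\<^sub>x (\<phi>\<psi>)(x)\<close> is convolution by \<open>\<Sum> J(s, t) s\<inverse>t\<close>, which is inverse to
  \<open>\<Sum> J\<inverse>(u, v) u v\<inverse>\<close>: apply \<open>a \<otimes> b \<otimes> c \<mapsto> a b\<inverse> c\<close> to the solved twist equation.\<close>

lemma sG'_inverse: assumes a: "a \<in> H" "d \<in> H"
  shows "(\<Sum>b\<in>H. sG' a b * (\<Sum>z\<in>H. sc b d z)) = (if a = d then 1 else 0)"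
proof -
  let ?F = "\<lambda>x y z. if d = a \<otimes> x \<otimes> inv y \<otimes> z then 1 else (0 :: complex)"
  have "(\<Sum>b\<in>H. sG' a b * (\<Sum>z\<in>H. sc b d z))
      = IJ' (\<lambda>u v. \<Sum>z\<in>H. sc (a \<otimes> u \<otimes> inv v) d z)"
    by (rule sG'_sum[OF a(1)])
  also have "\<dots> = IJ' (\<lambda>u v. IJ (\<lambda>s t. ?F u (s \<otimes> v) t))"
    using a by (intro pairing_cong, subst sc_total)
      (auto intro!: pairing_cong simp: inv_mult_group m_assoc)
  also have "\<dots> = IJ (\<lambda>s t. IJ' (\<lambda>u v. ?F u (s \<otimes> v) t))" by (rule pairing_swap)
  also have "\<dots> = IJ' (\<lambda>u v. IJ (\<lambda>s t. ?F (u \<otimes> s) (v \<otimes> s) (v \<otimes> t)))"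
    by (rule mixed[symmetric])
  also have "\<dots> = IJ' (\<lambda>u v. IJ (\<lambda>s t. if d = a \<otimes> u \<otimes> t then 1 else 0))"
  proof (intro pairing_cong)
    fix u v s t assume uv: "u \<in> H" "v \<in> H" "s \<in> H" "t \<in> H"
    have "a \<otimes> (u \<otimes> s) \<otimes> inv (v \<otimes> s) \<otimes> (v \<otimes> t) = a \<otimes> u \<otimes> (s \<otimes> inv s) \<otimes> (inv v \<otimes> v) \<otimes> t"
      using uv a by (simp add: inv_mult_group m_assoc del: r_inv l_inv)
    also have "\<dots> = a \<otimes> u \<otimes> t" using uv a by simp
    finally show "?F (u \<otimes> s) (v \<otimes> s) (v \<otimes> t) = (if d = a \<otimes> u \<otimes> t then 1 else 0)" by simp
  qed
  also have "\<dots> = IJ' (\<lambda>u v. if d = a \<otimes> u \<otimes> \<one> then 1 else 0)"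
    by (simp only: cu2[of "\<lambda>t. if d = _ \<otimes> t then 1 else 0"])
  also have "\<dots> = (if d = a \<otimes> \<one> \<otimes> \<one> then 1 else 0)"
    by (rule cu1'[of "\<lambda>u. if d = a \<otimes> u \<otimes> \<one> then 1 else 0"])
  finally show ?thesis using a by auto
qed

text \<open>Coassociativity of the twisted comultiplication, which is the twist equation.\<close>

lemma sc_assoc:
  assumes "a \<in> H" "b \<in> H" "d \<in> H" "x \<in> H"
  shows "(\<Sum>y\<in>H. sc a b y * sc y d x) = (\<Sum>y\<in>H. sc b d y * sc a y x)"
proof -
  let ?F = "\<lambda>\<alpha> \<beta> \<gamma>. (if a = x \<otimes> \<alpha> then 1 else 0) * (if b = x \<otimes> \<beta> then 1 else 0) * (if d = x \<otimes> \<gamma> then 1 else (0 :: complex))"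
  have "(\<Sum>y\<in>H. sc a b y * sc y d x) = (\<Sum>y\<in>H. sc y d x * sc a b y)" by (simp only: mult.commute)
  also have "\<dots> = IJ (\<lambda>s t. (if d = x \<otimes> t then 1 else 0) * sc a b (x \<otimes> s))"
    by (rule sc_sum_left[OF assms(4,3)])
  also have "\<dots> = IJ (\<lambda>s t. IJ (\<lambda>u v. ?F (s \<otimes> u) (s \<otimes> v) t))"
    using assms by (intro pairing_cong) (auto simp: sc_eq pairing_cmult[symmetric] m_assoc intro!: pairing_cong)
  also have "\<dots> = IJ (\<lambda>s t. IJ (\<lambda>u v. ?F s (t \<otimes> u) (t \<otimes> v)))" by (rule tw)
  also have "\<dots> = IJ (\<lambda>s t. (if a = x \<otimes> s then 1 else 0) * sc b d (x \<otimes> t))"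
    using assms by (intro pairing_cong) (auto simp: sc_eq pairing_cmult[symmetric] m_assoc intro!: pairing_cong)
  also have "\<dots> = (\<Sum>y\<in>H. sc a y x * sc b d y)" by (rule sc_sum_right[OF assms(4,1), symmetric])
  finally show ?thesis by (simp only: mult.commute)
qed

lemma sc_unit_left: assumes "b \<in> H" "x \<in> H" shows "(\<Sum>a\<in>H. sc a b x) = (if x = b then 1 else 0)"
proof -
  have "(\<Sum>a\<in>H. sc a b x) = IJ (\<lambda>s t. if b = x \<otimes> t then 1 else 0)"
    using sc_sum_left[OF assms(2,1), of "\<lambda>_. 1"] by simp
  also have "\<dots> = (if b = x \<otimes> \<one> then 1 else 0)" by (rule cu2)
  finally show ?thesis using assms by auto
qed

text \<open>Both traces are partial sums of \<open>J\<close> at the identity in one variable, hence given by the counit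
  conditions.\<close>

lemma sc_trace_left: assumes a: "a \<in> H" shows "(\<Sum>x\<in>H. sc a x x) = 1"
proof -
  have bij: "bij_betw (\<lambda>x. inv x \<otimes> a) H H"
    using a by (intro bij_betw_byWitness[of _ "\<lambda>s. a \<otimes> inv s"]) (auto simp: m_assoc inv_mult_group)
  have "(\<Sum>x\<in>H. sc a x x) = (\<Sum>x\<in>H. J (inv x \<otimes> a) \<one>)"
    by (intro sum.cong refl) (simp add: sc_def)
  also have "\<dots> = (\<Sum>s\<in>H. J s \<one>)" by (rule sum.reindex_bij_betw[OF bij])
  also have "\<dots> = IJ (\<lambda>s t. if t = \<one> then 1 else 0)"
    unfolding pairing_def using finH by (simp add: sum_delta_left)
  also have "\<dots> = 1" by (subst cu2) simp
  finally show ?thesis .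
qed

lemma sc_trace_right: assumes a: "a \<in> H" shows "(\<Sum>x\<in>H. sc x a x) = 1"
proof -
  have bij: "bij_betw (\<lambda>x. inv x \<otimes> a) H H"
    using a by (intro bij_betw_byWitness[of _ "\<lambda>s. a \<otimes> inv s"]) (auto simp: m_assoc inv_mult_group)
  have "(\<Sum>x\<in>H. sc x a x) = (\<Sum>x\<in>H. J \<one> (inv x \<otimes> a))"
    by (intro sum.cong refl) (simp add: sc_def)
  also have "\<dots> = (\<Sum>t\<in>H. J \<one> t)" by (rule sum.reindex_bij_betw[OF bij])
  also have "\<dots> = (\<Sum>t\<in>H. \<Sum>s\<in>H. J s t * (if s = \<one> then 1 else 0))"
    using finH by (simp add: sum_delta_left)
  also have "\<dots> = IJ (\<lambda>s t. if s = \<one> then 1 else 0)"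
    unfolding pairing_def by (rule sum.swap)
  also have "\<dots> = 1" by (subst cu1) simp
  finally show ?thesis .
qed

text \<open>If \<open>v\<close> is central then \<open>(I \<otimes> v)(J) = (I \<otimes> v)(J\<^sub>2\<^sub>1)\<close> for all translates of \<open>v\<close>, hence
  \<open>(I \<otimes> v)(R) = v(1)\<close>. As \<open>(I \<otimes> \<epsilon>)(R) = 1\<close> too, minimality makes \<open>v\<close> a multiple of \<open>\<epsilon>\<close>.\<close>

lemma sc_center:
  assumes v: "\<And>b x. b \<in> H \<Longrightarrow> x \<in> H \<Longrightarrow> (\<Sum>a\<in>H. v a * sc a b x) = (\<Sum>a\<in>H. v a * sc b a x)"
    and ab: "a \<in> H" "b \<in> H"
  shows "v a = v b"
proof -
  have comm: "IJ (\<lambda>s t. F s * v (x \<otimes> t)) = IJ (\<lambda>s t. F t * v (x \<otimes> s))" if x: "x \<in> H" for F x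
  proof -
    have 1: "F s = (\<Sum>b\<in>H. F (inv x \<otimes> b) * (if b = x \<otimes> s then 1 else 0))" if "s \<in> H" for s
      using x that finH by (simp add: sum_delta_left m_assoc[symmetric])
    have "IJ (\<lambda>s t. F s * v (x \<otimes> t))
        = IJ (\<lambda>s t. \<Sum>b\<in>H. F (inv x \<otimes> b) * ((if b = x \<otimes> s then 1 else 0) * v (x \<otimes> t)))"
      by (rule pairing_cong, subst 1) (simp_all add: sum_distrib_right mult.assoc)
    also have "\<dots> = (\<Sum>b\<in>H. F (inv x \<otimes> b) * (\<Sum>a\<in>H. v a * sc b a x))"
      unfolding pairing_sum pairing_cmult
      by (rule sum.cong[OF refl], subst sc_sum_right[OF x, symmetric], assumption) (simp only: mult.commute)
    also have "\<dots> = (\<Sum>b\<in>H. F (inv x \<otimes> b) * (\<Sum>a\<in>H. v a * sc a b x))"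
      by (intro sum.cong refl) (simp add: v x)
    also have "\<dots> = IJ (\<lambda>s t. \<Sum>b\<in>H. F (inv x \<otimes> b) * ((if b = x \<otimes> t then 1 else 0) * v (x \<otimes> s)))"
      unfolding pairing_sum pairing_cmult
      by (rule sum.cong[OF refl], subst sc_sum_left[OF x, symmetric], assumption) (simp only: mult.commute)
    also have "\<dots> = IJ (\<lambda>s t. F t * v (x \<otimes> s))"
      by (rule pairing_cong, subst (2) 1) (simp_all add: sum_distrib_right mult.assoc)
    finally show ?thesis .
  qed
  have "v h - v \<one> = 0" if h: "h \<in> H" for h
  proof (rule min1[of "\<lambda>h. v h - v \<one>", OF _ h])
    fix F
    have "IJ' (\<lambda>u w. IJ (\<lambda>s t. F (w \<otimes> s) * (v (u \<otimes> t) - v \<one>)))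
        = IJ' (\<lambda>u w. IJ (\<lambda>s t. F (w \<otimes> s) * v (u \<otimes> t))) - IJ' (\<lambda>u w. IJ (\<lambda>s t. F (w \<otimes> s) * v \<one>))"
      by (simp only: pairing_diff right_diff_distrib)
    also have "IJ' (\<lambda>u w. IJ (\<lambda>s t. F (w \<otimes> s) * v \<one>)) = F \<one> * v \<one>"
    proof -
      have "IJ' (\<lambda>u w. IJ (\<lambda>s t. F (w \<otimes> s) * v \<one>)) = IJ' (\<lambda>u w. F (w \<otimes> \<one>) * v \<one>)"
        by (simp only: cu1[of "\<lambda>s. F (_ \<otimes> s) * v \<one>"])
      also have "\<dots> = F (\<one> \<otimes> \<one>) * v \<one>" by (rule cu2'[of "\<lambda>w. F (w \<otimes> \<one>) * v \<one>"])
      finally show ?thesis by simp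
    qed
    also have "IJ' (\<lambda>u w. IJ (\<lambda>s t. F (w \<otimes> s) * v (u \<otimes> t)))
        = IJ' (\<lambda>u w. IJ (\<lambda>s t. F (w \<otimes> t) * v (u \<otimes> s)))"
      by (rule pairing_cong) (rule comm[of _ "\<lambda>s. F (_ \<otimes> s)"])
    also have "\<dots> = F \<one> * v \<one>" by (rule inv2[of "\<lambda>x y. F y * v x"])
    finally show "IJ' (\<lambda>u w. IJ (\<lambda>s t. F (w \<otimes> s) * (v (u \<otimes> t) - v \<one>))) = 0" by simp
  qed
  from this[OF ab(1)] this[OF ab(2)] show ?thesis by simp
qed

lemma sc_symmetric: "symmetric_constants H sc sG'"
proof (unfold_locales, goal_cases)
  case 1 show ?case by (rule finH)
next
  case 2 then show ?case by (rule sc_assoc)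
next
  case 3 then show ?case by (rule sc_unit_left)
next
  case 4 then show ?case by (rule sc_trace_left)
next
  case 5 then show ?case by (rule sc_trace_right)
next
  case 6 then show ?case by (rule sG'_inverse)
next
  case (7 v a b) then show ?case by (rule sc_center)
qed

end

text \<open>The comultiplication \<open>x \<mapsto> J\<inverse> (x \<otimes> x)\<close> is of the form \<open>x \<mapsto> (x \<otimes> x) J\<close> for the opposite group and
  the twist \<open>J\<inverse>\<close>. So everything about the second dual algebra follows from the first.\<close>

definition opposite :: "('a, 'm) monoid_scheme \<Rightarrow> ('a, 'm) monoid_scheme" where
  "opposite \<Gamma> = \<Gamma>\<lparr>mult := \<lambda>x y. y \<otimes>\<^bsub>\<Gamma>\<^esub> x\<rparr>"

lemma opposite_simps [simp]:
  "carrier (opposite \<Gamma>) = carrier \<Gamma>" "x \<otimes>\<^bsub>opposite \<Gamma>\<^esub> y = y \<otimes>\<^bsub>\<Gamma>\<^esub> x" "\<one>\<^bsub>opposite \<Gamma>\<^esub> = \<one>\<^bsub>\<Gamma>\<^esub>"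
  by (simp_all add: opposite_def)

lemma group_opposite: assumes "group \<Gamma>" shows "group (opposite \<Gamma>)"
proof -
  interpret group \<Gamma> by fact
  show ?thesis
    by (rule groupI) (auto simp: m_assoc intro: r_inv_ex)
qed

context twist_datum
begin

text \<open>The inverse \<open>(J\<inverse> \<otimes> 1)(\<Delta> \<otimes> I)(J\<inverse>) = (1 \<otimes> J\<inverse>)(I \<otimes> \<Delta>)(J\<inverse>)\<close> of the twist equation.\<close>

lemma tw_inverse:
  "IJ' (\<lambda>u v. IJ' (\<lambda>s t. F (u \<otimes> s) (v \<otimes> s) t)) = IJ' (\<lambda>u v. IJ' (\<lambda>s t. F s (u \<otimes> t) (v \<otimes> t)))"
proof -
  \<comment> \<open>\<open>A\<close> and \<open>B\<close> are the two sides of the twist equation, \<open>A'\<close> and \<open>B'\<close> their inverses\<close>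
  define A where "A F = IJ (\<lambda>s t. IJ (\<lambda>u v. F (s \<otimes> u) (s \<otimes> v) t))" for F
  define B where "B F = IJ (\<lambda>s t. IJ (\<lambda>u v. F s (t \<otimes> u) (t \<otimes> v)))" for F
  define A' where "A' F = IJ' (\<lambda>u v. IJ' (\<lambda>s t. F (u \<otimes> s) (v \<otimes> s) t))" for F
  define B' where "B' F = IJ' (\<lambda>u v. IJ' (\<lambda>s t. F s (u \<otimes> t) (v \<otimes> t)))" for F
  have AB: "A F = B F" for F unfolding A_def B_def by (rule tw)
  have cong_A': "A' F = A' F'" if "\<And>x y z. x \<in> H \<Longrightarrow> y \<in> H \<Longrightarrow> z \<in> H \<Longrightarrow> F x y z = F' x y z" for F F'
    unfolding A'_def by (intro pairing_cong that) auto
  have A'A: "A' (\<lambda>x y z. A (\<lambda>x' y' z'. F (x \<otimes> x') (y \<otimes> y') (z \<otimes> z'))) = F \<one> \<one> \<one>" for F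
  proof -
    have "A' (\<lambda>x y z. A (\<lambda>x' y' z'. F (x \<otimes> x') (y \<otimes> y') (z \<otimes> z')))
        = IJ' (\<lambda>u v. IJ' (\<lambda>s t. IJ (\<lambda>p q. IJ (\<lambda>k l.
            F (u \<otimes> (s \<otimes> p) \<otimes> k) (v \<otimes> (s \<otimes> p) \<otimes> l) (t \<otimes> q)))))"
      unfolding A_def A'_def by (intro pairing_cong) (simp add: m_assoc)
    also have "\<dots> = IJ' (\<lambda>u v. IJ (\<lambda>k l. F (u \<otimes> \<one> \<otimes> k) (v \<otimes> \<one> \<otimes> l) \<one>))"
      by (rule pairing_cong) (rule inv2[of "\<lambda>x y. IJ (\<lambda>k l. F (_ \<otimes> x \<otimes> k) (_ \<otimes> x \<otimes> l) y)"])
    also have "\<dots> = IJ' (\<lambda>u v. IJ (\<lambda>k l. F (u \<otimes> k) (v \<otimes> l) \<one>))"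
      by (intro pairing_cong) simp
    also have "\<dots> = F \<one> \<one> \<one>" by (rule inv2[of "\<lambda>x y. F x y \<one>"])
    finally show ?thesis .
  qed
  have BB': "B (\<lambda>x y z. B' (\<lambda>x' y' z'. F (x \<otimes> x') (y \<otimes> y') (z \<otimes> z'))) = F \<one> \<one> \<one>" for F
  proof -
    have "B (\<lambda>x y z. B' (\<lambda>x' y' z'. F (x \<otimes> x') (y \<otimes> y') (z \<otimes> z')))
        = IJ (\<lambda>s t. IJ (\<lambda>u v. IJ' (\<lambda>p q. IJ' (\<lambda>k l.
            F (s \<otimes> k) (t \<otimes> (u \<otimes> p) \<otimes> l) (t \<otimes> (v \<otimes> q) \<otimes> l)))))"
      unfolding B_def B'_def by (intro pairing_cong) (simp add: m_assoc)
    also have "\<dots> = IJ (\<lambda>s t. IJ' (\<lambda>k l. F (s \<otimes> k) (t \<otimes> \<one> \<otimes> l) (t \<otimes> \<one> \<otimes> l)))"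
      by (rule pairing_cong) (rule inv1[of "\<lambda>x y. IJ' (\<lambda>k l. F (_ \<otimes> k) (_ \<otimes> x \<otimes> l) (_ \<otimes> y \<otimes> l))"])
    also have "\<dots> = IJ (\<lambda>s t. IJ' (\<lambda>k l. F (s \<otimes> k) (t \<otimes> l) (t \<otimes> l)))"
      by (intro pairing_cong) simp
    also have "\<dots> = F \<one> \<one> \<one>" by (rule inv1[of "\<lambda>x y. F x y y"])
    finally show ?thesis .
  qed
  have "A' F = A' (\<lambda>x y z. B (\<lambda>x1 y1 z1. B' (\<lambda>x2 y2 z2.
      F (x \<otimes> (x1 \<otimes> x2)) (y \<otimes> (y1 \<otimes> y2)) (z \<otimes> (z1 \<otimes> z2)))))"
  proof (rule cong_A')
    fix x y z assume "x \<in> H" "y \<in> H" "z \<in> H"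
    then show "F x y z = B (\<lambda>x1 y1 z1. B' (\<lambda>x2 y2 z2. F (x \<otimes> (x1 \<otimes> x2)) (y \<otimes> (y1 \<otimes> y2)) (z \<otimes> (z1 \<otimes> z2))))"
      using BB'[of "\<lambda>x' y' z'. F (x \<otimes> x') (y \<otimes> y') (z \<otimes> z')"] by simp
  qed
  also have "\<dots> = A' (\<lambda>x y z. A (\<lambda>x1 y1 z1. B' (\<lambda>x2 y2 z2.
      F (x \<otimes> x1 \<otimes> x2) (y \<otimes> y1 \<otimes> y2) (z \<otimes> z1 \<otimes> z2))))"
    unfolding AB[symmetric]
    by (rule cong_A') (unfold A_def B'_def, intro pairing_cong, simp add: m_assoc)
  also have "\<dots> = B' (\<lambda>x2 y2 z2. F (\<one> \<otimes> x2) (\<one> \<otimes> y2) (\<one> \<otimes> z2))"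
    by (rule A'A)
  also have "\<dots> = B' F" unfolding B'_def by (intro pairing_cong) simp
  finally show ?thesis unfolding A'_def B'_def .
qed

text \<open>Passing to the opposite group exchanges \<open>J\<close> with its inverse and \<open>R\<close> with \<open>R\<^sub>2\<^sub>1\<close>.\<close>

lemma opposite_twist_datum: "twist_datum (opposite \<Gamma>) J' J"
proof (intro twist_datum.intro twist_datum_axioms.intro)
  show "group (opposite \<Gamma>)" by (rule group_opposite) (rule is_group)
  show "finite (carrier (opposite \<Gamma>))" using finH by simp
next
  fix F :: "'a \<Rightarrow> 'a \<Rightarrow> complex"
  show "pairing (carrier (opposite \<Gamma>)) J' (\<lambda>s t. pairing (carrier (opposite \<Gamma>)) J
      (\<lambda>u v. F (s \<otimes>\<^bsub>opposite \<Gamma>\<^esub> u) (t \<otimes>\<^bsub>opposite \<Gamma>\<^esub> v))) = F \<one>\<^bsub>opposite \<Gamma>\<^esub> \<one>\<^bsub>opposite \<Gamma>\<^esub>"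
    using inv1[of F] by (simp, subst pairing_swap, simp)
  show "pairing (carrier (opposite \<Gamma>)) J (\<lambda>s t. pairing (carrier (opposite \<Gamma>)) J'
      (\<lambda>u v. F (s \<otimes>\<^bsub>opposite \<Gamma>\<^esub> u) (t \<otimes>\<^bsub>opposite \<Gamma>\<^esub> v))) = F \<one>\<^bsub>opposite \<Gamma>\<^esub> \<one>\<^bsub>opposite \<Gamma>\<^esub>"
    using inv2[of F] by (simp, subst pairing_swap, simp)
next
  fix F :: "'a \<Rightarrow> 'a \<Rightarrow> 'a \<Rightarrow> complex"
  have "IJ' (\<lambda>s t. IJ' (\<lambda>u v. F (u \<otimes> s) (v \<otimes> s) t)) = IJ' (\<lambda>u v. IJ' (\<lambda>s t. F (u \<otimes> s) (v \<otimes> s) t))"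
    by (rule pairing_swap)
  also have "\<dots> = IJ' (\<lambda>u v. IJ' (\<lambda>s t. F s (u \<otimes> t) (v \<otimes> t)))" by (rule tw_inverse)
  also have "\<dots> = IJ' (\<lambda>s t. IJ' (\<lambda>u v. F s (u \<otimes> t) (v \<otimes> t)))" by (rule pairing_swap)
  finally show "pairing (carrier (opposite \<Gamma>)) J' (\<lambda>s t. pairing (carrier (opposite \<Gamma>)) J'
      (\<lambda>u v. F (s \<otimes>\<^bsub>opposite \<Gamma>\<^esub> u) (s \<otimes>\<^bsub>opposite \<Gamma>\<^esub> v) t))
    = pairing (carrier (opposite \<Gamma>)) J' (\<lambda>s t. pairing (carrier (opposite \<Gamma>)) J'
      (\<lambda>u v. F s (t \<otimes>\<^bsub>opposite \<Gamma>\<^esub> u) (t \<otimes>\<^bsub>opposite \<Gamma>\<^esub> v)))" by simp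
next
  fix F :: "'a \<Rightarrow> complex"
  show "pairing (carrier (opposite \<Gamma>)) J' (\<lambda>s t. F s) = F \<one>\<^bsub>opposite \<Gamma>\<^esub>"
    "pairing (carrier (opposite \<Gamma>)) J' (\<lambda>s t. F t) = F \<one>\<^bsub>opposite \<Gamma>\<^esub>"
    using cu1'[of F] cu2'[of F] by simp_all
next
  fix f :: "'a \<Rightarrow> complex" and h
  assume *: "\<And>F. pairing (carrier (opposite \<Gamma>)) J (\<lambda>u w. pairing (carrier (opposite \<Gamma>)) J'
      (\<lambda>s t. F (w \<otimes>\<^bsub>opposite \<Gamma>\<^esub> s) * f (u \<otimes>\<^bsub>opposite \<Gamma>\<^esub> t))) = 0"
    and h: "h \<in> carrier (opposite \<Gamma>)"
  show "f h = 0"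
  proof (rule min2)
    fix F
    have "IJ' (\<lambda>u w. IJ (\<lambda>s t. f (w \<otimes> s) * F (u \<otimes> t))) = IJ (\<lambda>s t. IJ' (\<lambda>u w. F (u \<otimes> t) * f (w \<otimes> s)))"
      by (subst pairing_swap) (simp only: mult.commute)
    also have "\<dots> = 0" using *[of F] by simp
    finally show "IJ' (\<lambda>u w. IJ (\<lambda>s t. f (w \<otimes> s) * F (u \<otimes> t))) = 0" .
  qed (use h in simp)
next
  fix f :: "'a \<Rightarrow> complex" and h
  assume *: "\<And>F. pairing (carrier (opposite \<Gamma>)) J (\<lambda>u w. pairing (carrier (opposite \<Gamma>)) J'
      (\<lambda>s t. f (w \<otimes>\<^bsub>opposite \<Gamma>\<^esub> s) * F (u \<otimes>\<^bsub>opposite \<Gamma>\<^esub> t))) = 0"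
    and h: "h \<in> carrier (opposite \<Gamma>)"
  show "f h = 0"
  proof (rule min1)
    fix F
    have "IJ' (\<lambda>u w. IJ (\<lambda>s t. F (w \<otimes> s) * f (u \<otimes> t))) = IJ (\<lambda>s t. IJ' (\<lambda>u w. f (u \<otimes> t) * F (w \<otimes> s)))"
      by (subst pairing_swap) (simp only: mult.commute)
    also have "\<dots> = 0" using *[of F] by simp
    finally show "IJ' (\<lambda>u w. IJ (\<lambda>s t. F (w \<otimes> s) * f (u \<otimes> t))) = 0" .
  qed (use h in simp)
qed

end

section \<open>Group algebras through their functionals\<close>

text \<open>Products and linear extensions are defined by sums over fibres of a map; evaluated on test
  functions, the fibres disappear.\<close>

lemma sum_fibres:
  fixes h :: "'p \<Rightarrow> complex"
  assumes "finite S" "finite T" "g ` S \<subseteq> T"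
  shows "(\<Sum>x\<in>T. (\<Sum>p\<in>{p\<in>S. g p = x}. h p) * F x) = (\<Sum>p\<in>S. h p * F (g p))"
proof -
  have "(\<Sum>x\<in>T. (\<Sum>p\<in>{p\<in>S. g p = x}. h p) * F x) = (\<Sum>x\<in>T. \<Sum>p\<in>{p\<in>S. g p = x}. h p * F (g p))"
    unfolding sum_distrib_right by (intro sum.cong refl) auto
  also have "\<dots> = (\<Sum>p\<in>S. h p * F (g p))" by (rule sum.group[OF assms])
  finally show ?thesis .
qed

lemma lin_ext_pairing:
  assumes "finite X" "finite Y" "f ` X \<subseteq> Y"
  shows "(\<Sum>y\<in>Y. lin_ext X f v y * F y) = (\<Sum>x\<in>X. v x * F (f x))"
  unfolding lin_ext_def by (rule sum_fibres[OF assms])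

lemma group_algebra_simps [simp]:
  "carrier (group_algebra \<Gamma>) = vectors_on (carrier \<Gamma>)" "one (group_algebra \<Gamma>) = indicator {\<one>\<^bsub>\<Gamma>\<^esub>}"
  by (simp_all add: group_algebra_def)

lemma group_algebra_mult:
  "(u \<otimes>\<^bsub>group_algebra \<Gamma>\<^esub> v) x
    = (\<Sum>p\<in>{p \<in> carrier \<Gamma> \<times> carrier \<Gamma>. fst p \<otimes>\<^bsub>\<Gamma>\<^esub> snd p = x}. u (fst p) * v (snd p))"
proof -
  have "{(y, z). y \<in> carrier \<Gamma> \<and> z \<in> carrier \<Gamma> \<and> y \<otimes>\<^bsub>\<Gamma>\<^esub> z = x}
      = {p \<in> carrier \<Gamma> \<times> carrier \<Gamma>. fst p \<otimes>\<^bsub>\<Gamma>\<^esub> snd p = x}" by auto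
  then show ?thesis by (simp add: group_algebra_def case_prod_beta)
qed

lemma group_algebra_pairing:
  assumes "monoid \<Gamma>" "finite (carrier \<Gamma>)"
  shows "(\<Sum>x\<in>carrier \<Gamma>. (u \<otimes>\<^bsub>group_algebra \<Gamma>\<^esub> v) x * F x)
    = (\<Sum>y\<in>carrier \<Gamma>. \<Sum>z\<in>carrier \<Gamma>. u y * v z * F (y \<otimes>\<^bsub>\<Gamma>\<^esub> z))"
proof -
  interpret monoid \<Gamma> by fact
  have "(\<Sum>x\<in>carrier \<Gamma>. (u \<otimes>\<^bsub>group_algebra \<Gamma>\<^esub> v) x * F x)
      = (\<Sum>p\<in>carrier \<Gamma> \<times> carrier \<Gamma>. u (fst p) * v (snd p) * F (fst p \<otimes>\<^bsub>\<Gamma>\<^esub> snd p))"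
    unfolding group_algebra_mult by (rule sum_fibres) (use assms in auto)
  then show ?thesis by (simp add: sum.cartesian_product case_prod_beta)
qed

lemma group_algebra_mult_closed:
  assumes "monoid \<Gamma>" shows "u \<otimes>\<^bsub>group_algebra \<Gamma>\<^esub> v \<in> vectors_on (carrier \<Gamma>)"
proof -
  interpret monoid \<Gamma> by fact
  show ?thesis unfolding vectors_on_def
  proof (intro CollectI allI impI)
    fix x assume "x \<notin> carrier \<Gamma>"
    then have empty: "{p \<in> carrier \<Gamma> \<times> carrier \<Gamma>. fst p \<otimes>\<^bsub>\<Gamma>\<^esub> snd p = x} = {}" by auto
    show "(u \<otimes>\<^bsub>group_algebra \<Gamma>\<^esub> v) x = 0" unfolding group_algebra_mult empty by simp
  qed
qed

lemma vectors_on_eqI: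
  assumes "finite X" "u \<in> vectors_on X" "v \<in> vectors_on X"
    and "\<And>F. (\<Sum>x\<in>X. u x * F x) = (\<Sum>x\<in>X. v x * F x)"
  shows "u = v"
proof
  fix x
  show "u x = v x"
  proof (cases "x \<in> X")
    case True
    then show ?thesis using assms(4)[of "\<lambda>y. if y = x then 1 else 0"] assms(1) by (simp add: sum_delta_left)
  next
    case False
    then show ?thesis using assms(2,3) by (simp add: vectors_on_def)
  qed
qed

lemma indicator_sum:
  "finite X \<Longrightarrow> a \<in> X \<Longrightarrow> (\<Sum>x\<in>X. indicator {a} x * F x) = (F a :: complex)"
  using sum_delta_left(1)[of X a F] by (simp add: indicator_def)

lemma indicator_in_vectors_on: "a \<in> X \<Longrightarrow> indicator {a} \<in> vectors_on X"
  by (auto simp: vectors_on_def indicator_def)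

lemma monoid_group_algebra:
  assumes "monoid \<Gamma>" and fin: "finite (carrier \<Gamma>)"
  shows "monoid (group_algebra \<Gamma>)"
proof -
  interpret monoid \<Gamma> by fact
  note closed = group_algebra_mult_closed[OF assms(1)] and pair = group_algebra_pairing[OF assms]
  show ?thesis
  proof (rule monoidI; simp only: group_algebra_simps)
    show "u \<otimes>\<^bsub>group_algebra \<Gamma>\<^esub> v \<in> vectors_on (carrier \<Gamma>)" for u v by (rule closed)
    show "indicator {\<one>\<^bsub>\<Gamma>\<^esub>} \<in> vectors_on (carrier \<Gamma>)" by (rule indicator_in_vectors_on) simp
  next
    fix u v w :: "'a \<Rightarrow> complex"
    show "u \<otimes>\<^bsub>group_algebra \<Gamma>\<^esub> v \<otimes>\<^bsub>group_algebra \<Gamma>\<^esub> w = u \<otimes>\<^bsub>group_algebra \<Gamma>\<^esub> (v \<otimes>\<^bsub>group_algebra \<Gamma>\<^esub> w)"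
    proof (rule vectors_on_eqI[OF fin closed closed])
      fix F
      have "(\<Sum>x\<in>carrier \<Gamma>. (u \<otimes>\<^bsub>group_algebra \<Gamma>\<^esub> v \<otimes>\<^bsub>group_algebra \<Gamma>\<^esub> w) x * F x)
          = (\<Sum>x\<in>carrier \<Gamma>. (u \<otimes>\<^bsub>group_algebra \<Gamma>\<^esub> v) x * (\<Sum>z\<in>carrier \<Gamma>. w z * F (x \<otimes>\<^bsub>\<Gamma>\<^esub> z)))"
        unfolding pair sum_distrib_left by (simp only: mult.assoc)
      also have "\<dots> = (\<Sum>x\<in>carrier \<Gamma>. \<Sum>y\<in>carrier \<Gamma>. u x * v y * (\<Sum>z\<in>carrier \<Gamma>. w z * F (x \<otimes>\<^bsub>\<Gamma>\<^esub> y \<otimes>\<^bsub>\<Gamma>\<^esub> z)))"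
        by (rule pair)
      also have "\<dots> = (\<Sum>x\<in>carrier \<Gamma>. u x * (\<Sum>y\<in>carrier \<Gamma>. \<Sum>z\<in>carrier \<Gamma>. v y * w z * F (x \<otimes>\<^bsub>\<Gamma>\<^esub> (y \<otimes>\<^bsub>\<Gamma>\<^esub> z))))"
        unfolding sum_distrib_left by (intro sum.cong refl) (simp add: m_assoc mult.assoc)
      also have "\<dots> = (\<Sum>x\<in>carrier \<Gamma>. u x * (\<Sum>y\<in>carrier \<Gamma>. (v \<otimes>\<^bsub>group_algebra \<Gamma>\<^esub> w) y * F (x \<otimes>\<^bsub>\<Gamma>\<^esub> y)))"
        unfolding pair ..
      also have "\<dots> = (\<Sum>x\<in>carrier \<Gamma>. (u \<otimes>\<^bsub>group_algebra \<Gamma>\<^esub> (v \<otimes>\<^bsub>group_algebra \<Gamma>\<^esub> w)) x * F x)"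
        unfolding pair[of u] sum_distrib_left by (simp only: mult.assoc)
      finally show "(\<Sum>x\<in>carrier \<Gamma>. (u \<otimes>\<^bsub>group_algebra \<Gamma>\<^esub> v \<otimes>\<^bsub>group_algebra \<Gamma>\<^esub> w) x * F x) = \<dots>" .
    qed
  next
    fix u :: "'a \<Rightarrow> complex" assume u: "u \<in> vectors_on (carrier \<Gamma>)"
    show "indicator {\<one>\<^bsub>\<Gamma>\<^esub>} \<otimes>\<^bsub>group_algebra \<Gamma>\<^esub> u = u"
    proof (rule vectors_on_eqI[OF fin closed u])
      fix F
      show "(\<Sum>x\<in>carrier \<Gamma>. (indicator {\<one>\<^bsub>\<Gamma>\<^esub>} \<otimes>\<^bsub>group_algebra \<Gamma>\<^esub> u) x * F x) = (\<Sum>x\<in>carrier \<Gamma>. u x * F x)"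
        unfolding pair mult.assoc sum_distrib_left[symmetric] by (subst indicator_sum[OF fin]) auto
    qed
    show "u \<otimes>\<^bsub>group_algebra \<Gamma>\<^esub> indicator {\<one>\<^bsub>\<Gamma>\<^esub>} = u"
    proof (rule vectors_on_eqI[OF fin closed u])
      fix F
      show "(\<Sum>x\<in>carrier \<Gamma>. (u \<otimes>\<^bsub>group_algebra \<Gamma>\<^esub> indicator {\<one>\<^bsub>\<Gamma>\<^esub>}) x * F x) = (\<Sum>x\<in>carrier \<Gamma>. u x * F x)"
        unfolding pair mult.assoc sum_distrib_left[symmetric]
        by (intro sum.cong refl, subst indicator_sum[OF fin]) auto
    qed
  qed
qed

lemma square_pairing:
  assumes "group \<Gamma>" "finite (carrier \<Gamma>)"
  shows "(\<Sum>p\<in>carrier \<Gamma> \<times> carrier \<Gamma>. (u \<otimes>\<^bsub>group_algebra (\<Gamma> \<times>\<times> \<Gamma>)\<^esub> v) p * F p)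
    = pairing (carrier \<Gamma>) (curry u) (\<lambda>s t. pairing (carrier \<Gamma>) (curry v)
        (\<lambda>a b. F (s \<otimes>\<^bsub>\<Gamma>\<^esub> a, t \<otimes>\<^bsub>\<Gamma>\<^esub> b)))"
proof -
  interpret group \<Gamma> by fact
  have "monoid (\<Gamma> \<times>\<times> \<Gamma>)" using DirProd_monoid is_monoid by blast
  from group_algebra_pairing[OF this, of u v F] assms(2)
  have "(\<Sum>p\<in>carrier \<Gamma> \<times> carrier \<Gamma>. (u \<otimes>\<^bsub>group_algebra (\<Gamma> \<times>\<times> \<Gamma>)\<^esub> v) p * F p)
     = (\<Sum>y\<in>carrier \<Gamma> \<times> carrier \<Gamma>. \<Sum>z\<in>carrier \<Gamma> \<times> carrier \<Gamma>. u y * v z * F (y \<otimes>\<^bsub>\<Gamma> \<times>\<times> \<Gamma>\<^esub> z))"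
    by simp
  also have "\<dots> = (\<Sum>y\<in>carrier \<Gamma> \<times> carrier \<Gamma>. u y *
      (\<Sum>z\<in>carrier \<Gamma> \<times> carrier \<Gamma>. v z * F (y \<otimes>\<^bsub>\<Gamma> \<times>\<times> \<Gamma>\<^esub> z)))"
    unfolding sum_distrib_left by (simp only: mult.assoc)
  finally show ?thesis unfolding pairing_def by (simp add: sum.cartesian_product' curry_def)
qed

lemma pairing_curry:
  "(\<Sum>p\<in>X \<times> X. u p * F p) = pairing X (curry u) (\<lambda>s t. F (s, t))"
  by (simp add: pairing_def sum.cartesian_product' curry_def)

lemma lin_ext_mult_pairing:
  assumes "monoid M" "finite (carrier M)" "finite X" "f ` X \<subseteq> carrier M" "g ` X \<subseteq> carrier M"
  shows "(\<Sum>p\<in>carrier M. (lin_ext X f u \<otimes>\<^bsub>group_algebra M\<^esub> lin_ext X g v) p * F p)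
    = (\<Sum>x\<in>X. u x * (\<Sum>y\<in>X. v y * F (f x \<otimes>\<^bsub>M\<^esub> g y)))"
proof -
  have "(\<Sum>p\<in>carrier M. (lin_ext X f u \<otimes>\<^bsub>group_algebra M\<^esub> lin_ext X g v) p * F p)
     = (\<Sum>y\<in>carrier M. lin_ext X f u y * (\<Sum>z\<in>carrier M. lin_ext X g v z * F (y \<otimes>\<^bsub>M\<^esub> z)))"
    unfolding group_algebra_pairing[OF assms(1,2)] sum_distrib_left by (simp only: mult.assoc)
  also have "\<dots> = (\<Sum>x\<in>X. u x * (\<Sum>z\<in>carrier M. lin_ext X g v z * F (f x \<otimes>\<^bsub>M\<^esub> z)))"
    by (rule lin_ext_pairing[OF assms(3,2,4)])
  also have "\<dots> = (\<Sum>x\<in>X. u x * (\<Sum>y\<in>X. v y * F (f x \<otimes>\<^bsub>M\<^esub> g y)))"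
    by (simp only: lin_ext_pairing[OF assms(3,2,5)])
  finally show ?thesis .
qed

lemma lin_ext_closed: "f ` X \<subseteq> Y \<Longrightarrow> lin_ext X f v \<in> vectors_on Y"
  by (auto simp: vectors_on_def lin_ext_def intro!: sum.neutral)

lemma lin_ext_id: "v \<in> vectors_on X \<Longrightarrow> lin_ext X (\<lambda>x. x) v = v"
proof
  fix y assume v: "v \<in> vectors_on X"
  have "{x \<in> X. x = y} = (if y \<in> X then {y} else {})" by auto
  then show "lin_ext X (\<lambda>x. x) v y = v y" using v by (simp add: lin_ext_def vectors_on_def)
qed

locale minimal_twist_group = group \<Gamma> for \<Gamma> :: "('a, 'm) monoid_scheme" (structure) +
  fixes J :: "'a \<times> 'a \<Rightarrow> complex"
  assumes finite_carrier: "finite (carrier \<Gamma>)" and minimal: "minimal_twist \<Gamma> J"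
begin

abbreviation "C2 \<equiv> group_algebra (\<Gamma> \<times>\<times> \<Gamma>)"

definition Jinv :: "'a \<times> 'a \<Rightarrow> complex" where "Jinv = inv\<^bsub>C2\<^esub> J"

sublocale C2: monoid C2
  by (rule monoid_group_algebra) (use DirProd_monoid is_monoid finite_carrier in auto)

lemma J_unit: "J \<in> Units C2"
  using minimal by (simp add: minimal_twist_def twist_def Let_def)

lemma J_closed: "J \<in> vectors_on (carrier \<Gamma> \<times> carrier \<Gamma>)" "Jinv \<in> vectors_on (carrier \<Gamma> \<times> carrier \<Gamma>)"
  using C2.Units_closed[OF J_unit] C2.Units_inv_closed[OF J_unit] by (simp_all add: Jinv_def)

lemma J_inv: "J \<otimes>\<^bsub>C2\<^esub> Jinv = indicator {(\<one>, \<one>)}" "Jinv \<otimes>\<^bsub>C2\<^esub> J = indicator {(\<one>, \<one>)}"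
  using C2.Units_r_inv[OF J_unit] C2.Units_l_inv[OF J_unit] by (simp_all add: Jinv_def)

lemmas pair2 = square_pairing[OF is_group finite_carrier]

lemma inv_pairing:
  "pairing (carrier \<Gamma>) (curry J) (\<lambda>s t. pairing (carrier \<Gamma>) (curry Jinv) (\<lambda>u v. F (s \<otimes> u) (t \<otimes> v))) = F \<one> \<one>"
  "pairing (carrier \<Gamma>) (curry Jinv) (\<lambda>s t. pairing (carrier \<Gamma>) (curry J) (\<lambda>u v. F (s \<otimes> u) (t \<otimes> v))) = F \<one> \<one>"
proof -
  have ind: "(\<Sum>p\<in>carrier \<Gamma> \<times> carrier \<Gamma>. indicator {(\<one>, \<one>)} p * case_prod F p) = F \<one> \<one>"
    using finite_carrier by (subst indicator_sum) auto
  show "pairing (carrier \<Gamma>) (curry J) (\<lambda>s t. pairing (carrier \<Gamma>) (curry Jinv) (\<lambda>u v. F (s \<otimes> u) (t \<otimes> v))) = F \<one> \<one>"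
    using pair2[of J Jinv "case_prod F"] ind unfolding J_inv by simp
  show "pairing (carrier \<Gamma>) (curry Jinv) (\<lambda>s t. pairing (carrier \<Gamma>) (curry J) (\<lambda>u v. F (s \<otimes> u) (t \<otimes> v))) = F \<one> \<one>"
    using pair2[of Jinv J "case_prod F"] ind unfolding J_inv by simp
qed

definition Rm :: "'a \<times> 'a \<Rightarrow> complex" where "Rm = twist_R \<Gamma> J"

lemma R_pairing:
  "(\<Sum>p\<in>carrier \<Gamma> \<times> carrier \<Gamma>. Rm p * F p)
    = pairing (carrier \<Gamma>) (curry Jinv) (\<lambda>u w. pairing (carrier \<Gamma>) (curry J) (\<lambda>s t. F (w \<otimes> s, u \<otimes> t)))"
proof -
  let ?X = "carrier \<Gamma> \<times> carrier \<Gamma>" and ?f = "\<lambda>(x, y). (y, x)"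
  have fin: "finite ?X" and mon: "monoid (\<Gamma> \<times>\<times> \<Gamma>)"
    using finite_carrier DirProd_monoid is_monoid by auto
  have f: "?f ` ?X \<subseteq> ?X" by auto
  have lm: "(\<Sum>p\<in>?X. (lin_ext ?X ?f u \<otimes>\<^bsub>C2\<^esub> lin_ext ?X ?f v) p * F p)
      = pairing (carrier \<Gamma>) (curry u) (\<lambda>s t. pairing (carrier \<Gamma>) (curry v) (\<lambda>a b. F (t \<otimes> b, s \<otimes> a)))" for u v F
    using lin_ext_mult_pairing[OF mon, of ?X ?f ?f u v F] fin f by (simp add: pairing_curry)
  have eq1: "lin_ext ?X ?f u \<otimes>\<^bsub>C2\<^esub> lin_ext ?X ?f v = indicator {(\<one>, \<one>)}"
    if "\<And>F. pairing (carrier \<Gamma>) (curry u) (\<lambda>s t. pairing (carrier \<Gamma>) (curry v) (\<lambda>a b. F (s \<otimes> a) (t \<otimes> b))) = F \<one> \<one>" for u v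
  proof (rule vectors_on_eqI[OF fin])
    show "lin_ext ?X ?f u \<otimes>\<^bsub>C2\<^esub> lin_ext ?X ?f v \<in> vectors_on ?X"
      using group_algebra_mult_closed[OF mon] by simp
    show "indicator {(\<one>, \<one>)} \<in> vectors_on ?X" by (rule indicator_in_vectors_on) simp
    fix F
    have "(\<Sum>p\<in>?X. (lin_ext ?X ?f u \<otimes>\<^bsub>C2\<^esub> lin_ext ?X ?f v) p * F p) = F (\<one>, \<one>)"
      unfolding lm by (rule that[of "\<lambda>x y. F (y, x)"])
    also have "\<dots> = (\<Sum>p\<in>?X. indicator {(\<one>, \<one>)} p * F p)" using fin by (subst indicator_sum) auto
    finally show "(\<Sum>p\<in>?X. (lin_ext ?X ?f u \<otimes>\<^bsub>C2\<^esub> lin_ext ?X ?f v) p * F p) = \<dots>" .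
  qed
  have "inv\<^bsub>C2\<^esub> (lin_ext ?X ?f J) = lin_ext ?X ?f Jinv"
  proof (rule C2.inv_char)
    show "lin_ext ?X ?f J \<in> carrier C2" "lin_ext ?X ?f Jinv \<in> carrier C2"
      using lin_ext_closed[OF f] by simp_all
    show "lin_ext ?X ?f J \<otimes>\<^bsub>C2\<^esub> lin_ext ?X ?f Jinv = \<one>\<^bsub>C2\<^esub>" "lin_ext ?X ?f Jinv \<otimes>\<^bsub>C2\<^esub> lin_ext ?X ?f J = \<one>\<^bsub>C2\<^esub>"
      using eq1[OF inv_pairing(1)] eq1[OF inv_pairing(2)] by simp_all
  qed
  then have "Rm = lin_ext ?X ?f Jinv \<otimes>\<^bsub>C2\<^esub> lin_ext ?X (\<lambda>p. p) J"
    unfolding Rm_def twist_R_def Let_def lin_ext_id[OF J_closed(1)] by simp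
  then show ?thesis
    using lin_ext_mult_pairing[OF mon, of ?X ?f "\<lambda>p. p" Jinv J F] fin f by (simp add: pairing_curry)
qed

text \<open>Each condition is an equality of tensors evaluated on a test function. For minimality, \<open>f h\<close> is read
  off by writing \<open>h\<close> as \<open>(f0 \<otimes> I)(R)\<close> or \<open>(I \<otimes> f0)(R)\<close>, which is possible since these elements
  exhaust the group algebra.\<close>

lemma is_twist_datum: "twist_datum \<Gamma> (curry J) (curry Jinv)"
proof (intro twist_datum.intro twist_datum_axioms.intro)
  show "group \<Gamma>" by (rule is_group)
  show "finite (carrier \<Gamma>)" by (rule finite_carrier)
  let ?X = "carrier \<Gamma> \<times> carrier \<Gamma>"
  have fin: "finite ?X" using finite_carrier by simp
  have C3: "monoid (\<Gamma> \<times>\<times> \<Gamma> \<times>\<times> \<Gamma>)" "finite (carrier (\<Gamma> \<times>\<times> \<Gamma> \<times>\<times> \<Gamma>))"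
    by (intro DirProd_monoid is_monoid) (simp add: finite_carrier)
  have tw: "twist \<Gamma> J" using minimal by (simp add: minimal_twist_def)
  show "pairing (carrier \<Gamma>) (curry J) (\<lambda>s t. pairing (carrier \<Gamma>) (curry Jinv) (\<lambda>u v. F (s \<otimes> u) (t \<otimes> v))) = F \<one> \<one>"
    "pairing (carrier \<Gamma>) (curry Jinv) (\<lambda>s t. pairing (carrier \<Gamma>) (curry J) (\<lambda>u v. F (s \<otimes> u) (t \<otimes> v))) = F \<one> \<one>" for F
    by (rule inv_pairing)+
  fix F :: "'a \<Rightarrow> 'a \<Rightarrow> 'a \<Rightarrow> complex"
  let ?F = "\<lambda>(x, y, z). F x y z"
  have "pairing (carrier \<Gamma>) (curry J) (\<lambda>s t. pairing (carrier \<Gamma>) (curry J) (\<lambda>u v. F (s \<otimes> u) (s \<otimes> v) t))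
     = pairing (carrier \<Gamma>) (curry J) (\<lambda>s t. pairing (carrier \<Gamma>) (curry J) (\<lambda>u v. F (s \<otimes> u) (s \<otimes> v) (t \<otimes> \<one>)))"
    by (intro pairing_cong) simp
  also have "\<dots> = (\<Sum>p\<in>carrier (\<Gamma> \<times>\<times> \<Gamma> \<times>\<times> \<Gamma>). (lin_ext ?X (\<lambda>(x, y). (x, x, y)) J
      \<otimes>\<^bsub>group_algebra (\<Gamma> \<times>\<times> \<Gamma> \<times>\<times> \<Gamma>)\<^esub> lin_ext ?X (\<lambda>(x, y). (x, y, \<one>)) J) p * ?F p)"
    by (subst lin_ext_mult_pairing[OF C3 fin]) (auto simp: pairing_curry)
  also have "\<dots> = (\<Sum>p\<in>carrier (\<Gamma> \<times>\<times> \<Gamma> \<times>\<times> \<Gamma>). (lin_ext ?X (\<lambda>(x, y). (x, y, y)) J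
      \<otimes>\<^bsub>group_algebra (\<Gamma> \<times>\<times> \<Gamma> \<times>\<times> \<Gamma>)\<^esub> lin_ext ?X (\<lambda>(x, y). (\<one>, x, y)) J) p * ?F p)"
    using tw by (simp add: twist_def Let_def)
  also have "\<dots> = pairing (carrier \<Gamma>) (curry J) (\<lambda>s t. pairing (carrier \<Gamma>) (curry J) (\<lambda>u v. F (s \<otimes> \<one>) (t \<otimes> u) (t \<otimes> v)))"
    by (subst lin_ext_mult_pairing[OF C3 fin]) (auto simp: pairing_curry)
  also have "\<dots> = pairing (carrier \<Gamma>) (curry J) (\<lambda>s t. pairing (carrier \<Gamma>) (curry J) (\<lambda>u v. F s (t \<otimes> u) (t \<otimes> v)))"
    by (intro pairing_cong) simp
  finally show "pairing (carrier \<Gamma>) (curry J) (\<lambda>s t. pairing (carrier \<Gamma>) (curry J) (\<lambda>u v. F (s \<otimes> u) (s \<otimes> v) t))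
     = pairing (carrier \<Gamma>) (curry J) (\<lambda>s t. pairing (carrier \<Gamma>) (curry J) (\<lambda>u v. F s (t \<otimes> u) (t \<otimes> v)))" .
next
  let ?X = "carrier \<Gamma> \<times> carrier \<Gamma>"
  have fin: "finite ?X" using finite_carrier by simp
  fix F :: "'a \<Rightarrow> complex"
  have tw: "lin_ext ?X snd J = indicator {\<one>}" "lin_ext ?X fst J = indicator {\<one>}"
    using minimal by (simp_all add: minimal_twist_def twist_def Let_def)
  have "pairing (carrier \<Gamma>) (curry J) (\<lambda>s t. F s) = (\<Sum>p\<in>?X. J p * F (fst p))"
    by (simp add: pairing_curry)
  also have "\<dots> = (\<Sum>x\<in>carrier \<Gamma>. lin_ext ?X fst J x * F x)"
    using fin finite_carrier by (intro lin_ext_pairing[symmetric]) auto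
  also have "\<dots> = F \<one>" unfolding tw using finite_carrier by (subst indicator_sum) auto
  finally show "pairing (carrier \<Gamma>) (curry J) (\<lambda>s t. F s) = F \<one>" .
  have "pairing (carrier \<Gamma>) (curry J) (\<lambda>s t. F t) = (\<Sum>p\<in>?X. J p * F (snd p))"
    by (simp add: pairing_curry)
  also have "\<dots> = (\<Sum>x\<in>carrier \<Gamma>. lin_ext ?X snd J x * F x)"
    using fin finite_carrier by (intro lin_ext_pairing[symmetric]) auto
  also have "\<dots> = F \<one>" unfolding tw using finite_carrier by (subst indicator_sum) auto
  finally show "pairing (carrier \<Gamma>) (curry J) (\<lambda>s t. F t) = F \<one>" .
next
  fix f :: "'a \<Rightarrow> complex" and h
  assume *: "\<And>F. pairing (carrier \<Gamma>) (curry Jinv) (\<lambda>u w. pairing (carrier \<Gamma>) (curry J)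
      (\<lambda>s t. F (w \<otimes> s) * f (u \<otimes> t))) = 0" and h: "h \<in> carrier \<Gamma>"
  have "indicator {h} \<in> range (\<lambda>f y. \<Sum>x\<in>carrier \<Gamma>. f x * Rm (x, y))"
    using minimal indicator_in_vectors_on[OF h] by (simp add: minimal_twist_def Rm_def)
  then obtain f0 where f0: "indicator {h} = (\<lambda>y. \<Sum>x\<in>carrier \<Gamma>. f0 x * Rm (x, y))" by blast
  have "f h = (\<Sum>y\<in>carrier \<Gamma>. indicator {h} y * f y)" by (rule indicator_sum[OF finite_carrier h, symmetric])
  also have "\<dots> = (\<Sum>y\<in>carrier \<Gamma>. \<Sum>x\<in>carrier \<Gamma>. Rm (x, y) * (f0 x * f y))"
    unfolding f0 sum_distrib_right by (intro sum.cong refl) (simp only: mult_ac)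
  also have "\<dots> = (\<Sum>x\<in>carrier \<Gamma>. \<Sum>y\<in>carrier \<Gamma>. Rm (x, y) * (f0 x * f y))" by (rule sum.swap)
  also have "\<dots> = (\<Sum>p\<in>carrier \<Gamma> \<times> carrier \<Gamma>. Rm p * (f0 (fst p) * f (snd p)))"
    by (simp add: sum.cartesian_product')
  also have "\<dots> = 0" unfolding R_pairing using *[of f0] by simp
  finally show "f h = 0" .
next
  fix f :: "'a \<Rightarrow> complex" and h
  assume *: "\<And>F. pairing (carrier \<Gamma>) (curry Jinv) (\<lambda>u w. pairing (carrier \<Gamma>) (curry J)
      (\<lambda>s t. f (w \<otimes> s) * F (u \<otimes> t))) = 0" and h: "h \<in> carrier \<Gamma>"
  have "indicator {h} \<in> range (\<lambda>f x. \<Sum>y\<in>carrier \<Gamma>. f y * Rm (x, y))"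
    using minimal indicator_in_vectors_on[OF h] by (simp add: minimal_twist_def Rm_def)
  then obtain f0 where f0: "indicator {h} = (\<lambda>x. \<Sum>y\<in>carrier \<Gamma>. f0 y * Rm (x, y))" by blast
  have "f h = (\<Sum>x\<in>carrier \<Gamma>. indicator {h} x * f x)" by (rule indicator_sum[OF finite_carrier h, symmetric])
  also have "\<dots> = (\<Sum>x\<in>carrier \<Gamma>. \<Sum>y\<in>carrier \<Gamma>. Rm (x, y) * (f x * f0 y))"
    unfolding f0 sum_distrib_right by (intro sum.cong refl) (simp only: mult_ac)
  also have "\<dots> = (\<Sum>p\<in>carrier \<Gamma> \<times> carrier \<Gamma>. Rm p * (f (fst p) * f0 (snd p)))"
    by (simp add: sum.cartesian_product')
  also have "\<dots> = 0" unfolding R_pairing using *[of f0] by simp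
  finally show "f h = 0" .
qed

sublocale td: twist_datum \<Gamma> "curry J" "curry Jinv"
  by (rule is_twist_datum)

sublocale op: twist_datum "opposite \<Gamma>" "curry Jinv" "curry J"
  by (rule td.opposite_twist_datum)

lemma A1_constants:
  assumes "a \<in> carrier \<Gamma>" "b \<in> carrier \<Gamma>" "x \<in> carrier \<Gamma>"
  shows "(indicator {(x, x)} \<otimes>\<^bsub>C2\<^esub> J) (a, b) = td.sc a b x"
proof -
  let ?X = "carrier \<Gamma> \<times> carrier \<Gamma>"
  have fin: "finite ?X" using finite_carrier by simp
  have "(indicator {(x, x)} \<otimes>\<^bsub>C2\<^esub> J) (a, b)
      = (\<Sum>p\<in>?X. (indicator {(x, x)} \<otimes>\<^bsub>C2\<^esub> J) p * (if p = (a, b) then 1 else 0))"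
    using assms fin by (simp add: sum_delta_left)
  also have "\<dots> = (\<Sum>q\<in>?X. indicator {(x, x)} q * pairing (carrier \<Gamma>) (curry J)
      (\<lambda>s t. if (fst q \<otimes> s, snd q \<otimes> t) = (a, b) then 1 else 0))"
    unfolding pair2 by (simp add: pairing_curry)
  also have "\<dots> = pairing (carrier \<Gamma>) (curry J) (\<lambda>s t. if (x \<otimes> s, x \<otimes> t) = (a, b) then 1 else 0)"
    using assms fin by (subst indicator_sum) auto
  also have "\<dots> = pairing (carrier \<Gamma>) (curry J) (\<lambda>s t. (if a = x \<otimes> s then 1 else 0) * (if b = x \<otimes> t then 1 else 0))"
    by (rule pairing_cong) auto
  also have "\<dots> = td.sc a b x" using td.sc_eq[of x a b] assms by simp
  finally show ?thesis .
qed

lemma A2_constants: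
  assumes "a \<in> carrier \<Gamma>" "b \<in> carrier \<Gamma>" "x \<in> carrier \<Gamma>"
  shows "(Jinv \<otimes>\<^bsub>C2\<^esub> indicator {(x, x)}) (a, b) = op.sc a b x"
proof -
  let ?X = "carrier \<Gamma> \<times> carrier \<Gamma>"
  have fin: "finite ?X" using finite_carrier by simp
  have "(Jinv \<otimes>\<^bsub>C2\<^esub> indicator {(x, x)}) (a, b)
      = (\<Sum>p\<in>?X. (Jinv \<otimes>\<^bsub>C2\<^esub> indicator {(x, x)}) p * (if p = (a, b) then 1 else 0))"
    using assms fin by (simp add: sum_delta_left)
  also have "\<dots> = pairing (carrier \<Gamma>) (curry Jinv) (\<lambda>s t. \<Sum>q\<in>?X. indicator {(x, x)} q *
      (if (s \<otimes> fst q, t \<otimes> snd q) = (a, b) then 1 else 0))"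
    unfolding pair2 by (simp add: pairing_curry)
  also have "\<dots> = pairing (carrier \<Gamma>) (curry Jinv) (\<lambda>s t. (if a = s \<otimes> x then 1 else 0) * (if b = t \<otimes> x then 1 else 0))"
    using assms fin by (intro pairing_cong, subst indicator_sum) auto
  also have "\<dots> = op.sc a b x" using op.sc_eq[of x a b] assms by simp
  finally show ?thesis .
qed

end

section \<open>Representations of dual algebras\<close>

text \<open>A representation of an algebra of functions is determined by the matrices of the functions \<open>\<delta>\<^sub>x\<close>.\<close>

lemma rep_expansion:
  fixes A :: "(complex, 'a \<Rightarrow> complex) module"
  assumes A: "carrier A = vectors_on X" "add A = (\<lambda>\<phi> \<psi> x. \<phi> x + \<psi> x)" "module.smult A = (\<lambda>c \<phi> x. c * \<phi> x)"
    and rep: "alg_rep A n \<rho>" and X: "finite X" and \<phi>: "\<phi> \<in> vectors_on X"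
  shows "\<rho> \<phi> = msum n n (\<lambda>x. \<phi> x \<cdot>\<^sub>m \<rho> (indicator {x})) X"
proof -
  have hom: "\<rho> \<in> Ring.ring_hom A (ring_mat TYPE(complex) n ())"
    and sm: "\<And>c x. x \<in> vectors_on X \<Longrightarrow> \<rho> (\<lambda>y. c * x y) = c \<cdot>\<^sub>m \<rho> x"
    using rep A by (auto simp: alg_rep_def)
  have cl: "\<rho> x \<in> carrier_mat n n" if "x \<in> vectors_on X" for x
    using ring_hom_closed[OF hom] that A(1) by (simp add: ring_mat_simps)
  have add: "\<rho> (\<lambda>z. x z + y z) = \<rho> x + \<rho> y" if "x \<in> vectors_on X" "y \<in> vectors_on X" for x y
    using ring_hom_add[OF hom, of x y] that A by (simp add: ring_mat_simps)
  have ind: "indicator {x} \<in> vectors_on X" if "x \<in> X" for x using that by (rule indicator_in_vectors_on)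
  have restr: "\<rho> (\<lambda>x. if x \<in> Y then \<phi> x else 0) = msum n n (\<lambda>x. \<phi> x \<cdot>\<^sub>m \<rho> (indicator {x})) Y"
    if "finite Y" "Y \<subseteq> X" for Y
    using that
  proof (induction Y rule: finite_induct)
    case empty
    have "(\<lambda>_. 0) \<in> vectors_on X" by (simp add: vectors_on_def)
    note 0 = cl[OF this] sm[OF this, of 0]
    have "0 \<cdot>\<^sub>m \<rho> (\<lambda>_. 0) = 0\<^sub>m n n" using 0(1) by (intro eq_matI) auto
    with 0(2) have "\<rho> (\<lambda>_. 0) = 0\<^sub>m n n" by simp
    then show ?case by simp
  next
    case (insert y Y)
    let ?u = "\<lambda>x. if x \<in> Y then \<phi> x else 0"
    have u: "?u \<in> vectors_on X" using insert.prems by (auto simp: vectors_on_def)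
    have w: "(\<lambda>z. \<phi> y * indicator {y} z) \<in> vectors_on X" using insert.prems by (auto simp: vectors_on_def indicator_def)
    have "(\<lambda>x. if x \<in> insert y Y then \<phi> x else 0) = (\<lambda>z. ?u z + \<phi> y * indicator {y} z)"
      using insert.hyps(2) by (auto simp: indicator_def)
    then have "\<rho> (\<lambda>x. if x \<in> insert y Y then \<phi> x else 0) = \<rho> ?u + \<phi> y \<cdot>\<^sub>m \<rho> (indicator {y})"
      using add[OF u w] sm[OF ind, of y "\<phi> y"] insert.prems by simp
    also have "\<rho> ?u = msum n n (\<lambda>x. \<phi> x \<cdot>\<^sub>m \<rho> (indicator {x})) Y"
      using insert.IH insert.prems by simp
    also have "\<dots> + \<phi> y \<cdot>\<^sub>m \<rho> (indicator {y}) = msum n n (\<lambda>x. \<phi> x \<cdot>\<^sub>m \<rho> (indicator {x})) (insert y Y)"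
      using insert.hyps insert.prems cl[OF ind, of y] by (simp add: msum_insert)
    finally show ?case .
  qed
  moreover have "(\<lambda>x. if x \<in> X then \<phi> x else 0) = \<phi>" using \<phi> by (auto simp: vectors_on_def)
  ultimately show ?thesis using restr[OF X order_refl] by simp
qed

lemma msum_invariant_subspace:
  assumes U: "lin_subspace n U" and fin: "finite X"
    and b: "\<And>x. x \<in> X \<Longrightarrow> b x \<in> carrier_mat n n" "\<And>x u. x \<in> X \<Longrightarrow> u \<in> U \<Longrightarrow> b x *\<^sub>v u \<in> U"
    and u: "u \<in> U"
  shows "msum n n (\<lambda>x. f x \<cdot>\<^sub>m b x) X *\<^sub>v u \<in> U"
proof -
  have uc: "u \<in> carrier_vec n" using U u by (auto simp: lin_subspace_def)
  have "msum n n (\<lambda>x. f x \<cdot>\<^sub>m b x) Y *\<^sub>v u \<in> U" if "finite Y" "Y \<subseteq> X" for Y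
    using that
  proof (induction Y rule: finite_induct)
    case empty
    show ?case using U uc by (simp add: lin_subspace_def)
  next
    case (insert y Y)
    have bY: "b y \<in> carrier_mat n n" using b(1) insert.prems by simp
    have "msum n n (\<lambda>x. f x \<cdot>\<^sub>m b x) (insert y Y) = msum n n (\<lambda>x. f x \<cdot>\<^sub>m b x) Y + f y \<cdot>\<^sub>m b y"
      using insert.hyps bY by (simp add: msum_insert)
    then have "msum n n (\<lambda>x. f x \<cdot>\<^sub>m b x) (insert y Y) *\<^sub>v u
        = msum n n (\<lambda>x. f x \<cdot>\<^sub>m b x) Y *\<^sub>v u + f y \<cdot>\<^sub>v (b y *\<^sub>v u)"
      using bY uc by (simp add: add_mult_distrib_mat_vec[of _ n n] smult_mult_mat_vec[of _ n n])
    then show ?case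
      using U insert b(2)[of y u] u by (simp add: lin_subspace_def)
  qed
  from this[OF fin order_refl] show ?thesis .
qed

lemma dual_algebra_irrep:
  assumes sc: "symmetric_constants X c G'"
    and D: "\<And>a b x. a \<in> X \<Longrightarrow> b \<in> X \<Longrightarrow> x \<in> X \<Longrightarrow> D x (a, b) = c a b x"
    and irr: "alg_irrep (dual_algebra X D) n \<tau>"
  shows "symmetric_constants_irrep X c G' n (\<lambda>x. \<tau> (indicator {x}))"
proof -
  interpret symmetric_constants X c G' by (rule sc)
  let ?A = "dual_algebra X D"
  have A: "carrier ?A = vectors_on X" "add ?A = (\<lambda>\<phi> \<psi> x. \<phi> x + \<psi> x)" "module.smult ?A = (\<lambda>c \<phi> x. c * \<phi> x)"
    by (simp_all add: dual_algebra_def)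
  have rep: "alg_rep ?A n \<tau>" using irr by (simp add: alg_irrep_def)
  then have hom: "\<tau> \<in> Ring.ring_hom ?A (ring_mat TYPE(complex) n ())" by (simp add: alg_rep_def)
  note exp = rep_expansion[OF A rep fin]
  have ind: "indicator {x} \<in> vectors_on X" if "x \<in> X" for x using that by (rule indicator_in_vectors_on)
  have cl: "\<tau> (indicator {x}) \<in> carrier_mat n n" if "x \<in> X" for x
    using ring_hom_closed[OF hom] ind[OF that] A(1) by (simp add: ring_mat_simps)
  show ?thesis
  proof (unfold_locales, goal_cases)
    case (1 x)
    then show ?case by (rule cl)
  next
    case (2 x y)
    let ?p = "indicator {x} \<otimes>\<^bsub>?A\<^esub> indicator {y}"
    have p: "?p z = c x y z" if "z \<in> X" for z
    proof -
      have "?p z = (\<Sum>a\<in>X. \<Sum>b\<in>X. indicator {x} a * indicator {y} b * D z (a, b))"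
        using that by (simp add: dual_algebra_def sum.cartesian_product case_prod_beta)
      also have "\<dots> = (\<Sum>a\<in>X. indicator {x} a * (\<Sum>b\<in>X. indicator {y} b * D z (a, b)))"
        unfolding sum_distrib_left by (simp only: mult.assoc)
      also have "\<dots> = D z (x, y)" by (simp add: indicator_sum[OF fin] 2)
      finally show ?thesis using D 2 that by simp
    qed
    have "?p \<in> vectors_on X" by (simp add: vectors_on_def dual_algebra_def)
    then have "\<tau> ?p = msum n n (\<lambda>z. ?p z \<cdot>\<^sub>m \<tau> (indicator {z})) X" by (rule exp)
    also have "\<dots> = msum n n (\<lambda>z. c x y z \<cdot>\<^sub>m \<tau> (indicator {z})) X"
      by (intro msum_cong) (simp add: p)
    also have "\<tau> ?p = \<tau> (indicator {x}) * \<tau> (indicator {y})"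
      using ring_hom_mult[OF hom] ind 2 A(1) by (simp add: ring_mat_simps)
    finally show ?case .
  next
    case 3
    have "indicator X \<in> vectors_on X" by (simp add: vectors_on_def)
    from exp[OF this] have "\<tau> (indicator X) = msum n n (\<lambda>x. \<tau> (indicator {x})) X"
      by (auto intro!: eq_matI sum.cong simp: smult_entry[OF cl])
    moreover have "\<tau> (indicator X) = 1\<^sub>m n"
      using ring_hom_one[OF hom] by (simp add: dual_algebra_def ring_mat_simps)
    ultimately show ?case by simp
  next
    case 4
    have irr': "irreducible_matrices n (\<tau> ` vectors_on X)" using irr A by (simp add: alg_irrep_def)
    show ?case
      unfolding irreducible_matrices_iff
    proof (intro conjI allI impI; (elim conjE)?)
      show "n > 0" using irr' by (simp add: irreducible_matrices_iff)
      fix U assume U: "lin_subspace n U"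
        and inv: "\<forall>M\<in>(\<lambda>x. \<tau> (indicator {x})) ` X. \<forall>u\<in>U. M *\<^sub>v u \<in> U"
      have inv': "\<tau> (indicator {x}) *\<^sub>v u \<in> U" if "x \<in> X" "u \<in> U" for x u
        using inv that by blast
      have "\<forall>M\<in>\<tau> ` vectors_on X. \<forall>u\<in>U. M *\<^sub>v u \<in> U"
      proof (intro ballI)
        fix M u assume "M \<in> \<tau> ` vectors_on X" and u: "u \<in> U"
        then obtain \<phi> where \<phi>: "\<phi> \<in> vectors_on X" "M = \<tau> \<phi>" by blast
        show "M *\<^sub>v u \<in> U"
          unfolding \<phi>(2) exp[OF \<phi>(1)]
          by (rule msum_invariant_subspace[OF U fin cl inv' u])
      qed
      then show "U = {0\<^sub>v n} \<or> U = carrier_vec n"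
        using irr' U unfolding irreducible_matrices_iff by blast
    qed
  qed
qed

section \<open>Representations of a group and of its commutant\<close>

text \<open>A group \<open>K'\<close> with a finite quotient \<open>K\<close>, and a representation \<open>\<pi>\<close> of \<open>K'\<close> on which the kernel acts by
  \<open>\<chi>\<close> and whose trace vanishes outside the kernel. The trace condition says that \<open>\<pi>\<close> is a multiple of
  the \<open>\<chi>\<close>-twisted regular representation, so that each irreducible representation of \<open>K'\<close> with
  character \<open>\<chi>\<close> on the kernel occurs in it, with multiplicity proportional to its dimension. By the
  double commutant principle, the multiplicity spaces are the irreducible modules of the commutant
  of \<open>\<pi>\<close>.\<close>

locale extension_rep = K: group K + K': group K'
  for K :: "('a, 'm) monoid_scheme" and K' :: "('k, 'l) monoid_scheme" +
  fixes p :: "'k \<Rightarrow> 'a" and \<pi> :: "'k \<Rightarrow> complex mat" and \<chi> :: "'k \<Rightarrow> complex" and D :: nat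
  assumes fin: "finite (carrier K)" and p_hom: "p \<in> hom K' K" and p_surj: "p ` carrier K' = carrier K"
    and \<pi>_hom: "\<pi> \<in> hom K' (GL D)" and \<pi>_\<zeta>: "acts_by (kernel K' K p) \<chi> D \<pi>" and D_pos: "D > 0"
    and \<pi>_trace: "\<And>k. k \<in> carrier K' \<Longrightarrow> p k \<noteq> \<one>\<^bsub>K\<^esub> \<Longrightarrow> mtrace (\<pi> k) = 0"
begin

definition admissible :: "nat \<Rightarrow> ('k \<Rightarrow> complex mat) \<Rightarrow> bool" where
  "admissible m \<sigma> \<longleftrightarrow> \<sigma> \<in> hom K' (GL m) \<and> acts_by (kernel K' K p) \<chi> m \<sigma>"

lemma \<pi>_admissible: "admissible D \<pi>"
  using \<pi>_hom \<pi>_\<zeta> by (simp add: admissible_def)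

lemma admissible_facts:
  assumes "admissible m \<sigma>"
  shows adm_carrier: "k \<in> carrier K' \<Longrightarrow> \<sigma> k \<in> carrier_mat m m"
    and adm_mult: "k \<in> carrier K' \<Longrightarrow> l \<in> carrier K' \<Longrightarrow> \<sigma> (k \<otimes>\<^bsub>K'\<^esub> l) = \<sigma> k * \<sigma> l"
    and adm_one: "\<sigma> \<one>\<^bsub>K'\<^esub> = 1\<^sub>m m"
    and adm_inv: "k \<in> carrier K' \<Longrightarrow> \<sigma> (inv\<^bsub>K'\<^esub> k) * \<sigma> k = 1\<^sub>m m" "k \<in> carrier K' \<Longrightarrow> \<sigma> k * \<sigma> (inv\<^bsub>K'\<^esub> k) = 1\<^sub>m m"
    and adm_\<zeta>: "z \<in> kernel K' K p \<Longrightarrow> \<sigma> z = \<chi> z \<cdot>\<^sub>m 1\<^sub>m m"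
proof -
  have hom: "\<sigma> \<in> hom K' (GL m)" using assms by (simp add: admissible_def)
  interpret GL: group "GL m" by (rule group_GL)
  interpret h: group_hom K' "GL m" \<sigma> by unfold_locales (rule hom)
  show c: "\<sigma> k \<in> carrier_mat m m" if "k \<in> carrier K'" for k using h.hom_closed[OF that] carrier_GL_mat by blast
  show mu: "\<sigma> (k \<otimes>\<^bsub>K'\<^esub> l) = \<sigma> k * \<sigma> l" if "k \<in> carrier K'" "l \<in> carrier K'" for k l
    using h.hom_mult[OF that] by simp
  show o: "\<sigma> \<one>\<^bsub>K'\<^esub> = 1\<^sub>m m" using h.hom_one by simp
  show "\<sigma> (inv\<^bsub>K'\<^esub> k) * \<sigma> k = 1\<^sub>m m" "\<sigma> k * \<sigma> (inv\<^bsub>K'\<^esub> k) = 1\<^sub>m m" if "k \<in> carrier K'" for k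
    using mu[of "inv\<^bsub>K'\<^esub> k" k] mu[of k "inv\<^bsub>K'\<^esub> k"] that o by simp_all
  show "\<sigma> z = \<chi> z \<cdot>\<^sub>m 1\<^sub>m m" if "z \<in> kernel K' K p" for z
    using assms that by (simp add: admissible_def acts_by_def)
qed

lemma p_simps [simp]:
  "k \<in> carrier K' \<Longrightarrow> p k \<in> carrier K"
  "k \<in> carrier K' \<Longrightarrow> l \<in> carrier K' \<Longrightarrow> p (k \<otimes>\<^bsub>K'\<^esub> l) = p k \<otimes>\<^bsub>K\<^esub> p l"
  "k \<in> carrier K' \<Longrightarrow> p (inv\<^bsub>K'\<^esub> k) = inv\<^bsub>K\<^esub> (p k)"
  "p \<one>\<^bsub>K'\<^esub> = \<one>\<^bsub>K\<^esub>"
proof -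
  interpret h: group_hom K' K p by unfold_locales (rule p_hom)
  show "k \<in> carrier K' \<Longrightarrow> p k \<in> carrier K"
    "k \<in> carrier K' \<Longrightarrow> l \<in> carrier K' \<Longrightarrow> p (k \<otimes>\<^bsub>K'\<^esub> l) = p k \<otimes>\<^bsub>K\<^esub> p l"
    "k \<in> carrier K' \<Longrightarrow> p (inv\<^bsub>K'\<^esub> k) = inv\<^bsub>K\<^esub> (p k)"
    "p \<one>\<^bsub>K'\<^esub> = \<one>\<^bsub>K\<^esub>" by simp_all
qed

text \<open>On a fibre of \<open>p\<close> all admissible representations change by the same scalar, because they have the
  same restriction to the kernel. Expressions in which this scalar cancels can therefore be summed
  over \<open>K\<close> although \<open>K'\<close> may be infinite.\<close>

lemma fibre_scalar:
  assumes k: "k \<in> carrier K'" "l \<in> carrier K'" "p k = p l"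
  obtains c where "c \<noteq> 0" "\<And>m \<sigma>. admissible m \<sigma> \<Longrightarrow> \<sigma> l = c \<cdot>\<^sub>m \<sigma> k"
    "\<And>m \<sigma>. admissible m \<sigma> \<Longrightarrow> \<sigma> (inv\<^bsub>K'\<^esub> l) = inverse c \<cdot>\<^sub>m \<sigma> (inv\<^bsub>K'\<^esub> k)"
proof -
  define z where "z = inv\<^bsub>K'\<^esub> k \<otimes>\<^bsub>K'\<^esub> l"
  have z: "z \<in> kernel K' K p" "z \<in> carrier K'" using k by (auto simp: z_def kernel_def)
  have z': "inv\<^bsub>K'\<^esub> z \<in> kernel K' K p" using z by (auto simp: kernel_def)
  have l: "l = k \<otimes>\<^bsub>K'\<^esub> z" using k by (simp add: z_def K'.m_assoc[symmetric])
  have "(\<chi> z * \<chi> (inv\<^bsub>K'\<^esub> z)) \<cdot>\<^sub>m 1\<^sub>m D = (1\<^sub>m D :: complex mat)"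
    using adm_inv(2)[OF \<pi>_admissible z(2)] adm_\<zeta>[OF \<pi>_admissible z(1)] adm_\<zeta>[OF \<pi>_admissible z']
    by (simp add: mult_smult_assoc_mat[of _ D D _ D] smult_smult_mat)
  from arg_cong[OF this, of "\<lambda>M. M $$ (0, 0)"] have c: "\<chi> z * \<chi> (inv\<^bsub>K'\<^esub> z) = 1" using D_pos by simp
  have "\<chi> z \<noteq> 0" using c by auto
  moreover have "\<chi> (inv\<^bsub>K'\<^esub> z) = inverse (\<chi> z)" by (rule inverse_unique[OF c, symmetric])
  moreover have "\<sigma> l = \<chi> z \<cdot>\<^sub>m \<sigma> k" if a: "admissible m \<sigma>" for m \<sigma>
    using adm_mult[OF a k(1) z(2)] adm_\<zeta>[OF a z(1)] adm_carrier[OF a k(1)] l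
      mult_smult_distrib[OF adm_carrier[OF a k(1)] one_carrier_mat] by simp
  moreover have "\<sigma> (inv\<^bsub>K'\<^esub> l) = \<chi> (inv\<^bsub>K'\<^esub> z) \<cdot>\<^sub>m \<sigma> (inv\<^bsub>K'\<^esub> k)" if a: "admissible m \<sigma>" for m \<sigma>
  proof -
    have ki: "inv\<^bsub>K'\<^esub> k \<in> carrier K'" using k by simp
    have "inv\<^bsub>K'\<^esub> l = inv\<^bsub>K'\<^esub> z \<otimes>\<^bsub>K'\<^esub> inv\<^bsub>K'\<^esub> k" unfolding l using k z by (simp add: K'.inv_mult_group)
    then show ?thesis
      using adm_mult[OF a, of "inv\<^bsub>K'\<^esub> z" "inv\<^bsub>K'\<^esub> k"] adm_\<zeta>[OF a z'] adm_carrier[OF a ki] k z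
        mult_smult_assoc_mat[OF one_carrier_mat adm_carrier[OF a ki]] by simp
  qed
  ultimately show thesis using that by metis
qed

definition s :: "'a \<Rightarrow> 'k" where "s a = (SOME k. k \<in> carrier K' \<and> p k = a)"

lemma s: "a \<in> carrier K \<Longrightarrow> s a \<in> carrier K'" "a \<in> carrier K \<Longrightarrow> p (s a) = a"
proof -
  assume "a \<in> carrier K"
  then have "a \<in> p ` carrier K'" unfolding p_surj .
  then have "\<exists>k. k \<in> carrier K' \<and> p k = a" by blast
  from someI_ex[OF this] show "s a \<in> carrier K'" "p (s a) = a" by (simp_all add: s_def)
qed

text \<open>Functions for which the sum over \<open>K\<close> through the section \<open>s\<close> is independent of \<open>s\<close> and hence invariant
  under translation.\<close>

definition fibre_const :: "('k \<Rightarrow> complex mat) \<Rightarrow> bool" where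
  "fibre_const F \<longleftrightarrow> (\<forall>k\<in>carrier K'. \<forall>l\<in>carrier K'. p k = p l \<longrightarrow> F k = F l)"

lemma fibre_constD: "fibre_const F \<Longrightarrow> k \<in> carrier K' \<Longrightarrow> l \<in> carrier K' \<Longrightarrow> p k = p l \<Longrightarrow> F k = F l"
  unfolding fibre_const_def by blast

lemma left_translate:
  assumes F: "fibre_const F" and k: "k \<in> carrier K'"
  shows "msum r c (\<lambda>a. F (k \<otimes>\<^bsub>K'\<^esub> s a)) (carrier K) = msum r c (\<lambda>a. F (s a)) (carrier K)"
proof -
  have bij: "bij_betw (\<lambda>a. p k \<otimes>\<^bsub>K\<^esub> a) (carrier K) (carrier K)"
    using k by (intro bij_betw_byWitness[of _ "\<lambda>a. inv\<^bsub>K\<^esub> (p k) \<otimes>\<^bsub>K\<^esub> a"]) (auto simp: K.m_assoc[symmetric])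
  have "msum r c (\<lambda>a. F (k \<otimes>\<^bsub>K'\<^esub> s a)) (carrier K) = msum r c (\<lambda>a. F (s (p k \<otimes>\<^bsub>K\<^esub> a))) (carrier K)"
  proof (rule msum_cong)
    fix a assume a: "a \<in> carrier K"
    then have "k \<otimes>\<^bsub>K'\<^esub> s a \<in> carrier K'" "s (p k \<otimes>\<^bsub>K\<^esub> a) \<in> carrier K'"
      "p (k \<otimes>\<^bsub>K'\<^esub> s a) = p (s (p k \<otimes>\<^bsub>K\<^esub> a))"
      using k s by simp_all
    then show "F (k \<otimes>\<^bsub>K'\<^esub> s a) = F (s (p k \<otimes>\<^bsub>K\<^esub> a))" by (rule fibre_constD[OF F])
  qed
  also have "\<dots> = msum r c (\<lambda>a. F (s a)) (carrier K)"
    by (rule msum_reindex[OF bij])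
  finally show ?thesis .
qed

lemma right_translate:
  assumes F: "fibre_const F" and k: "k \<in> carrier K'"
  shows "msum r c (\<lambda>a. F (s a \<otimes>\<^bsub>K'\<^esub> k)) (carrier K) = msum r c (\<lambda>a. F (s a)) (carrier K)"
proof -
  have bij: "bij_betw (\<lambda>a. a \<otimes>\<^bsub>K\<^esub> p k) (carrier K) (carrier K)"
    using k by (intro bij_betw_byWitness[of _ "\<lambda>a. a \<otimes>\<^bsub>K\<^esub> inv\<^bsub>K\<^esub> (p k)"]) (auto simp: K.m_assoc)
  have "msum r c (\<lambda>a. F (s a \<otimes>\<^bsub>K'\<^esub> k)) (carrier K) = msum r c (\<lambda>a. F (s (a \<otimes>\<^bsub>K\<^esub> p k))) (carrier K)"
  proof (rule msum_cong)
    fix a assume a: "a \<in> carrier K"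
    then have "s a \<otimes>\<^bsub>K'\<^esub> k \<in> carrier K'" "s (a \<otimes>\<^bsub>K\<^esub> p k) \<in> carrier K'"
      "p (s a \<otimes>\<^bsub>K'\<^esub> k) = p (s (a \<otimes>\<^bsub>K\<^esub> p k))"
      using k s by simp_all
    then show "F (s a \<otimes>\<^bsub>K'\<^esub> k) = F (s (a \<otimes>\<^bsub>K\<^esub> p k))" by (rule fibre_constD[OF F])
  qed
  also have "\<dots> = msum r c (\<lambda>a. F (s a)) (carrier K)"
    by (rule msum_reindex[OF bij])
  finally show ?thesis .
qed

subsection \<open>Averaging\<close>

definition avg :: "nat \<Rightarrow> ('k \<Rightarrow> complex mat) \<Rightarrow> nat \<Rightarrow> ('k \<Rightarrow> complex mat) \<Rightarrow> complex mat \<Rightarrow> complex mat" where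
  "avg m \<sigma> m' \<sigma>' M = msum m m' (\<lambda>a. \<sigma> (s a) * M * \<sigma>' (inv\<^bsub>K'\<^esub> (s a))) (carrier K)"

lemma avg_carrier [simp]: "avg m \<sigma> m' \<sigma>' M \<in> carrier_mat m m'"
  by (simp add: avg_def)

lemma avg_intertwines:
  assumes \<sigma>: "admissible m \<sigma>" and \<sigma>': "admissible m' \<sigma>'" and M: "M \<in> carrier_mat m m'" and k: "k \<in> carrier K'"
  shows "\<sigma> k * avg m \<sigma> m' \<sigma>' M = avg m \<sigma> m' \<sigma>' M * \<sigma>' k"
proof -
  define F where "F l = \<sigma> l * M * \<sigma>' (inv\<^bsub>K'\<^esub> l)" for l
  note c = adm_carrier[OF \<sigma>] and c' = adm_carrier[OF \<sigma>']
  have Fc: "F l \<in> carrier_mat m m'" if "l \<in> carrier K'" for l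
    unfolding F_def using c[OF that] c'[of "inv\<^bsub>K'\<^esub> l"] M that by auto
  have "fibre_const F"
    unfolding fibre_const_def
  proof (intro ballI impI)
    fix k l assume kl: "k \<in> carrier K'" "l \<in> carrier K'" "p k = p l"
    obtain x where x: "x \<noteq> 0" "\<sigma> l = x \<cdot>\<^sub>m \<sigma> k" "\<sigma>' (inv\<^bsub>K'\<^esub> l) = inverse x \<cdot>\<^sub>m \<sigma>' (inv\<^bsub>K'\<^esub> k)"
      using fibre_scalar[OF kl] \<sigma> \<sigma>' by metis
    have ck: "\<sigma> k \<in> carrier_mat m m" and ck': "\<sigma>' (inv\<^bsub>K'\<^esub> k) \<in> carrier_mat m' m'"
      using c c' kl by auto
    have "F l = x \<cdot>\<^sub>m (\<sigma> k * M) * (inverse x \<cdot>\<^sub>m \<sigma>' (inv\<^bsub>K'\<^esub> k))"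
      unfolding F_def x(2,3) mult_smult_assoc_mat[OF ck M] ..
    also have "\<dots> = x \<cdot>\<^sub>m (inverse x \<cdot>\<^sub>m (\<sigma> k * M * \<sigma>' (inv\<^bsub>K'\<^esub> k)))"
      using ck ck' M by (subst mult_smult_assoc_mat[of _ m m' _ m'], simp, simp)
        (subst mult_smult_distrib[of _ m m' _ m'], auto)
    also have "\<dots> = F k" unfolding F_def using x(1) ck ck' M by (auto intro!: eq_matI)
    finally show "F k = F l" by simp
  qed
  have step: "\<sigma> k * F (s a) = F (k \<otimes>\<^bsub>K'\<^esub> s a) * \<sigma>' k" if a: "a \<in> carrier K" for a
  proof -
    have sa: "s a \<in> carrier K'" using s a by simp
    let ?i = "\<sigma>' (inv\<^bsub>K'\<^esub> (s a))" and ?ki = "\<sigma>' (inv\<^bsub>K'\<^esub> k)"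
    have cs: "\<sigma> k \<in> carrier_mat m m" "\<sigma> (s a) \<in> carrier_mat m m" "?i \<in> carrier_mat m' m'"
       "?ki \<in> carrier_mat m' m'" "\<sigma>' k \<in> carrier_mat m' m'"
      using c c' sa k by auto
    have "F (k \<otimes>\<^bsub>K'\<^esub> s a) * \<sigma>' k = \<sigma> k * \<sigma> (s a) * M * (?i * ?ki) * \<sigma>' k"
      unfolding F_def using k sa by (simp add: adm_mult[OF \<sigma>] adm_mult[OF \<sigma>'] K'.inv_mult_group)
    also have "\<dots> = \<sigma> k * \<sigma> (s a) * M * ((?i * ?ki) * \<sigma>' k)"
      using cs M by (intro assoc_mult_mat[of _ m m' _ m' _ m']) auto
    also have "(?i * ?ki) * \<sigma>' k = ?i"
      using assoc_mult_mat[OF cs(3,4,5)] adm_inv(1)[OF \<sigma>' k] cs by simp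
    also have "\<sigma> k * \<sigma> (s a) * M = \<sigma> k * (\<sigma> (s a) * M)"
      by (rule assoc_mult_mat[OF cs(1,2) M])
    also have "\<dots> * ?i = \<sigma> k * F (s a)"
      unfolding F_def using cs M by (intro assoc_mult_mat[of _ m m _ m' _ m']) auto
    finally show ?thesis by simp
  qed
  have ck: "\<sigma> k \<in> carrier_mat m m" "\<sigma>' k \<in> carrier_mat m' m'" using c c' k by auto
  have "\<sigma> k * avg m \<sigma> m' \<sigma>' M = msum m m' (\<lambda>a. \<sigma> k * F (s a)) (carrier K)"
    unfolding avg_def F_def[symmetric] using Fc s by (intro mult_msum[OF ck(1)]) auto
  also have "\<dots> = msum m m' (\<lambda>a. F (k \<otimes>\<^bsub>K'\<^esub> s a) * \<sigma>' k) (carrier K)"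
    by (rule msum_cong) (rule step)
  also have "\<dots> = msum m m' (\<lambda>a. F (k \<otimes>\<^bsub>K'\<^esub> s a)) (carrier K) * \<sigma>' k"
    using Fc s k by (intro msum_mult[symmetric, OF ck(2)]) auto
  also have "msum m m' (\<lambda>a. F (k \<otimes>\<^bsub>K'\<^esub> s a)) (carrier K) = avg m \<sigma> m' \<sigma>' M"
    unfolding left_translate[OF \<open>fibre_const F\<close> k] by (simp only: avg_def F_def)
  finally show ?thesis .
qed

lemma avg_entry:
  assumes \<sigma>: "admissible m \<sigma>" and \<sigma>': "admissible m' \<sigma>'" and "i < m" "j < m'" "k < m" "l < m'"
  shows "avg m \<sigma> m' \<sigma>' (munit m m' k l) $$ (i, j)
    = (\<Sum>a\<in>carrier K. \<sigma> (s a) $$ (i, k) * \<sigma>' (inv\<^bsub>K'\<^esub> (s a)) $$ (l, j))"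
  unfolding avg_def using assms s
  by (simp, intro sum.cong refl mult_munit_mult[of _ m _ _ m']) (auto intro: adm_carrier)

definition irr :: "nat \<Rightarrow> ('k \<Rightarrow> complex mat) \<Rightarrow> bool" where
  "irr m \<sigma> \<longleftrightarrow> admissible m \<sigma> \<and> irreducible_matrices m (\<sigma> ` carrier K')"

lemma irrD: "irr m \<sigma> \<Longrightarrow> admissible m \<sigma>" "irr m \<sigma> \<Longrightarrow> irreducible_matrices m (\<sigma> ` carrier K')"
  "irr m \<sigma> \<Longrightarrow> m > 0"
  by (simp_all add: irr_def irreducible_matrices_iff)

definition N :: complex where "N = of_nat (card (carrier K))"

lemma N_nonzero: "N \<noteq> 0"
  unfolding N_def using fin K.one_closed by auto

lemma schur_orthogonality:
  assumes \<sigma>: "irr m \<sigma>" and "i < m" "j < m" "k < m" "l < m"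
  shows "(\<Sum>a\<in>carrier K. \<sigma> (s a) $$ (i, k) * \<sigma> (inv\<^bsub>K'\<^esub> (s a)) $$ (l, j))
    = (if i = j \<and> k = l then N / of_nat m else 0)"
proof -
  note a = irrD[OF \<sigma>]
  let ?A = "avg m \<sigma> m \<sigma> (munit m m k l)"
  have "\<exists>c. ?A = c \<cdot>\<^sub>m 1\<^sub>m m"
    by (rule schur_scalar[OF adm_carrier[OF a(1)] a(2) avg_carrier])
      (simp_all add: avg_intertwines[OF a(1,1) munit_carrier])
  then obtain c where c: "?A = c \<cdot>\<^sub>m 1\<^sub>m m" ..
  have tr: "mtrace (\<sigma> (s x) * munit m m k l * \<sigma> (inv\<^bsub>K'\<^esub> (s x))) = (if k = l then 1 else 0)" if x: "x \<in> carrier K" for x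
  proof -
    have cs: "\<sigma> (s x) \<in> carrier_mat m m" "\<sigma> (inv\<^bsub>K'\<^esub> (s x)) \<in> carrier_mat m m"
      using adm_carrier[OF a(1)] s x by auto
    have "mtrace (\<sigma> (s x) * munit m m k l * \<sigma> (inv\<^bsub>K'\<^esub> (s x)))
        = mtrace (\<sigma> (inv\<^bsub>K'\<^esub> (s x)) * (\<sigma> (s x) * munit m m k l))"
      using cs by (intro mtrace_comm[of _ m m]) auto
    also have "\<sigma> (inv\<^bsub>K'\<^esub> (s x)) * (\<sigma> (s x) * munit m m k l) = munit m m k l"
      using assoc_mult_mat[OF cs(2,1) munit_carrier] adm_inv(1)[OF a(1)] s x
      by (simp add: left_mult_one_mat[OF munit_carrier])
    also have "mtrace (munit m m k l) = (if k = l then 1 else 0)"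
    proof -
      have "mtrace (munit m m k l) = (\<Sum>q<m. (if q = k then 1 else 0) * (if q = l then 1 else 0))"
        unfolding mtrace_def by (intro sum.cong) (auto simp: munit_def)
      then show ?thesis using assms by (simp add: sum_delta_left)
    qed
    finally show ?thesis .
  qed
  have "of_nat m * c = mtrace ?A" unfolding c by (simp add: mtrace_smult[of _ m])
  also have "\<dots> = N * (if k = l then 1 else 0)"
    unfolding avg_def N_def
    by (subst mtrace_msum) (use s adm_carrier[OF a(1)] in \<open>auto simp: tr\<close>)
  finally have "c = (if k = l then N / of_nat m else 0)" using a(3) by (auto simp: field_simps)
  then show ?thesis using avg_entry[OF a(1,1), of i j k l] assms c by auto
qed

lemma schur_orthogonality_distinct:
  assumes \<sigma>: "irr m \<sigma>" and \<sigma>': "irr m' \<sigma>'" and ni: "\<not> rep_isomorphic (carrier K') (m', \<sigma>') (m, \<sigma>)"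
    and ij: "i < m" "j < m'" "k < m" "l < m'"
  shows "(\<Sum>a\<in>carrier K. \<sigma> (s a) $$ (i, k) * \<sigma>' (inv\<^bsub>K'\<^esub> (s a)) $$ (l, j)) = 0"
proof -
  note a = irrD[OF \<sigma>] and a' = irrD[OF \<sigma>']
  let ?A = "avg m \<sigma> m' \<sigma>' (munit m m' k l)"
  have int: "?A * \<sigma>' x = \<sigma> x * ?A" if "x \<in> carrier K'" for x
    using avg_intertwines[OF a(1) a'(1) munit_carrier that] by simp
  have "?A = 0\<^sub>m m m'"
  proof (rule ccontr)
    assume "?A \<noteq> 0\<^sub>m m m'"
    from schur_isomorphism[OF adm_carrier[OF a'(1)] a'(2) adm_carrier[OF a(1)] a(2) avg_carrier int this]
    have "m = m'" "?A \<in> carrier (GL m')" by auto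
    then have "rep_isomorphic (carrier K') (m', \<sigma>') (m, \<sigma>)"
      using int by (auto simp: rep_isomorphic_def)
    then show False using ni by simp
  qed
  then show ?thesis using avg_entry[OF a(1) a'(1) ij] ij by simp
qed

subsection \<open>Matrix units\<close>

text \<open>The matrix units of the isotypic component of \<open>\<sigma>\<close>, namely the images under \<open>\<pi>\<close> of the elements of the
  group algebra that act in \<open>\<sigma>\<close> as matrix units.\<close>

definition e :: "nat \<Rightarrow> ('k \<Rightarrow> complex mat) \<Rightarrow> nat \<Rightarrow> nat \<Rightarrow> complex mat" where
  "e m \<sigma> i j = msum D D (\<lambda>a. (of_nat m / N * \<sigma> (inv\<^bsub>K'\<^esub> (s a)) $$ (j, i)) \<cdot>\<^sub>m \<pi> (s a)) (carrier K)"

lemma e_carrier [simp]: "e m \<sigma> i j \<in> carrier_mat D D"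
  by (simp add: e_def)

lemmas \<pi>_carrier = adm_carrier[OF \<pi>_admissible]

text \<open>The matrix units span, on the left and on the right, copies of \<open>\<sigma>\<close> under multiplication by \<open>\<pi>\<close>. Their
  products are then governed by Schur orthogonality.\<close>

lemma e_left:
  assumes \<sigma>: "admissible m \<sigma>" and k: "k \<in> carrier K'" and ij: "i < m" "j < m"
  shows "\<pi> k * e m \<sigma> i j = msum D D (\<lambda>l. \<sigma> k $$ (l, i) \<cdot>\<^sub>m e m \<sigma> l j) {..<m}"
proof -
  note c = adm_carrier[OF \<sigma>]
  define F where "F k' = (\<Sum>l<m. \<sigma> k $$ (l, i) * (of_nat m / N * \<sigma> (inv\<^bsub>K'\<^esub> k') $$ (j, l))) \<cdot>\<^sub>m \<pi> k'" for k'
  have "fibre_const F"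
    unfolding fibre_const_def
  proof (intro ballI impI)
    fix k1 l1 assume kl: "k1 \<in> carrier K'" "l1 \<in> carrier K'" "p k1 = p l1"
    obtain x where x: "x \<noteq> 0" "\<pi> l1 = x \<cdot>\<^sub>m \<pi> k1" "\<sigma> (inv\<^bsub>K'\<^esub> l1) = inverse x \<cdot>\<^sub>m \<sigma> (inv\<^bsub>K'\<^esub> k1)"
      using fibre_scalar[OF kl] \<sigma> \<pi>_admissible by metis
    have "(\<Sum>l<m. \<sigma> k $$ (l, i) * (of_nat m / N * \<sigma> (inv\<^bsub>K'\<^esub> l1) $$ (j, l)))
        = inverse x * (\<Sum>l<m. \<sigma> k $$ (l, i) * (of_nat m / N * \<sigma> (inv\<^bsub>K'\<^esub> k1) $$ (j, l)))"
      unfolding sum_distrib_left x(3) using ij kl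
      by (intro sum.cong refl) (simp add: smult_entry[OF c])
    then show "F k1 = F l1"
      unfolding F_def x(2) using x(1) \<pi>_carrier[OF kl(1)] by (auto intro!: eq_matI)
  qed
  have step: "(of_nat m / N * \<sigma> (inv\<^bsub>K'\<^esub> (s a)) $$ (j, i)) \<cdot>\<^sub>m (\<pi> k * \<pi> (s a)) = F (k \<otimes>\<^bsub>K'\<^esub> s a)"
    if a: "a \<in> carrier K" for a
  proof -
    have sa: "s a \<in> carrier K'" using s a by simp
    have "inv\<^bsub>K'\<^esub> (k \<otimes>\<^bsub>K'\<^esub> s a) \<otimes>\<^bsub>K'\<^esub> k = inv\<^bsub>K'\<^esub> (s a)"
      using k sa by (simp add: K'.inv_mult_group K'.m_assoc)
    then have "\<sigma> (inv\<^bsub>K'\<^esub> (s a)) = \<sigma> (inv\<^bsub>K'\<^esub> (k \<otimes>\<^bsub>K'\<^esub> s a)) * \<sigma> k"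
      using adm_mult[OF \<sigma>, of "inv\<^bsub>K'\<^esub> (k \<otimes>\<^bsub>K'\<^esub> s a)" k] k sa by simp
    then have "\<sigma> (inv\<^bsub>K'\<^esub> (s a)) $$ (j, i) = (\<Sum>l<m. \<sigma> (inv\<^bsub>K'\<^esub> (k \<otimes>\<^bsub>K'\<^esub> s a)) $$ (j, l) * \<sigma> k $$ (l, i))"
      using mult_entry[OF c c, of "inv\<^bsub>K'\<^esub> (k \<otimes>\<^bsub>K'\<^esub> s a)" k j i] k sa ij by simp
    then have "of_nat m / N * \<sigma> (inv\<^bsub>K'\<^esub> (s a)) $$ (j, i)
        = (\<Sum>l<m. \<sigma> k $$ (l, i) * (of_nat m / N * \<sigma> (inv\<^bsub>K'\<^esub> (k \<otimes>\<^bsub>K'\<^esub> s a)) $$ (j, l)))"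
      by (simp add: sum_distrib_left mult_ac)
    then show ?thesis unfolding F_def adm_mult[OF \<pi>_admissible k sa] by simp
  qed
  have "\<pi> k * e m \<sigma> i j
      = msum D D (\<lambda>a. (of_nat m / N * \<sigma> (inv\<^bsub>K'\<^esub> (s a)) $$ (j, i)) \<cdot>\<^sub>m (\<pi> k * \<pi> (s a))) (carrier K)"
    unfolding e_def using \<pi>_carrier s k
    by (subst mult_msum[of _ D D]) (auto intro!: msum_cong mult_smult_distrib[of _ D D _ D])
  also have "\<dots> = msum D D (\<lambda>a. F (k \<otimes>\<^bsub>K'\<^esub> s a)) (carrier K)"
    by (rule msum_cong) (rule step)
  also have "\<dots> = msum D D (\<lambda>a. F (s a)) (carrier K)"
    by (rule left_translate[OF \<open>fibre_const F\<close> k])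
  also have "\<dots> = msum D D (\<lambda>l. \<sigma> k $$ (l, i) \<cdot>\<^sub>m e m \<sigma> l j) {..<m}"
    unfolding F_def e_def by (rule msum_lincomb[symmetric]) (use \<pi>_carrier s in auto)
  finally show ?thesis .
qed

lemma e_right:
  assumes \<sigma>: "admissible m \<sigma>" and k: "k \<in> carrier K'" and ij: "i < m" "j < m"
  shows "e m \<sigma> i j * \<pi> k = msum D D (\<lambda>l. \<sigma> k $$ (j, l) \<cdot>\<^sub>m e m \<sigma> i l) {..<m}"
proof -
  note c = adm_carrier[OF \<sigma>]
  define F where "F k' = (\<Sum>l<m. \<sigma> k $$ (j, l) * (of_nat m / N * \<sigma> (inv\<^bsub>K'\<^esub> k') $$ (l, i))) \<cdot>\<^sub>m \<pi> k'" for k'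
  have "fibre_const F"
    unfolding fibre_const_def
  proof (intro ballI impI)
    fix k1 l1 assume kl: "k1 \<in> carrier K'" "l1 \<in> carrier K'" "p k1 = p l1"
    obtain x where x: "x \<noteq> 0" "\<pi> l1 = x \<cdot>\<^sub>m \<pi> k1" "\<sigma> (inv\<^bsub>K'\<^esub> l1) = inverse x \<cdot>\<^sub>m \<sigma> (inv\<^bsub>K'\<^esub> k1)"
      using fibre_scalar[OF kl] \<sigma> \<pi>_admissible by metis
    have "(\<Sum>l<m. \<sigma> k $$ (j, l) * (of_nat m / N * \<sigma> (inv\<^bsub>K'\<^esub> l1) $$ (l, i)))
        = inverse x * (\<Sum>l<m. \<sigma> k $$ (j, l) * (of_nat m / N * \<sigma> (inv\<^bsub>K'\<^esub> k1) $$ (l, i)))"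
      unfolding sum_distrib_left x(3) using ij kl
      by (intro sum.cong refl) (simp add: smult_entry[OF c])
    then show "F k1 = F l1"
      unfolding F_def x(2) using x(1) \<pi>_carrier[OF kl(1)] by (auto intro!: eq_matI)
  qed
  have step: "(of_nat m / N * \<sigma> (inv\<^bsub>K'\<^esub> (s a)) $$ (j, i)) \<cdot>\<^sub>m (\<pi> (s a) * \<pi> k) = F (s a \<otimes>\<^bsub>K'\<^esub> k)"
    if a: "a \<in> carrier K" for a
  proof -
    have sa: "s a \<in> carrier K'" using s a by simp
    have "k \<otimes>\<^bsub>K'\<^esub> inv\<^bsub>K'\<^esub> (s a \<otimes>\<^bsub>K'\<^esub> k) = inv\<^bsub>K'\<^esub> (s a)"
      using k sa by (simp add: K'.inv_mult_group K'.m_assoc[symmetric])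
    then have "\<sigma> (inv\<^bsub>K'\<^esub> (s a)) = \<sigma> k * \<sigma> (inv\<^bsub>K'\<^esub> (s a \<otimes>\<^bsub>K'\<^esub> k))"
      using adm_mult[OF \<sigma>, of k "inv\<^bsub>K'\<^esub> (s a \<otimes>\<^bsub>K'\<^esub> k)"] k sa by simp
    then have "\<sigma> (inv\<^bsub>K'\<^esub> (s a)) $$ (j, i) = (\<Sum>l<m. \<sigma> k $$ (j, l) * \<sigma> (inv\<^bsub>K'\<^esub> (s a \<otimes>\<^bsub>K'\<^esub> k)) $$ (l, i))"
      using mult_entry[OF c c, of k "inv\<^bsub>K'\<^esub> (s a \<otimes>\<^bsub>K'\<^esub> k)" j i] k sa ij by simp
    then have "of_nat m / N * \<sigma> (inv\<^bsub>K'\<^esub> (s a)) $$ (j, i)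
        = (\<Sum>l<m. \<sigma> k $$ (j, l) * (of_nat m / N * \<sigma> (inv\<^bsub>K'\<^esub> (s a \<otimes>\<^bsub>K'\<^esub> k)) $$ (l, i)))"
      by (simp add: sum_distrib_left mult_ac)
    then show ?thesis unfolding F_def adm_mult[OF \<pi>_admissible sa k] by simp
  qed
  have "e m \<sigma> i j * \<pi> k
      = msum D D (\<lambda>a. (of_nat m / N * \<sigma> (inv\<^bsub>K'\<^esub> (s a)) $$ (j, i)) \<cdot>\<^sub>m (\<pi> (s a) * \<pi> k)) (carrier K)"
    unfolding e_def using \<pi>_carrier s k
    by (subst msum_mult[of _ D D]) (auto intro!: msum_cong mult_smult_assoc_mat[of _ D D _ D])
  also have "\<dots> = msum D D (\<lambda>a. F (s a \<otimes>\<^bsub>K'\<^esub> k)) (carrier K)"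
    by (rule msum_cong) (rule step)
  also have "\<dots> = msum D D (\<lambda>a. F (s a)) (carrier K)"
    by (rule right_translate[OF \<open>fibre_const F\<close> k])
  also have "\<dots> = msum D D (\<lambda>l. \<sigma> k $$ (j, l) \<cdot>\<^sub>m e m \<sigma> i l) {..<m}"
    unfolding F_def e_def by (rule msum_lincomb[symmetric]) (use \<pi>_carrier s in auto)
  finally show ?thesis .
qed

lemma e_mult_general:
  assumes \<sigma>': "admissible m' \<sigma>'" and kl: "k < m'" "l < m'"
  shows "e m \<sigma> i j * e m' \<sigma>' k l = msum D D (\<lambda>r. (of_nat m / N *
    (\<Sum>a\<in>carrier K. \<sigma>' (s a) $$ (r, k) * \<sigma> (inv\<^bsub>K'\<^esub> (s a)) $$ (j, i))) \<cdot>\<^sub>m e m' \<sigma>' r l) {..<m'}"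
proof -
  have "e m \<sigma> i j * e m' \<sigma>' k l
      = msum D D (\<lambda>a. (of_nat m / N * \<sigma> (inv\<^bsub>K'\<^esub> (s a)) $$ (j, i)) \<cdot>\<^sub>m (\<pi> (s a) * e m' \<sigma>' k l)) (carrier K)"
    unfolding e_def[of m \<sigma>] using \<pi>_carrier s
    by (subst msum_mult[of _ D D]) (auto intro!: msum_cong mult_smult_assoc_mat[of _ D D _ D])
  also have "\<dots> = msum D D (\<lambda>a. (of_nat m / N * \<sigma> (inv\<^bsub>K'\<^esub> (s a)) $$ (j, i)) \<cdot>\<^sub>m
      msum D D (\<lambda>r. \<sigma>' (s a) $$ (r, k) \<cdot>\<^sub>m e m' \<sigma>' r l) {..<m'}) (carrier K)"
    by (intro msum_cong) (simp add: e_left[OF \<sigma>' s(1) kl])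
  also have "\<dots> = msum D D (\<lambda>r. (\<Sum>a\<in>carrier K. of_nat m / N * \<sigma> (inv\<^bsub>K'\<^esub> (s a)) $$ (j, i) * \<sigma>' (s a) $$ (r, k))
      \<cdot>\<^sub>m e m' \<sigma>' r l) {..<m'}"
    by (rule msum_lincomb) simp
  finally show ?thesis by (simp add: sum_distrib_left mult_ac)
qed

lemma e_mult:
  assumes \<sigma>: "irr m \<sigma>" and ij: "i < m" "j < m" "k < m" "l < m"
  shows "e m \<sigma> i j * e m \<sigma> k l = (if j = k then e m \<sigma> i l else 0\<^sub>m D D)"
proof -
  note m = irrD(3)[OF \<sigma>]
  have "of_nat m / N * (\<Sum>a\<in>carrier K. \<sigma> (s a) $$ (r, k) * \<sigma> (inv\<^bsub>K'\<^esub> (s a)) $$ (j, i))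
      = (if r = i then 1 else 0) * (if j = k then 1 else 0)" if "r < m" for r
    using schur_orthogonality[OF \<sigma> that ij(1,3,2)] m N_nonzero by simp
  then have "e m \<sigma> i j * e m \<sigma> k l
      = msum D D (\<lambda>r. ((if r = i then 1 else 0) * (if j = k then 1 else 0)) \<cdot>\<^sub>m e m \<sigma> r l) {..<m}"
    unfolding e_mult_general[OF irrD(1)[OF \<sigma>] ij(3,4)] by (intro msum_cong) simp
  also have "\<dots> = (if j = k then e m \<sigma> i l else 0\<^sub>m D D)"
  proof (cases "j = k")
    case True
    then show ?thesis using msum_delta[of "{..<m}" i "\<lambda>r. e m \<sigma> r l" D D] ij by simp
  next
    case False
    then show ?thesis by (auto intro!: eq_matI simp: smult_entry[OF e_carrier])
  qed
  finally show ?thesis .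
qed

lemma e_mult_distinct:
  assumes \<sigma>: "irr m \<sigma>" and \<sigma>': "irr m' \<sigma>'" and ni: "\<not> rep_isomorphic (carrier K') (m, \<sigma>) (m', \<sigma>')"
    and ij: "i < m" "j < m" "k < m'" "l < m'"
  shows "e m \<sigma> i j * e m' \<sigma>' k l = 0\<^sub>m D D"
  unfolding e_mult_general[OF irrD(1)[OF \<sigma>'] ij(3,4)]
  using schur_orthogonality_distinct[OF \<sigma>' \<sigma> ni _ ij(1,3,2)]
  by (auto intro!: eq_matI simp: smult_entry[OF e_carrier])

subsection \<open>The commutant and the isotypic projections\<close>

text \<open>The projection to the isotypic component of \<open>\<sigma>\<close>.\<close>

definition z :: "nat \<Rightarrow> ('k \<Rightarrow> complex mat) \<Rightarrow> complex mat" where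
  "z m \<sigma> = msum D D (\<lambda>i. e m \<sigma> i i) {..<m}"

definition commutant :: "complex mat set" where
  "commutant = {M \<in> carrier_mat D D. \<forall>k\<in>carrier K'. M * \<pi> k = \<pi> k * M}"

lemma z_carrier [simp]: "z m \<sigma> \<in> carrier_mat D D"
  by (simp add: z_def)

lemma z_trace_formula:
  assumes \<sigma>: "admissible m \<sigma>"
  shows "z m \<sigma> = msum D D (\<lambda>a. (of_nat m / N * mtrace (\<sigma> (inv\<^bsub>K'\<^esub> (s a)))) \<cdot>\<^sub>m \<pi> (s a)) (carrier K)"
proof -
  have "z m \<sigma> = msum D D (\<lambda>a. msum D D (\<lambda>i. (of_nat m / N * \<sigma> (inv\<^bsub>K'\<^esub> (s a)) $$ (i, i)) \<cdot>\<^sub>m \<pi> (s a)) {..<m}) (carrier K)"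
    unfolding z_def e_def by (rule msum_swap)
  also have "\<dots> = msum D D (\<lambda>a. (of_nat m / N * mtrace (\<sigma> (inv\<^bsub>K'\<^esub> (s a)))) \<cdot>\<^sub>m \<pi> (s a)) (carrier K)"
  proof (rule msum_cong)
    fix a assume a: "a \<in> carrier K"
    then have "\<sigma> (inv\<^bsub>K'\<^esub> (s a)) \<in> carrier_mat m m" using adm_carrier[OF \<sigma>] s by simp
    then have "mtrace (\<sigma> (inv\<^bsub>K'\<^esub> (s a))) = (\<Sum>i<m. \<sigma> (inv\<^bsub>K'\<^esub> (s a)) $$ (i, i))"
      by (simp add: mtrace_def)
    then show "msum D D (\<lambda>i. (of_nat m / N * \<sigma> (inv\<^bsub>K'\<^esub> (s a)) $$ (i, i)) \<cdot>\<^sub>m \<pi> (s a)) {..<m}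
        = (of_nat m / N * mtrace (\<sigma> (inv\<^bsub>K'\<^esub> (s a)))) \<cdot>\<^sub>m \<pi> (s a)"
      using \<pi>_carrier s(1)[OF a] by (subst msum_smult) (auto simp: sum_distrib_left)
  qed
  finally show ?thesis .
qed

lemma z_in_commutant:
  assumes \<sigma>: "admissible m \<sigma>"
  shows "z m \<sigma> \<in> commutant"
proof -
  have "z m \<sigma> * \<pi> k = \<pi> k * z m \<sigma>" if k: "k \<in> carrier K'" for k
  proof -
    have "z m \<sigma> * \<pi> k = msum D D (\<lambda>i. e m \<sigma> i i * \<pi> k) {..<m}"
      unfolding z_def by (rule msum_mult[OF \<pi>_carrier[OF k]]) simp
    also have "\<dots> = msum D D (\<lambda>i. msum D D (\<lambda>l. \<sigma> k $$ (i, l) \<cdot>\<^sub>m e m \<sigma> i l) {..<m}) {..<m}"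
      by (rule msum_cong) (simp add: e_right[OF \<sigma> k])
    also have "\<dots> = msum D D (\<lambda>l. msum D D (\<lambda>i. \<sigma> k $$ (i, l) \<cdot>\<^sub>m e m \<sigma> i l) {..<m}) {..<m}"
      by (rule msum_swap)
    also have "\<dots> = msum D D (\<lambda>l. \<pi> k * e m \<sigma> l l) {..<m}"
      by (rule msum_cong) (simp add: e_left[OF \<sigma> k])
    also have "\<dots> = \<pi> k * z m \<sigma>"
      unfolding z_def by (rule mult_msum[OF \<pi>_carrier[OF k], symmetric]) simp
    finally show ?thesis .
  qed
  then show ?thesis by (simp add: commutant_def)
qed

lemma commutant_e:
  assumes M: "M \<in> commutant"
  shows "M * e m \<sigma> i j = e m \<sigma> i j * M"
proof -
  have Mc: "M \<in> carrier_mat D D" and comm: "\<And>k. k \<in> carrier K' \<Longrightarrow> M * \<pi> k = \<pi> k * M"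
    using M by (auto simp: commutant_def)
  show ?thesis
    unfolding e_def using \<pi>_carrier s Mc
    by (subst mult_msum[OF Mc], simp, subst msum_mult[OF Mc], simp, intro msum_cong)
      (simp add: mult_smult_distrib[of _ D D _ D] mult_smult_assoc_mat[of _ D D _ D] comm)
qed

lemma commutant_z: "M \<in> commutant \<Longrightarrow> M * z m \<sigma> = z m \<sigma> * M"
  unfolding z_def by (subst mult_msum[of _ D D], simp add: commutant_def, simp,
      subst msum_mult[of _ D D], simp add: commutant_def, simp, intro msum_cong commutant_e)

lemma z_e:
  assumes \<sigma>: "irr m \<sigma>" and ij: "i < m" "j < m"
  shows "z m \<sigma> * e m \<sigma> i j = e m \<sigma> i j"
proof -
  have "z m \<sigma> * e m \<sigma> i j = msum D D (\<lambda>k. e m \<sigma> k k * e m \<sigma> i j) {..<m}"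
    unfolding z_def by (rule msum_mult) auto
  also have "\<dots> = msum D D (\<lambda>k. (if k = i then 1 else 0) \<cdot>\<^sub>m e m \<sigma> k j) {..<m}"
    by (rule msum_cong) (use ij in \<open>simp add: e_mult[OF \<sigma>] zero_smult_mat[OF e_carrier] one_smult_mat\<close>)
  also have "\<dots> = e m \<sigma> i j" using ij by (intro msum_delta) auto
  finally show ?thesis .
qed

lemma z_idem: assumes \<sigma>: "irr m \<sigma>" shows "z m \<sigma> * z m \<sigma> = z m \<sigma>"
proof -
  have "z m \<sigma> * z m \<sigma> = msum D D (\<lambda>i. z m \<sigma> * e m \<sigma> i i) {..<m}"
    by (subst (2) z_def, rule mult_msum) auto
  also have "\<dots> = msum D D (\<lambda>i. e m \<sigma> i i) {..<m}"
    by (rule msum_cong) (simp add: z_e[OF \<sigma>])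
  also have "\<dots> = z m \<sigma>" by (simp only: z_def)
  finally show ?thesis .
qed

lemma z_distinct:
  assumes "irr m \<sigma>" "irr m' \<sigma>'" "\<not> rep_isomorphic (carrier K') (m, \<sigma>) (m', \<sigma>')"
  shows "z m \<sigma> * z m' \<sigma>' = 0\<^sub>m D D"
proof -
  have "z m \<sigma> * z m' \<sigma>' = msum D D (\<lambda>i. e m \<sigma> i i * z m' \<sigma>') {..<m}"
    unfolding z_def[of m \<sigma>] by (rule msum_mult) auto
  also have "\<dots> = msum D D (\<lambda>i. msum D D (\<lambda>k. e m \<sigma> i i * e m' \<sigma>' k k) {..<m'}) {..<m}"
    unfolding z_def[of m' \<sigma>'] by (rule msum_cong, rule mult_msum) auto
  also have "\<dots> = 0\<^sub>m D D"
    using e_mult_distinct[OF assms] by (auto intro!: eq_matI)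
  finally show ?thesis .
qed

lemma z_isomorphic:
  assumes \<sigma>: "admissible m \<sigma>" and \<sigma>': "admissible m' \<sigma>'"
    and iso: "rep_isomorphic (carrier K') (m, \<sigma>) (m', \<sigma>')"
  shows "z m \<sigma> = z m' \<sigma>'"
proof -
  obtain P where mm: "m = m'" and P: "P \<in> carrier (GL m)" "\<And>k. k \<in> carrier K' \<Longrightarrow> P * \<sigma> k = \<sigma>' k * P"
    using iso by (auto simp: rep_isomorphic_def)
  obtain X where X: "X \<in> carrier_mat m m" "X * P = 1\<^sub>m m" "P * X = 1\<^sub>m m" and Pc: "P \<in> carrier_mat m m"
    using P(1) by (auto simp: carrier_GL_iff)
  have tr: "mtrace (\<sigma> k) = mtrace (\<sigma>' k)" if k: "k \<in> carrier K'" for k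
  proof -
    have c: "\<sigma> k \<in> carrier_mat m m" "\<sigma>' k \<in> carrier_mat m m"
      using adm_carrier[OF \<sigma> k] adm_carrier[OF \<sigma>' k] mm by auto
    have "mtrace (\<sigma>' k) = mtrace (\<sigma>' k * (P * X))" using X c by simp
    also have "\<sigma>' k * (P * X) = P * \<sigma> k * X" using assoc_mult_mat[OF c(2) Pc X(1)] P(2)[OF k] by simp
    also have "mtrace (P * \<sigma> k * X) = mtrace (X * (P * \<sigma> k))"
      using Pc X c by (intro mtrace_comm[of _ m m]) auto
    also have "X * (P * \<sigma> k) = \<sigma> k" using assoc_mult_mat[OF X(1) Pc c(1)] X c by simp
    finally show ?thesis by simp
  qed
  show ?thesis
    unfolding mm z_trace_formula[OF \<sigma>[unfolded mm]] z_trace_formula[OF \<sigma>']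
    by (rule msum_cong) (use tr s in simp)
qed

subsection \<open>The commutant acting on the range of a matrix unit\<close>

definition com_irrep :: "nat \<Rightarrow> (complex mat \<Rightarrow> complex mat) \<Rightarrow> bool" where
  "com_irrep n f \<longleftrightarrow> (\<forall>M\<in>commutant. f M \<in> carrier_mat n n) \<and> f (1\<^sub>m D) = 1\<^sub>m n \<and>
    (\<forall>M\<in>commutant. \<forall>L\<in>commutant. f (M * L) = f M * f L \<and> f (M + L) = f M + f L) \<and>
    (\<forall>c. \<forall>M\<in>commutant. f (c \<cdot>\<^sub>m M) = c \<cdot>\<^sub>m f M) \<and> irreducible_matrices n (f ` commutant)"

lemma commutant_carrier: "M \<in> commutant \<Longrightarrow> M \<in> carrier_mat D D"
  by (simp add: commutant_def)

lemma one_in_commutant: "1\<^sub>m D \<in> commutant"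
  by (simp add: commutant_def left_mult_one_mat[OF \<pi>_carrier] right_mult_one_mat[OF \<pi>_carrier])

lemma commutant_add: "M \<in> commutant \<Longrightarrow> L \<in> commutant \<Longrightarrow> M + L \<in> commutant"
  using \<pi>_carrier by (auto simp: commutant_def add_mult_distrib_mat[of _ D D _ _ D] mult_add_distrib_mat[of _ D D _ D])

lemma commutant_smult: "M \<in> commutant \<Longrightarrow> c \<cdot>\<^sub>m M \<in> commutant"
  using \<pi>_carrier by (auto simp: commutant_def mult_smult_assoc_mat[of _ D D _ D] mult_smult_distrib[of _ D D _ D])

lemma avg_in_commutant: "M \<in> carrier_mat D D \<Longrightarrow> avg D \<pi> D \<pi> M \<in> commutant"
  using avg_intertwines[OF \<pi>_admissible \<pi>_admissible] by (simp add: commutant_def)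

text \<open>Only the summand at the identity of \<open>K\<close> has a nonzero trace. As the trace of the idempotent is its
  rank, this is the multiplicity of \<open>\<sigma>\<close> in \<open>\<pi>\<close>.\<close>

lemma mtrace_e00:
  assumes \<sigma>: "irr m \<sigma>"
  shows "N * mtrace (e m \<sigma> 0 0) = of_nat D * of_nat m"
proof -
  note a = irrD[OF \<sigma>]
  define w where "w = s \<one>\<^bsub>K\<^esub>"
  have w: "w \<in> carrier K'" "p w = \<one>\<^bsub>K\<^esub>" using s[OF K.one_closed] by (simp_all add: w_def)
  obtain c where c: "c \<noteq> 0" "\<pi> w = c \<cdot>\<^sub>m \<pi> \<one>\<^bsub>K'\<^esub>" "\<sigma> (inv\<^bsub>K'\<^esub> w) = inverse c \<cdot>\<^sub>m \<sigma> (inv\<^bsub>K'\<^esub> \<one>\<^bsub>K'\<^esub>)"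
    using fibre_scalar[of "\<one>\<^bsub>K'\<^esub>" w] w a(1) \<pi>_admissible by (metis K'.one_closed p_simps(4))
  have "mtrace (e m \<sigma> 0 0)
      = (\<Sum>a\<in>carrier K. of_nat m / N * \<sigma> (inv\<^bsub>K'\<^esub> (s a)) $$ (0, 0) * mtrace (\<pi> (s a)))"
    unfolding e_def using \<pi>_carrier s
    by (subst mtrace_msum) (auto simp: mtrace_smult[of _ D])
  also have "\<dots> = (\<Sum>a\<in>{\<one>\<^bsub>K\<^esub>}. of_nat m / N * \<sigma> (inv\<^bsub>K'\<^esub> (s a)) $$ (0, 0) * mtrace (\<pi> (s a)))"
    using fin s \<pi>_trace by (intro sum.mono_neutral_right) auto
  also have "\<dots> = of_nat m / N * (inverse c * (c * of_nat D))"
    using c a(3) adm_one[OF a(1)] adm_one[OF \<pi>_admissible] by (simp add: w_def[symmetric] mtrace_smult[of _ D])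
  finally show ?thesis using N_nonzero c(1) by (simp add: field_simps)
qed

text \<open>A rank one map between vectors \<open>v\<close>, \<open>w\<close> of the range of \<open>e\<^sub>0\<^sub>0\<close>, preceded by \<open>e\<^sub>0\<^sub>0\<close> and averaged,
  sends \<open>v\<close> to a multiple of \<open>w\<close>. This makes the range an irreducible module of the commutant.\<close>

lemma transitive_on_range:
  assumes \<sigma>: "irr m \<sigma>" and v: "v \<in> carrier_vec D" "v \<noteq> 0\<^sub>v D" "e m \<sigma> 0 0 *\<^sub>v v = v"
    and w: "w \<in> carrier_vec D" "e m \<sigma> 0 0 *\<^sub>v w = w"
  shows "\<exists>M\<in>commutant. M *\<^sub>v v = w"
proof -
  note a = irrD[OF \<sigma>]
  let ?e = "e m \<sigma>"
  obtain q where q: "q < D" "v $ q \<noteq> 0"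
  proof -
    have "\<exists>q<D. v $ q \<noteq> 0"
    proof (rule ccontr)
      assume "\<not> (\<exists>q<D. v $ q \<noteq> 0)"
      then have "v = 0\<^sub>v D" using v(1) by (intro eq_vecI) auto
      then show False using v(2) by simp
    qed
    then show thesis using that by blast
  qed
  define R where "R = mat D D (\<lambda>(i, j). if j = q then w $ i / v $ q else 0)"
  have R: "R \<in> carrier_mat D D" by (simp add: R_def)
  have Rv: "R *\<^sub>v v = w"
  proof (rule eq_vecI)
    fix i assume "i < dim_vec w"
    then have i: "i < D" using w(1) by simp
    have "(R *\<^sub>v v) $ i = (\<Sum>j<D. (if j = q then 1 else 0) * (w $ i / v $ q * v $ j))"
      unfolding mult_vec_entry[OF R v(1) i] using i by (intro sum.cong refl) (simp add: R_def)
    also have "\<dots> = w $ i / v $ q * v $ q" using q(1) by (simp only: sum_delta_left finite_lessThan lessThan_iff if_True)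
    finally show "(R *\<^sub>v v) $ i = w $ i" using q(2) by simp
  qed (use R w in simp)
  have e1v: "?e i j *\<^sub>v v = (if j = 0 then ?e i 0 *\<^sub>v v else 0\<^sub>v D)" if ij: "i < m" "j < m" for i j
  proof -
    have "?e i j *\<^sub>v v = ?e i j *\<^sub>v (?e 0 0 *\<^sub>v v)" using v(3) by simp
    also have "\<dots> = (?e i j * ?e 0 0) *\<^sub>v v" by (rule assoc_mult_mat_vec[OF e_carrier e_carrier v(1), symmetric])
    finally show ?thesis using e_mult[OF \<sigma> ij a(3) a(3)] v(1) by auto
  qed
  have eRe: "?e 0 0 *\<^sub>v (\<pi> k *\<^sub>v v) = \<sigma> k $$ (0, 0) \<cdot>\<^sub>v v" if k: "k \<in> carrier K'" for k
  proof -
    have "?e 0 0 *\<^sub>v (\<pi> k *\<^sub>v v) = (?e 0 0 * \<pi> k) *\<^sub>v v"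
      by (rule assoc_mult_mat_vec[OF e_carrier \<pi>_carrier[OF k] v(1), symmetric])
    also have "\<dots> = msum D D (\<lambda>l. \<sigma> k $$ (0, l) \<cdot>\<^sub>m ?e 0 l) {..<m} *\<^sub>v v"
      unfolding e_right[OF a(1) k a(3) a(3)] ..
    also have "\<dots> = \<sigma> k $$ (0, 0) \<cdot>\<^sub>v v"
    proof (rule eq_vecI)
      fix i assume "i < dim_vec (\<sigma> k $$ (0, 0) \<cdot>\<^sub>v v)"
      then have i: "i < D" using v(1) by simp
      have "(msum D D (\<lambda>l. \<sigma> k $$ (0, l) \<cdot>\<^sub>m ?e 0 l) {..<m} *\<^sub>v v) $ i
          = (\<Sum>j<D. \<Sum>l<m. \<sigma> k $$ (0, l) * (?e 0 l $$ (i, j) * v $ j))"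
        unfolding mult_vec_entry[OF msum_carrier v(1) i] using i
        by (intro sum.cong refl) (simp add: smult_entry[OF e_carrier] sum_distrib_right mult.assoc)
      also have "\<dots> = (\<Sum>l<m. \<sigma> k $$ (0, l) * (?e 0 l *\<^sub>v v) $ i)"
        unfolding mult_vec_entry[OF e_carrier v(1) i] sum_distrib_left by (rule sum.swap)
      also have "\<dots> = (\<Sum>l<m. (if l = 0 then 1 else 0) * (\<sigma> k $$ (0, l) * v $ i))"
      proof (rule sum.cong[OF refl])
        fix l assume "l \<in> {..<m}"
        then have "?e 0 l *\<^sub>v v = (if l = 0 then v else 0\<^sub>v D)" using e1v[OF a(3), of l] by (simp only: v(3) lessThan_iff)
        then show "\<sigma> k $$ (0, l) * (?e 0 l *\<^sub>v v) $ i = (if l = 0 then 1 else 0) * (\<sigma> k $$ (0, l) * v $ i)"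
          using i by simp
      qed
      finally show "(msum D D (\<lambda>l. \<sigma> k $$ (0, l) \<cdot>\<^sub>m ?e 0 l) {..<m} *\<^sub>v v) $ i = (\<sigma> k $$ (0, 0) \<cdot>\<^sub>v v) $ i"
        using a(3) i v(1) by (simp add: sum_delta_left)
    qed (use v in simp)
    finally show ?thesis .
  qed
  define M where "M = (of_nat m / N) \<cdot>\<^sub>m avg D \<pi> D \<pi> (R * ?e 0 0)"
  have Re: "R * ?e 0 0 \<in> carrier_mat D D" using R by simp
  have MC: "M \<in> commutant" unfolding M_def by (intro commutant_smult avg_in_commutant Re)
  have summand: "(\<pi> (s a) * (R * ?e 0 0) * \<pi> (inv\<^bsub>K'\<^esub> (s a))) *\<^sub>v v
      = \<sigma> (inv\<^bsub>K'\<^esub> (s a)) $$ (0, 0) \<cdot>\<^sub>v (\<pi> (s a) *\<^sub>v w)" if a: "a \<in> carrier K" for a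
  proof -
    have sa: "s a \<in> carrier K'" "inv\<^bsub>K'\<^esub> (s a) \<in> carrier K'" using s a by auto
    have pv: "\<pi> (inv\<^bsub>K'\<^esub> (s a)) *\<^sub>v v \<in> carrier_vec D" using \<pi>_carrier[OF sa(2)] v(1) by auto
    have "(\<pi> (s a) * (R * ?e 0 0) * \<pi> (inv\<^bsub>K'\<^esub> (s a))) *\<^sub>v v
        = (\<pi> (s a) * (R * ?e 0 0)) *\<^sub>v (\<pi> (inv\<^bsub>K'\<^esub> (s a)) *\<^sub>v v)"
      using \<pi>_carrier[OF sa(1)] \<pi>_carrier[OF sa(2)] R v(1) by (intro assoc_mult_mat_vec[of _ D D _ D]) auto
    also have "\<dots> = \<pi> (s a) *\<^sub>v ((R * ?e 0 0) *\<^sub>v (\<pi> (inv\<^bsub>K'\<^esub> (s a)) *\<^sub>v v))"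
      by (rule assoc_mult_mat_vec[OF \<pi>_carrier[OF sa(1)] Re pv])
    also have "(R * ?e 0 0) *\<^sub>v (\<pi> (inv\<^bsub>K'\<^esub> (s a)) *\<^sub>v v) = R *\<^sub>v (\<sigma> (inv\<^bsub>K'\<^esub> (s a)) $$ (0, 0) \<cdot>\<^sub>v v)"
      unfolding assoc_mult_mat_vec[OF R e_carrier pv] eRe[OF sa(2)] ..
    also have "\<dots> = \<sigma> (inv\<^bsub>K'\<^esub> (s a)) $$ (0, 0) \<cdot>\<^sub>v w" unfolding mult_mat_vec[OF R v(1)] Rv ..
    also have "\<pi> (s a) *\<^sub>v \<dots> = \<sigma> (inv\<^bsub>K'\<^esub> (s a)) $$ (0, 0) \<cdot>\<^sub>v (\<pi> (s a) *\<^sub>v w)"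
      by (rule mult_mat_vec[OF \<pi>_carrier[OF sa(1)] w(1)])
    finally show ?thesis .
  qed
  have "M *\<^sub>v v = ?e 0 0 *\<^sub>v w"
  proof (rule eq_vecI)
    fix i assume "i < dim_vec (?e 0 0 *\<^sub>v w)"
    then have i: "i < D" using carrier_matD[OF e_carrier] by simp
    have tc: "\<pi> (s a) * (R * ?e 0 0) * \<pi> (inv\<^bsub>K'\<^esub> (s a)) \<in> carrier_mat D D" if "a \<in> carrier K" for a
      using \<pi>_carrier s that R by simp
    have pc: "\<pi> (s a) \<in> carrier_mat D D" if "a \<in> carrier K" for a using \<pi>_carrier s that by simp
    have "(avg D \<pi> D \<pi> (R * ?e 0 0) *\<^sub>v v) $ i
        = (\<Sum>j<D. \<Sum>a\<in>carrier K. (\<pi> (s a) * (R * ?e 0 0) * \<pi> (inv\<^bsub>K'\<^esub> (s a))) $$ (i, j) * v $ j)"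
      unfolding mult_vec_entry[OF avg_carrier v(1) i] using i
      by (intro sum.cong refl) (simp add: avg_def sum_distrib_right)
    also have "\<dots> = (\<Sum>a\<in>carrier K. ((\<pi> (s a) * (R * ?e 0 0) * \<pi> (inv\<^bsub>K'\<^esub> (s a))) *\<^sub>v v) $ i)"
      by (subst sum.swap) (intro sum.cong refl mult_vec_entry[OF tc v(1) i, symmetric])
    also have "\<dots> = (\<Sum>a\<in>carrier K. \<sigma> (inv\<^bsub>K'\<^esub> (s a)) $$ (0, 0) * (\<pi> (s a) *\<^sub>v w) $ i)"
      using i by (intro sum.cong refl) (simp add: summand carrier_matD(1)[OF pc])
    finally have 1: "(avg D \<pi> D \<pi> (R * ?e 0 0) *\<^sub>v v) $ i = \<dots>" .
    have "(?e 0 0 *\<^sub>v w) $ i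
        = (\<Sum>j<D. \<Sum>a\<in>carrier K. of_nat m / N * (\<sigma> (inv\<^bsub>K'\<^esub> (s a)) $$ (0, 0) * (\<pi> (s a) $$ (i, j) * w $ j)))"
      unfolding mult_vec_entry[OF e_carrier w(1) i] using i
      by (intro sum.cong refl) (simp add: e_def smult_entry[OF pc] sum_distrib_right mult.assoc)
    also have "\<dots> = of_nat m / N * (\<Sum>a\<in>carrier K. \<sigma> (inv\<^bsub>K'\<^esub> (s a)) $$ (0, 0) * (\<pi> (s a) *\<^sub>v w) $ i)"
      unfolding sum_distrib_left
      by (subst sum.swap) (intro sum.cong refl, simp add: mult_vec_entry[OF pc w(1) i] sum_distrib_left)
    finally have "(?e 0 0 *\<^sub>v w) $ i = of_nat m / N * (avg D \<pi> D \<pi> (R * ?e 0 0) *\<^sub>v v) $ i"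
      unfolding 1 .
    then show "(M *\<^sub>v v) $ i = (?e 0 0 *\<^sub>v w) $ i"
      unfolding M_def using i v(1) carrier_matD[OF avg_carrier] by (simp add: smult_mult_mat_vec[OF avg_carrier])
  qed (use carrier_matD[OF e_carrier] commutant_carrier[OF MC] in simp)
  then show ?thesis using MC w(2) by auto
qed

subsection \<open>Irreducible modules of the commutant\<close>

text \<open>The multiplicity space of \<open>\<sigma>\<close> in \<open>\<pi>\<close>, realised as the range of the rank-\<open>n\<close> idempotent \<open>e\<^sub>0\<^sub>0\<close> with
  coordinates \<open>A\<close> and \<open>B\<close>. Elements of the commutant commute with \<open>e\<^sub>0\<^sub>0\<close> and so act on it.\<close>

lemma module_of_irr:
  assumes \<sigma>: "irr m \<sigma>"
  obtains n A B where "A \<in> carrier_mat D n" "B \<in> carrier_mat n D" "B * A = 1\<^sub>m n" "A * B = e m \<sigma> 0 0"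
    "com_irrep n (\<lambda>M. B * M * A)" "B * z m \<sigma> * A = 1\<^sub>m n" "N * of_nat n = of_nat D * of_nat m"
proof -
  note m = irrD(3)[OF \<sigma>]
  let ?e = "e m \<sigma> 0 0"
  have ee: "?e * ?e = ?e" using e_mult[OF \<sigma> m m m m] by simp
  obtain n A B where A: "A \<in> carrier_mat D n" and B: "B \<in> carrier_mat n D" and BA: "B * A = 1\<^sub>m n"
    and AB: "A * B = ?e" and tr: "of_nat n = mtrace ?e"
    by (rule idempotent_factorization[OF e_carrier ee]) (rule that)
  have dim: "N * of_nat n = of_nat D * of_nat m" unfolding tr by (rule mtrace_e00[OF \<sigma>])
  have n: "n > 0" using dim D_pos m by (cases n) auto
  have eA: "?e * A = A" unfolding AB[symmetric] using assoc_mult_mat[OF A B A] BA A by simp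
  have Be: "B * ?e = B" unfolding AB[symmetric] using assoc_mult_mat[OF B A B] BA B by simp
  have c: "B * M * A \<in> carrier_mat n n" if "M \<in> carrier_mat D D" for M
    using A B that by auto
  have zA: "z m \<sigma> * A = A"
    using assoc_mult_mat[OF z_carrier e_carrier A] z_e[OF \<sigma> m m] eA by metis
  have z1: "B * z m \<sigma> * A = 1\<^sub>m n" using assoc_mult_mat[OF B z_carrier A] zA BA by simp
  have mult: "B * (M * L) * A = B * M * A * (B * L * A)" if M: "M \<in> commutant" and L: "L \<in> commutant" for M L
  proof -
    note Mc = commutant_carrier[OF M] and Lc = commutant_carrier[OF L]
    have LA: "L * A \<in> carrier_mat D n" using Lc A by auto
    have "B * M * A * (B * L * A) = B * M * A * (B * (L * A))" unfolding assoc_mult_mat[OF B Lc A] ..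
    also have "\<dots> = B * M * (A * (B * (L * A)))"
      using A B Mc LA by (intro assoc_mult_mat[of _ n D _ n _ n]) auto
    also have "A * (B * (L * A)) = ?e * (L * A)" unfolding AB[symmetric] by (rule assoc_mult_mat[OF A B LA, symmetric])
    also have "\<dots> = ?e * L * A" by (rule assoc_mult_mat[OF e_carrier Lc A, symmetric])
    also have "\<dots> = L * (?e * A)" unfolding commutant_e[OF L, symmetric] by (rule assoc_mult_mat[OF Lc e_carrier A])
    also have "B * M * (L * (?e * A)) = B * M * L * A"
      unfolding eA using A B Mc Lc by (intro assoc_mult_mat[symmetric, of _ n D _ D _ n]) auto
    also have "B * M * L = B * (M * L)" by (rule assoc_mult_mat[OF B Mc Lc])
    finally show ?thesis by simp
  qed
  have add: "B * (M + L) * A = B * M * A + B * L * A" if M: "M \<in> commutant" and L: "L \<in> commutant" for M L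
    using commutant_carrier[OF M] commutant_carrier[OF L] A B
    by (simp add: mult_add_distrib_mat[of _ n D _ D] add_mult_distrib_mat[of _ n D _ _ n])
  have smult: "B * (x \<cdot>\<^sub>m M) * A = x \<cdot>\<^sub>m (B * M * A)" if M: "M \<in> commutant" for x M
    using commutant_carrier[OF M] A B
    by (simp add: mult_smult_distrib[of _ n D _ D] mult_smult_assoc_mat[of _ n D _ n])
  have "irreducible_matrices n ((\<lambda>M. B * M * A) ` commutant)"
    unfolding irreducible_matrices_iff
  proof (intro conjI allI impI n, elim conjE)
    fix U assume U: "lin_subspace n U" and inv: "\<forall>M\<in>(\<lambda>M. B * M * A) ` commutant. \<forall>u\<in>U. M *\<^sub>v u \<in> U"
    have Uc: "U \<subseteq> carrier_vec n" and U0: "0\<^sub>v n \<in> U" using U by (auto simp: lin_subspace_def)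
    have BAu: "B *\<^sub>v (A *\<^sub>v u) = u" if "u \<in> carrier_vec n" for u
      using assoc_mult_mat_vec[OF B A that] BA that by simp
    have Au: "A *\<^sub>v u \<in> carrier_vec D" "?e *\<^sub>v (A *\<^sub>v u) = A *\<^sub>v u" if "u \<in> carrier_vec n" for u
      using A that assoc_mult_mat_vec[OF e_carrier A that, of m \<sigma> 0 0] eA by auto
    show "U = {0\<^sub>v n} \<or> U = carrier_vec n"
    proof (rule disjCI)
      assume "U \<noteq> carrier_vec n"
      show "U = {0\<^sub>v n}"
      proof (rule ccontr)
        assume "U \<noteq> {0\<^sub>v n}"
        then obtain u where u: "u \<in> U" "u \<noteq> 0\<^sub>v n" using U0 by blast
        have uc: "u \<in> carrier_vec n" using u Uc by blast
        have nz: "A *\<^sub>v u \<noteq> 0\<^sub>v D" using BAu[OF uc] u(2) B by auto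
        have "w \<in> U" if w: "w \<in> carrier_vec n" for w
        proof -
          obtain M where M: "M \<in> commutant" "M *\<^sub>v (A *\<^sub>v u) = A *\<^sub>v w"
            using transitive_on_range[OF \<sigma> Au(1)[OF uc] nz Au(2)[OF uc] Au[OF w]] by blast
          note Mc = commutant_carrier[OF M(1)]
          have "(B * M * A) *\<^sub>v u = (B * M) *\<^sub>v (A *\<^sub>v u)"
            using A B Mc uc by (intro assoc_mult_mat_vec[of _ n D _ n]) auto
          also have "\<dots> = B *\<^sub>v (M *\<^sub>v (A *\<^sub>v u))" by (rule assoc_mult_mat_vec[OF B Mc Au(1)[OF uc]])
          also have "\<dots> = w" using M(2) BAu[OF w] by simp
          finally have "(B * M * A) *\<^sub>v u = w" .
          then show ?thesis using inv M(1) u(1) by blast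
        qed
        then show False using Uc \<open>U \<noteq> carrier_vec n\<close> by blast
      qed
    qed
  qed
  then have "com_irrep n (\<lambda>M. B * M * A)"
    unfolding com_irrep_def using c commutant_carrier mult add smult BA B by auto
  with A B BA AB show thesis using that z1 dim by blast
qed

lemma com_irrepD:
  assumes "com_irrep n f"
  shows "M \<in> commutant \<Longrightarrow> f M \<in> carrier_mat n n" "f (1\<^sub>m D) = 1\<^sub>m n"
    "M \<in> commutant \<Longrightarrow> L \<in> commutant \<Longrightarrow> f (M * L) = f M * f L"
    "M \<in> commutant \<Longrightarrow> L \<in> commutant \<Longrightarrow> f (M + L) = f M + f L"
    "M \<in> commutant \<Longrightarrow> f (c \<cdot>\<^sub>m M) = c \<cdot>\<^sub>m f M" "irreducible_matrices n (f ` commutant)" "n > 0"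
  using assms by (auto simp: com_irrep_def irreducible_matrices_iff)

lemma zero_in_commutant: "0\<^sub>m D D \<in> commutant"
  using commutant_smult[OF one_in_commutant, of 0] by (simp add: zero_smult_mat[OF one_carrier_mat])

lemma com_irrep_zero: assumes f: "com_irrep n f" shows "f (0\<^sub>m D D) = 0\<^sub>m n n"
  using com_irrepD(5)[OF f one_in_commutant, of 0] com_irrepD(2)[OF f]
  by (simp add: zero_smult_mat[OF one_carrier_mat])

lemma com_irrep_msum:
  assumes f: "com_irrep n f" and M: "\<And>i. i \<in> I \<Longrightarrow> M i \<in> commutant" and "finite I"
  shows "msum D D (\<lambda>i. x i \<cdot>\<^sub>m M i) I \<in> commutant"
    "f (msum D D (\<lambda>i. x i \<cdot>\<^sub>m M i) I) = msum n n (\<lambda>i. x i \<cdot>\<^sub>m f (M i)) I"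
proof -
  have "msum D D (\<lambda>i. x i \<cdot>\<^sub>m M i) J \<in> commutant \<and> f (msum D D (\<lambda>i. x i \<cdot>\<^sub>m M i) J) = msum n n (\<lambda>i. x i \<cdot>\<^sub>m f (M i)) J"
    if "finite J" "J \<subseteq> I" for J
    using that
  proof (induction J rule: finite_induct)
    case empty
    then show ?case using zero_in_commutant com_irrep_zero[OF f] by simp
  next
    case (insert j J)
    have Mj: "M j \<in> commutant" using M insert.prems by simp
    have ins: "msum D D (\<lambda>i. x i \<cdot>\<^sub>m M i) (insert j J) = msum D D (\<lambda>i. x i \<cdot>\<^sub>m M i) J + x j \<cdot>\<^sub>m M j"
      "msum n n (\<lambda>i. x i \<cdot>\<^sub>m f (M i)) (insert j J) = msum n n (\<lambda>i. x i \<cdot>\<^sub>m f (M i)) J + x j \<cdot>\<^sub>m f (M j)"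
      using insert.hyps commutant_carrier[OF Mj] com_irrepD(1)[OF f Mj] by (simp_all add: msum_insert)
    have "J \<subseteq> I" using insert.prems by simp
    with insert.IH have IH: "msum D D (\<lambda>i. x i \<cdot>\<^sub>m M i) J \<in> commutant"
      "f (msum D D (\<lambda>i. x i \<cdot>\<^sub>m M i) J) = msum n n (\<lambda>i. x i \<cdot>\<^sub>m f (M i)) J" by simp_all
    show ?case
      unfolding ins com_irrepD(4)[OF f IH(1) commutant_smult[OF Mj]] com_irrepD(5)[OF f Mj] IH(2)
      by (simp add: commutant_add[OF IH(1) commutant_smult[OF Mj]])
  qed
  from this[OF assms(3) order_refl] show "msum D D (\<lambda>i. x i \<cdot>\<^sub>m M i) I \<in> commutant"
    "f (msum D D (\<lambda>i. x i \<cdot>\<^sub>m M i) I) = msum n n (\<lambda>i. x i \<cdot>\<^sub>m f (M i)) I" by auto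
qed

lemma avg_msum:
  assumes "finite I" "\<And>i. i \<in> I \<Longrightarrow> M i \<in> carrier_mat D D"
  shows "avg D \<pi> D \<pi> (msum D D (\<lambda>i. x i \<cdot>\<^sub>m M i) I) = msum D D (\<lambda>i. x i \<cdot>\<^sub>m avg D \<pi> D \<pi> (M i)) I"
proof -
  have pc: "\<pi> (s a) \<in> carrier_mat D D" "\<pi> (inv\<^bsub>K'\<^esub> (s a)) \<in> carrier_mat D D" if "a \<in> carrier K" for a
    using \<pi>_carrier s that by auto
  have "\<pi> (s a) * msum D D (\<lambda>i. x i \<cdot>\<^sub>m M i) I * \<pi> (inv\<^bsub>K'\<^esub> (s a))
      = msum D D (\<lambda>i. x i \<cdot>\<^sub>m (\<pi> (s a) * M i * \<pi> (inv\<^bsub>K'\<^esub> (s a)))) I" if a: "a \<in> carrier K" for a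
    using pc[OF a] assms(2)
    by (subst mult_msum[of _ D D], simp, simp, subst msum_mult[of _ D D])
      (auto intro!: msum_cong simp: mult_smult_distrib[of _ D D _ D] mult_smult_assoc_mat[of _ D D _ D])
  then have "avg D \<pi> D \<pi> (msum D D (\<lambda>i. x i \<cdot>\<^sub>m M i) I)
      = msum D D (\<lambda>a. msum D D (\<lambda>i. x i \<cdot>\<^sub>m (\<pi> (s a) * M i * \<pi> (inv\<^bsub>K'\<^esub> (s a)))) I) (carrier K)"
    unfolding avg_def by (intro msum_cong) simp
  also have "\<dots> = msum D D (\<lambda>i. msum D D (\<lambda>a. x i \<cdot>\<^sub>m (\<pi> (s a) * M i * \<pi> (inv\<^bsub>K'\<^esub> (s a)))) (carrier K)) I"
    by (rule msum_swap)
  also have "\<dots> = msum D D (\<lambda>i. x i \<cdot>\<^sub>m avg D \<pi> D \<pi> (M i)) I"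
    unfolding avg_def using pc assms(2) by (intro msum_cong smult_msum[symmetric]) auto
  finally show ?thesis .
qed

lemma avg_mult_commutant:
  assumes M: "M \<in> commutant" and L: "L \<in> carrier_mat D D"
  shows "M * avg D \<pi> D \<pi> L = avg D \<pi> D \<pi> (M * L)"
proof -
  note Mc = commutant_carrier[OF M]
  have pc: "\<pi> (s a) \<in> carrier_mat D D" "\<pi> (inv\<^bsub>K'\<^esub> (s a)) \<in> carrier_mat D D" if "a \<in> carrier K" for a
    using \<pi>_carrier s that by auto
  have "M * (\<pi> (s a) * L * \<pi> (inv\<^bsub>K'\<^esub> (s a))) = \<pi> (s a) * (M * L) * \<pi> (inv\<^bsub>K'\<^esub> (s a))"
    if a: "a \<in> carrier K" for a
  proof -
    have "M * (\<pi> (s a) * L * \<pi> (inv\<^bsub>K'\<^esub> (s a))) = M * \<pi> (s a) * L * \<pi> (inv\<^bsub>K'\<^esub> (s a))"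
      using Mc L pc[OF a] by (simp add: assoc_mult_mat[of _ D D _ D _ D])
    also have "M * \<pi> (s a) = \<pi> (s a) * M" using M s(1)[OF a] by (simp add: commutant_def)
    also have "\<pi> (s a) * M * L = \<pi> (s a) * (M * L)" by (rule assoc_mult_mat[OF pc(1)[OF a] Mc L])
    finally show ?thesis .
  qed
  then show ?thesis
    unfolding avg_def using pc L by (subst mult_msum[OF Mc]) (auto intro!: msum_cong)
qed

lemma avg_one: "avg D \<pi> D \<pi> (1\<^sub>m D) = N \<cdot>\<^sub>m 1\<^sub>m D"
proof -
  have "avg D \<pi> D \<pi> (1\<^sub>m D) = msum D D (\<lambda>a. 1 \<cdot>\<^sub>m 1\<^sub>m D) (carrier K)"
    unfolding avg_def
  proof (rule msum_cong)
    fix a assume "a \<in> carrier K"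
    then have k: "s a \<in> carrier K'" by (rule s)
    show "\<pi> (s a) * 1\<^sub>m D * \<pi> (inv\<^bsub>K'\<^esub> (s a)) = 1 \<cdot>\<^sub>m 1\<^sub>m D"
      unfolding right_mult_one_mat[OF \<pi>_carrier[OF k]] adm_inv(2)[OF \<pi>_admissible k] one_smult_mat ..
  qed
  also have "\<dots> = N \<cdot>\<^sub>m 1\<^sub>m D" by (subst msum_smult) (simp_all add: N_def)
  finally show ?thesis .
qed

text \<open>Every irreducible module of the commutant is a quotient of \<open>\<complex>\<^sup>D\<close>: for a fixed index \<open>k\<close> and
  a fixed vector, send \<open>w\<close> to the average of the rank one matrix with column \<open>k\<close> equal to \<open>w\<close>,
  applied to this vector. Some \<open>k\<close> gives a nonzero map because the averages of the diagonal matrix units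
  add up to a nonzero scalar.\<close>

lemma quotient_map:
  assumes f: "com_irrep n f"
  obtains S where "S \<in> carrier_mat n D" "S \<noteq> 0\<^sub>m n D" "\<And>M. M \<in> commutant \<Longrightarrow> f M * S = S * M"
proof -
  note n = com_irrepD(7)[OF f]
  define E where "E l k = avg D \<pi> D \<pi> (munit D D l k)" for l k
  have E: "E l k \<in> commutant" for l k unfolding E_def by (rule avg_in_commutant) simp
  have "\<exists>k<D. f (E k k) $$ (0, 0) \<noteq> 0"
  proof (rule ccontr)
    assume "\<not> (\<exists>k<D. f (E k k) $$ (0, 0) \<noteq> 0)"
    then have zero: "f (E k k) $$ (0, 0) = 0" if "k < D" for k using that by blast
    have "1\<^sub>m D = msum D D (\<lambda>k. 1 \<cdot>\<^sub>m munit D D k k) {..<D}"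
      by (rule eq_matI) (auto simp: one_smult_mat sum.delta)
    then have "N \<cdot>\<^sub>m 1\<^sub>m D = msum D D (\<lambda>k. 1 \<cdot>\<^sub>m E k k) {..<D}"
      using avg_msum[of "{..<D}" "\<lambda>k. munit D D k k" "\<lambda>_. 1"] avg_one by (simp add: E_def)
    then have "N \<cdot>\<^sub>m 1\<^sub>m n = msum n n (\<lambda>k. 1 \<cdot>\<^sub>m f (E k k)) {..<D}"
      using com_irrep_msum(2)[OF f, of "{..<D}" "\<lambda>k. E k k" "\<lambda>_. 1"] E
        com_irrepD(5)[OF f one_in_commutant, of N] com_irrepD(2)[OF f] by simp
    from arg_cong[OF this, of "\<lambda>M. M $$ (0, 0)"] have "N = (\<Sum>k<D. f (E k k) $$ (0, 0))"
      using n by (simp add: one_smult_mat)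
    then show False using zero N_nonzero by simp
  qed
  then obtain k where k: "k < D" "f (E k k) $$ (0, 0) \<noteq> 0" by (elim exE conjE)
  define S where "S = mat n D (\<lambda>(i, l). f (E l k) $$ (i, 0))"
  have S: "S \<in> carrier_mat n D" by (simp add: S_def)
  have "S \<noteq> 0\<^sub>m n D"
  proof
    assume "S = 0\<^sub>m n D"
    then have "S $$ (0, k) = 0" using n k by simp
    then show False using n k by (simp add: S_def)
  qed
  moreover have "f M * S = S * M" if M: "M \<in> commutant" for M
  proof (rule eq_matI)
    note Mc = commutant_carrier[OF M]
    fix i l assume "i < dim_row (S * M)" "l < dim_col (S * M)"
    then have il: "i < n" "l < D" using S Mc by auto
    have "M * munit D D l k = msum D D (\<lambda>j. M $$ (j, l) \<cdot>\<^sub>m munit D D j k) {..<D}"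
    proof (rule eq_matI)
      fix r t assume "r < dim_row (msum D D (\<lambda>j. M $$ (j, l) \<cdot>\<^sub>m munit D D j k) {..<D})"
        "t < dim_col (msum D D (\<lambda>j. M $$ (j, l) \<cdot>\<^sub>m munit D D j k) {..<D})"
      then have rt: "r < D" "t < D" by auto
      have "(M * munit D D l k) $$ (r, t) = (\<Sum>q<D. M $$ (r, q) * munit D D l k $$ (q, t))"
        by (rule mult_entry[OF Mc munit_carrier rt])
      also have "\<dots> = (\<Sum>q<D. (if q = l then 1 else 0) * (M $$ (r, q) * (if t = k then 1 else 0)))"
        using rt by (intro sum.cong refl) auto
      also have "\<dots> = M $$ (r, l) * (if t = k then 1 else 0)" using il by (simp add: sum_delta_left)
      also have "\<dots> = (\<Sum>j<D. (if r = j then 1 else 0) * (M $$ (j, l) * (if t = k then 1 else 0)))"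
        using rt by (simp add: sum_delta_left)
      also have "\<dots> = msum D D (\<lambda>j. M $$ (j, l) \<cdot>\<^sub>m munit D D j k) {..<D} $$ (r, t)"
        unfolding index_msum[OF rt]
        by (intro sum.cong refl) (use rt in \<open>simp add: smult_entry[OF munit_carrier]\<close>)
      finally show "(M * munit D D l k) $$ (r, t) = \<dots>" .
    qed (use Mc in auto)
    then have ME: "M * E l k = msum D D (\<lambda>j. M $$ (j, l) \<cdot>\<^sub>m E j k) {..<D}"
      unfolding E_def avg_mult_commutant[OF M munit_carrier] by (simp add: avg_msum)
    have "(f M * S) $$ (i, l) = (\<Sum>r<n. f M $$ (i, r) * S $$ (r, l))"
      by (rule mult_entry[OF com_irrepD(1)[OF f M] S il])
    also have "\<dots> = (\<Sum>r<n. f M $$ (i, r) * f (E l k) $$ (r, 0))"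
      using il by (intro sum.cong refl) (simp add: S_def)
    also have "\<dots> = (f M * f (E l k)) $$ (i, 0)"
      by (rule mult_entry[OF com_irrepD(1)[OF f M] com_irrepD(1)[OF f E] il(1) n, symmetric])
    also have "f M * f (E l k) = msum n n (\<lambda>j. M $$ (j, l) \<cdot>\<^sub>m f (E j k)) {..<D}"
      unfolding com_irrepD(3)[OF f M E, symmetric] ME by (rule com_irrep_msum(2)[OF f E]) simp
    also have "\<dots> $$ (i, 0) = (\<Sum>j<D. S $$ (i, j) * M $$ (j, l))"
      using il n by (simp, intro sum.cong refl) (simp add: smult_entry[OF com_irrepD(1)[OF f E]] S_def)
    also have "\<dots> = (S * M) $$ (i, l)" by (rule mult_entry[OF S Mc il, symmetric])
    finally show "(f M * S) $$ (i, l) = (S * M) $$ (i, l)" .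
  qed (use carrier_matD[OF com_irrepD(1)[OF f M]] carrier_matD[OF S]
      carrier_matD[OF commutant_carrier[OF M]] in simp_all)
  ultimately show thesis using that[OF S] by simp
qed

text \<open>Otherwise \<open>S\<close> would vanish on each \<open>e\<^sub>i\<^sub>i = e\<^sub>i\<^sub>0 e\<^sub>0\<^sub>i\<close>, hence on their sum \<open>z\<close>.\<close>

lemma rank_one_sum_nonzero:
  assumes S: "S \<in> carrier_mat n D" and \<sigma>: "irr m \<sigma>" and Sz: "S * z m \<sigma> = S" and nz: "S \<noteq> 0\<^sub>m n D"
  obtains i where "i < m" "S * e m \<sigma> i 0 \<noteq> 0\<^sub>m n D"
proof -
  note m = irrD(3)[OF \<sigma>]
  have "\<exists>i<m. S * e m \<sigma> i 0 \<noteq> 0\<^sub>m n D"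
  proof (rule ccontr)
    assume "\<not> (\<exists>i<m. S * e m \<sigma> i 0 \<noteq> 0\<^sub>m n D)"
    then have "\<forall>i<m. S * e m \<sigma> i 0 = 0\<^sub>m n D" by simp
    then have zero: "S * e m \<sigma> i 0 = 0\<^sub>m n D" if "i < m" for i using that by simp
    have "S * e m \<sigma> i i = 0\<^sub>m n D" if i: "i < m" for i
    proof -
      have "S * e m \<sigma> i i = S * (e m \<sigma> i 0 * e m \<sigma> 0 i)" using e_mult[OF \<sigma> i m m i] by simp
      also have "\<dots> = S * e m \<sigma> i 0 * e m \<sigma> 0 i" by (rule assoc_mult_mat[OF S e_carrier e_carrier, symmetric])
      finally show ?thesis unfolding zero[OF i] by (simp add: left_mult_zero_mat[OF e_carrier])
    qed
    then have "S * z m \<sigma> = msum n D (\<lambda>i. 0\<^sub>m n D) {..<m}"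
      unfolding z_def by (subst mult_msum[OF S]) (auto intro!: msum_cong)
    also have "\<dots> = 0\<^sub>m n D" by (rule eq_matI) auto
    finally show False using Sz nz by simp
  qed
  then show thesis using that by (elim exE conjE)
qed

text \<open>The quotient map \<open>S\<close> from \<open>\<complex>\<^sup>D\<close> factors through \<open>z\<close>, so some \<open>S e\<^sub>i\<^sub>0\<close> is nonzero. Restricted to the
  range of \<open>e\<^sub>0\<^sub>0\<close> it is a nonzero intertwiner from the multiplicity space of \<open>\<sigma>\<close>.\<close>

lemma com_irrep_unique:
  assumes \<sigma>: "irr m \<sigma>" and f: "com_irrep n f" "f (z m \<sigma>) = 1\<^sub>m n"
    and A: "A \<in> carrier_mat D n0" and B: "B \<in> carrier_mat n0 D" and BA: "B * A = 1\<^sub>m n0"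
    and AB: "A * B = e m \<sigma> 0 0" and g: "com_irrep n0 (\<lambda>M. B * M * A)"
  obtains P where "n = n0" "P \<in> carrier (GL n0)" "\<And>M. M \<in> commutant \<Longrightarrow> P * (B * M * A) = f M * P"
proof -
  note m = irrD(3)[OF \<sigma>]
  obtain S where S: "S \<in> carrier_mat n D" "S \<noteq> 0\<^sub>m n D" and int: "\<And>M. M \<in> commutant \<Longrightarrow> f M * S = S * M"
    using quotient_map[OF f(1)] by metis
  have "S * z m \<sigma> = S" using int[OF z_in_commutant[OF irrD(1)[OF \<sigma>]]] f(2) S(1) by simp
  then obtain i where i: "i < m" "S * e m \<sigma> i 0 \<noteq> 0\<^sub>m n D"
    using rank_one_sum_nonzero[OF S(1) \<sigma> _ S(2)] by metis
  let ?e = "e m \<sigma>"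
  have Se: "S * ?e i 0 \<in> carrier_mat n D" using mult_carrier_mat[OF S(1) e_carrier] .
  define T where "T = S * ?e i 0 * A"
  have T: "T \<in> carrier_mat n n0" unfolding T_def using mult_carrier_mat[OF Se A] .
  have ee: "?e i 0 * ?e 0 0 = ?e i 0" using e_mult[OF \<sigma> i(1) m m m] by simp
  have Tint: "T * (B * M * A) = f M * T" if M: "M \<in> commutant" for M
  proof -
    note Mc = commutant_carrier[OF M] and fM = com_irrepD(1)[OF f(1) M]
    have BM: "B * M \<in> carrier_mat n0 D" using mult_carrier_mat[OF B Mc] .
    have MA: "M * A \<in> carrier_mat D n0" using mult_carrier_mat[OF Mc A] .
    have "T * (B * M * A) = S * ?e i 0 * A * (B * (M * A))" unfolding T_def assoc_mult_mat[OF B Mc A] ..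
    also have "\<dots> = S * ?e i 0 * (A * (B * (M * A)))"
      using Se A B MA by (intro assoc_mult_mat[of _ n D _ n0 _ n0]) auto
    also have "A * (B * (M * A)) = ?e 0 0 * (M * A)" unfolding AB[symmetric] by (rule assoc_mult_mat[OF A B MA, symmetric])
    also have "S * ?e i 0 * (?e 0 0 * (M * A)) = S * ?e i 0 * ?e 0 0 * (M * A)"
      by (rule assoc_mult_mat[OF Se e_carrier MA, symmetric])
    also have "S * ?e i 0 * ?e 0 0 = S * ?e i 0" using assoc_mult_mat[OF S(1) e_carrier e_carrier] ee by simp
    also have "S * ?e i 0 * (M * A) = S * ?e i 0 * M * A" by (rule assoc_mult_mat[OF Se Mc A, symmetric])
    also have "S * ?e i 0 * M = S * (M * ?e i 0)"
      unfolding commutant_e[OF M] by (rule assoc_mult_mat[OF S(1) e_carrier Mc])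
    also have "\<dots> = f M * S * ?e i 0" using assoc_mult_mat[OF S(1) Mc e_carrier] int[OF M] by simp
    also have "f M * S * ?e i 0 * A = f M * (S * ?e i 0) * A" unfolding assoc_mult_mat[OF fM S(1) e_carrier] ..
    also have "\<dots> = f M * T" unfolding T_def by (rule assoc_mult_mat[OF fM Se A])
    finally show ?thesis .
  qed
  have "T \<noteq> 0\<^sub>m n n0"
  proof
    assume "T = 0\<^sub>m n n0"
    then have "0\<^sub>m n D = T * B" using B by (simp add: left_mult_zero_mat[OF B])
    also have "\<dots> = S * ?e i 0 * ?e 0 0" unfolding T_def AB[symmetric] by (rule assoc_mult_mat[OF Se A B])
    also have "\<dots> = S * ?e i 0" using assoc_mult_mat[OF S(1) e_carrier e_carrier] ee by simp
    finally show False using i(2) by simp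
  qed
  from schur_isomorphism[OF com_irrepD(1)[OF g] com_irrepD(6)[OF g] com_irrepD(1)[OF f(1)] com_irrepD(6)[OF f(1)] T Tint this]
  show thesis using that Tint by blast
qed

subsection \<open>Complete reducibility\<close>

text \<open>Maschke's theorem: averaging an idempotent \<open>P\<close> with invariant range gives an idempotent \<open>Q\<close> with the
  same range that commutes with \<open>\<pi>\<close>.\<close>

lemma subspace_of_commuting_idempotent:
  assumes Pc: "P \<in> carrier_mat D D" "P * P = P" and inv: "\<And>k. k \<in> carrier K' \<Longrightarrow> P * (\<pi> k * P) = \<pi> k * P"
  defines "Q \<equiv> inverse N \<cdot>\<^sub>m avg D \<pi> D \<pi> P"
  shows "Q \<in> commutant" "Q * P = P" "P * Q = Q"
proof -
  show Q: "Q \<in> commutant" unfolding Q_def by (intro commutant_smult avg_in_commutant Pc)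
  have pc: "\<pi> (s a) \<in> carrier_mat D D" "\<pi> (inv\<^bsub>K'\<^esub> (s a)) \<in> carrier_mat D D" if "a \<in> carrier K" for a
    using \<pi>_carrier s that by auto
  have t1: "\<pi> (s a) * P * \<pi> (inv\<^bsub>K'\<^esub> (s a)) * P = 1 \<cdot>\<^sub>m P" if a: "a \<in> carrier K" for a
  proof -
    have k: "s a \<in> carrier K'" "inv\<^bsub>K'\<^esub> (s a) \<in> carrier K'" using s a by auto
    have "\<pi> (s a) * P * \<pi> (inv\<^bsub>K'\<^esub> (s a)) * P = \<pi> (s a) * (P * (\<pi> (inv\<^bsub>K'\<^esub> (s a)) * P))"
      using pc[OF a] Pc by (simp add: assoc_mult_mat[of _ D D _ D _ D])
    also have "\<dots> = \<pi> (s a) * \<pi> (inv\<^bsub>K'\<^esub> (s a)) * P"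
      unfolding inv[OF k(2)] by (rule assoc_mult_mat[OF pc[OF a] Pc(1), symmetric])
    also have "\<dots> = 1 \<cdot>\<^sub>m P"
      unfolding adm_inv(2)[OF \<pi>_admissible k(1)] left_mult_one_mat[OF Pc(1)] one_smult_mat ..
    finally show ?thesis .
  qed
  have "avg D \<pi> D \<pi> P * P = msum D D (\<lambda>a. 1 \<cdot>\<^sub>m P) (carrier K)"
    unfolding avg_def using pc Pc by (subst msum_mult[OF Pc(1)]) (auto intro!: msum_cong t1)
  also have "\<dots> = N \<cdot>\<^sub>m P" by (subst msum_smult[OF Pc(1)]) (simp add: N_def)
  finally show "Q * P = P"
    unfolding Q_def mult_smult_assoc_mat[OF avg_carrier Pc(1)]
    using N_nonzero by (simp add: smult_smult_mat one_smult_mat)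
  have t2: "P * (\<pi> (s a) * P * \<pi> (inv\<^bsub>K'\<^esub> (s a))) = \<pi> (s a) * P * \<pi> (inv\<^bsub>K'\<^esub> (s a))" if a: "a \<in> carrier K" for a
  proof -
    have "P * (\<pi> (s a) * P * \<pi> (inv\<^bsub>K'\<^esub> (s a))) = P * (\<pi> (s a) * P) * \<pi> (inv\<^bsub>K'\<^esub> (s a))"
      using pc[OF a] Pc by (intro assoc_mult_mat[symmetric, of _ D D _ D _ D]) auto
    then show ?thesis unfolding inv[OF s(1)[OF a]] .
  qed
  have "P * avg D \<pi> D \<pi> P = avg D \<pi> D \<pi> P"
    unfolding avg_def using pc Pc by (subst mult_msum[OF Pc(1)]) (auto intro!: msum_cong t2)
  then show "P * Q = Q" unfolding Q_def mult_smult_distrib[OF Pc(1) avg_carrier] by simp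
qed

text \<open>Complete reducibility: the kernel of an invariant projection to \<open>V\<close> is a nonzero invariant
  complement and contains an irreducible subrepresentation.\<close>

lemma irr_outside:
  assumes V: "lin_subspace D V" and inv: "\<And>k v. k \<in> carrier K' \<Longrightarrow> v \<in> V \<Longrightarrow> \<pi> k *\<^sub>v v \<in> V"
    and proper: "V \<noteq> carrier_vec D"
  obtains m \<sigma> A x where "irr m \<sigma>" "A \<in> carrier_mat D m" "\<And>k. k \<in> carrier K' \<Longrightarrow> \<pi> k * A = A * \<sigma> k"
    "x \<in> carrier_vec m" "A *\<^sub>v x \<notin> V"
proof -
  have Vc: "V \<subseteq> carrier_vec D" using V by (simp add: lin_subspace_def)
  obtain r A0 B0 where A0: "A0 \<in> carrier_mat D r" and B0: "B0 \<in> carrier_mat r D" and BA0: "B0 * A0 = 1\<^sub>m r"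
    and VA: "V = {A0 *\<^sub>v x | x. x \<in> carrier_vec r}" and AB0: "\<And>v. v \<in> V \<Longrightarrow> A0 *\<^sub>v (B0 *\<^sub>v v) = v"
    by (rule subspace_coordinates[OF V]) (rule that)
  define P where "P = A0 * B0"
  have P: "P \<in> carrier_mat D D" using A0 B0 by (simp add: P_def)
  have Pv: "P *\<^sub>v v = v" if "v \<in> V" for v
    unfolding P_def using assoc_mult_mat_vec[OF A0 B0, of v] AB0[OF that] that Vc by auto
  have PV: "P *\<^sub>v w \<in> V" if w: "w \<in> carrier_vec D" for w
  proof -
    have "P *\<^sub>v w = A0 *\<^sub>v (B0 *\<^sub>v w)" unfolding P_def by (rule assoc_mult_mat_vec[OF A0 B0 w])
    moreover have "B0 *\<^sub>v w \<in> carrier_vec r" using B0 w by auto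
    ultimately show ?thesis unfolding VA by (intro CollectI exI[of _ "B0 *\<^sub>v w"] conjI)
  qed
  have PP: "P * P = P"
    by (rule mat_eq_by_vec[of _ D D]) (use P in \<open>auto simp: assoc_mult_mat_vec[OF P P] Pv PV\<close>)
  have PpP: "P * (\<pi> k * P) = \<pi> k * P" if k: "k \<in> carrier K'" for k
  proof (rule mat_eq_by_vec[of _ D D])
    note pk = \<pi>_carrier[OF k]
    fix v :: "complex vec" assume v: "v \<in> carrier_vec D"
    have "(\<pi> k * P) *\<^sub>v v \<in> V" unfolding assoc_mult_mat_vec[OF pk P v] by (rule inv[OF k PV[OF v]])
    then show "P * (\<pi> k * P) *\<^sub>v v = \<pi> k * P *\<^sub>v v"
      using assoc_mult_mat_vec[OF P square_mult_carrier[OF pk P] v] Pv by simp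
  qed (use P \<pi>_carrier[OF k] in auto)
  define Q where "Q = inverse N \<cdot>\<^sub>m avg D \<pi> D \<pi> P"
  note Q = subspace_of_commuting_idempotent[OF P PP PpP, folded Q_def]
  note Qc = commutant_carrier[OF Q(1)]
  have QV: "Q *\<^sub>v w \<in> V" if w: "w \<in> carrier_vec D" for w
  proof -
    have 1: "P *\<^sub>v (Q *\<^sub>v w) = Q *\<^sub>v w" using assoc_mult_mat_vec[OF P Qc w] Q(3) by simp
    have "Q *\<^sub>v w \<in> carrier_vec D" using Qc w by auto
    from PV[OF this] show ?thesis unfolding 1 .
  qed
  have Qv: "Q *\<^sub>v v = v" if v: "v \<in> V" for v
  proof -
    have vc: "v \<in> carrier_vec D" using v Vc by blast
    have "Q *\<^sub>v v = Q *\<^sub>v (P *\<^sub>v v)" using Pv[OF v] by simp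
    also have "\<dots> = v" using assoc_mult_mat_vec[OF Qc P vc] Q(2) Pv[OF v] by simp
    finally show ?thesis .
  qed
  define W where "W = {u \<in> carrier_vec D. Q *\<^sub>v u = 0\<^sub>v D}"
  have W: "lin_subspace D W" unfolding W_def by (rule kernel_lin_subspace[OF Qc])
  have W_inv: "\<pi> k *\<^sub>v u \<in> W" if k: "k \<in> carrier K'" and u: "u \<in> W" for k u
  proof -
    note pk = \<pi>_carrier[OF k]
    have uc: "u \<in> carrier_vec D" "Q *\<^sub>v u = 0\<^sub>v D" using u by (auto simp: W_def)
    have "Q *\<^sub>v (\<pi> k *\<^sub>v u) = \<pi> k *\<^sub>v (Q *\<^sub>v u)"
      using assoc_mult_mat_vec[OF Qc pk uc(1)] assoc_mult_mat_vec[OF pk Qc uc(1)] Q(1) k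
      by (simp add: commutant_def)
    then show ?thesis using uc pk by (auto simp: W_def)
  qed
  have "W \<noteq> {0\<^sub>v D}"
  proof
    assume W0: "W = {0\<^sub>v D}"
    have "w \<in> V" if w: "w \<in> carrier_vec D" for w
    proof -
      define u where "u = w + (-1) \<cdot>\<^sub>v (Q *\<^sub>v w)"
      have Qw: "Q *\<^sub>v w \<in> carrier_vec D" using Qc w by auto
      have "Q *\<^sub>v u = Q *\<^sub>v w + (-1) \<cdot>\<^sub>v (Q *\<^sub>v w)"
        unfolding u_def using w Qw Qv[OF QV[OF w]]
        by (simp add: mult_add_distrib_mat_vec[OF Qc] mult_mat_vec[OF Qc])
      also have "\<dots> = 0\<^sub>v D" using Qw Qc by (intro eq_vecI) auto
      finally have "u \<in> W" using w Qw by (auto simp: W_def u_def)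
      then have "u = 0\<^sub>v D" using W0 by simp
      have "w $ i = (Q *\<^sub>v w) $ i" if "i < D" for i
      proof -
        have "u $ i = w $ i - (Q *\<^sub>v w) $ i" using that w Qc by (simp add: u_def)
        then show ?thesis using \<open>u = 0\<^sub>v D\<close> that by simp
      qed
      then have "w = Q *\<^sub>v w" using w Qc by (intro eq_vecI) auto
      then show ?thesis using QV[OF w] by simp
    qed
    then show False using proper Vc by blast
  qed
  obtain m A B where A: "A \<in> carrier_mat D m" and B: "B \<in> carrier_mat m D" and BA: "B * A = 1\<^sub>m m"
    and AW: "\<And>w. w \<in> carrier_vec m \<Longrightarrow> A *\<^sub>v w \<in> W"
    and pA: "\<And>k. k \<in> carrier K' \<Longrightarrow> \<pi> k * A = A * (B * \<pi> k * A)"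
    and irr: "irreducible_matrices m ((\<lambda>k. B * \<pi> k * A) ` carrier K')"
    by (rule irreducible_subrepresentation[where f = \<pi> and I = "carrier K'", OF \<pi>_carrier W \<open>W \<noteq> {0\<^sub>v D}\<close> W_inv])
      (assumption | rule that)+
  define \<sigma> where "\<sigma> k = B * \<pi> k * A" for k
  have \<sigma>c: "\<sigma> k \<in> carrier_mat m m" if "k \<in> carrier K'" for k
    unfolding \<sigma>_def using A B \<pi>_carrier[OF that] by auto
  have pA': "\<pi> k * A = A * \<sigma> k" if "k \<in> carrier K'" for k unfolding \<sigma>_def by (rule pA[OF that])
  have \<sigma>_mult: "\<sigma> (k \<otimes>\<^bsub>K'\<^esub> l) = \<sigma> k * \<sigma> l" if k: "k \<in> carrier K'" and l: "l \<in> carrier K'" for k l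
  proof -
    note pk = \<pi>_carrier[OF k] and pl = \<pi>_carrier[OF l]
    have "\<sigma> (k \<otimes>\<^bsub>K'\<^esub> l) = B * (\<pi> k * \<pi> l) * A" unfolding \<sigma>_def adm_mult[OF \<pi>_admissible k l] ..
    also have "B * (\<pi> k * \<pi> l) = B * \<pi> k * \<pi> l" by (rule assoc_mult_mat[OF B pk pl, symmetric])
    also have "\<dots> * A = B * \<pi> k * (A * \<sigma> l)"
      unfolding pA'[OF l, symmetric] using B pk pl A by (intro assoc_mult_mat[of _ m D _ D _ m]) auto
    also have "\<dots> = \<sigma> k * \<sigma> l"
      unfolding \<sigma>_def[of k] using B pk A \<sigma>c[OF l] by (intro assoc_mult_mat[symmetric, of _ m D _ m _ m]) auto
    finally show ?thesis .
  qed
  have \<sigma>1: "\<sigma> \<one>\<^bsub>K'\<^esub> = 1\<^sub>m m" unfolding \<sigma>_def adm_one[OF \<pi>_admissible] using B BA by simp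
  have "\<sigma> \<in> hom K' (GL m)"
  proof (rule homI)
    fix k assume k: "k \<in> carrier K'"
    have "\<sigma> k * \<sigma> (inv\<^bsub>K'\<^esub> k) = 1\<^sub>m m" using \<sigma>_mult[of k "inv\<^bsub>K'\<^esub> k"] k \<sigma>1 by simp
    from GL_I[OF \<sigma>c[OF k] \<sigma>c this] show "\<sigma> k \<in> carrier (GL m)" using k by simp
  qed (simp add: \<sigma>_mult)
  moreover have "acts_by (kernel K' K p) \<chi> m \<sigma>"
    unfolding acts_by_def
  proof
    fix y assume y: "y \<in> kernel K' K p"
    show "\<sigma> y = \<chi> y \<cdot>\<^sub>m 1\<^sub>m m"
      unfolding \<sigma>_def adm_\<zeta>[OF \<pi>_admissible y] mult_smult_distrib[OF B one_carrier_mat]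
        right_mult_one_mat[OF B] mult_smult_assoc_mat[OF B A] BA ..
  qed
  ultimately have "irr m \<sigma>" using irr by (simp add: irr_def admissible_def \<sigma>_def)
  have "\<exists>x\<in>carrier_vec m. A *\<^sub>v x \<notin> V"
  proof (rule ccontr)
    assume "\<not> (\<exists>x\<in>carrier_vec m. A *\<^sub>v x \<notin> V)"
    then have inV: "A *\<^sub>v x \<in> V" if "x \<in> carrier_vec m" for x using that by blast
    have "A = 0\<^sub>m D m"
    proof (rule mat_eq_by_vec[OF A])
      fix x :: "complex vec" assume x: "x \<in> carrier_vec m"
      have "A *\<^sub>v x = Q *\<^sub>v (A *\<^sub>v x)" using Qv[OF inV[OF x]] by simp
      also have "\<dots> = 0\<^sub>v D" using AW[OF x] by (simp add: W_def)
      finally show "A *\<^sub>v x = 0\<^sub>m D m *\<^sub>v x" using x by simp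
    qed simp
    then have "1\<^sub>m m = (0\<^sub>m m m :: complex mat)" using BA B by (simp add: right_mult_zero_mat[OF B])
    from arg_cong[OF this, of "\<lambda>M. M $$ (0, 0)"] show False using irrD(3)[OF \<open>irr m \<sigma>\<close>] by simp
  qed
  then obtain x where x: "x \<in> carrier_vec m" "A *\<^sub>v x \<notin> V" by (elim bexE)
  show thesis by (rule that[OF \<open>irr m \<sigma>\<close> A pA' x])
qed

text \<open>On any copy of \<open>\<sigma>\<close> in \<open>\<pi>\<close> the element \<open>e\<^sub>i\<^sub>i\<close> acts as the matrix unit of \<open>\<sigma>\<close>, by Schur orthogonality.\<close>

lemma z_intertwiner:
  assumes \<sigma>: "irr m \<sigma>" and A: "A \<in> carrier_mat D m" and int: "\<And>k. k \<in> carrier K' \<Longrightarrow> \<pi> k * A = A * \<sigma> k"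
  shows "z m \<sigma> * A = A"
proof -
  note c = adm_carrier[OF irrD(1)[OF \<sigma>]] and m = irrD(3)[OF \<sigma>]
  have sc: "\<sigma> (s a) \<in> carrier_mat m m" if "a \<in> carrier K" for a using c s that by simp
  have eA: "e m \<sigma> i i * A = A * munit m m i i" if i: "i < m" for i
  proof -
    have "e m \<sigma> i i * A = msum D m (\<lambda>a. (of_nat m / N * \<sigma> (inv\<^bsub>K'\<^esub> (s a)) $$ (i, i)) \<cdot>\<^sub>m \<pi> (s a) * A) (carrier K)"
      unfolding e_def using \<pi>_carrier s by (intro msum_mult[OF A]) auto
    also have "\<dots> = msum D m (\<lambda>a. A * ((of_nat m / N * \<sigma> (inv\<^bsub>K'\<^esub> (s a)) $$ (i, i)) \<cdot>\<^sub>m \<sigma> (s a))) (carrier K)"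
    proof (rule msum_cong)
      fix a assume a: "a \<in> carrier K"
      then have k: "s a \<in> carrier K'" by (rule s)
      show "(of_nat m / N * \<sigma> (inv\<^bsub>K'\<^esub> (s a)) $$ (i, i)) \<cdot>\<^sub>m \<pi> (s a) * A
          = A * ((of_nat m / N * \<sigma> (inv\<^bsub>K'\<^esub> (s a)) $$ (i, i)) \<cdot>\<^sub>m \<sigma> (s a))"
        unfolding mult_smult_assoc_mat[OF \<pi>_carrier[OF k] A] mult_smult_distrib[OF A sc[OF a]] int[OF k] ..
    qed
    also have "\<dots> = A * msum m m (\<lambda>a. (of_nat m / N * \<sigma> (inv\<^bsub>K'\<^esub> (s a)) $$ (i, i)) \<cdot>\<^sub>m \<sigma> (s a)) (carrier K)"
      using sc by (intro mult_msum[OF A, symmetric]) auto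
    also have "msum m m (\<lambda>a. (of_nat m / N * \<sigma> (inv\<^bsub>K'\<^esub> (s a)) $$ (i, i)) \<cdot>\<^sub>m \<sigma> (s a)) (carrier K) = munit m m i i"
    proof (rule eq_matI)
      fix q r assume "q < dim_row (munit m m i i)" "r < dim_col (munit m m i i)"
      then have qr: "q < m" "r < m" by auto
      have "msum m m (\<lambda>a. (of_nat m / N * \<sigma> (inv\<^bsub>K'\<^esub> (s a)) $$ (i, i)) \<cdot>\<^sub>m \<sigma> (s a)) (carrier K) $$ (q, r)
          = (\<Sum>a\<in>carrier K. of_nat m / N * (\<sigma> (s a) $$ (q, r) * \<sigma> (inv\<^bsub>K'\<^esub> (s a)) $$ (i, i)))"
        unfolding index_msum[OF qr] by (intro sum.cong refl) (simp add: smult_entry[OF sc] qr)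
      also have "\<dots> = of_nat m / N * (if q = i \<and> r = i then N / of_nat m else 0)"
        unfolding sum_distrib_left[symmetric] schur_orthogonality[OF \<sigma> qr(1) i qr(2) i] ..
      also have "\<dots> = munit m m i i $$ (q, r)" using qr m N_nonzero by simp
      finally show "msum m m (\<lambda>a. (of_nat m / N * \<sigma> (inv\<^bsub>K'\<^esub> (s a)) $$ (i, i)) \<cdot>\<^sub>m \<sigma> (s a)) (carrier K) $$ (q, r) = \<dots>" .
    qed auto
    finally show ?thesis .
  qed
  have "z m \<sigma> * A = msum D m (\<lambda>i. e m \<sigma> i i * A) {..<m}"
    unfolding z_def by (rule msum_mult[OF A]) simp
  also have "\<dots> = msum D m (\<lambda>i. A * munit m m i i) {..<m}" by (rule msum_cong) (simp add: eA)
  also have "\<dots> = A * msum m m (\<lambda>i. munit m m i i) {..<m}" by (rule mult_msum[OF A, symmetric]) simp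
  also have "msum m m (\<lambda>i. munit m m i i) {..<m} = 1\<^sub>m m"
    by (rule eq_matI) (auto simp: sum.delta)
  finally show ?thesis using A by simp
qed

text \<open>The idempotent \<open>z \<sigma>\<close> is central in the commutant, so it acts on an irreducible module as 0 or 1. If \<open>S\<close>
  is a nonzero quotient map from \<open>\<complex>\<^sup>D\<close>, then the largest invariant subspace \<open>V\<close> of its kernel is proper.
  An irreducible subrepresentation \<open>\<sigma>\<close> outside \<open>V\<close> is not killed by \<open>S\<close>, so \<open>z \<sigma>\<close> does not act as 0.\<close>

lemma com_irrep_has_irr:
  assumes f: "com_irrep n f"
  obtains m \<sigma> where "irr m \<sigma>" "f (z m \<sigma>) = 1\<^sub>m n"
proof -
  note n = com_irrepD(7)[OF f]
  obtain S where S: "S \<in> carrier_mat n D" "S \<noteq> 0\<^sub>m n D" and int: "\<And>M. M \<in> commutant \<Longrightarrow> f M * S = S * M"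
    by (rule quotient_map[OF f]) (rule that)
  define V where "V = {w \<in> carrier_vec D. \<forall>k\<in>carrier K'. S *\<^sub>v (\<pi> k *\<^sub>v w) = 0\<^sub>v n}"
  have S\<pi>: "S * \<pi> k \<in> carrier_mat n D" if "k \<in> carrier K'" for k
    using mult_carrier_mat[OF S(1) \<pi>_carrier[OF that]] .
  have V_eq: "V = {w \<in> carrier_vec D. \<forall>k\<in>carrier K'. (S * \<pi> k) *\<^sub>v w = 0\<^sub>v n}"
    unfolding V_def by (auto simp: assoc_mult_mat_vec[OF S(1) \<pi>_carrier])
  have V: "lin_subspace D V"
    unfolding lin_subspace_def V_eq
    by (auto simp: mult_add_distrib_mat_vec[OF S\<pi>] mult_mat_vec[OF S\<pi>] mult_mat_vec_zero[OF S\<pi>])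
  have V_inv: "\<pi> k *\<^sub>v v \<in> V" if k: "k \<in> carrier K'" and v: "v \<in> V" for k v
  proof -
    have vc: "v \<in> carrier_vec D" and v0: "\<And>l. l \<in> carrier K' \<Longrightarrow> S *\<^sub>v (\<pi> l *\<^sub>v v) = 0\<^sub>v n"
      using v by (auto simp: V_def)
    have "S *\<^sub>v (\<pi> l *\<^sub>v (\<pi> k *\<^sub>v v)) = 0\<^sub>v n" if l: "l \<in> carrier K'" for l
    proof -
      have "\<pi> l *\<^sub>v (\<pi> k *\<^sub>v v) = \<pi> (l \<otimes>\<^bsub>K'\<^esub> k) *\<^sub>v v"
        unfolding adm_mult[OF \<pi>_admissible l k]
        by (rule assoc_mult_mat_vec[OF \<pi>_carrier[OF l] \<pi>_carrier[OF k] vc, symmetric])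
      then show ?thesis using v0[of "l \<otimes>\<^bsub>K'\<^esub> k"] l k by simp
    qed
    then show ?thesis using \<pi>_carrier[OF k] vc by (auto simp: V_def)
  qed
  have "V \<noteq> carrier_vec D"
  proof
    assume V_all: "V = carrier_vec D"
    have "S = 0\<^sub>m n D"
    proof (rule mat_eq_by_vec[OF S(1)])
      fix v :: "complex vec" assume v: "v \<in> carrier_vec D"
      then have "S *\<^sub>v (\<pi> \<one>\<^bsub>K'\<^esub> *\<^sub>v v) = 0\<^sub>v n" using V_all by (auto simp: V_def)
      then show "S *\<^sub>v v = 0\<^sub>m n D *\<^sub>v v" using v adm_one[OF \<pi>_admissible] by simp
    qed simp
    then show False using S(2) by simp
  qed
  obtain m \<sigma> A x where \<sigma>: "irr m \<sigma>" and A: "A \<in> carrier_mat D m" and pA: "\<And>k. k \<in> carrier K' \<Longrightarrow> \<pi> k * A = A * \<sigma> k"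
    and x: "x \<in> carrier_vec m" "A *\<^sub>v x \<notin> V"
    by (rule irr_outside[OF V V_inv \<open>V \<noteq> carrier_vec D\<close>]) (assumption | rule that)+
  have zA: "z m \<sigma> * A = A" by (rule z_intertwiner[OF \<sigma> A pA])
  let ?z = "z m \<sigma>"
  have zc: "?z \<in> commutant" by (rule z_in_commutant[OF irrD(1)[OF \<sigma>]])
  have fz: "f ?z \<in> carrier_mat n n" by (rule com_irrepD(1)[OF f zc])
  have "\<exists>t. f ?z = t \<cdot>\<^sub>m 1\<^sub>m n"
  proof (rule schur_scalar[OF com_irrepD(1)[OF f] com_irrepD(6)[OF f] fz])
    fix M assume M: "M \<in> commutant"
    show "f ?z * f M = f M * f ?z"
      unfolding com_irrepD(3)[OF f zc M, symmetric] com_irrepD(3)[OF f M zc, symmetric] commutant_z[OF M] ..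
  qed
  then obtain t where t: "f ?z = t \<cdot>\<^sub>m 1\<^sub>m n" by blast
  have "f ?z * f ?z = f ?z" using com_irrepD(3)[OF f zc zc] z_idem[OF \<sigma>] by simp
  then have "(t * t) \<cdot>\<^sub>m 1\<^sub>m n = t \<cdot>\<^sub>m (1\<^sub>m n :: complex mat)"
    unfolding t by (simp add: mult_smult_assoc_mat[of _ n n _ n] smult_smult_mat)
  from arg_cong[OF this, of "\<lambda>M. M $$ (0, 0)"] have tt: "t * t = t" using n by simp
  have "t \<noteq> 0"
  proof
    assume "t = 0"
    then have "f ?z = 0\<^sub>m n n" unfolding t by (simp add: zero_smult_mat[OF one_carrier_mat])
    then have Sz: "S * ?z = 0\<^sub>m n D" using int[OF zc] by (simp add: left_mult_zero_mat[OF S(1)])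
    have SA: "S * A = 0\<^sub>m n m"
      using assoc_mult_mat[OF S(1) z_carrier A, of m \<sigma>] zA Sz by (simp add: left_mult_zero_mat[OF A])
    have "A *\<^sub>v x \<in> V"
      unfolding V_def
    proof (intro CollectI conjI ballI)
      show "A *\<^sub>v x \<in> carrier_vec D" using A x by auto
      fix k assume k: "k \<in> carrier K'"
      have \<sigma>k: "\<sigma> k \<in> carrier_mat m m" by (rule adm_carrier[OF irrD(1)[OF \<sigma>] k])
      have \<sigma>x: "\<sigma> k *\<^sub>v x \<in> carrier_vec m" using \<sigma>k x by auto
      have "\<pi> k *\<^sub>v (A *\<^sub>v x) = A *\<^sub>v (\<sigma> k *\<^sub>v x)"
        unfolding assoc_mult_mat_vec[OF \<pi>_carrier[OF k] A x(1), symmetric] pA[OF k] by (rule assoc_mult_mat_vec[OF A \<sigma>k x(1)])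
      also have "S *\<^sub>v \<dots> = (S * A) *\<^sub>v (\<sigma> k *\<^sub>v x)" by (rule assoc_mult_mat_vec[OF S(1) A \<sigma>x, symmetric])
      also have "\<dots> = 0\<^sub>v n" unfolding SA using \<sigma>x by simp
      finally show "S *\<^sub>v (\<pi> k *\<^sub>v (A *\<^sub>v x)) = 0\<^sub>v n" .
    qed
    then show False using x(2) by simp
  qed
  then have "t = 1" using tt by simp
  then have "f ?z = 1\<^sub>m n" unfolding t by (simp add: one_smult_mat)
  with \<sigma> show thesis by (rule that)
qed

text \<open>Isotypic projections of representations that are not isomorphic are orthogonal.\<close>

lemma irr_isomorphic_of_common:
  assumes f: "com_irrep n f" and \<sigma>: "irr m \<sigma>" "f (z m \<sigma>) = 1\<^sub>m n" and \<sigma>': "irr m' \<sigma>'" "f (z m' \<sigma>') = 1\<^sub>m n"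
  shows "rep_isomorphic (carrier K') (m, \<sigma>) (m', \<sigma>')"
proof (rule ccontr)
  assume "\<not> rep_isomorphic (carrier K') (m, \<sigma>) (m', \<sigma>')"
  then have "z m \<sigma> * z m' \<sigma>' = 0\<^sub>m D D" by (rule z_distinct[OF \<sigma>(1) \<sigma>'(1)])
  then have "f (z m \<sigma>) * f (z m' \<sigma>') = 0\<^sub>m n n"
    using com_irrepD(3)[OF f z_in_commutant z_in_commutant] irrD(1) \<sigma>(1) \<sigma>'(1) com_irrep_zero[OF f] by metis
  then have "1\<^sub>m n = (0\<^sub>m n n :: complex mat)" using \<sigma>(2) \<sigma>'(2) by simp
  from arg_cong[OF this, of "\<lambda>M. M $$ (0, 0)"] show False using com_irrepD(7)[OF f] by simp
qed

end

section \<open>Isomorphism classes\<close>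

lemma rep_isomorphic_sym:
  assumes "rep_isomorphic X (n, \<rho>) (m, \<sigma>)"
    and c: "\<And>x. x \<in> X \<Longrightarrow> \<rho> x \<in> carrier_mat n n" "\<And>x. x \<in> X \<Longrightarrow> \<sigma> x \<in> carrier_mat m m"
  shows "rep_isomorphic X (m, \<sigma>) (n, \<rho>)"
proof -
  obtain P where mn: "m = n" and P: "P \<in> carrier (GL n)" "\<And>x. x \<in> X \<Longrightarrow> P * \<rho> x = \<sigma> x * P"
    using assms(1) by (auto simp: rep_isomorphic_def)
  obtain Q where Q: "Q \<in> carrier_mat n n" "Q * P = 1\<^sub>m n" "P * Q = 1\<^sub>m n" and Pc: "P \<in> carrier_mat n n"
    using P(1) by (auto simp: carrier_GL_iff)
  have "Q * \<sigma> x = \<rho> x * Q" if x: "x \<in> X" for x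
  proof -
    have cx: "\<rho> x \<in> carrier_mat n n" "\<sigma> x \<in> carrier_mat n n" using c[OF x] mn by auto
    have "Q * \<sigma> x = Q * (\<sigma> x * (P * Q))" using Q cx by simp
    also have "\<dots> = Q * (P * \<rho> x * Q)" using assoc_mult_mat[OF cx(2) Pc Q(1)] P(2)[OF x] by simp
    also have "\<dots> = Q * (P * (\<rho> x * Q))" unfolding assoc_mult_mat[OF Pc cx(1) Q(1)] ..
    also have "\<dots> = Q * P * (\<rho> x * Q)"
      by (rule assoc_mult_mat[OF Q(1) Pc square_mult_carrier[OF cx(1) Q(1)], symmetric])
    also have "\<dots> = \<rho> x * Q"
      unfolding Q(2) by (rule left_mult_one_mat[OF square_mult_carrier[OF cx(1) Q(1)]])
    finally show ?thesis .
  qed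
  moreover have "Q \<in> carrier (GL n)" by (rule GL_I[OF Q(1) Pc Q(2)])
  ultimately show ?thesis using mn by (auto simp: rep_isomorphic_def)
qed

lemma rep_isomorphic_trans:
  assumes "rep_isomorphic X (n, \<rho>) (m, \<sigma>)" "rep_isomorphic X (m, \<sigma>) (k, \<tau>)"
    and c: "\<And>x. x \<in> X \<Longrightarrow> \<rho> x \<in> carrier_mat n n" "\<And>x. x \<in> X \<Longrightarrow> \<sigma> x \<in> carrier_mat m m"
      "\<And>x. x \<in> X \<Longrightarrow> \<tau> x \<in> carrier_mat k k"
  shows "rep_isomorphic X (n, \<rho>) (k, \<tau>)"
proof -
  obtain P where nm: "n = m" and P: "P \<in> carrier (GL n)" "\<And>x. x \<in> X \<Longrightarrow> P * \<rho> x = \<sigma> x * P"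
    using assms(1) by (auto simp: rep_isomorphic_def)
  obtain Q where mk: "m = k" and Q: "Q \<in> carrier (GL n)" "\<And>x. x \<in> X \<Longrightarrow> Q * \<sigma> x = \<tau> x * Q"
    using assms(2) nm by (auto simp: rep_isomorphic_def)
  interpret group "GL n" by (rule group_GL)
  have "Q * P * \<rho> x = \<tau> x * (Q * P)" if x: "x \<in> X" for x
  proof -
    have cx: "\<rho> x \<in> carrier_mat n n" "\<sigma> x \<in> carrier_mat n n" "\<tau> x \<in> carrier_mat n n" using c[OF x] nm mk by auto
    note PQ = carrier_GL_mat[OF P(1)] carrier_GL_mat[OF Q(1)]
    have "Q * P * \<rho> x = Q * (\<sigma> x * P)" using assoc_mult_mat[OF PQ(2,1) cx(1)] P(2)[OF x] by simp
    also have "\<dots> = \<tau> x * Q * P" using assoc_mult_mat[OF PQ(2) cx(2) PQ(1)] Q(2)[OF x] by simp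
    also have "\<dots> = \<tau> x * (Q * P)" by (rule assoc_mult_mat[OF cx(3) PQ(2,1)])
    finally show ?thesis .
  qed
  moreover have "Q * P \<in> carrier (GL n)" using m_closed[OF Q(1) P(1)] by simp
  ultimately show ?thesis using nm mk by (auto simp: rep_isomorphic_def)
qed

lemma equiv_rep_isomorphic:
  assumes c: "\<And>n \<rho> x. (n, \<rho>) \<in> R \<Longrightarrow> x \<in> X \<Longrightarrow> \<rho> x \<in> carrier_mat n n"
  shows "equiv R {(r, s). r \<in> R \<and> s \<in> R \<and> rep_isomorphic X r s}"
proof (rule equivI)
  show "{(r, s). r \<in> R \<and> s \<in> R \<and> rep_isomorphic X r s} \<subseteq> R \<times> R" by auto
  show "refl_on R {(r, s). r \<in> R \<and> s \<in> R \<and> rep_isomorphic X r s}"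
  proof (rule refl_onI)
    fix r assume r: "r \<in> R"
    obtain n \<rho> where [simp]: "r = (n, \<rho>)" by (cases r)
    interpret group "GL n" by (rule group_GL)
    have "1\<^sub>m n \<in> carrier (GL n)" using one_closed by simp
    moreover have "1\<^sub>m n * \<rho> x = \<rho> x * 1\<^sub>m n" if "x \<in> X" for x using c[of n \<rho> x] r that by simp
    ultimately have "rep_isomorphic X r r" by (auto simp: rep_isomorphic_def)
    then show "(r, r) \<in> {(r, s). r \<in> R \<and> s \<in> R \<and> rep_isomorphic X r s}" using r by simp
  qed
  show "sym {(r, s). r \<in> R \<and> s \<in> R \<and> rep_isomorphic X r s}"
    using c by (auto intro!: symI intro: rep_isomorphic_sym)
  show "trans {(r, s). r \<in> R \<and> s \<in> R \<and> rep_isomorphic X r s}"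
    using c by (auto intro!: transI intro: rep_isomorphic_trans)
qed

text \<open>A relation that is total on both sides and matches the two equivalences induces a bijection of
  the quotients.\<close>

lemma quotient_correspondence:
  assumes E: "equiv R E" and E': "equiv R' E'"
    and tot: "\<And>r. r \<in> R \<Longrightarrow> \<exists>r'\<in>R'. C r r'" and tot': "\<And>r'. r' \<in> R' \<Longrightarrow> \<exists>r\<in>R. C r r'"
    and match: "\<And>r s r' s'. r \<in> R \<Longrightarrow> s \<in> R \<Longrightarrow> r' \<in> R' \<Longrightarrow> s' \<in> R' \<Longrightarrow> C r r' \<Longrightarrow> C s s' \<Longrightarrow>
      (r, s) \<in> E \<longleftrightarrow> (r', s') \<in> E'"
  obtains F where "bij_betw F (R // E) (R' // E')"
    "\<And>Y r r'. Y \<in> R // E \<Longrightarrow> r \<in> Y \<Longrightarrow> r' \<in> F Y \<Longrightarrow> r \<in> R \<and> r' \<in> R' \<and> (\<exists>s\<in>R. (r, s) \<in> E \<and> C s r')"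
proof -
  define F where "F Y = {r' \<in> R'. \<exists>r\<in>Y. C r r'}" for Y
  have F_class: "F (E `` {r}) = E' `` {r'}" if r: "r \<in> R" "r' \<in> R'" "C r r'" for r r'
  proof (intro equalityI subsetI)
    fix s' assume "s' \<in> F (E `` {r})"
    then obtain s where s: "s' \<in> R'" "(r, s) \<in> E" "C s s'" by (auto simp: F_def)
    then have "s \<in> R" using E by (auto simp: equiv_def refl_on_def)
    then have "(r', s') \<in> E'" using match[OF r(1) _ r(2) s(1) r(3) s(3)] s(2) by simp
    then show "s' \<in> E' `` {r'}" by simp
  next
    fix s' assume "s' \<in> E' `` {r'}"
    then have s': "(r', s') \<in> E'" "s' \<in> R'" using E' by (auto simp: equiv_def refl_on_def)
    then obtain s where s: "s \<in> R" "C s s'" using tot' by blast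
    then have "(r, s) \<in> E" using match[OF r(1) s(1) r(2) s'(2) r(3) s(2)] s'(1) by simp
    then show "s' \<in> F (E `` {r})" using s s' by (auto simp: F_def)
  qed
  have "bij_betw F (R // E) (R' // E')"
    unfolding bij_betw_def
  proof
    show "inj_on F (R // E)"
    proof (rule inj_onI)
      fix Y Y' assume Y: "Y \<in> R // E" "Y' \<in> R // E" and FY: "F Y = F Y'"
      obtain r s where rs: "Y = E `` {r}" "r \<in> R" "Y' = E `` {s}" "s \<in> R" using Y by (auto elim!: quotientE)
      obtain r' s' where rs': "r' \<in> R'" "C r r'" "s' \<in> R'" "C s s'" using tot rs by metis
      have "E' `` {r'} = E' `` {s'}"
        using FY F_class[OF rs(2) rs'(1,2)] F_class[OF rs(4) rs'(3,4)] rs by simp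
      then have "(r', s') \<in> E'" using eq_equiv_class[OF _ E' rs'(3)] by blast
      then have "(r, s) \<in> E" using match[OF rs(2,4) rs'(1,3,2,4)] by simp
      then show "Y = Y'" using equiv_class_eq[OF E] rs by simp
    qed
    show "F ` (R // E) = R' // E'"
    proof (intro equalityI subsetI)
      fix Z assume "Z \<in> F ` (R // E)"
      then obtain r where r: "r \<in> R" "Z = F (E `` {r})" by (auto elim!: quotientE)
      obtain r' where "r' \<in> R'" "C r r'" using tot[OF r(1)] by blast
      then show "Z \<in> R' // E'" using F_class[OF r(1)] r(2) by (auto intro: quotientI)
    next
      fix Z assume "Z \<in> R' // E'"
      then obtain r' where r': "r' \<in> R'" "Z = E' `` {r'}" by (auto elim!: quotientE)
      obtain r where r: "r \<in> R" "C r r'" using tot'[OF r'(1)] by blast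
      have "Z = F (E `` {r})" using F_class[OF r(1) r'(1) r(2)] r'(2) by simp
      then show "Z \<in> F ` (R // E)" using quotientI[OF r(1)] by blast
    qed
  qed
  moreover have "r \<in> R \<and> r' \<in> R' \<and> (\<exists>s\<in>R. (r, s) \<in> E \<and> C s r')"
    if Y: "Y \<in> R // E" "r \<in> Y" "r' \<in> F Y" for Y r r'
  proof -
    obtain q where q: "q \<in> R" "Y = E `` {q}" using Y(1) by (auto elim!: quotientE)
    obtain s where s: "r' \<in> R'" "s \<in> Y" "C s r'" using Y(3) by (auto simp: F_def)
    have "(q, r) \<in> E" "(q, s) \<in> E" using q Y(2) s(2) by auto
    then have "(r, s) \<in> E" "r \<in> R" "s \<in> R" using E by (auto simp: equiv_def refl_on_def dest: symD transD)
    then show ?thesis using s by blast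
  qed
  ultimately show thesis by (rule that)
qed

section \<open>Tensor products of matrix algebras with dual bases\<close>

text \<open>The indexing of the Kronecker product.\<close>

lemma sum_div_mod:
  fixes f :: "nat \<Rightarrow> nat \<Rightarrow> complex"
  shows "(\<Sum>k<n * m. f (k div m) (k mod m)) = (\<Sum>i<n. \<Sum>j<m. f i j)"
proof -
  have "(\<Sum>k\<in>{i * m..<i * m + m}. f (k div m) (k mod m)) = (\<Sum>j<m. f i j)" for i
  proof -
    have "(\<Sum>k\<in>{i * m..<i * m + m}. f (k div m) (k mod m)) = (\<Sum>j<m. f ((j + i * m) div m) ((j + i * m) mod m))"
      using sum.shift_bounds_nat_ivl[of "\<lambda>k. f (k div m) (k mod m)" 0 "i * m" m]
      by (simp add: lessThan_atLeast0 add.commute)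
    also have "\<dots> = (\<Sum>j<m. f i j)" by (intro sum.cong refl) auto
    finally show ?thesis .
  qed
  then show ?thesis by (simp add: sum.nat_group[symmetric])
qed

lemma div_mod_less: "(k :: nat) < n * m \<Longrightarrow> k div m < n" "(k :: nat) < n * m \<Longrightarrow> k mod m < m"
  by (simp add: less_mult_imp_div_less, cases "m = 0") auto

lemma kronecker_carrier [simp]:
  "S \<in> carrier_mat r c \<Longrightarrow> T \<in> carrier_mat r' c' \<Longrightarrow> kronecker S T \<in> carrier_mat (r * r') (c * c')"
  by (auto simp: kronecker_def)

lemma kronecker_entry:
  assumes "S \<in> carrier_mat r c" "T \<in> carrier_mat r' c'" "i < r * r'" "j < c * c'"
  shows "kronecker S T $$ (i, j) = S $$ (i div r', j div c') * T $$ (i mod r', j mod c')"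
  using assms by (auto simp: kronecker_def)

lemma kronecker_mult:
  assumes S: "S \<in> carrier_mat r m" "S' \<in> carrier_mat m c" and T: "T \<in> carrier_mat r' m'" "T' \<in> carrier_mat m' c'"
  shows "kronecker S T * kronecker S' T' = kronecker (S * S') (T * T')"
proof (rule eq_matI)
  fix i j assume "i < dim_row (kronecker (S * S') (T * T'))" "j < dim_col (kronecker (S * S') (T * T'))"
  then have ij: "i < r * r'" "j < c * c'" using S T by (auto simp: kronecker_def)
  note dm = div_mod_less[OF ij(1)] div_mod_less[OF ij(2)]
  define f where "f a b = (S $$ (i div r', a) * S' $$ (a, j div c')) * (T $$ (i mod r', b) * T' $$ (b, j mod c'))" for a b
  have "(kronecker S T * kronecker S' T') $$ (i, j)
      = (\<Sum>k<m * m'. kronecker S T $$ (i, k) * kronecker S' T' $$ (k, j))"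
    by (rule mult_entry[of _ "r * r'" _ _ "c * c'"]) (use S T ij in simp_all)
  also have "\<dots> = (\<Sum>k<m * m'. f (k div m') (k mod m'))"
    by (rule sum.cong[OF refl])
      (simp add: f_def kronecker_entry[OF S(1) T(1)] kronecker_entry[OF S(2) T(2)] ij)
  also have "\<dots> = (\<Sum>a<m. \<Sum>b<m'. f a b)" by (rule sum_div_mod)
  also have "\<dots> = (\<Sum>a<m. S $$ (i div r', a) * S' $$ (a, j div c'))
      * (\<Sum>b<m'. T $$ (i mod r', b) * T' $$ (b, j mod c'))"
    unfolding f_def by (rule sum_product[symmetric])
  also have "\<dots> = (S * S') $$ (i div r', j div c') * (T * T') $$ (i mod r', j mod c')"
    by (simp only: mult_entry[OF S dm(1,3)] mult_entry[OF T dm(2,4)])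
  also have "\<dots> = kronecker (S * S') (T * T') $$ (i, j)"
    by (rule kronecker_entry[symmetric]) (use S T ij in auto)
  finally show "(kronecker S T * kronecker S' T') $$ (i, j) = kronecker (S * S') (T * T') $$ (i, j)" .
qed (use S T in \<open>auto simp: kronecker_def\<close>)

lemma mtrace_kronecker:
  assumes "S \<in> carrier_mat n n" "T \<in> carrier_mat m m"
  shows "mtrace (kronecker S T) = mtrace S * mtrace T"
proof -
  define f where "f i j = S $$ (i, i) * T $$ (j, j)" for i j
  have "mtrace (kronecker S T) = (\<Sum>k<n * m. f (k div m) (k mod m))"
    unfolding mtrace_def f_def using assms
    by (intro sum.cong) (auto simp: kronecker_def)
  also have "\<dots> = (\<Sum>i<n. \<Sum>j<m. f i j)" by (rule sum_div_mod)
  also have "\<dots> = mtrace S * mtrace T"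
    unfolding mtrace_def f_def using assms by (simp add: sum_product)
  finally show ?thesis .
qed

lemma kronecker_one: "kronecker (1\<^sub>m n) (1\<^sub>m m) = 1\<^sub>m (n * m)"
proof (rule eq_matI)
  fix i j assume "i < dim_row (1\<^sub>m (n * m))" "j < dim_col (1\<^sub>m (n * m))"
  then have ij: "i < n * m" "j < n * m" by auto
  have "(i div m = j div m \<and> i mod m = j mod m) \<longleftrightarrow> i = j" by (metis div_mult_mod_eq)
  then show "kronecker (1\<^sub>m n) (1\<^sub>m m) $$ (i, j) = 1\<^sub>m (n * m) $$ (i, j)"
    using ij div_mod_less[OF ij(1)] div_mod_less[OF ij(2)]
    by (auto simp: kronecker_entry[of _ n n _ m m])
qed (auto simp: kronecker_def)

lemma kronecker_msum:
  assumes "\<And>x. x \<in> I \<Longrightarrow> S x \<in> carrier_mat n n" "\<And>y. y \<in> J \<Longrightarrow> T y \<in> carrier_mat m m"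
  shows "kronecker (msum n n (\<lambda>x. a x \<cdot>\<^sub>m S x) I) (msum m m (\<lambda>y. b y \<cdot>\<^sub>m T y) J)
    = msum (n * m) (n * m) (\<lambda>(x, y). (a x * b y) \<cdot>\<^sub>m kronecker (S x) (T y)) (I \<times> J)"
proof (rule eq_matI)
  fix i j assume "i < dim_row (msum (n * m) (n * m) (\<lambda>(x, y). (a x * b y) \<cdot>\<^sub>m kronecker (S x) (T y)) (I \<times> J))"
    "j < dim_col (msum (n * m) (n * m) (\<lambda>(x, y). (a x * b y) \<cdot>\<^sub>m kronecker (S x) (T y)) (I \<times> J))"
  then have ij: "i < n * m" "j < n * m" by auto
  note dm = div_mod_less[OF ij(1)] div_mod_less[OF ij(2)]
  have "kronecker (msum n n (\<lambda>x. a x \<cdot>\<^sub>m S x) I) (msum m m (\<lambda>y. b y \<cdot>\<^sub>m T y) J) $$ (i, j)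
      = (\<Sum>x\<in>I. a x * S x $$ (i div m, j div m)) * (\<Sum>y\<in>J. b y * T y $$ (i mod m, j mod m))"
    unfolding kronecker_entry[OF msum_carrier msum_carrier ij] index_msum[OF dm(1,3)] index_msum[OF dm(2,4)]
    by (simp add: smult_entry[OF assms(1) dm(1,3)] smult_entry[OF assms(2) dm(2,4)])
  also have "\<dots> = (\<Sum>x\<in>I. \<Sum>y\<in>J. (a x * b y) * (S x $$ (i div m, j div m) * T y $$ (i mod m, j mod m)))"
    unfolding sum_product by (intro sum.cong refl) simp
  also have "\<dots> = (\<Sum>x\<in>I. \<Sum>y\<in>J. ((a x * b y) \<cdot>\<^sub>m kronecker (S x) (T y)) $$ (i, j))"
    by (intro sum.cong refl)
      (simp add: smult_entry[OF kronecker_carrier[OF assms] ij] kronecker_entry[OF assms ij])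
  also have "\<dots> = msum (n * m) (n * m) (\<lambda>(x, y). (a x * b y) \<cdot>\<^sub>m kronecker (S x) (T y)) (I \<times> J) $$ (i, j)"
    unfolding index_msum[OF ij] sum.cartesian_product by (intro sum.cong refl) auto
  finally show "kronecker (msum n n (\<lambda>x. a x \<cdot>\<^sub>m S x) I) (msum m m (\<lambda>y. b y \<cdot>\<^sub>m T y) J) $$ (i, j) = \<dots>" .
qed (auto simp: kronecker_def)

text \<open>The Kronecker products of the matrices of two such irreducible modules form a basis of the full
  matrix algebra on the tensor product, again with an explicit dual basis.\<close>

locale irrep_pair =
  L: symmetric_constants_irrep X c1 G1 d1 b1 + R: symmetric_constants_irrep X c2 G2 d2 b2
  for X :: "'a set" and c1 c2 G1 G2 d1 d2 b1 b2
begin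

abbreviation "D \<equiv> d1 * d2"

definition B :: "'a \<times> 'a \<Rightarrow> complex mat" where "B p = kronecker (b1 (fst p)) (b2 (snd p))"

definition B' :: "'a \<times> 'a \<Rightarrow> complex mat" where "B' p = kronecker (L.b' (fst p)) (R.b' (snd p))"

lemma B_carrier [simp]: "p \<in> X \<times> X \<Longrightarrow> B p \<in> carrier_mat D D" and B'_carrier [simp]: "B' p \<in> carrier_mat D D"
  by (auto simp: B_def B'_def)

lemma D_card: "D = card X"
proof -
  have "d1 = d2" using L.dim_square R.dim_square by (metis power2_eq_iff_nonneg power2_eq_square zero_le)
  then show ?thesis using L.dim_square by simp
qed

lemma D_pos: "D > 0"
  using L.d_pos R.d_pos by simp

lemma B_trace:
  assumes "p \<in> X \<times> X" "q \<in> X \<times> X"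
  shows "mtrace (B p * B' q) = (if p = q then 1 else 0)"
proof -
  have "B p * B' q = kronecker (b1 (fst p) * L.b' (fst q)) (b2 (snd p) * R.b' (snd q))"
    unfolding B_def B'_def using assms by (intro kronecker_mult[of _ d1 d1 _ d1 _ d2 d2 _ d2]) auto
  then have "mtrace (B p * B' q) = mtrace (b1 (fst p) * L.b' (fst q)) * mtrace (b2 (snd p) * R.b' (snd q))"
    using assms by (subst mtrace_kronecker[symmetric, of _ d1 _ d2]) auto
  then show ?thesis using assms L.dual_basis_trace R.dual_basis_trace by (auto simp: prod_eq_iff)
qed

lemma B_entries:
  assumes "i < D" "j < D" "k < D" "l < D"
  shows "(\<Sum>p\<in>X \<times> X. B' p $$ (l, k) * B p $$ (i, j)) = (if i = k \<and> j = l then 1 else 0)"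
proof -
  note dm = div_mod_less[OF assms(1)] div_mod_less[OF assms(2)] div_mod_less[OF assms(3)] div_mod_less[OF assms(4)]
  have eq: "a div d2 = b div d2 \<and> a mod d2 = b mod d2 \<longleftrightarrow> a = b" for a b by (metis div_mult_mod_eq)
  have "(\<Sum>p\<in>X \<times> X. B' p $$ (l, k) * B p $$ (i, j))
      = (\<Sum>x\<in>X. \<Sum>y\<in>X. (L.b' x $$ (l div d2, k div d2) * b1 x $$ (i div d2, j div d2))
          * (R.b' y $$ (l mod d2, k mod d2) * b2 y $$ (i mod d2, j mod d2)))"
    unfolding sum.cartesian_product'
    by (intro sum.cong refl) (simp add: B_def B'_def kronecker_entry[of _ d1 d1 _ d2 d2] assms)
  also have "\<dots> = (if i div d2 = k div d2 \<and> j div d2 = l div d2 then 1 else 0)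
      * (if i mod d2 = k mod d2 \<and> j mod d2 = l mod d2 then 1 else 0)"
    unfolding sum_product[symmetric] L.dual_basis_entries[OF dm(1,3,5,7)] R.dual_basis_entries[OF dm(2,4,6,8)] ..
  finally show ?thesis using eq[of i k] eq[of j l] by auto
qed

lemma B_expansion:
  assumes M: "M \<in> carrier_mat D D"
  shows "M = msum D D (\<lambda>p. mtrace (M * B' p) \<cdot>\<^sub>m B p) (X \<times> X)"
  by (rule expansion_in_dual_basis[OF B_carrier B'_carrier B_entries M])

lemma B_mult:
  assumes "p \<in> X \<times> X" "q \<in> X \<times> X"
  shows "B p * B q = msum D D (\<lambda>r. (c1 (fst p) (fst q) (fst r) * c2 (snd p) (snd q) (snd r)) \<cdot>\<^sub>m B r) (X \<times> X)"
proof -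
  have "B p * B q = kronecker (b1 (fst p) * b1 (fst q)) (b2 (snd p) * b2 (snd q))"
    unfolding B_def using assms by (intro kronecker_mult[of _ d1 d1 _ d1 _ d2 d2 _ d2]) auto
  also have "\<dots> = msum D D (\<lambda>(x, y). (c1 (fst p) (fst q) x * c2 (snd p) (snd q) y) \<cdot>\<^sub>m kronecker (b1 x) (b2 y)) (X \<times> X)"
    using assms by (subst L.b_mult, (auto)[2], subst R.b_mult, (auto)[2], subst kronecker_msum) auto
  finally show ?thesis by (simp add: B_def case_prod_unfold)
qed

lemma B_one: "msum D D B (X \<times> X) = 1\<^sub>m D"
proof -
  have "1\<^sub>m D = kronecker (msum d1 d1 (\<lambda>x. 1 \<cdot>\<^sub>m b1 x) X) (msum d2 d2 (\<lambda>x. 1 \<cdot>\<^sub>m b2 x) X)"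
    by (simp add: one_smult_mat L.b_one R.b_one kronecker_one)
  also have "\<dots> = msum D D B (X \<times> X)"
    by (subst kronecker_msum) (auto simp: one_smult_mat B_def case_prod_unfold intro!: msum_cong)
  finally show ?thesis by simp
qed

text \<open>If conjugation by \<open>U\<close> permutes the basis without fixed points, its trace as a linear map of
  the matrix algebra vanishes; but that trace is the product of the traces of \<open>U\<close> and \<open>U\<inverse>\<close>.\<close>

lemma trace_of_fixed_point_free:
  assumes U: "U \<in> carrier_mat D D" and V: "V \<in> carrier_mat D D" "U * V = 1\<^sub>m D"
    and \<phi>: "\<And>p. p \<in> X \<times> X \<Longrightarrow> \<phi> p \<in> X \<times> X" "\<And>p. p \<in> X \<times> X \<Longrightarrow> \<phi> p \<noteq> p"
    and UB: "\<And>p. p \<in> X \<times> X \<Longrightarrow> U * B p = B (\<phi> p) * U"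
  shows "mtrace U * mtrace V = 0"
proof -
  have UBV: "U * B p * V = B (\<phi> p)" if p: "p \<in> X \<times> X" for p
    unfolding UB[OF p] assoc_mult_mat[OF B_carrier[OF \<phi>(1)[OF p]] U V(1)] V(2)
    by (rule right_mult_one_mat[OF B_carrier[OF \<phi>(1)[OF p]]])
  have "mtrace U * mtrace V = (\<Sum>i<D. \<Sum>j<D. U $$ (i, i) * V $$ (j, j))"
    using U V by (simp add: mtrace_def sum_product)
  also have "\<dots> = (\<Sum>i<D. \<Sum>j<D. \<Sum>p\<in>X \<times> X. B' p $$ (j, i) * (U * B p * V) $$ (i, j))"
  proof (intro sum.cong refl)
    fix i j assume "i \<in> {..<D}" "j \<in> {..<D}"
    then have ij: "i < D" "j < D" by auto
    have tr: "mtrace (munit D D i j * M) = M $$ (j, i)" if M: "M \<in> carrier_mat D D" for M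
    proof -
      have "mtrace (munit D D i j * M) = (\<Sum>k<D. \<Sum>l<D. munit D D i j $$ (k, l) * M $$ (l, k))"
        by (rule mtrace_mult_entries) (use M in auto)
      also have "\<dots> = (\<Sum>k<D. (if k = i then 1 else 0) * (\<Sum>l<D. (if l = j then 1 else 0) * M $$ (l, k)))"
        unfolding sum_distrib_left by (intro sum.cong refl) auto
      finally show ?thesis using ij by (simp add: sum_delta_left)
    qed
    have exp: "munit D D i j = msum D D (\<lambda>p. B' p $$ (j, i) \<cdot>\<^sub>m B p) (X \<times> X)"
      using B_expansion[OF munit_carrier[of D D i j]] by (simp add: tr[OF B'_carrier])
    have "U $$ (i, i) * V $$ (j, j) = (U * munit D D i j * V) $$ (i, j)"
      by (rule mult_munit_mult[symmetric, OF U V(1)]) (use ij in auto)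
    also have "U * munit D D i j * V = msum D D (\<lambda>p. B' p $$ (j, i) \<cdot>\<^sub>m (U * B p * V)) (X \<times> X)"
      unfolding exp using U V
      by (subst mult_msum[OF U], simp, subst msum_mult[OF V(1)], simp, intro msum_cong)
        (simp add: mult_smult_distrib[OF U B_carrier] mult_smult_assoc_mat[OF square_mult_carrier[OF U B_carrier] V(1)])
    also have "\<dots> $$ (i, j) = (\<Sum>p\<in>X \<times> X. B' p $$ (j, i) * (U * B p * V) $$ (i, j))"
      using ij U V by (simp add: smult_entry[of _ D D])
    finally show "U $$ (i, i) * V $$ (j, j) = \<dots>" .
  qed
  also have "\<dots> = (\<Sum>p\<in>X \<times> X. \<Sum>i<D. \<Sum>j<D. B (\<phi> p) $$ (i, j) * B' p $$ (j, i))"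
    by (subst sum_rotate[symmetric]) (intro sum.cong refl, simp add: UBV mult.commute)
  also have "\<dots> = (\<Sum>p\<in>X \<times> X. 0)"
    by (rule sum.cong[OF refl])
      (simp only: mtrace_mult_entries[symmetric, OF B_carrier[OF \<phi>(1)] B'_carrier] B_trace[OF \<phi>(1)] \<phi>(2) if_False)
  finally show ?thesis by simp
qed

end

section \<open>The algebra of a double coset\<close>

lemma lin_ext_indicator:
  assumes "finite X" "y \<in> X" shows "lin_ext X f (indicator {y}) = indicator {f y}"
proof
  fix w
  have "lin_ext X f (indicator {y}) w = (\<Sum>x\<in>{x \<in> X. f x = w}. (if x = y then 1 else 0))"
    unfolding lin_ext_def by (intro sum.cong refl) (simp add: indicator_def)
  also have "\<dots> = indicator {f y} w" using assms by (auto simp: indicator_def)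
  finally show "lin_ext X f (indicator {y}) w = indicator {f y} w" .
qed

text \<open>The twist of the subgroup is viewed as a tensor over the whole group by extension by zero.\<close>

lemma pairing_restrict:
  assumes "finite X" "Y \<subseteq> X" "u \<in> vectors_on (Y \<times> Y)"
  shows "pairing X (curry u) F = pairing Y (curry u) F"
proof -
  have "(\<Sum>p\<in>X \<times> X. u p * case_prod F p) = (\<Sum>p\<in>Y \<times> Y. u p * case_prod F p)"
    using assms by (intro sum.mono_neutral_right) (auto simp: vectors_on_def)
  then show ?thesis by (simp add: pairing_curry)
qed

lemma msum_product:
  assumes B: "\<And>p. p \<in> I \<Longrightarrow> B p \<in> carrier_mat n n"
    and mult: "\<And>p q. p \<in> I \<Longrightarrow> q \<in> I \<Longrightarrow> B p * B q = msum n n (\<lambda>r. C p q r \<cdot>\<^sub>m B r) I"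
  shows "msum n n (\<lambda>p. a p \<cdot>\<^sub>m B p) I * msum n n (\<lambda>q. b q \<cdot>\<^sub>m B q) I
    = msum n n (\<lambda>r. (\<Sum>p\<in>I. \<Sum>q\<in>I. a p * b q * C p q r) \<cdot>\<^sub>m B r) I"
proof -
  let ?M = "msum n n (\<lambda>q. b q \<cdot>\<^sub>m B q) I"
  have row: "(a p \<cdot>\<^sub>m B p) * ?M = 1 \<cdot>\<^sub>m msum n n (\<lambda>r. (\<Sum>q\<in>I. a p * b q * C p q r) \<cdot>\<^sub>m B r) I"
    if p: "p \<in> I" for p
  proof -
    have "(a p \<cdot>\<^sub>m B p) * ?M = msum n n (\<lambda>q. (a p \<cdot>\<^sub>m B p) * (b q \<cdot>\<^sub>m B q)) I"
      by (rule mult_msum) (use B p in auto)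
    also have "\<dots> = msum n n (\<lambda>q. (a p * b q) \<cdot>\<^sub>m msum n n (\<lambda>r. C p q r \<cdot>\<^sub>m B r) I) I"
      by (rule msum_cong)
        (simp add: mult_smult_assoc_mat[OF B[OF p] smult_carrier_mat[OF B]] mult_smult_distrib[OF B[OF p] B]
          mult[OF p] smult_smult_mat mult.commute)
    also have "\<dots> = msum n n (\<lambda>r. (\<Sum>q\<in>I. a p * b q * C p q r) \<cdot>\<^sub>m B r) I"
      by (rule msum_lincomb[OF B])
    finally show ?thesis by (simp add: one_smult_mat)
  qed
  have "msum n n (\<lambda>p. a p \<cdot>\<^sub>m B p) I * ?M = msum n n (\<lambda>p. (a p \<cdot>\<^sub>m B p) * ?M) I"
    by (rule msum_mult) (use B in auto)
  also have "\<dots> = msum n n (\<lambda>p. 1 \<cdot>\<^sub>m msum n n (\<lambda>r. (\<Sum>q\<in>I. a p * b q * C p q r) \<cdot>\<^sub>m B r) I) I"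
    by (rule msum_cong) (rule row)
  also have "\<dots> = msum n n (\<lambda>r. (\<Sum>p\<in>I. 1 * (\<Sum>q\<in>I. a p * b q * C p q r)) \<cdot>\<^sub>m B r) I"
    by (rule msum_lincomb[OF B])
  finally show ?thesis by simp
qed

lemma conj_class_on_basis:
  assumes S: "S \<in> conj_class (dual_algebra X C) n \<tau> \<alpha>" and \<tau>: "\<And>x. x \<in> X \<Longrightarrow> \<tau> (indicator {x}) \<in> carrier_mat n n"
    and \<alpha>: "\<alpha> (indicator {x}) = indicator {x'}" and x: "x \<in> X"
  shows "S \<in> carrier_mat n n" "S * \<tau> (indicator {x}) = \<tau> (indicator {x'}) * S"
proof -
  have GL: "S \<in> carrier (GL n)" using S by (simp add: conj_class_def)
  show Sc: "S \<in> carrier_mat n n" by (rule carrier_GL_mat[OF GL])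
  note Si = GL_inv[OF GL]
  have "indicator {x} \<in> carrier (dual_algebra X C)"
    using indicator_in_vectors_on[OF x] by (simp add: dual_algebra_def)
  then have eq: "\<tau> (indicator {x'}) = S * \<tau> (indicator {x}) * inv\<^bsub>GL n\<^esub> S"
    using S \<alpha> unfolding conj_class_def by auto
  have St: "S * \<tau> (indicator {x}) \<in> carrier_mat n n" using Sc \<tau>[OF x] by simp
  show "S * \<tau> (indicator {x}) = \<tau> (indicator {x'}) * S"
    unfolding eq assoc_mult_mat[OF St Si(1) Sc] Si(3) by (rule right_mult_one_mat[OF St, symmetric])
qed

locale double_coset = group G for G :: "('a, 'm) monoid_scheme" (structure) +
  fixes H :: "'a set" and J :: "'a \<times> 'a \<Rightarrow> complex" and g :: 'a and d1 d2 :: nat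
    and \<tau>1 \<tau>2 :: "('a \<Rightarrow> complex) \<Rightarrow> complex mat"
  assumes finite_G: "finite (carrier G)" and subgroup_H: "subgroup H G" and g: "g \<in> carrier G"
    and minimal_J: "minimal_twist (G\<lparr>carrier := H\<rparr>) J"
    and irrep1: "alg_irrep (A1_dual (G\<lparr>carrier := H\<rparr>) J) d1 \<tau>1"
    and irrep2: "alg_irrep (A2_dual (G\<lparr>carrier := H\<rparr>) J) d2 \<tau>2"
begin

abbreviation "\<Gamma> \<equiv> G\<lparr>carrier := H\<rparr>"

lemma H_G: "x \<in> H \<Longrightarrow> x \<in> carrier G"
  using subgroup.mem_carrier[OF subgroup_H] .

lemma H_closed: "x \<in> H \<Longrightarrow> y \<in> H \<Longrightarrow> x \<otimes> y \<in> H" "x \<in> H \<Longrightarrow> inv x \<in> H" "\<one> \<in> H"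
  using subgroup.m_closed[OF subgroup_H] subgroup.m_inv_closed[OF subgroup_H] subgroup.one_closed[OF subgroup_H]
  by auto

lemma H_sub: "H \<subseteq> carrier G" by (rule subgroup.subset[OF subgroup_H])

lemma finite_H: "finite H"
  using finite_subset[OF H_sub finite_G] .

sublocale tw: minimal_twist_group \<Gamma> J
proof (intro minimal_twist_group.intro minimal_twist_group_axioms.intro)
  show "group \<Gamma>" by (rule subgroup.subgroup_is_group[OF subgroup_H is_group])
  show "finite (carrier \<Gamma>)" using finite_H by simp
  show "minimal_twist \<Gamma> J" by (rule minimal_J)
qed

definition b1 :: "'a \<Rightarrow> complex mat" where "b1 x = \<tau>1 (indicator {x})"
definition b2 :: "'a \<Rightarrow> complex mat" where "b2 x = \<tau>2 (indicator {x})"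

sublocale irrep_pair H tw.td.sc tw.op.sc tw.td.sG' tw.op.sG' d1 d2 b1 b2
proof (rule irrep_pair.intro)
  have "symmetric_constants H tw.td.sc tw.td.sG'" using tw.td.sc_symmetric by simp
  then show "symmetric_constants_irrep H tw.td.sc tw.td.sG' d1 b1"
    unfolding b1_def
  proof (rule dual_algebra_irrep)
    show "alg_irrep (dual_algebra H (\<lambda>x. indicator {(x, x)} \<otimes>\<^bsub>group_algebra (\<Gamma> \<times>\<times> \<Gamma>)\<^esub> J)) d1 \<tau>1"
      using irrep1 by (simp add: A1_dual_def)
    show "(indicator {(x, x)} \<otimes>\<^bsub>group_algebra (\<Gamma> \<times>\<times> \<Gamma>)\<^esub> J) (a, b) = tw.td.sc a b x"
      if "a \<in> H" "b \<in> H" "x \<in> H" for a b x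
      using that by (intro tw.A1_constants) simp_all
  qed
  have "symmetric_constants H tw.op.sc tw.op.sG'" using tw.op.sc_symmetric by simp
  then show "symmetric_constants_irrep H tw.op.sc tw.op.sG' d2 b2"
    unfolding b2_def
  proof (rule dual_algebra_irrep)
    show "alg_irrep (dual_algebra H (\<lambda>x. tw.Jinv \<otimes>\<^bsub>group_algebra (\<Gamma> \<times>\<times> \<Gamma>)\<^esub> indicator {(x, x)})) d2 \<tau>2"
      using irrep2 by (simp add: A2_dual_def tw.Jinv_def)
    show "(tw.Jinv \<otimes>\<^bsub>group_algebra (\<Gamma> \<times>\<times> \<Gamma>)\<^esub> indicator {(x, x)}) (a, b) = tw.op.sc a b x"
      if "a \<in> H" "b \<in> H" "x \<in> H" for a b x
      using that by (intro tw.A2_constants) simp_all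
  qed
qed

lemma sc_sum1: "x \<in> H \<Longrightarrow> (\<Sum>a\<in>H. \<Sum>b\<in>H. tw.td.sc a b x * F a b)
    = pairing H (curry J) (\<lambda>s t. F (x \<otimes> s) (x \<otimes> t))"
  using tw.td.sc_sum[of x F] by simp

lemma sc_sum2: "x \<in> H \<Longrightarrow> (\<Sum>a\<in>H. \<Sum>b\<in>H. tw.op.sc a b x * F a b)
    = pairing H (curry tw.Jinv) (\<lambda>s t. F (s \<otimes> x) (t \<otimes> x))"
  using tw.op.sc_sum[of x F] by simp

definition Z :: "'a set" where "Z = {x \<otimes> g \<otimes> y | x y. x \<in> H \<and> y \<in> H}"

lemma Z_I: "x \<in> H \<Longrightarrow> y \<in> H \<Longrightarrow> x \<otimes> g \<otimes> y \<in> Z"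
  unfolding Z_def by blast

lemma Z_translate:
  assumes x: "x \<in> H" "y \<in> H" and w: "w \<in> carrier G" "x \<otimes> w \<otimes> y \<in> Z"
  shows "w \<in> Z"
proof -
  obtain a b where ab: "a \<in> H" "b \<in> H" "x \<otimes> w \<otimes> y = a \<otimes> g \<otimes> b" using w(2) by (auto simp: Z_def)
  note [simp] = H_G[OF x(1)] H_G[OF x(2)] H_G[OF ab(1)] H_G[OF ab(2)] g w(1)
  have "w = inv x \<otimes> (x \<otimes> w \<otimes> y) \<otimes> inv y" by (simp add: m_assoc cancel)
  also have "\<dots> = (inv x \<otimes> a) \<otimes> g \<otimes> (b \<otimes> inv y)" unfolding ab(3) by (simp add: m_assoc)
  also have "\<dots> \<in> Z" using x ab H_closed by (intro Z_I) auto
  finally show ?thesis .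
qed

lemma Z_unique:
  assumes "Z0 \<in> double_cosets G H" "g \<in> Z0" shows "Z0 = Z"
proof -
  obtain w where w: "w \<in> carrier G" "Z0 = H <#> {w} <#> H" using assms(1) by (auto simp: double_cosets_def)
  have Z0: "Z0 = {x \<otimes> w \<otimes> y | x y. x \<in> H \<and> y \<in> H}"
    unfolding w(2) set_mult_def by blast
  obtain a b where ab: "a \<in> H" "b \<in> H" "g = a \<otimes> w \<otimes> b" using assms(2) Z0 by auto
  note [simp] = H_G[OF ab(1)] H_G[OF ab(2)] w(1)
  have g1: "x \<otimes> g \<otimes> y = (x \<otimes> a) \<otimes> w \<otimes> (b \<otimes> y)" if "x \<in> H" "y \<in> H" for x y
    using H_G[OF that(1)] H_G[OF that(2)] by (simp add: ab(3) m_assoc)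
  have g2: "x \<otimes> w \<otimes> y = (x \<otimes> inv a) \<otimes> g \<otimes> (inv b \<otimes> y)" if "x \<in> H" "y \<in> H" for x y
    using H_G[OF that(1)] H_G[OF that(2)] by (simp add: ab(3) m_assoc cancel)
  show ?thesis
  proof (intro equalityI subsetI)
    fix v assume "v \<in> Z0"
    then obtain x y where xy: "x \<in> H" "y \<in> H" "v = x \<otimes> w \<otimes> y" using Z0 by auto
    show "v \<in> Z" unfolding xy(3) g2[OF xy(1,2)] using xy ab H_closed by (intro Z_I) auto
  next
    fix v assume "v \<in> Z"
    then obtain x y where xy: "x \<in> H" "y \<in> H" "v = x \<otimes> g \<otimes> y" by (auto simp: Z_def)
    have "x \<otimes> a \<in> H" "b \<otimes> y \<in> H" using xy ab H_closed by auto
    then show "v \<in> Z0" unfolding xy(3) g1[OF xy(1,2)] Z0 by blast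
  qed
qed

abbreviation "AZ \<equiv> double_coset_algebra G H J Z"

lemma AZ_simps:
  "carrier AZ = vectors_on Z" "one AZ = indicator Z" "add AZ = (\<lambda>\<phi> \<psi> x. \<phi> x + \<psi> x)"
  "module.smult AZ = (\<lambda>c \<phi> x. c * \<phi> x)"
  by (simp_all add: double_coset_algebra_def twisted_dual_def dual_algebra_def)

text \<open>The structure of the double coset algebra in functional form: the value at \<open>w\<close> of a product only
  involves the translates \<open>s w u\<close> and \<open>t w v\<close> with \<open>s, t, u, v\<close> in \<open>H\<close>.\<close>

lemma AZ_mult:
  assumes w: "w \<in> carrier G"
  shows "(\<phi> \<otimes>\<^bsub>AZ\<^esub> \<psi>) w = pairing H (curry tw.Jinv) (\<lambda>s t. pairing H (curry J)
    (\<lambda>u v. \<phi> (s \<otimes> w \<otimes> u) * \<psi> (t \<otimes> w \<otimes> v)))"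
proof -
  let ?C = "carrier G" and ?C2 = "group_algebra (G \<times>\<times> G)"
  let ?F = "\<lambda>(a, b). \<phi> a * \<psi> b"
  have J: "J \<in> vectors_on (H \<times> H)" "tw.Jinv \<in> vectors_on (H \<times> H)" using tw.J_closed by simp_all
  have ind: "pairing ?C (curry (indicator {(w, w)})) f = f w w" for f
    using pairing_curry[of "indicator {(w, w)}" "case_prod f" ?C] indicator_sum[of "?C \<times> ?C" "(w, w)" "case_prod f"] finite_G w
    by simp
  have sq: "pairing ?C (curry (u \<otimes>\<^bsub>?C2\<^esub> v)) F
      = pairing ?C (curry u) (\<lambda>s t. pairing ?C (curry v) (\<lambda>a b. F (s \<otimes> a) (t \<otimes> b)))" for u v F
    using square_pairing[OF is_group finite_G, of u v "case_prod F"] by (simp add: pairing_curry)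
  have "(\<phi> \<otimes>\<^bsub>AZ\<^esub> \<psi>) w = (\<Sum>p\<in>?C \<times> ?C. (tw.Jinv \<otimes>\<^bsub>?C2\<^esub> indicator {(w, w)} \<otimes>\<^bsub>?C2\<^esub> J) p * ?F p)"
    using w by (simp add: double_coset_algebra_def twisted_dual_def dual_algebra_def twisted_comult_def Let_def
        tw.Jinv_def case_prod_beta mult.commute)
  also have "\<dots> = pairing ?C (curry (tw.Jinv \<otimes>\<^bsub>?C2\<^esub> indicator {(w, w)}))
      (\<lambda>s t. pairing ?C (curry J) (\<lambda>u v. \<phi> (s \<otimes> u) * \<psi> (t \<otimes> v)))"
    unfolding square_pairing[OF is_group finite_G] by simp
  also have "\<dots> = pairing ?C (curry tw.Jinv) (\<lambda>s t. pairing ?C (curry J) (\<lambda>u v. \<phi> (s \<otimes> w \<otimes> u) * \<psi> (t \<otimes> w \<otimes> v)))"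
    unfolding sq ind ..
  also have "\<dots> = pairing H (curry tw.Jinv) (\<lambda>s t. pairing H (curry J) (\<lambda>u v. \<phi> (s \<otimes> w \<otimes> u) * \<psi> (t \<otimes> w \<otimes> v)))"
    unfolding pairing_restrict[OF finite_G H_sub J(1)] pairing_restrict[OF finite_G H_sub J(2)] ..
  finally show ?thesis .
qed

lemma AZ_mult_closed:
  assumes "\<phi> \<in> vectors_on Z" shows "\<phi> \<otimes>\<^bsub>AZ\<^esub> \<psi> \<in> vectors_on Z"
  unfolding vectors_on_def
proof (intro CollectI allI impI)
  fix w assume w: "w \<notin> Z"
  show "(\<phi> \<otimes>\<^bsub>AZ\<^esub> \<psi>) w = 0"
  proof (cases "w \<in> carrier G")
    case True
    have "\<phi> (s \<otimes> w \<otimes> u) = 0" if "s \<in> H" "u \<in> H" for s u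
      using Z_translate[OF that True] w assms by (auto simp: vectors_on_def)
    then show ?thesis unfolding AZ_mult[OF True] by (simp add: pairing_def)
  qed (simp add: double_coset_algebra_def twisted_dual_def dual_algebra_def)
qed

text \<open>The map from \<open>H \<times> H\<close> onto the double coset. The first coordinate \<open>y\<close> indexes the first dual algebra, in
  which \<open>J\<close> multiplies from the right, and so stands to the right of \<open>g\<close>; the second one stands to the left.\<close>

definition orbit_point :: "'a \<times> 'a \<Rightarrow> 'a" where "orbit_point p = snd p \<otimes> g \<otimes> fst p"

text \<open>A function on the double coset, pulled back to \<open>H \<times> H\<close>, is an element of the tensor product of the
  two dual algebras, which acts on the tensor product of their modules.\<close>

definition \<Theta> :: "('a \<Rightarrow> complex) \<Rightarrow> complex mat" where
  "\<Theta> \<phi> = msum D D (\<lambda>p. \<phi> (orbit_point p) \<cdot>\<^sub>m B p) (H \<times> H)"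

lemma orbit_point_Z: "p \<in> H \<times> H \<Longrightarrow> orbit_point p \<in> Z"
  unfolding orbit_point_def by (intro Z_I) auto

lemma \<Theta>_carrier [simp]: "\<Theta> \<phi> \<in> carrier_mat D D"
  by (simp add: \<Theta>_def)

lemma \<Theta>_add: "\<Theta> (\<lambda>x. \<phi> x + \<psi> x) = \<Theta> \<phi> + \<Theta> \<psi>"
  unfolding \<Theta>_def
  by (subst msum_add[symmetric]) (auto intro!: msum_cong add_smult_distrib_right_mat[OF B_carrier])

lemma \<Theta>_smult: "\<Theta> (\<lambda>x. c * \<phi> x) = c \<cdot>\<^sub>m \<Theta> \<phi>"
  unfolding \<Theta>_def by (subst smult_msum) (auto intro!: msum_cong simp: smult_smult_mat)

lemma \<Theta>_one: "\<Theta> (indicator Z) = 1\<^sub>m D"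
  unfolding \<Theta>_def B_one[symmetric] by (rule msum_cong) (simp add: orbit_point_Z one_smult_mat)

text \<open>For \<open>w = x g y\<close> the comultiplication factors as
  \<open>J\<inverse> (w \<otimes> w) J = (J\<inverse> (x \<otimes> x)) (g \<otimes> g) ((y \<otimes> y) J)\<close>, where the outer factors are the
  comultiplications of the two one-sided twists.\<close>

lemma \<Theta>_mult: "\<Theta> (\<phi> \<otimes>\<^bsub>AZ\<^esub> \<psi>) = \<Theta> \<phi> * \<Theta> \<psi>"
proof -
  have "\<Theta> \<phi> * \<Theta> \<psi> = msum D D (\<lambda>r. (\<Sum>p\<in>H \<times> H. \<Sum>q\<in>H \<times> H. \<phi> (orbit_point p) * \<psi> (orbit_point q)
      * (tw.td.sc (fst p) (fst q) (fst r) * tw.op.sc (snd p) (snd q) (snd r))) \<cdot>\<^sub>m B r) (H \<times> H)"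
    unfolding \<Theta>_def by (rule msum_product[OF B_carrier B_mult])
  also have "\<dots> = msum D D (\<lambda>r. (\<phi> \<otimes>\<^bsub>AZ\<^esub> \<psi>) (orbit_point r) \<cdot>\<^sub>m B r) (H \<times> H)"
  proof (rule msum_cong)
    fix r assume "r \<in> H \<times> H"
    then obtain y x where r: "r = (y, x)" "y \<in> H" "x \<in> H" by auto
    define f where "f x1 y1 x2 y2 = \<phi> (x1 \<otimes> g \<otimes> y1) * \<psi> (x2 \<otimes> g \<otimes> y2)" for x1 y1 x2 y2
    note [simp] = H_G[OF r(2)] H_G[OF r(3)] g
    have "(\<Sum>p\<in>H \<times> H. \<Sum>q\<in>H \<times> H. \<phi> (orbit_point p) * \<psi> (orbit_point q)
        * (tw.td.sc (fst p) (fst q) y * tw.op.sc (snd p) (snd q) x))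
      = (\<Sum>y1\<in>H. \<Sum>x1\<in>H. \<Sum>y2\<in>H. \<Sum>x2\<in>H. tw.op.sc x1 x2 x * (tw.td.sc y1 y2 y * f x1 y1 x2 y2))"
      unfolding sum.cartesian_product' fst_conv snd_conv orbit_point_def f_def by (simp only: mult_ac)
    also have "\<dots> = (\<Sum>x1\<in>H. \<Sum>y1\<in>H. \<Sum>y2\<in>H. \<Sum>x2\<in>H. tw.op.sc x1 x2 x * (tw.td.sc y1 y2 y * f x1 y1 x2 y2))"
      by (rule sum.swap)
    also have "\<dots> = (\<Sum>x1\<in>H. \<Sum>x2\<in>H. \<Sum>y1\<in>H. \<Sum>y2\<in>H. tw.op.sc x1 x2 x * (tw.td.sc y1 y2 y * f x1 y1 x2 y2))"
      by (rule sum.cong[OF refl]) (rule sum_rotate[symmetric])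
    also have "\<dots> = (\<Sum>x1\<in>H. \<Sum>x2\<in>H. tw.op.sc x1 x2 x * (\<Sum>y1\<in>H. \<Sum>y2\<in>H. tw.td.sc y1 y2 y * f x1 y1 x2 y2))"
      by (simp only: sum_distrib_left)
    also have "\<dots> = pairing H (curry tw.Jinv) (\<lambda>s t. pairing H (curry J) (\<lambda>u v. f (s \<otimes> x) (y \<otimes> u) (t \<otimes> x) (y \<otimes> v)))"
      unfolding sc_sum1[OF r(2)] sc_sum2[OF r(3)] ..
    also have "\<dots> = pairing H (curry tw.Jinv) (\<lambda>s t. pairing H (curry J)
        (\<lambda>u v. \<phi> (s \<otimes> (x \<otimes> g \<otimes> y) \<otimes> u) * \<psi> (t \<otimes> (x \<otimes> g \<otimes> y) \<otimes> v)))"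
      unfolding f_def by (intro pairing_cong) (simp add: H_G m_assoc)
    also have "\<dots> = (\<phi> \<otimes>\<^bsub>AZ\<^esub> \<psi>) (orbit_point r)"
      unfolding r(1) orbit_point_def by (subst AZ_mult) simp_all
    finally show "(\<Sum>p\<in>H \<times> H. \<Sum>q\<in>H \<times> H. \<phi> (orbit_point p) * \<psi> (orbit_point q)
        * (tw.td.sc (fst p) (fst q) (fst r) * tw.op.sc (snd p) (snd q) (snd r))) \<cdot>\<^sub>m B r
      = (\<phi> \<otimes>\<^bsub>AZ\<^esub> \<psi>) (orbit_point r) \<cdot>\<^sub>m B r"
      by (simp add: r(1))
  qed
  finally show ?thesis by (simp add: \<Theta>_def)
qed

lemma coefficient_trace:
  assumes q: "q \<in> H \<times> H"
  shows "mtrace (msum D D (\<lambda>p. a p \<cdot>\<^sub>m B p) (H \<times> H) * B' q) = a q"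
proof -
  have "msum D D (\<lambda>p. a p \<cdot>\<^sub>m B p) (H \<times> H) * B' q = msum D D (\<lambda>p. (a p \<cdot>\<^sub>m B p) * B' q) (H \<times> H)"
    by (rule msum_mult) auto
  also have "\<dots> = msum D D (\<lambda>p. a p \<cdot>\<^sub>m (B p * B' q)) (H \<times> H)"
    by (rule msum_cong) (rule mult_smult_assoc_mat[OF B_carrier B'_carrier])
  finally have "mtrace (msum D D (\<lambda>p. a p \<cdot>\<^sub>m B p) (H \<times> H) * B' q) = (\<Sum>p\<in>H \<times> H. a p * (if p = q then 1 else 0))"
    by (simp add: mtrace_msum[OF smult_carrier_mat[OF square_mult_carrier[OF B_carrier B'_carrier]]]
        mtrace_smult[OF square_mult_carrier[OF B_carrier B'_carrier]] B_trace q)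
  then show ?thesis using q finite_H by (simp add: sum_delta_left)
qed

lemma \<Theta>_inj: "inj_on \<Theta> (vectors_on Z)"
proof (rule inj_onI, rule ext)
  fix \<phi> \<psi> x assume v: "\<phi> \<in> vectors_on Z" "\<psi> \<in> vectors_on Z" and eq: "\<Theta> \<phi> = \<Theta> \<psi>"
  show "\<phi> x = \<psi> x"
  proof (cases "x \<in> Z")
    case True
    then obtain a b where ab: "a \<in> H" "b \<in> H" "x = a \<otimes> g \<otimes> b" by (auto simp: Z_def)
    then have p: "(b, a) \<in> H \<times> H" and x: "x = orbit_point (b, a)" by (simp_all add: orbit_point_def)
    show ?thesis using coefficient_trace[OF p, of "\<lambda>p. \<phi> (orbit_point p)"]
        coefficient_trace[OF p, of "\<lambda>p. \<psi> (orbit_point p)"] eq unfolding \<Theta>_def x by simp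
  qed (use v in \<open>simp add: vectors_on_def\<close>)
qed

subsection \<open>The fibres of the orbit map\<close>

abbreviation "KG \<equiv> K_subgroup G H g"

lemma KG_D:
  assumes "a \<in> KG" shows "a \<in> H" "inv g \<otimes> a \<otimes> g \<in> H" "a \<in> carrier G"
proof -
  obtain h where h: "a \<in> H" "h \<in> H" "a = g \<otimes> h \<otimes> inv g" using assms by (auto simp: K_subgroup_def)
  have "inv g \<otimes> a \<otimes> g = h" unfolding h(3) using g H_G[OF h(2)] by (simp add: m_assoc cancel)
  then show "a \<in> H" "inv g \<otimes> a \<otimes> g \<in> H" "a \<in> carrier G" using h H_G by auto
qed

lemma KG_I:
  assumes "a \<in> H" "inv g \<otimes> a \<otimes> g \<in> H" shows "a \<in> KG"
proof -
  have "a = g \<otimes> (inv g \<otimes> a \<otimes> g) \<otimes> inv g" using g H_G[OF assms(1)] by (simp add: m_assoc cancel)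
  then show ?thesis using assms by (auto simp: K_subgroup_def)
qed

lemma subgroup_KG: "subgroup KG G"
proof (rule subgroupI)
  show "KG \<subseteq> carrier G" using KG_D(3) by blast
  have "\<one> \<in> KG" by (rule KG_I) (use g H_closed in simp_all)
  then show "KG \<noteq> {}" by blast
  fix a assume a: "a \<in> KG"
  note [simp] = KG_D(3)[OF a] g
  have "inv g \<otimes> inv a \<otimes> g = inv (inv g \<otimes> a \<otimes> g)" by (simp add: inv_mult_group m_assoc)
  then show "inv a \<in> KG" using KG_D[OF a] H_closed(2) by (intro KG_I) auto
  fix b assume b: "b \<in> KG"
  note [simp] = KG_D(3)[OF b]
  have "inv g \<otimes> (a \<otimes> b) \<otimes> g = (inv g \<otimes> a \<otimes> g) \<otimes> (inv g \<otimes> b \<otimes> g)" by (simp add: m_assoc cancel)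
  then show "a \<otimes> b \<in> KG" using KG_D[OF a] KG_D[OF b] H_closed(1) by (intro KG_I) auto
qed

text \<open>The action of the intersection of \<open>H\<close> with its conjugate on \<open>H \<times> H\<close>: on the first coordinate as in \<open>V\<^sub>1\<close>
  pulled back by \<open>a \<mapsto> g\<inverse> a g\<close>, on the second one as in \<open>V\<^sub>2\<close>. It is free, and its orbits are the
  fibres of the map to the double coset.\<close>

definition move :: "'a \<Rightarrow> 'a \<times> 'a \<Rightarrow> 'a \<times> 'a" where
  "move a p = (inv g \<otimes> a \<otimes> g \<otimes> fst p, snd p \<otimes> inv a)"

lemma move_closed: "a \<in> KG \<Longrightarrow> p \<in> H \<times> H \<Longrightarrow> move a p \<in> H \<times> H"
  unfolding move_def using KG_D[of a] H_closed by auto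

lemma move_orbit_point:
  assumes a: "a \<in> KG" and p: "p \<in> H \<times> H" shows "orbit_point (move a p) = orbit_point p"
proof -
  obtain y x where "p = (y, x)" "y \<in> carrier G" "x \<in> carrier G" using p H_G by auto
  then show ?thesis using KG_D(3)[OF a] g by (simp add: move_def orbit_point_def m_assoc cancel)
qed

lemma move_inv:
  assumes a: "a \<in> KG" and p: "p \<in> H \<times> H"
  shows "move (inv a) (move a p) = p" "move a (move (inv a) p) = p"
proof -
  obtain y x where "p = (y, x)" "y \<in> carrier G" "x \<in> carrier G" using p H_G by auto
  then show "move (inv a) (move a p) = p" "move a (move (inv a) p) = p"
    using KG_D(3)[OF a] g by (simp_all add: move_def m_assoc cancel)
qed

lemma move_bij: assumes a: "a \<in> KG" shows "bij_betw (move a) (H \<times> H) (H \<times> H)"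
proof (rule bij_betw_byWitness[of _ "move (inv a)"])
  show "\<forall>q\<in>H \<times> H. move (inv a) (move a q) = q" "\<forall>q\<in>H \<times> H. move a (move (inv a) q) = q"
    using move_inv[OF a] by blast+
  show "move a ` (H \<times> H) \<subseteq> H \<times> H" "move (inv a) ` (H \<times> H) \<subseteq> H \<times> H"
    using move_closed[OF a] move_closed[OF subgroup.m_inv_closed[OF subgroup_KG a]] by blast+
qed

lemma move_fixed_point_free:
  assumes a: "a \<in> KG" "a \<noteq> \<one>" and p: "p \<in> H \<times> H" shows "move a p \<noteq> p"
proof
  assume eq: "move a p = p"
  obtain y x where yx: "p = (y, x)" "y \<in> carrier G" "x \<in> carrier G" using p H_G by auto
  then have "x \<otimes> inv a = x \<otimes> \<one>" using eq by (simp add: move_def)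
  then have "inv x \<otimes> (x \<otimes> inv a) = inv x \<otimes> (x \<otimes> \<one>)" by simp
  then have "inv a = \<one>" using yx KG_D(3)[OF a(1)] by (simp add: cancel)
  then have "inv (inv a) = \<one>" by simp
  then show False using a KG_D(3)[OF a(1)] by simp
qed

lemma same_orbit_point:
  assumes p: "p \<in> H \<times> H" and q: "q \<in> H \<times> H" and eq: "orbit_point p = orbit_point q"
  obtains a where "a \<in> KG" "q = move a p"
proof -
  obtain y x where yx: "p = (y, x)" "y \<in> H" "x \<in> H" using p by auto
  obtain y' x' where yx': "q = (y', x')" "y' \<in> H" "x' \<in> H" using q by auto
  note [simp] = H_G[OF yx(2)] H_G[OF yx(3)] H_G[OF yx'(2)] H_G[OF yx'(3)] g
  have e: "x \<otimes> g \<otimes> y = x' \<otimes> g \<otimes> y'" using eq by (simp add: orbit_point_def yx yx')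
  define a where "a = inv x' \<otimes> x"
  have aG [simp]: "a \<in> carrier G" by (simp add: a_def)
  have "a \<otimes> g \<otimes> y = inv x' \<otimes> (x \<otimes> g \<otimes> y)" by (simp add: a_def m_assoc)
  also have "\<dots> = g \<otimes> y'" unfolding e by (simp add: m_assoc cancel)
  finally have agy: "a \<otimes> g \<otimes> y = g \<otimes> y'" .
  have "inv g \<otimes> a \<otimes> g \<otimes> y = inv g \<otimes> (a \<otimes> g \<otimes> y)" by (simp add: m_assoc)
  also have "\<dots> = y'" unfolding agy by (simp add: cancel)
  finally have y': "inv g \<otimes> a \<otimes> g \<otimes> y = y'" .
  have "inv g \<otimes> a \<otimes> g = y' \<otimes> inv y" unfolding y'[symmetric] by (simp add: m_assoc)
  then have "a \<in> KG" using yx yx' H_closed by (intro KG_I) (auto simp: a_def)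
  moreover have "q = move a p" using y' by (simp add: move_def yx(1) yx'(1) a_def inv_mult_group cancel)
  ultimately show thesis by (rule that)
qed

end

section \<open>The double coset algebra as a commutant\<close>

locale linearized_double_coset = double_coset +
  fixes K' :: "('k, 'l) monoid_scheme" and p :: "'k \<Rightarrow> 'a" and \<pi> :: "'k \<Rightarrow> complex mat" and \<chi> :: "'k \<Rightarrow> complex"
  assumes lin: "linearization (G\<lparr>carrier := K_subgroup G H g\<rparr>) (d1 * d2)
      (\<lambda>a. pgl_tensor (V1_proj (G\<lparr>carrier := H\<rparr>) J d1 \<tau>1 (inv g \<otimes> a \<otimes> g)) (V2_proj (G\<lparr>carrier := H\<rparr>) J d2 \<tau>2 a)) K' p \<pi>"
    and central_character: "acts_by (kernel K' (G\<lparr>carrier := K_subgroup G H g\<rparr>) p) \<chi> (d1 * d2) \<pi>"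
begin

abbreviation "K \<equiv> G\<lparr>carrier := KG\<rparr>"

lemma lin_facts:
  shows grp: "group K'" and p_hom: "p \<in> hom K' K" and p_surj: "p ` carrier K' = KG" and \<pi>_hom: "\<pi> \<in> hom K' (GL D)"
    and \<pi>_coset: "k \<in> carrier K' \<Longrightarrow> scalar_matrices D #>\<^bsub>GL D\<^esub> \<pi> k
      = pgl_tensor (V1_proj \<Gamma> J d1 \<tau>1 (inv g \<otimes> p k \<otimes> g)) (V2_proj \<Gamma> J d2 \<tau>2 (p k))"
  using lin by (auto simp: linearization_def central_extension_def epi_def)

lemma p_KG: "k \<in> carrier K' \<Longrightarrow> p k \<in> KG"
  using p_surj by blast

lemma \<pi>_GL: "k \<in> carrier K' \<Longrightarrow> \<pi> k \<in> carrier (GL D)"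
  using \<pi>_hom by (auto simp: hom_def)

text \<open>The matrix of \<open>k\<close> is a Kronecker product of matrices implementing the two algebra automorphisms, and
  these permute the bases of functions \<open>\<delta>\<^sub>y\<close>.\<close>

lemma \<pi>_permutes_basis:
  assumes k: "k \<in> carrier K'" and q: "q \<in> H \<times> H"
  shows "\<pi> k * B q = B (move (p k) q) * \<pi> k"
proof -
  define a where "a = p k"
  have a: "a \<in> KG" using p_KG[OF k] by (simp add: a_def)
  note aH = KG_D[OF a]
  obtain y x where yx: "q = (y, x)" "y \<in> H" "x \<in> H" using q by auto
  have "1 \<cdot>\<^sub>m 1\<^sub>m D \<in> scalar_matrices D" unfolding scalar_matrices_def by force
  moreover have "(1 \<cdot>\<^sub>m 1\<^sub>m D) * \<pi> k = \<pi> k" using carrier_GL_mat[OF \<pi>_GL[OF k]] by (simp add: one_smult_mat)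
  ultimately have "\<pi> k \<in> scalar_matrices D #>\<^bsub>GL D\<^esub> \<pi> k"
    unfolding r_coset_def GL_simps by (intro UN_I[of "1 \<cdot>\<^sub>m 1\<^sub>m D"]) simp_all
  then obtain S T where ST: "\<pi> k = kronecker S T" "S \<in> V1_proj \<Gamma> J d1 \<tau>1 (inv g \<otimes> a \<otimes> g)" "T \<in> V2_proj \<Gamma> J d2 \<tau>2 a"
    unfolding \<pi>_coset[OF k] pgl_tensor_def a_def by blast
  have \<rho>1: "\<rho>1 \<Gamma> (inv g \<otimes> a \<otimes> g) (indicator {y}) = indicator {inv g \<otimes> a \<otimes> g \<otimes> y}"
    unfolding \<rho>1_def using finite_H yx by (simp add: lin_ext_indicator)
  have S: "S \<in> carrier_mat d1 d1" "S * b1 y = b1 (inv g \<otimes> a \<otimes> g \<otimes> y) * S"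
    using conj_class_on_basis[OF ST(2)[unfolded V1_proj_def A1_dual_def] _ \<rho>1] yx L.b_carrier by (simp_all add: b1_def)
  have "\<rho>2 \<Gamma> a (indicator {x}) = indicator {x \<otimes> inv\<^bsub>\<Gamma>\<^esub> a}"
    unfolding \<rho>2_def using finite_H yx by (simp add: lin_ext_indicator)
  also have "inv\<^bsub>\<Gamma>\<^esub> a = inv a" using aH(1) subgroup_H by (rule m_inv_consistent[OF _ _, rotated])
  finally have \<rho>2: "\<rho>2 \<Gamma> a (indicator {x}) = indicator {x \<otimes> inv a}" .
  have T: "T \<in> carrier_mat d2 d2" "T * b2 x = b2 (x \<otimes> inv a) * T"
    using conj_class_on_basis[OF ST(3)[unfolded V2_proj_def A2_dual_def] _ \<rho>2] yx R.b_carrier by (simp_all add: b2_def)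
  have m: "inv g \<otimes> a \<otimes> g \<otimes> y \<in> H" "x \<otimes> inv a \<in> H" using yx aH H_closed by auto
  note bc = L.b_carrier[OF yx(2)] R.b_carrier[OF yx(3)] L.b_carrier[OF m(1)] R.b_carrier[OF m(2)]
  have "\<pi> k * B q = kronecker (S * b1 y) (T * b2 x)"
    unfolding ST(1) B_def yx(1) fst_conv snd_conv by (rule kronecker_mult[OF S(1) bc(1) T(1) bc(2)])
  also have "\<dots> = B (move a q) * \<pi> k"
    unfolding S(2) T(2) ST(1) B_def move_def yx(1) fst_conv snd_conv
    by (rule kronecker_mult[OF bc(3) S(1) bc(4) T(1), symmetric])
  finally show ?thesis by (simp add: a_def)
qed

lemma \<pi>_power:
  assumes k: "k \<in> carrier K'" shows "\<pi> (k [^]\<^bsub>K'\<^esub> (n :: nat)) = \<pi> k ^\<^sub>m n"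
proof -
  interpret K': group K' by (rule grp)
  interpret h: group_hom K' "GL D" \<pi> by (intro group_hom.intro group_hom_axioms.intro grp group_GL \<pi>_hom)
  show ?thesis
  proof (induction n)
    case 0
    show ?case using h.hom_one carrier_GL_mat[OF \<pi>_GL[OF k]] by simp
  next
    case (Suc n)
    then show ?case using h.hom_mult[of "k [^]\<^bsub>K'\<^esub> n" k] k by simp
  qed
qed

text \<open>The permutation of the basis by a nontrivial element is free, and some power of the matrix is scalar
  since the quotient group is finite.\<close>

lemma \<pi>_trace:
  assumes k: "k \<in> carrier K'" and nt: "p k \<noteq> \<one>"
  shows "mtrace (\<pi> k) = 0"
proof -
  interpret K': group K' by (rule grp)
  interpret K: group K by (rule subgroup.subgroup_is_group[OF subgroup_KG is_group])
  interpret h: group_hom K' K p by (intro group_hom.intro group_hom_axioms.intro grp K.is_group p_hom)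
  note U = carrier_GL_mat[OF \<pi>_GL[OF k]]
  obtain V where V: "V \<in> carrier_mat D D" "\<pi> k * V = 1\<^sub>m D" "V * \<pi> k = 1\<^sub>m D"
    using \<pi>_GL[OF k] by (auto simp: carrier_GL_iff)
  have finK: "finite (carrier K)" using finite_subset[OF H_sub finite_G] KG_D(1) by (auto intro: finite_subset[of _ H])
  define m where "m = Coset.order K"
  have m0: "m > 0" using K.order_gt_0_iff_finite finK by (simp add: m_def)
  have "p (k [^]\<^bsub>K'\<^esub> m) = p k [^]\<^bsub>K\<^esub> m" by (rule h.hom_nat_pow[OF k])
  also have "\<dots> = \<one>\<^bsub>K\<^esub>" unfolding m_def by (rule K.pow_order_eq_1) (use p_KG[OF k] in simp)
  finally have "k [^]\<^bsub>K'\<^esub> m \<in> kernel K' K p" using k by (simp add: kernel_def)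
  then have pow: "\<pi> k ^\<^sub>m m = \<chi> (k [^]\<^bsub>K'\<^esub> m) \<cdot>\<^sub>m 1\<^sub>m D"
    using central_character \<pi>_power[OF k] by (auto simp: acts_by_def)
  have "\<chi> (k [^]\<^bsub>K'\<^esub> m) \<noteq> 0"
  proof
    assume "\<chi> (k [^]\<^bsub>K'\<^esub> m) = 0"
    then have z: "\<pi> (k [^]\<^bsub>K'\<^esub> m) = 0\<^sub>m D D" using pow \<pi>_power[OF k] by (simp add: zero_smult_mat[OF one_carrier_mat])
    have "\<pi> (k [^]\<^bsub>K'\<^esub> m) \<in> carrier (GL D)" by (rule \<pi>_GL) (use k in simp)
    then obtain W where "W \<in> carrier_mat D D" "W * 0\<^sub>m D D = (1\<^sub>m D :: complex mat)"
      unfolding z carrier_GL_iff by blast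
    then have "0\<^sub>m D D = (1\<^sub>m D :: complex mat)" by simp
    from arg_cong[OF this, of "\<lambda>M. M $$ (0, 0)"] show False using D_pos by simp
  qed
  then show ?thesis
  proof (rule trace_zero_of_finite_order[OF U V(1,2) pow _ m0])
    show "mtrace (\<pi> k) * mtrace V = 0"
      by (rule trace_of_fixed_point_free[OF U V(1,2), of "move (p k)"])
        (use move_closed move_fixed_point_free \<pi>_permutes_basis p_KG[OF k] k nt in auto)
  qed
qed

sublocale er: extension_rep K K' p \<pi> \<chi> D
proof (intro extension_rep.intro extension_rep_axioms.intro)
  show "group K" by (rule subgroup.subgroup_is_group[OF subgroup_KG is_group])
  show "group K'" by (rule grp)
  show "finite (carrier K)" using finite_H KG_D(1) by (auto intro: finite_subset[of _ H])
  show "p \<in> hom K' K" by (rule p_hom)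
  show "p ` carrier K' = carrier K" using p_surj by simp
  show "\<pi> \<in> hom K' (GL D)" by (rule \<pi>_hom)
  show "acts_by (kernel K' K p) \<chi> D \<pi>" by (rule central_character)
  show "D > 0" by (rule D_pos)
  show "mtrace (\<pi> k) = 0" if "k \<in> carrier K'" "p k \<noteq> \<one>\<^bsub>K\<^esub>" for k using \<pi>_trace that by simp
qed

lemma \<pi>_coefficients:
  assumes k: "k \<in> carrier K'"
  shows "\<pi> k * msum D D (\<lambda>q. a q \<cdot>\<^sub>m B q) (H \<times> H)
    = msum D D (\<lambda>q. a (move (inv (p k)) q) \<cdot>\<^sub>m B q) (H \<times> H) * \<pi> k"
proof -
  note U = carrier_GL_mat[OF \<pi>_GL[OF k]] and K = p_KG[OF k]
  have "\<pi> k * msum D D (\<lambda>q. a q \<cdot>\<^sub>m B q) (H \<times> H) = msum D D (\<lambda>q. \<pi> k * (a q \<cdot>\<^sub>m B q)) (H \<times> H)"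
    by (rule mult_msum[OF U]) auto
  also have "\<dots> = msum D D (\<lambda>q. (\<lambda>r. (a (move (inv (p k)) r) \<cdot>\<^sub>m B r) * \<pi> k) (move (p k) q)) (H \<times> H)"
    by (rule msum_cong)
      (simp add: mult_smult_distrib[OF U B_carrier] mult_smult_assoc_mat[OF B_carrier[OF move_closed[OF K]] U]
        move_inv(1)[OF K] \<pi>_permutes_basis[OF k])
  also have "\<dots> = msum D D (\<lambda>r. (a (move (inv (p k)) r) \<cdot>\<^sub>m B r) * \<pi> k) (H \<times> H)"
    by (rule msum_reindex[OF move_bij[OF K]])
  also have "\<dots> = msum D D (\<lambda>q. a (move (inv (p k)) q) \<cdot>\<^sub>m B q) (H \<times> H) * \<pi> k"
    by (rule msum_mult[OF U, symmetric]) auto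
  finally show ?thesis .
qed

lemma \<Theta>_in_commutant: "\<Theta> \<phi> \<in> er.commutant"
proof -
  have "\<Theta> \<phi> * \<pi> k = \<pi> k * \<Theta> \<phi>" if k: "k \<in> carrier K'" for k
    unfolding \<Theta>_def \<pi>_coefficients[OF k]
    by (intro arg_cong2[of _ _ _ _ times] refl msum_cong)
      (simp add: move_orbit_point subgroup.m_inv_closed[OF subgroup_KG] p_KG[OF k])
  then show ?thesis by (simp add: er.commutant_def)
qed

text \<open>The coefficients of a matrix in the basis \<open>B\<close> form a function on \<open>H \<times> H\<close>. If the matrix commutes with the
  group, this function is constant on the orbits, hence comes from the double coset.\<close>

lemma \<Theta>_onto:
  assumes M: "M \<in> er.commutant"
  shows "\<exists>\<phi>\<in>vectors_on Z. \<Theta> \<phi> = M"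
proof -
  define a where "a q = mtrace (M * B' q)" for q
  have exp: "M = msum D D (\<lambda>q. a q \<cdot>\<^sub>m B q) (H \<times> H)"
    unfolding a_def by (rule B_expansion[OF er.commutant_carrier[OF M]])
  have inv: "a (move b q) = a q" if b: "b \<in> KG" and q: "q \<in> H \<times> H" for b q
  proof -
    obtain k where k: "k \<in> carrier K'" "b = p k" using b p_surj by blast
    note U = carrier_GL_mat[OF \<pi>_GL[OF k(1)]]
    obtain V where V: "V \<in> carrier_mat D D" "\<pi> k * V = 1\<^sub>m D" using \<pi>_GL[OF k(1)] by (auto simp: carrier_GL_iff)
    let ?L = "msum D D (\<lambda>q. a (move (inv b) q) \<cdot>\<^sub>m B q) (H \<times> H)"
    have "M * \<pi> k = ?L * \<pi> k"
      using M k \<pi>_coefficients[OF k(1), of a] by (simp add: er.commutant_def exp[symmetric])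
    then have "M * \<pi> k * V = ?L * \<pi> k * V" by simp
    then have "M = ?L"
      using assoc_mult_mat[OF er.commutant_carrier[OF M] U V(1)] assoc_mult_mat[OF msum_carrier U V(1)]
        V(2) right_mult_one_mat[OF er.commutant_carrier[OF M]] right_mult_one_mat[OF msum_carrier] by metis
    moreover have mq: "move b q \<in> H \<times> H" by (rule move_closed[OF b q])
    ultimately show ?thesis
      using coefficient_trace[OF mq, of "\<lambda>q. a (move (inv b) q)"] move_inv(1)[OF b q] by (simp add: a_def)
  qed
  define \<phi> where "\<phi> w = (if w \<in> Z then a (SOME q. q \<in> H \<times> H \<and> orbit_point q = w) else 0)" for w
  have "\<phi> (orbit_point q) = a q" if q: "q \<in> H \<times> H" for q
  proof -
    define r where "r = (SOME r. r \<in> H \<times> H \<and> orbit_point r = orbit_point q)"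
    have "r \<in> H \<times> H \<and> orbit_point r = orbit_point q"
      unfolding r_def by (rule someI[of _ q]) (use q in simp)
    then have r: "r \<in> H \<times> H" "orbit_point r = orbit_point q" by auto
    obtain b where b: "b \<in> KG" "q = move b r" by (rule same_orbit_point[OF r(1) q r(2)])
    have "\<phi> (orbit_point q) = a r" using orbit_point_Z[OF q] by (simp add: \<phi>_def r_def)
    then show ?thesis using inv[OF b(1) r(1)] b(2) by simp
  qed
  then have "\<Theta> \<phi> = M" unfolding \<Theta>_def by (subst exp) (auto intro!: msum_cong)
  moreover have "\<phi> \<in> vectors_on Z" by (simp add: vectors_on_def \<phi>_def)
  ultimately show ?thesis by blast
qed

definition \<Theta>inv :: "complex mat \<Rightarrow> 'a \<Rightarrow> complex" where "\<Theta>inv = inv_into (vectors_on Z) \<Theta>"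

lemma \<Theta>inv:
  assumes "M \<in> er.commutant" shows "\<Theta>inv M \<in> vectors_on Z" "\<Theta> (\<Theta>inv M) = M"
proof -
  have "M \<in> \<Theta> ` vectors_on Z" using \<Theta>_onto[OF assms] by blast
  then show "\<Theta>inv M \<in> vectors_on Z" "\<Theta> (\<Theta>inv M) = M"
    unfolding \<Theta>inv_def by (rule inv_into_into, rule f_inv_into_f)
qed

lemma \<Theta>inv_\<Theta>: "\<phi> \<in> vectors_on Z \<Longrightarrow> \<Theta>inv (\<Theta> \<phi>) = \<phi>"
  unfolding \<Theta>inv_def by (rule inv_into_f_f[OF \<Theta>_inj])

lemma \<Theta>inv_unique: "\<phi> \<in> vectors_on Z \<Longrightarrow> \<Theta> \<phi> = M \<Longrightarrow> \<Theta>inv M = \<phi>"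
  using \<Theta>inv_\<Theta> by blast

text \<open>As \<open>\<Theta>\<close> is an isomorphism of algebras onto the commutant, irreducible modules can be transported both
  ways.\<close>

lemma commutant_rep:
  assumes "alg_irrep AZ n \<rho>"
  shows "er.com_irrep n (\<lambda>M. \<rho> (\<Theta>inv M))"
proof -
  have hom: "\<rho> \<in> Ring.ring_hom AZ (ring_mat TYPE(complex) n ())"
    and sm: "\<And>c x. x \<in> vectors_on Z \<Longrightarrow> \<rho> (\<lambda>w. c * x w) = c \<cdot>\<^sub>m \<rho> x"
    and irr: "irreducible_matrices n (\<rho> ` vectors_on Z)"
    using assms by (auto simp: alg_irrep_def alg_rep_def AZ_simps)
  have mult: "\<Theta>inv (M * L) = \<Theta>inv M \<otimes>\<^bsub>AZ\<^esub> \<Theta>inv L"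
    and add: "\<Theta>inv (M + L) = \<Theta>inv M \<oplus>\<^bsub>AZ\<^esub> \<Theta>inv L" if "M \<in> er.commutant" "L \<in> er.commutant" for M L
    using \<Theta>inv[OF that(1)] \<Theta>inv[OF that(2)]
    by (auto intro!: \<Theta>inv_unique AZ_mult_closed simp: \<Theta>_mult \<Theta>_add AZ_simps vectors_on_def[of Z])
  have smult: "\<Theta>inv (c \<cdot>\<^sub>m M) = (\<lambda>w. c * \<Theta>inv M w)" if "M \<in> er.commutant" for c M
    using \<Theta>inv[OF that] by (intro \<Theta>inv_unique) (auto simp: \<Theta>_smult vectors_on_def)
  have one: "\<Theta>inv (1\<^sub>m D) = indicator Z"
    by (rule \<Theta>inv_unique[OF _ \<Theta>_one]) (auto simp: vectors_on_def)
  have img: "(\<lambda>M. \<rho> (\<Theta>inv M)) ` er.commutant = \<rho> ` vectors_on Z"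
  proof (intro equalityI subsetI)
    fix N assume "N \<in> \<rho> ` vectors_on Z"
    then obtain \<phi> where \<phi>: "\<phi> \<in> vectors_on Z" "N = \<rho> \<phi>" by blast
    then have "N = \<rho> (\<Theta>inv (\<Theta> \<phi>))" by (simp add: \<Theta>inv_\<Theta>)
    then show "N \<in> (\<lambda>M. \<rho> (\<Theta>inv M)) ` er.commutant" using \<Theta>_in_commutant by blast
  qed (use \<Theta>inv in blast)
  show ?thesis
    unfolding er.com_irrep_def img
  proof (intro conjI ballI allI irr)
    show "\<rho> (\<Theta>inv M) \<in> carrier_mat n n" if "M \<in> er.commutant" for M
      using ring_hom_closed[OF hom, of "\<Theta>inv M"] \<Theta>inv[OF that] by (simp add: AZ_simps ring_mat_simps)
    show "\<rho> (\<Theta>inv (1\<^sub>m D)) = 1\<^sub>m n" using ring_hom_one[OF hom] by (simp add: one AZ_simps ring_mat_simps)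
    show "\<rho> (\<Theta>inv (M * L)) = \<rho> (\<Theta>inv M) * \<rho> (\<Theta>inv L)" "\<rho> (\<Theta>inv (M + L)) = \<rho> (\<Theta>inv M) + \<rho> (\<Theta>inv L)"
      if "M \<in> er.commutant" "L \<in> er.commutant" for M L
      unfolding mult[OF that] add[OF that]
      using ring_hom_mult[OF hom, of "\<Theta>inv M" "\<Theta>inv L"] ring_hom_add[OF hom, of "\<Theta>inv M" "\<Theta>inv L"]
        \<Theta>inv[OF that(1)] \<Theta>inv[OF that(2)] by (simp_all add: AZ_simps(1) ring_mat_simps)
    show "\<rho> (\<Theta>inv (c \<cdot>\<^sub>m M)) = c \<cdot>\<^sub>m \<rho> (\<Theta>inv M)" if "M \<in> er.commutant" for c M
      unfolding smult[OF that] by (rule sm[OF \<Theta>inv(1)[OF that]])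
  qed
qed

lemma double_coset_rep:
  assumes f: "er.com_irrep n f"
  shows "alg_irrep AZ n (\<lambda>\<phi>. f (\<Theta> \<phi>))"
proof -
  note f = er.com_irrepD[OF f]
  have img: "(\<lambda>\<phi>. f (\<Theta> \<phi>)) ` vectors_on Z = f ` er.commutant"
  proof (intro equalityI subsetI)
    fix N assume "N \<in> f ` er.commutant"
    then obtain M where M: "M \<in> er.commutant" "N = f M" by blast
    then have "N = f (\<Theta> (\<Theta>inv M))" by (simp add: \<Theta>inv)
    then show "N \<in> (\<lambda>\<phi>. f (\<Theta> \<phi>)) ` vectors_on Z" using \<Theta>inv(1)[OF M(1)] by blast
  qed (use \<Theta>_in_commutant in blast)
  have "(\<lambda>\<phi>. f (\<Theta> \<phi>)) \<in> Ring.ring_hom AZ (ring_mat TYPE(complex) n ())"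
    by (rule ring_hom_memI)
      (simp_all add: AZ_simps ring_mat_simps \<Theta>_one \<Theta>_add \<Theta>_mult f \<Theta>_in_commutant)
  then show ?thesis
    unfolding alg_irrep_def alg_rep_def by (simp add: AZ_simps img \<Theta>_smult f \<Theta>_in_commutant)
qed

subsection \<open>The correspondence\<close>

abbreviation "algebra_irreps \<equiv> {(n, \<rho>). alg_irrep AZ n \<rho>}"

abbreviation "extension_irreps \<equiv> {(m, \<sigma>). group_irrep K' m \<sigma> \<and> acts_by (kernel K' K p) \<chi> m \<sigma>}"

lemma irr_iff: "er.irr m \<sigma> \<longleftrightarrow> group_irrep K' m \<sigma> \<and> acts_by (kernel K' K p) \<chi> m \<sigma>"
  by (auto simp: er.irr_def er.admissible_def group_irrep_def)

text \<open>The isotypic projection of the group representation acts as the identity in the algebra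
  representation.\<close>

definition corresponds :: "nat \<times> (('a \<Rightarrow> complex) \<Rightarrow> complex mat) \<Rightarrow> nat \<times> ('k \<Rightarrow> complex mat) \<Rightarrow> bool" where
  "corresponds r s \<longleftrightarrow> snd r (\<Theta>inv (er.z (fst s) (snd s))) = 1\<^sub>m (fst r)"

text \<open>The multiplicity space is, up to isomorphism, the only module that corresponds to \<open>\<sigma>\<close>.\<close>

lemma corresponds_model:
  assumes \<sigma>: "er.irr m \<sigma>"
  obtains n0 \<rho>0 where "alg_irrep AZ n0 \<rho>0" "corresponds (n0, \<rho>0) (m, \<sigma>)" "card KG * n0 = card H * m"
    "\<And>n \<rho>. alg_irrep AZ n \<rho> \<Longrightarrow> corresponds (n, \<rho>) (m, \<sigma>) \<Longrightarrow> rep_isomorphic (vectors_on Z) (n0, \<rho>0) (n, \<rho>)"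
proof -
  obtain n0 A B where A: "A \<in> carrier_mat D n0" and B: "B \<in> carrier_mat n0 D" and BA: "B * A = 1\<^sub>m n0"
    and AB: "A * B = er.e m \<sigma> 0 0" and com: "er.com_irrep n0 (\<lambda>M. B * M * A)"
    and z1: "B * er.z m \<sigma> * A = 1\<^sub>m n0" and dim: "er.N * of_nat n0 = of_nat D * of_nat m"
    by (rule er.module_of_irr[OF \<sigma>]) (rule that)
  have z: "er.z m \<sigma> \<in> er.commutant" by (rule er.z_in_commutant[OF er.irrD(1)[OF \<sigma>]])
  have "(of_nat (card KG * n0) :: complex) = of_nat (card H * m)"
    using dim by (simp add: er.N_def D_card[symmetric])
  then have card: "card KG * n0 = card H * m" by (simp only: of_nat_eq_iff)
  have model: "corresponds (n0, \<lambda>\<phi>. B * \<Theta> \<phi> * A) (m, \<sigma>)"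
    using z1 \<Theta>inv[OF z] by (simp add: corresponds_def)
  have iso: "rep_isomorphic (vectors_on Z) (n0, \<lambda>\<phi>. B * \<Theta> \<phi> * A) (n, \<rho>)"
    if \<rho>: "alg_irrep AZ n \<rho>" and c: "corresponds (n, \<rho>) (m, \<sigma>)" for n \<rho>
  proof -
    have f: "\<rho> (\<Theta>inv (er.z m \<sigma>)) = 1\<^sub>m n" using c by (simp add: corresponds_def)
    obtain P where P: "n = n0" "P \<in> carrier (GL n0)"
      "\<And>M. M \<in> er.commutant \<Longrightarrow> P * (B * M * A) = \<rho> (\<Theta>inv M) * P"
      by (rule er.com_irrep_unique[OF \<sigma> commutant_rep[OF \<rho>] f A B BA AB com]) (rule that)
    have "P * (B * \<Theta> \<phi> * A) = \<rho> \<phi> * P" if "\<phi> \<in> vectors_on Z" for \<phi>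
      using P(3)[OF \<Theta>_in_commutant, of \<phi>] \<Theta>inv_\<Theta>[OF that] by simp
    then show ?thesis using P(1,2) by (auto simp: rep_isomorphic_def)
  qed
  show thesis by (rule that[OF double_coset_rep[OF com] model card iso])
qed

lemma alg_irrep_carrier: "alg_irrep AZ n \<rho> \<Longrightarrow> \<phi> \<in> vectors_on Z \<Longrightarrow> \<rho> \<phi> \<in> carrier_mat n n"
  by (auto simp: alg_irrep_def alg_rep_def AZ_simps ring_mat_simps dest: ring_hom_closed)

lemma corresponds_match:
  assumes \<rho>: "alg_irrep AZ n \<rho>" "alg_irrep AZ n' \<rho>'" and \<sigma>: "er.irr m \<sigma>" "er.irr m' \<sigma>'"
    and c: "corresponds (n, \<rho>) (m, \<sigma>)" "corresponds (n', \<rho>') (m', \<sigma>')"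
  shows "rep_isomorphic (vectors_on Z) (n, \<rho>) (n', \<rho>') \<longleftrightarrow> rep_isomorphic (carrier K') (m, \<sigma>) (m', \<sigma>')"
proof
  assume "rep_isomorphic (vectors_on Z) (n, \<rho>) (n', \<rho>')"
  then obtain P where nn: "n = n'" and P: "P \<in> carrier (GL n)"
    and int: "\<And>\<phi>. \<phi> \<in> vectors_on Z \<Longrightarrow> P * \<rho> \<phi> = \<rho>' \<phi> * P"
    by (auto simp: rep_isomorphic_def)
  define w where "w = \<Theta>inv (er.z m \<sigma>)"
  have w: "w \<in> vectors_on Z" "\<rho> w = 1\<^sub>m n"
    using \<Theta>inv(1)[OF er.z_in_commutant[OF er.irrD(1)[OF \<sigma>(1)]]] c(1) by (simp_all add: w_def corresponds_def)
  note Pc = carrier_GL_mat[OF P] and Pi = GL_inv[OF P]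
  have w': "\<rho>' w \<in> carrier_mat n n" using alg_irrep_carrier[OF \<rho>(2) w(1)] nn by simp
  have "\<rho>' w * P = P" using int[OF w(1)] w(2) Pc by simp
  then have "\<rho>' w * P * inv\<^bsub>GL n\<^esub> P = 1\<^sub>m n" using Pi(2) by simp
  then have "\<rho>' w = 1\<^sub>m n" unfolding assoc_mult_mat[OF w' Pc Pi(1)] Pi(2) right_mult_one_mat[OF w'] .
  then have "\<rho>' (\<Theta>inv (er.z m \<sigma>)) = 1\<^sub>m n'" using nn by (simp add: w_def)
  moreover have "\<rho>' (\<Theta>inv (er.z m' \<sigma>')) = 1\<^sub>m n'" using c(2) by (simp add: corresponds_def)
  ultimately show "rep_isomorphic (carrier K') (m, \<sigma>) (m', \<sigma>')"
    by (rule er.irr_isomorphic_of_common[OF commutant_rep[OF \<rho>(2)] \<sigma>(1) _ \<sigma>(2)])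
next
  assume "rep_isomorphic (carrier K') (m, \<sigma>) (m', \<sigma>')"
  then have "er.z m \<sigma> = er.z m' \<sigma>'" by (rule er.z_isomorphic[OF er.irrD(1)[OF \<sigma>(1)] er.irrD(1)[OF \<sigma>(2)]])
  then have c': "corresponds (n', \<rho>') (m, \<sigma>)" using c(2) by (simp add: corresponds_def)
  obtain n0 \<rho>0 where \<rho>0: "alg_irrep AZ n0 \<rho>0" and
    iso: "\<And>n \<rho>. alg_irrep AZ n \<rho> \<Longrightarrow> corresponds (n, \<rho>) (m, \<sigma>) \<Longrightarrow> rep_isomorphic (vectors_on Z) (n0, \<rho>0) (n, \<rho>)"
    by (rule corresponds_model[OF \<sigma>(1)]) (rule that)
  note cl = alg_irrep_carrier[OF \<rho>0] alg_irrep_carrier[OF \<rho>(1)] alg_irrep_carrier[OF \<rho>(2)]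
  have "rep_isomorphic (vectors_on Z) (n, \<rho>) (n0, \<rho>0)"
    by (rule rep_isomorphic_sym[OF iso[OF \<rho>(1) c(1)]]) (rule cl, assumption)+
  then show "rep_isomorphic (vectors_on Z) (n, \<rho>) (n', \<rho>')"
    by (rule rep_isomorphic_trans[OF _ iso[OF \<rho>(2) c']]) (rule cl, assumption)+
qed

lemma correspondence:
  "\<exists>F. bij_betw F (iso_classes (vectors_on Z) algebra_irreps) (iso_classes (carrier K') extension_irreps) \<and>
    (\<forall>Y\<in>iso_classes (vectors_on Z) algebra_irreps. \<forall>(n, \<rho>)\<in>Y. \<forall>(m, \<sigma>)\<in>F Y.
      real n = real (card H) / real (card KG) * real m)"
proof -
  let ?R = algebra_irreps and ?R' = extension_irreps
  let ?E = "{(r, s). r \<in> ?R \<and> s \<in> ?R \<and> rep_isomorphic (vectors_on Z) r s}"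
  let ?E' = "{(r, s). r \<in> ?R' \<and> s \<in> ?R' \<and> rep_isomorphic (carrier K') r s}"
  have E: "equiv ?R ?E" by (rule equiv_rep_isomorphic) (auto intro: alg_irrep_carrier)
  have E': "equiv ?R' ?E'"
    by (rule equiv_rep_isomorphic) (auto simp: irr_iff[symmetric] intro: er.adm_carrier er.irrD)
  have total: "\<exists>r'\<in>?R'. corresponds r r'" if r: "r \<in> ?R" for r
  proof -
    obtain n \<rho> where \<rho>: "r = (n, \<rho>)" "alg_irrep AZ n \<rho>" using r by auto
    obtain m \<sigma> where "er.irr m \<sigma>" "\<rho> (\<Theta>inv (er.z m \<sigma>)) = 1\<^sub>m n"
      by (rule er.com_irrep_has_irr[OF commutant_rep[OF \<rho>(2)]]) (rule that)
    then have "(m, \<sigma>) \<in> ?R'" "corresponds r (m, \<sigma>)" by (simp_all add: irr_iff corresponds_def \<rho>(1))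
    then show ?thesis by (rule bexI[rotated])
  qed
  have total': "\<exists>r\<in>?R. corresponds r r'" if r': "r' \<in> ?R'" for r'
  proof -
    obtain m \<sigma> where \<sigma>: "r' = (m, \<sigma>)" "er.irr m \<sigma>" using r' by (auto simp: irr_iff)
    obtain n0 \<rho>0 where \<rho>0: "alg_irrep AZ n0 \<rho>0" "corresponds (n0, \<rho>0) (m, \<sigma>)"
      by (rule corresponds_model[OF \<sigma>(2)]) (rule that)
    then have "(n0, \<rho>0) \<in> ?R" "corresponds (n0, \<rho>0) r'" by (simp_all add: \<sigma>(1))
    then show ?thesis by (rule bexI[rotated])
  qed
  have match: "(r, s) \<in> ?E \<longleftrightarrow> (r', s') \<in> ?E'"
    if "r \<in> ?R" "s \<in> ?R" "r' \<in> ?R'" "s' \<in> ?R'" "corresponds r r'" "corresponds s s'" for r s r' s'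
    using that corresponds_match[of "fst r" "snd r" "fst s" "snd s" "fst r'" "snd r'" "fst s'" "snd s'"]
    by (simp add: irr_iff case_prod_beta)
  obtain F where F: "bij_betw F (?R // ?E) (?R' // ?E')"
    "\<And>Y r r'. Y \<in> ?R // ?E \<Longrightarrow> r \<in> Y \<Longrightarrow> r' \<in> F Y \<Longrightarrow> r \<in> ?R \<and> r' \<in> ?R' \<and> (\<exists>s\<in>?R. (r, s) \<in> ?E \<and> corresponds s r')"
    by (rule quotient_correspondence[OF E E', of corresponds], erule total, erule total', rule match, assumption+, rule that)
  have dim: "real n = real (card H) / real (card KG) * real m"
    if Y: "Y \<in> ?R // ?E" "(n, \<rho>) \<in> Y" "(m, \<sigma>) \<in> F Y" for Y n \<rho> m \<sigma>
  proof -
    obtain n' \<rho>' where s: "alg_irrep AZ n' \<rho>'" "rep_isomorphic (vectors_on Z) (n, \<rho>) (n', \<rho>')"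
      "corresponds (n', \<rho>') (m, \<sigma>)" and \<sigma>: "er.irr m \<sigma>"
      using F(2)[OF Y] by (auto simp: irr_iff)
    obtain n0 \<rho>0 where n0: "card KG * n0 = card H * m" and
      iso: "rep_isomorphic (vectors_on Z) (n0, \<rho>0) (n', \<rho>')"
      by (rule corresponds_model[OF \<sigma>]) (rule that, assumption, blast intro: s)
    have "n0 = n" using iso s(2) by (simp add: rep_isomorphic_def)
    then have "real (card KG) * real n = real (card H) * real m" using n0 by (metis of_nat_mult)
    moreover have "finite KG" by (rule finite_subset[OF _ finite_H]) (use KG_D(1) in blast)
    then have "card KG \<noteq> 0" using subgroup.one_closed[OF subgroup_KG] card_0_eq by blast
    ultimately show ?thesis by (simp add: field_simps)
  qed
  show ?thesis unfolding iso_classes_def using F(1) dim by (intro exI[of _ F]) auto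
qed

end

theorem theorem3p2:
  fixes G :: "('a, 'm) monoid_scheme"
    and H :: "'a set"
    and J :: "'a \<times> 'a \<Rightarrow> complex"
    and Z :: "'a set"
    and g :: 'a
    and d1 d2 :: nat
    and \<tau>1 \<tau>2 :: "('a \<Rightarrow> complex) \<Rightarrow> complex mat"
    and K' :: "('k, 'l) monoid_scheme"
    and p :: "'k \<Rightarrow> 'a"
    and \<pi>W :: "'k \<Rightarrow> complex mat"
    and \<chi> :: "'k \<Rightarrow> complex"
    and \<Gamma> K :: "('a, 'm) monoid_scheme"
    and W1 W2 W :: "'a \<Rightarrow> complex mat set"
    and \<zeta> :: "'k set"
    and AZ :: "(complex, 'a \<Rightarrow> complex) module"
  assumes "\<Gamma> = G\<lparr>carrier := H\<rparr>"
    and "K = G\<lparr>carrier := K_subgroup G H g\<rparr>"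
    and "W1 = (\<lambda>a. V1_proj \<Gamma> J d1 \<tau>1 (inv\<^bsub>G\<^esub> g \<otimes>\<^bsub>G\<^esub> a \<otimes>\<^bsub>G\<^esub> g))"
    and "W2 = (\<lambda>a. V2_proj \<Gamma> J d2 \<tau>2 a)"
    and "W = (\<lambda>a. pgl_tensor (W1 a) (W2 a))"
    and "\<zeta> = kernel K' K p"
    and "AZ = double_coset_algebra G H J Z"
    and "group G" and "finite (carrier G)" and "subgroup H G"
    and "minimal_twist \<Gamma> J"
    and "Z \<in> double_cosets G H" and "g \<in> Z"
    and "alg_irrep (A1_dual \<Gamma> J) d1 \<tau>1"
    and "alg_irrep (A2_dual \<Gamma> J) d2 \<tau>2"
    and "linearization K (d1 * d2) W K' p \<pi>W"
    and "acts_by \<zeta> \<chi> (d1 * d2) \<pi>W"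
  shows "\<exists>F. bij_betw F
      (iso_classes (carrier AZ) {(n, \<rho>). alg_irrep AZ n \<rho>})
      (iso_classes (carrier K') {(m, \<sigma>). group_irrep K' m \<sigma> \<and> acts_by \<zeta> \<chi> m \<sigma>}) \<and>
    (\<forall>Y\<in>iso_classes (carrier AZ) {(n, \<rho>). alg_irrep AZ n \<rho>}.
      \<forall>(n, \<rho>)\<in>Y. \<forall>(m, \<sigma>)\<in>F Y.
        real n = real (card H) / real (card (K_subgroup G H g)) * real m)"
proof -
  interpret G: group G by fact
  have minimal: "minimal_twist (G\<lparr>carrier := H\<rparr>) J"
    and irreps: "alg_irrep (A1_dual (G\<lparr>carrier := H\<rparr>) J) d1 \<tau>1" "alg_irrep (A2_dual (G\<lparr>carrier := H\<rparr>) J) d2 \<tau>2"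
    using assms(1,11,14,15) by simp_all
  have lin: "linearization (G\<lparr>carrier := K_subgroup G H g\<rparr>) (d1 * d2)
      (\<lambda>a. pgl_tensor (V1_proj (G\<lparr>carrier := H\<rparr>) J d1 \<tau>1 (inv\<^bsub>G\<^esub> g \<otimes>\<^bsub>G\<^esub> a \<otimes>\<^bsub>G\<^esub> g))
        (V2_proj (G\<lparr>carrier := H\<rparr>) J d2 \<tau>2 a)) K' p \<pi>W"
    using assms(16) unfolding assms(1-5) .
  have central: "acts_by (kernel K' (G\<lparr>carrier := K_subgroup G H g\<rparr>) p) \<chi> (d1 * d2) \<pi>W"
    using assms(17) unfolding assms(2,6) .
  have "Z \<subseteq> carrier G"
    using \<open>Z \<in> double_cosets G H\<close> \<open>subgroup H G\<close> subgroup.mem_carrier[of H G] by (auto simp: double_cosets_def set_mult_def)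
  then have g: "g \<in> carrier G" using \<open>g \<in> Z\<close> by blast
  interpret linearized_double_coset G H J g d1 d2 \<tau>1 \<tau>2 K' p \<pi>W \<chi>
    by (intro linearized_double_coset.intro double_coset.intro double_coset_axioms.intro
        linearized_double_coset_axioms.intro assms(8-10) g minimal irreps lin central)
  show ?thesis
    using correspondence unfolding Z_unique[OF \<open>Z \<in> double_cosets G H\<close> \<open>g \<in> Z\<close>] assms(2,6,7) AZ_simps .
qed

end
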